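(* Let $E$ be an $(n+m)$-dimensional manifold with a torsion-free linear connection $\Gamma$ on $TE\to E$, and take as space of parameters $M=\mathbb R^n$, with a torsion-free linear connection $\Theta$ on $T\mathbb R^n\to\mathbb R^n$. Then the equation $\mathcal S$ of unparametrized $n$-dimensional totally geodesic submanifolds of $E$ is obtained by factoring the equation $\mathcal S_{\mathrm{pr}_{\mathbb R^n}}$ of parametrized totally geodesic submanifolds by the subgroup $\mathrm{Aff}(\mathbb R^n)$ of the group of external symmetries of $\mathcal S_{\mathrm{pr}_{\mathbb R^n}}$.
   Context: $J^2(E,n)$ is the manifold of second-order contact classes $[L]^2_p$ of $n$-dimensional embedded submanifolds $L\subset E$ at $p$. The equation $\mathcal S\subset J^2(E,n)$ is the set of those $[L]^2_p$ for which the second fundamental form $(X,Y)\mapsto\nabla_XY\bmod T_pL$ of $L$ with respect to $\Gamma$ vanishes at $p$. $\mathrm{pr}_{\mathbb R^n}\colon\mathbb R^n\times E\to\mathbb R^n$ is the projection, and $J^r\mathrm{pr}_{\mathbb R^n}$ is the bundle of $r$-jets $[s]^r_x$ of local maps $s\colon\mathbb R^n\to E$ (local sections of $\mathrm{pr}_{\mathbb R^n}$), with coordinates $(x^\lambda,u^A_{x^\sigma})$, $|\sigma|\le r$, given by the derivatives of $s$. $\mathrm{Imm}\,J^r\mathrm{pr}_{\mathbb R^n}$ is the open submanifold of $r$-jets of immersions. The equation $\mathcal S_{\mathrm{pr}_{\mathbb R^n}}\subset\mathrm{Imm}\,J^2\mathrm{pr}_{\mathbb R^n}$ is given locally by $$u^C_{x^\xi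 x^\lambda}+\Gamma_A{}^C{}_B\,u^A_{x^\xi}u^B_{x^\lambda}-\Theta_\xi{}^\eta{}_\lambda\,u^C_{x^\eta}=0,$$ where $\Gamma_A{}^C{}_B$ and $\Theta_\xi{}^\eta{}_\lambda$ are the Christoffel symbols of $\Gamma$ and $\Theta$. The Cartan distribution on a jet space is, at each point, the span of the tangent planes at that point of the $r$-jet prolongations of submanifolds (respectively, of local sections) whose $r$-jet is that point. A contact transformation is a diffeomorphism preserving the Cartan distribution. An external symmetry of an equation (a submanifold of a jet space) is a contact transformation of the jet space that preserves the equation. The affine group $\mathrm{Aff}(\mathbb R^n)$ acts on $J^r\mathrm{pr}_{\mathbb R^n}$ by the prolongations $(g\times\mathrm{id})^{(r)}$ of the maps $g\times\mathrm{id}\colon\mathbb R^n\times E\to\mathbb R^n\times E$, $(x,p)\mapsto(g(x),p)$, i.e. $[s]^r_x\mapsto[s\circ g^{-1}]^r_{g(x)}$.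
   Formalization: For arbitrary torsion-free Θ the claim is false, since homotheties in Aff(R^n) preserve the parametrized equation only if Θ = 0; it is proved that S is obtained by factoring by Aff(R^n) if and only if the Christoffel symbols of Θ vanish, and that the equation projects onto S for every Θ. *)

theory Defs
  imports "HOL-Analysis.Analysis" "HOL-Library.Uprod" "HOL-Algebra.Bij"
begin

section \<open>Smooth maps between Euclidean spaces\<close>

primrec Ck_on :: "nat \<Rightarrow> 'a::real_normed_vector set \<Rightarrow> ('a \<Rightarrow> 'b::real_normed_vector) \<Rightarrow> bool" where
  "Ck_on 0 S f \<longleftrightarrow> continuous_on S f"
| "Ck_on (Suc k) S f \<longleftrightarrow> (\<forall>x\<in>S. f differentiable (at x)) \<and>
     (\<forall>v. Ck_on k S (\<lambda>x. frechet_derivative f (at x) v))"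

text \<open>Only meaningful for open \<open>S\<close>.\<close>

definition smooth_on :: "'a::real_normed_vector set \<Rightarrow> ('a \<Rightarrow> 'b::real_normed_vector) \<Rightarrow> bool" where
  "smooth_on S f \<longleftrightarrow> (\<forall>k. Ck_on k S f)"

instance uprod :: (finite) finite
  by standard simp

definition partial :: "'n::finite \<Rightarrow> (real^'n \<Rightarrow> 'b::real_normed_vector) \<Rightarrow> real^'n \<Rightarrow> 'b" where
  "partial i f x = frechet_derivative f (at x) (axis i 1)"

text \<open>Multi-indices of length two are unordered pairs of indices. For smooth \<open>f\<close> the choice of
  an ordering of the pair is immaterial, since second partial derivatives commute.\<close>

definition partial2 :: "'n::finite uprod \<Rightarrow> (real^'n \<Rightarrow> 'b::real_normed_vector) \<Rightarrow> real^'n \<Rightarrow> 'b" where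
  "partial2 \<sigma> f x =
     (let ij = (SOME ij. \<sigma> = Upair (fst ij) (snd ij)) in partial (fst ij) (partial (snd ij) f) x)"


section \<open>Manifolds\<close>

text \<open>A chart is a pair of a domain and a coordinate map. The values of the coordinate map outside
  the domain are irrelevant.\<close>

type_synonym ('a, 'v) chart = "'a set \<times> ('a \<Rightarrow> 'v)"

definition in_charts ::
  "('a, 'v) chart \<Rightarrow> ('b, 'w) chart \<Rightarrow> ('a \<Rightarrow> 'b) \<Rightarrow> 'v \<Rightarrow> 'w" where
  "in_charts c d f = snd d \<circ> f \<circ> inv_into (fst c) (snd c)"

definition is_chart :: "('e::topological_space, 'v::euclidean_space) chart \<Rightarrow> bool" where
  "is_chart c \<longleftrightarrow> open (fst c) \<and> open (snd c ` fst c) \<and>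
     homeomorphism (fst c) (snd c ` fst c) (snd c) (inv_into (fst c) (snd c))"

definition compatible ::
  "('e::topological_space, 'v::euclidean_space) chart \<Rightarrow> ('e, 'v) chart \<Rightarrow> bool" where
  "compatible c d \<longleftrightarrow> smooth_on (snd c ` (fst c \<inter> fst d)) (in_charts c d (\<lambda>p. p))
                   \<and> smooth_on (snd d ` (fst c \<inter> fst d)) (in_charts d c (\<lambda>p. p))"

text \<open>The underlying space of the manifold is the whole (Hausdorff, second countable) type \<open>'e\<close>,
  and the smooth structure is a maximal atlas.\<close>

definition smooth_manifold ::
  "('e::{t2_space, second_countable_topology}, 'v::euclidean_space) chart set \<Rightarrow> bool" where
  "smooth_manifold A \<longleftrightarrow>
     (\<forall>c\<in>A. is_chart c) \<and> \<Union> (fst ` A) = UNIV \<and> (\<forall>c\<in>A. \<forall>d\<in>A. compatible c d) \<and>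
     (\<forall>c. is_chart c \<and> (\<forall>d\<in>A. compatible c d) \<longrightarrow> c \<in> A)"

text \<open>The coordinate expressions, in the chart \<open>c\<close>, of the velocities at \<open>a\<close> of the smooth curves
  in \<open>S\<close>. If \<open>S\<close> is an embedded submanifold, this is the tangent space of \<open>S\<close> at \<open>a\<close>.\<close>

definition tangent_vectors ::
  "('a, 'v::euclidean_space) chart \<Rightarrow> 'a set \<Rightarrow> 'a \<Rightarrow> 'v set" where
  "tangent_vectors c S a =
     {v. \<exists>\<gamma> \<epsilon>. \<epsilon> > 0 \<and> \<gamma> (0::real) = a \<and> (\<forall>t\<in>{-\<epsilon><..<\<epsilon>}. \<gamma> t \<in> S \<inter> fst c) \<and>
        smooth_on {-\<epsilon><..<\<epsilon>} (snd c \<circ> \<gamma>) \<and> v = vector_derivative (snd c \<circ> \<gamma>) (at 0)}"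


section \<open>Linear connections\<close>

text \<open>A linear connection is given by its Christoffel symbols in every chart \<open>c\<close>, as bilinear maps
  \<open>\<Gamma> c z\<close> depending smoothly on the coordinates \<open>z\<close>, i.e. \<open>\<nabla>\<^sub>X Y = D Y (X) + \<Gamma> c z X Y\<close>. The third
  condition is the transformation law that makes this expression independent of the chart.\<close>

type_synonym ('e, 'v) christoffel = "('e, 'v) chart \<Rightarrow> 'v \<Rightarrow> 'v \<Rightarrow> 'v \<Rightarrow> 'v"

definition linear_connection ::
  "('e, 'v::euclidean_space) chart set \<Rightarrow> ('e, 'v) christoffel \<Rightarrow> bool" where
  "linear_connection A \<Gamma> \<longleftrightarrow>
     (\<forall>c\<in>A. \<forall>z\<in>snd c ` fst c. bilinear (\<Gamma> c z)) \<and>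
     (\<forall>c\<in>A. \<forall>v w. smooth_on (snd c ` fst c) (\<lambda>z. \<Gamma> c z v w)) \<and>
     (\<forall>c\<in>A. \<forall>d\<in>A. \<forall>z\<in>snd c ` (fst c \<inter> fst d). \<forall>v w.
        (let \<tau> = in_charts c d (\<lambda>p. p); D = (\<lambda>y. frechet_derivative \<tau> (at y)) in
         D z (\<Gamma> c z v w) =
           frechet_derivative (\<lambda>y. D y w) (at z) v + \<Gamma> d (\<tau> z) (D z v) (D z w)))"

definition torsion_free ::
  "('e, 'v::euclidean_space) chart set \<Rightarrow> ('e, 'v) christoffel \<Rightarrow> bool" where
  "torsion_free A \<Gamma> \<longleftrightarrow> (\<forall>c\<in>A. \<forall>z\<in>snd c ` fst c. \<forall>v w. \<Gamma> c z v w = \<Gamma> c z w v)"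

text \<open>Since \<open>\<real>\<^sup>n\<close> has a global chart, it suffices to give a connection on it in that chart.\<close>

definition std_chart :: "('v::euclidean_space, 'v) chart" where
  "std_chart = (UNIV, \<lambda>x. x)"


section \<open>Jet spaces, contact transformations and external symmetries\<close>

text \<open>A jet space as a set of jets with an atlas, which also determines its topology, and with the
  Cartan distribution. The latter is given by the coordinate expression in each chart of its plane
  at each point.\<close>

record ('a, 'v) jet_space =
  jets :: "'a set"
  jet_charts :: "('a, 'v) chart set"
  cartan :: "('a, 'v) chart \<Rightarrow> 'a \<Rightarrow> 'v set"

text \<open>Openness of the sets on which the coordinate expressions of \<open>f\<close> are defined means that \<open>f\<close> is
  continuous on \<open>X\<close>, and that \<open>X\<close> is open.\<close>

definition smooth_map ::
  "('a, 'v::euclidean_space) jet_space \<Rightarrow> ('b, 'w::euclidean_space) jet_space \<Rightarrow>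
     'a set \<Rightarrow> ('a \<Rightarrow> 'b) \<Rightarrow> bool" where
  "smooth_map J K X f \<longleftrightarrow> X \<subseteq> jets J \<and> f ` X \<subseteq> jets K \<and>
     (\<forall>c\<in>jet_charts J. \<forall>d\<in>jet_charts K.
        (let V = snd c ` {a \<in> fst c \<inter> X. f a \<in> fst d} in
         open V \<and> smooth_on V (in_charts c d f)))"

definition differential ::
  "('a, 'v::euclidean_space) chart \<Rightarrow> ('b, 'w::euclidean_space) chart \<Rightarrow> ('a \<Rightarrow> 'b) \<Rightarrow> 'a \<Rightarrow> 'v \<Rightarrow> 'w" where
  "differential c d f a = frechet_derivative (in_charts c d f) (at (snd c a))"

definition contact_transformation :: "('a, 'v::euclidean_space) jet_space \<Rightarrow> ('a \<Rightarrow> 'a) \<Rightarrow> bool" where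
  "contact_transformation J \<Phi> \<longleftrightarrow> bij_betw \<Phi> (jets J) (jets J) \<and>
     smooth_map J J (jets J) \<Phi> \<and> smooth_map J J (jets J) (inv_into (jets J) \<Phi>) \<and>
     (\<forall>\<theta>\<in>jets J. \<forall>c\<in>jet_charts J. \<forall>d\<in>jet_charts J. \<theta> \<in> fst c \<and> \<Phi> \<theta> \<in> fst d \<longrightarrow>
        differential c d \<Phi> \<theta> ` cartan J c \<theta> = cartan J d (\<Phi> \<theta>))"

definition external_symmetry ::
  "('a, 'v::euclidean_space) jet_space \<Rightarrow> 'a set \<Rightarrow> ('a \<Rightarrow> 'a) \<Rightarrow> bool" where
  "external_symmetry J S \<Phi> \<longleftrightarrow> contact_transformation J \<Phi> \<and> \<Phi> ` S = S"

definition external_symmetry_group ::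
  "('a, 'v::euclidean_space) jet_space \<Rightarrow> 'a set \<Rightarrow> ('a \<Rightarrow> 'a) monoid" where
  "external_symmetry_group J S =
     (BijGroup (jets J))\<lparr>carrier := {\<Phi> \<in> extensional (jets J). external_symmetry J S \<Phi>}\<rparr>"

text \<open>The map \<open>\<pi>\<close>, smooth on an open set \<open>X\<close> of jets containing the equation \<open>S\<close>, restricts to a
  surjective submersion of \<open>S\<close> onto the equation \<open>R\<close> that carries the Cartan distribution of
  \<open>S\<close> to that of \<open>R\<close>. The Cartan distribution of an equation consists of the vectors
  of the Cartan distribution of the ambient jet space that are tangent to the equation.\<close>

definition projects_onto ::
  "('a, 'v::euclidean_space) jet_space \<Rightarrow> 'a set \<Rightarrow> 'a set \<Rightarrow>
   ('b, 'w::euclidean_space) jet_space \<Rightarrow> 'b set \<Rightarrow> ('a \<Rightarrow> 'b) \<Rightarrow> bool" where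
  "projects_onto J X S K R \<pi> \<longleftrightarrow> S \<subseteq> X \<and> smooth_map J K X \<pi> \<and> \<pi> ` S = R \<and>
     (\<forall>\<theta>\<in>S. \<forall>c\<in>jet_charts J. \<forall>d\<in>jet_charts K. \<theta> \<in> fst c \<and> \<pi> \<theta> \<in> fst d \<longrightarrow>
        differential c d \<pi> \<theta> ` tangent_vectors c S \<theta> = tangent_vectors d R (\<pi> \<theta>) \<and>
        differential c d \<pi> \<theta> ` (cartan J c \<theta> \<inter> tangent_vectors c S \<theta>) =
          cartan K d (\<pi> \<theta>) \<inter> tangent_vectors d R (\<pi> \<theta>))"

text \<open>The equation \<open>R\<close> is the quotient, with quotient map \<open>\<pi>\<close>, of the equation \<open>S\<close> by the group
  \<open>G\<close>, which is embedded by \<open>act\<close> as a subgroup of the external symmetries of \<open>S\<close>.\<close>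

definition obtained_by_factoring ::
  "('a, 'v::euclidean_space) jet_space \<Rightarrow> 'a set \<Rightarrow> 'a set \<Rightarrow>
   ('b, 'w::euclidean_space) jet_space \<Rightarrow> 'b set \<Rightarrow> ('a \<Rightarrow> 'b) \<Rightarrow>
   'g monoid \<Rightarrow> ('g \<Rightarrow> 'a \<Rightarrow> 'a) \<Rightarrow> bool" where
  "obtained_by_factoring J X S K R \<pi> G act \<longleftrightarrow>
     group_hom G (external_symmetry_group J S) act \<and> inj_on act (carrier G) \<and>
     projects_onto J X S K R \<pi> \<and>
     (\<forall>\<theta>\<in>S. \<forall>\<theta>'\<in>S. \<pi> \<theta> = \<pi> \<theta>' \<longleftrightarrow> (\<exists>g\<in>carrier G. \<theta>' = act g \<theta>))"


section \<open>Jets of maps from the parameter space\<close>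

definition smooth_param ::
  "('e::topological_space, 'v::euclidean_space) chart set \<Rightarrow> (real^'n) set \<Rightarrow> (real^'n \<Rightarrow> 'e) \<Rightarrow> bool" where
  "smooth_param A N s \<longleftrightarrow> open N \<and> continuous_on N s \<and>
     (\<forall>c\<in>A. smooth_on (N \<inter> s -` fst c) (snd c \<circ> s))"

definition smooth_near ::
  "('e::topological_space, 'v::euclidean_space) chart set \<Rightarrow> real^'n \<Rightarrow> (real^'n \<Rightarrow> 'e) \<Rightarrow> bool" where
  "smooth_near A x s \<longleftrightarrow> (\<exists>N. x \<in> N \<and> smooth_param A N s)"

definition immersive_at ::
  "('e, 'v::euclidean_space) chart set \<Rightarrow> real^'n \<Rightarrow> (real^'n \<Rightarrow> 'e) \<Rightarrow> bool" where
  "immersive_at A x s \<longleftrightarrow>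
     (\<forall>c\<in>A. s x \<in> fst c \<longrightarrow> inj (frechet_derivative (snd c \<circ> s) (at x)))"

text \<open>The 2-jet of \<open>s\<close> at \<open>x\<close> is \<open>x\<close> together with the class of all \<open>t\<close> whose derivatives up to
  order two at \<open>x\<close> are those of \<open>s\<close>.\<close>

definition same_2jet ::
  "('e, 'v::euclidean_space) chart set \<Rightarrow> real^'n \<Rightarrow> (real^'n \<Rightarrow> 'e) \<Rightarrow> (real^'n \<Rightarrow> 'e) \<Rightarrow> bool" where
  "same_2jet A x s t \<longleftrightarrow> s x = t x \<and> (\<forall>c\<in>A. s x \<in> fst c \<longrightarrow>
     (\<forall>i. partial i (snd c \<circ> s) x = partial i (snd c \<circ> t) x) \<and>
     (\<forall>i j. partial i (partial j (snd c \<circ> s)) x = partial i (partial j (snd c \<circ> t)) x))"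

type_synonym ('n, 'e) jet = "(real^'n) \<times> (real^'n \<Rightarrow> 'e) set"

definition jet ::
  "('e::topological_space, 'v::euclidean_space) chart set \<Rightarrow> real^'n \<Rightarrow> (real^'n \<Rightarrow> 'e) \<Rightarrow> ('n, 'e) jet" where
  "jet A x s = (x, {t. smooth_near A x t \<and> same_2jet A x s t})"

definition J2pr ::
  "('e::topological_space, 'v::euclidean_space) chart set \<Rightarrow> ('n::finite, 'e) jet set" where
  "J2pr A = {jet A x s |x s. smooth_near A x s}"

definition ImmJ2pr ::
  "('e::topological_space, 'v::euclidean_space) chart set \<Rightarrow> ('n::finite, 'e) jet set" where
  "ImmJ2pr A = {jet A x s |x s. smooth_near A x s \<and> immersive_at A x s}"

text \<open>The coordinates \<open>(x, u, u\<^sub>i, u\<^sub>i\<^sub>j)\<close> on the jets with target in the domain of a chart of \<open>E\<close>.\<close>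

definition jet_chart ::
  "('e::topological_space, 'v::euclidean_space) chart set \<Rightarrow> ('e, 'v) chart \<Rightarrow>
   (('n::finite, 'e) jet, (real^'n) \<times> 'v \<times> ('v^'n) \<times> ('v^('n uprod))) chart" where
  "jet_chart A c =
     ({jet A x s |x s. smooth_near A x s \<and> s x \<in> fst c},
      \<lambda>\<theta>. (let x = fst \<theta>; f = snd c \<circ> (SOME s. s \<in> snd \<theta>) in
            (x, f x, (\<chi> i. partial i f x), (\<chi> \<sigma>. partial2 \<sigma> f x))))"

definition prolonged_section ::
  "('e::topological_space, 'v::euclidean_space) chart set \<Rightarrow> (real^'n \<Rightarrow> 'e) \<Rightarrow> ('n::finite, 'e) jet set" where
  "prolonged_section A s = {jet A y s |y. smooth_near A y s}"

definition J2pr_space ::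
  "('e::topological_space, 'v::euclidean_space) chart set \<Rightarrow>
   (('n::finite, 'e) jet, (real^'n) \<times> 'v \<times> ('v^'n) \<times> ('v^('n uprod))) jet_space" where
  "J2pr_space A = \<lparr>jets = J2pr A, jet_charts = jet_chart A ` A,
     cartan = (\<lambda>c \<theta>. span (\<Union>s\<in>snd \<theta>. tangent_vectors c (prolonged_section A s) \<theta>))\<rparr>"

definition S_pr ::
  "('e::topological_space, 'v::euclidean_space) chart set \<Rightarrow> ('e, 'v) christoffel \<Rightarrow>
   (real^'n, real^'n) christoffel \<Rightarrow> ('n::finite, 'e) jet set" where
  "S_pr A \<Gamma> \<Theta> = {jet A x s |x s. smooth_near A x s \<and> immersive_at A x s \<and>
     (\<forall>c\<in>A. s x \<in> fst c \<longrightarrow> (let u = snd c \<circ> s in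
        \<forall>\<xi> \<zeta>. partial \<xi> (partial \<zeta> u) x + \<Gamma> c (u x) (partial \<xi> u x) (partial \<zeta> u x)
          - (\<Sum>\<eta>\<in>UNIV. \<Theta> std_chart x (axis \<xi> 1) (axis \<zeta> 1) $ \<eta> *\<^sub>R partial \<eta> u x) = 0))}"


section \<open>Jets of submanifolds\<close>

text \<open>The manifold has dimension \<open>n + m\<close> and is modelled on \<open>\<real>\<^sup>n \<times> \<real>\<^sup>m\<close>. Its maximal atlas contains,
  for every splitting of the coordinates into \<open>n\<close> independent and \<open>m\<close> dependent ones, charts in
  which the independent coordinates come first.\<close>

definition embedded_submanifold ::
  "('e, (real^'n) \<times> (real^'m)) chart set \<Rightarrow> 'e set \<Rightarrow> bool" where
  "embedded_submanifold A L \<longleftrightarrow> (\<forall>p\<in>L. \<exists>c\<in>A. p \<in> fst c \<and>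
     snd c ` (L \<inter> fst c) = {z \<in> snd c ` fst c. snd z = 0})"

text \<open>Near \<open>p\<close> and in the chart \<open>c\<close>, \<open>L\<close> is the graph of \<open>f\<close>.\<close>

definition graph_near ::
  "('e::topological_space, (real^'n) \<times> (real^'m)) chart \<Rightarrow> 'e set \<Rightarrow> 'e \<Rightarrow> (real^'n \<Rightarrow> real^'m) \<Rightarrow> bool" where
  "graph_near c L p f \<longleftrightarrow> p \<in> L \<and> (\<exists>W N. open W \<and> p \<in> W \<and> W \<subseteq> fst c \<and>
     open N \<and> (fst \<circ> snd c) ` W \<subseteq> N \<and> smooth_on N f \<and>
     L \<inter> W = {q \<in> W. snd (snd c q) = f (fst (snd c q))})"

definition contact2 ::
  "('e::topological_space, (real^'n) \<times> (real^'m)) chart set \<Rightarrow> 'e \<Rightarrow> 'e set \<Rightarrow> 'e set \<Rightarrow> bool" where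
  "contact2 A p L L' \<longleftrightarrow> (\<exists>c\<in>A. \<exists>f f'. graph_near c L p f \<and> graph_near c L' p f' \<and>
     (let x = fst (snd c p) in
        (\<forall>i. partial i f x = partial i f' x) \<and>
        (\<forall>i j. partial i (partial j f) x = partial i (partial j f') x)))"

type_synonym 'e subjet = "'e \<times> 'e set set"

definition subjet ::
  "('e::topological_space, (real^'n) \<times> (real^'m)) chart set \<Rightarrow> 'e \<Rightarrow> 'e set \<Rightarrow> 'e subjet" where
  "subjet A p L = (p, {L'. embedded_submanifold A L' \<and> contact2 A p L L'})"

definition J2sub ::
  "('e::topological_space, (real^'n) \<times> (real^'m)) chart set \<Rightarrow> 'e subjet set" where
  "J2sub A = {subjet A p L |p L. embedded_submanifold A L \<and> p \<in> L}"

text \<open>The coordinates \<open>(x, f x, f\<^sub>i x, f\<^sub>i\<^sub>j x)\<close> of the jets of graphs of maps \<open>f\<close>.\<close>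

definition subjet_chart ::
  "('e::topological_space, (real^'n) \<times> (real^'m)) chart set \<Rightarrow> ('e, (real^'n) \<times> (real^'m)) chart \<Rightarrow>
   ('e subjet, (real^'n) \<times> (real^'m) \<times> ((real^'m)^'n) \<times> ((real^'m)^('n uprod))) chart" where
  "subjet_chart A c =
     ({subjet A p L |p L. embedded_submanifold A L \<and> p \<in> fst c \<and> (\<exists>f. graph_near c L p f)},
      \<lambda>\<theta>. (let x = fst (snd c (fst \<theta>));
                f = (SOME f. \<exists>L\<in>snd \<theta>. graph_near c L (fst \<theta>) f)
            in (x, f x, (\<chi> i. partial i f x), (\<chi> \<sigma>. partial2 \<sigma> f x))))"

definition J2sub_space ::
  "('e::topological_space, (real^'n) \<times> (real^'m)) chart set \<Rightarrow>
   ('e subjet, (real^'n) \<times> (real^'m) \<times> ((real^'m)^'n) \<times> ((real^'m)^('n uprod))) jet_space" where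
  "J2sub_space A = \<lparr>jets = J2sub A, jet_charts = subjet_chart A ` A,
     cartan = (\<lambda>c \<theta>. span (\<Union>L\<in>snd \<theta>. tangent_vectors c ((\<lambda>q. subjet A q L) ` L) \<theta>))\<rparr>"

text \<open>In the chart \<open>c\<close>, \<open>\<nabla>\<^sub>X Y\<close> is tangent to \<open>L\<close> at \<open>p\<close> for all local vector fields \<open>X\<close>, \<open>Y\<close>
  that are tangent to \<open>L\<close>.\<close>

definition second_fundamental_form_vanishes ::
  "('e, 'v::euclidean_space) chart set \<Rightarrow> ('e, 'v) christoffel \<Rightarrow> 'e set \<Rightarrow> 'e \<Rightarrow> bool" where
  "second_fundamental_form_vanishes A \<Gamma> L p \<longleftrightarrow> (\<forall>c\<in>A. p \<in> fst c \<longrightarrow>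
     (\<forall>W X Y. open W \<and> snd c p \<in> W \<and> W \<subseteq> snd c ` fst c \<and> smooth_on W X \<and> smooth_on W Y \<and>
        (\<forall>q\<in>L \<inter> fst c. snd c q \<in> W \<longrightarrow>
           X (snd c q) \<in> tangent_vectors c L q \<and> Y (snd c q) \<in> tangent_vectors c L q) \<longrightarrow>
        (let z = snd c p in
         frechet_derivative Y (at z) (X z) + \<Gamma> c z (X z) (Y z) \<in> tangent_vectors c L p)))"

definition S_unparam ::
  "('e::topological_space, (real^'n) \<times> (real^'m)) chart set \<Rightarrow>
   ('e, (real^'n) \<times> (real^'m)) christoffel \<Rightarrow> 'e subjet set" where
  "S_unparam A \<Gamma> = {subjet A p L |p L.
     embedded_submanifold A L \<and> p \<in> L \<and> second_fundamental_form_vanishes A \<Gamma> L p}"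


section \<open>Forgetting the parametrization, and the action of the affine group\<close>

definition embedding_on ::
  "('e::topological_space, 'v::euclidean_space) chart set \<Rightarrow> (real^'n) set \<Rightarrow> (real^'n \<Rightarrow> 'e) \<Rightarrow> bool" where
  "embedding_on A N s \<longleftrightarrow> smooth_param A N s \<and> (\<forall>y\<in>N. immersive_at A y s) \<and>
     homeomorphism N (s ` N) s (inv_into N s)"

text \<open>The 2-jet at \<open>x\<close> of an immersion \<open>s\<close> is sent to the 2-jet at \<open>s x\<close> of the image under \<open>s\<close>
  of a small neighbourhood \<open>N\<close> of \<open>x\<close>.\<close>

definition forget_param ::
  "('e::topological_space, (real^'n) \<times> (real^'m)) chart set \<Rightarrow> ('n::finite, 'e) jet \<Rightarrow> 'e subjet" where
  "forget_param A \<theta> =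
     (let sN = (SOME sN. fst sN \<in> snd \<theta> \<and> fst \<theta> \<in> snd sN \<and> embedding_on A (snd sN) (fst sN))
      in subjet A (fst sN (fst \<theta>)) (fst sN ` snd sN))"

definition Aff :: "(real^'n \<Rightarrow> real^'n) monoid" where
  "Aff = \<lparr>carrier = {\<lambda>x. M *v x + b |M b. invertible M}, mult = (\<circ>), one = id\<rparr>"

text \<open>The prolongation \<open>[s]\<^sub>x \<mapsto> [s \<circ> g\<^sup>-\<^sup>1]\<^sub>g\<^sub>x\<close> of \<open>(x, p) \<mapsto> (g x, p)\<close>.\<close>

definition prolong ::
  "('e::topological_space, 'v::euclidean_space) chart set \<Rightarrow> (real^'n \<Rightarrow> real^'n) \<Rightarrow>
   ('n::finite, 'e) jet \<Rightarrow> ('n, 'e) jet" where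
  "prolong A g = (\<lambda>\<theta>\<in>J2pr A. jet A (g (fst \<theta>)) ((SOME s. s \<in> snd \<theta>) \<circ> inv_into UNIV g))"

end

theory Submission imports Defs begin

text \<open>
  Let \<open>v = (a, b)\<close> be the coordinate expression of an immersion whose image is the graph of \<open>f\<close>, so that
  \<open>b = f \<circ> a\<close>. Differentiating twice relates the coordinates of the 2-jet of the immersion to those of the 2-jet
  of its image (\<open>graph_rel\<close>). The relation can be solved for the derivatives of \<open>f\<close> by inverting \<open>Da\<close>,
  which makes \<open>forget_param\<close> well defined and smooth.

  The equation of parametrized submanifolds is \<open>D\<^sup>2v (h, k) + \<Gamma> (Dv h, Dv k) = Dv (\<Theta> (h, k))\<close>. Its normal part
  says that the left-hand side is tangent to the image, which is the vanishing of the second fundamental form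
  of the image (\<open>sff_iff_normal_eq\<close>), and thus the equation of unparametrized submanifolds. Its tangential part
  prescribes \<open>D\<^sup>2a\<close> and imposes no condition on the image. Therefore the solutions over a solution of the
  unparametrized equation correspond to the choices of a base point \<open>x\<close> and of an invertible \<open>Da\<close>
  (\<open>lift_jet\<close>, \<open>lift_coords_of_S_pr\<close>). Symmetry of both connections is what makes the prescribed \<open>D\<^sup>2a\<close>
  symmetric. In particular the projection of the equations is surjective, and by lifting curves with \<open>x\<close>
  and \<open>Da\<close> fixed it is surjective on tangent vectors (\<open>tangent_S_unparam\<close>).

  On either equation the second derivatives are functions of the lower ones, so a Cartan vector tangent to the
  equation is determined by its independent components. What has to be shown is that
  Cartan vectors tangent to the parametrized equation exist with arbitrary independent components. A section that
  is a cubic polynomial has a prescribed third derivative in one direction \<open>\<zeta>\<close>. By its choice, the curve of jets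
  of this section over a line in the direction \<open>\<zeta>\<close> has the same velocity as a curve in the equation
  (\<open>cartan_tangent_exists\<close>).

  It remains to compare the fibres with the orbits of the affine group. The affine maps act simply transitively on
  the pairs \<open>(x, Da)\<close>. If \<open>\<Theta>\<close> vanishes in the standard chart they preserve the equation, since an affine change of
  parameters acts on \<open>D\<^sup>2v\<close> and on \<open>\<Gamma> (Dv, Dv)\<close> in the same way. Then the orbits are the fibres
  (\<open>forget_param_eq_iff\<close>). Conversely, the homothety with ratio 2 and centre \<open>x\<close> multiplies the left-hand side of
  the equation by \<open>1/4\<close> but the right-hand side by \<open>1/2\<close>. If it is a symmetry, then \<open>\<Theta>\<close> vanishes at \<open>x\<close>
  (\<open>param_flat_if_symmetric\<close>). So the affine group consists of external symmetries, and the quotient by it is the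
  unparametrized equation, precisely if \<open>\<Theta>\<close> vanishes in the standard chart.
\<close>


section \<open>Calculus of smooth maps\<close>

abbreviation FD :: "('a::real_normed_vector \<Rightarrow> 'b::real_normed_vector) \<Rightarrow> 'a \<Rightarrow> 'a \<Rightarrow> 'b" where
  "FD f x \<equiv> frechet_derivative f (at x)"

text \<open>The arguments are in the order of the nested derivatives in \<open>partial i (partial j f)\<close>.\<close>

definition deriv2 :: "('a::real_normed_vector \<Rightarrow> 'b::real_normed_vector) \<Rightarrow> 'a \<Rightarrow> 'a \<Rightarrow> 'a \<Rightarrow> 'b" where
  "deriv2 f x h k = FD (\<lambda>y. FD f y k) x h"

lemma FD_eq: "(f has_derivative f') (at x) \<Longrightarrow> FD f x = f'"
  using frechet_derivative_at by metis

lemma FD_cong: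
  assumes "open S" "x \<in> S" "\<And>y. y \<in> S \<Longrightarrow> f y = g y"
  shows "FD f x = FD g x"
proof -
  have "(f has_derivative D) (at x) = (g has_derivative D) (at x)" for D
    using assms by (metis has_derivative_transform_within_open)
  then show ?thesis unfolding frechet_derivative_def by simp
qed

lemma differentiable_cong_open:
  assumes "open S" "x \<in> S" "\<And>y. y \<in> S \<Longrightarrow> f y = g y" "f differentiable (at x)"
  shows "g differentiable (at x)"
  using assms unfolding differentiable_def by (metis has_derivative_transform_within_open)

lemma deriv2_cong:
  assumes "open S" "x \<in> S" "\<And>y. y \<in> S \<Longrightarrow> f y = g y"
  shows "deriv2 f x = deriv2 g x"
  unfolding deriv2_def
  by (intro ext fun_cong[OF FD_cong[OF assms(1,2)]] fun_cong[OF FD_cong[OF assms(1) _ assms(3)]])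

lemma Ck_on_subset: "Ck_on k S f \<Longrightarrow> T \<subseteq> S \<Longrightarrow> Ck_on k T f"
  by (induction k arbitrary: f) (auto intro: continuous_on_subset)

lemma Ck_on_SucD: "Ck_on (Suc k) S f \<Longrightarrow> Ck_on k S f"
proof (induction k arbitrary: f)
  case 0
  then show ?case
    by (auto intro!: continuous_at_imp_continuous_on differentiable_imp_continuous_within)
next
  case (Suc k)
  then show ?case by simp
qed

lemma Ck_on_cong:
  assumes "open S" "\<And>y. y \<in> S \<Longrightarrow> f y = g y" "Ck_on k S f"
  shows "Ck_on k S g"
  using assms(2,3)
proof (induction k arbitrary: f g)
  case 0
  then show ?case by (metis Ck_on.simps(1) continuous_on_cong)
next
  case (Suc k)
  have "Ck_on k S (\<lambda>x. FD g x v)" for v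
    by (rule Suc.IH[of "\<lambda>x. FD f x v"])
      (use Suc.prems assms(1) FD_cong[of S _ f g] in auto)
  with Suc.prems show ?case
    using assms(1) differentiable_cong_open by (metis Ck_on.simps(2))
qed

lemma Ck_on_const: "Ck_on k S (\<lambda>x. c)"
  by (induction k arbitrary: c) auto

lemma Ck_on_SucI:
  assumes "open S" "\<And>x. x \<in> S \<Longrightarrow> (f has_derivative f' x) (at x)" "\<And>v. Ck_on k S (\<lambda>x. f' x v)"
  shows "Ck_on (Suc k) S f"
proof -
  have "Ck_on k S (\<lambda>x. FD f x v)" for v
    by (rule Ck_on_cong[OF assms(1) _ assms(3)[of v]]) (simp add: FD_eq[OF assms(2)])
  then show ?thesis using assms(2) by (auto simp: differentiable_def)
qed

lemma Ck_on_has_derivative: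
  "Ck_on (Suc k) S f \<Longrightarrow> x \<in> S \<Longrightarrow> (f has_derivative FD f x) (at x)"
  by (simp add: frechet_derivative_works[symmetric])

lemma Ck_on_bounded_linear:
  assumes "open S" "bounded_linear T" "Ck_on k S f"
  shows "Ck_on k S (\<lambda>x. T (f x))"
  using assms(3)
proof (induction k arbitrary: f)
  case 0
  then show ?case by (simp add: bounded_linear.continuous_on[OF assms(2)])
next
  case (Suc k)
  show ?case
    by (rule Ck_on_SucI[OF assms(1) bounded_linear.has_derivative[OF assms(2) Ck_on_has_derivative[OF Suc.prems]]])
      (use Suc in auto)
qed

lemma Ck_on_add:
  assumes "open S" "Ck_on k S f" "Ck_on k S g"
  shows "Ck_on k S (\<lambda>x. f x + g x)"
  using assms(2,3)
proof (induction k arbitrary: f g)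
  case 0
  then show ?case by (simp add: continuous_on_add)
next
  case (Suc k)
  show ?case
    by (rule Ck_on_SucI[OF assms(1) has_derivative_add[OF
          Ck_on_has_derivative[OF Suc.prems(1)] Ck_on_has_derivative[OF Suc.prems(2)]]])
      (use Suc in auto)
qed

lemma Ck_on_sum:
  assumes "open S" "\<And>i. i \<in> I \<Longrightarrow> Ck_on k S (f i)"
  shows "Ck_on k S (\<lambda>x. \<Sum>i\<in>I. f i x)"
  using assms(2) by (induction I rule: infinite_finite_induct) (auto simp: Ck_on_const intro!: Ck_on_add[OF assms(1)])

lemma Ck_on_bilinear:
  assumes "open S" "bounded_bilinear B" "Ck_on k S f" "Ck_on k S g"
  shows "Ck_on k S (\<lambda>x. B (f x) (g x))"
  using assms(3,4)
proof (induction k arbitrary: f g)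
  case 0
  then show ?case by (simp add: bounded_bilinear.continuous_on[OF assms(2)])
next
  case (Suc k)
  have f: "Ck_on k S f" "Ck_on k S g" using Suc.prems Ck_on_SucD by blast+
  show ?case
    by (rule Ck_on_SucI[OF assms(1) bounded_bilinear.FDERIV[OF assms(2)
          Ck_on_has_derivative[OF Suc.prems(1)] Ck_on_has_derivative[OF Suc.prems(2)]]])
      (use Suc f in \<open>auto intro!: Ck_on_add[OF assms(1)]\<close>)
qed

text \<open>\<open>Ck_on\<close> controls the derivative of \<open>g\<close> only in fixed directions. Expanding \<open>D f v\<close> in the basis
  reduces the chain rule to such directions, so that the induction hypothesis applies.\<close>

lemma Ck_on_compose:
  fixes f :: "'a::real_normed_vector \<Rightarrow> 'b::euclidean_space" and g :: "'b \<Rightarrow> 'c::real_normed_vector"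
  assumes "open S" "open T" "f ` S \<subseteq> T" "Ck_on k S f" "Ck_on k T g"
  shows "Ck_on k S (\<lambda>x. g (f x))"
  using assms(4,5)
proof (induction k arbitrary: g)
  case 0
  then show ?case using continuous_on_compose2 assms(3) by (metis Ck_on.simps(1))
next
  case (Suc k)
  have der: "((\<lambda>x. g (f x)) has_derivative (\<lambda>v. \<Sum>b\<in>Basis. (FD f x v \<bullet> b) *\<^sub>R FD g (f x) b)) (at x)"
    if "x \<in> S" for x
  proof -
    have g: "(g has_derivative FD g (f x)) (at (f x))"
      using Ck_on_has_derivative[OF Suc.prems(2)] that assms(3) by blast
    have f: "(f has_derivative FD f x) (at x)" using Ck_on_has_derivative Suc.prems(1) that by blast
    have "FD g (f x) (FD f x v) = (\<Sum>b\<in>Basis. (FD f x v \<bullet> b) *\<^sub>R FD g (f x) b)" for v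
    proof -
      have "FD g (f x) (FD f x v) = FD g (f x) (\<Sum>b\<in>Basis. (FD f x v \<bullet> b) *\<^sub>R b)"
        by (simp add: euclidean_representation)
      also have "\<dots> = (\<Sum>b\<in>Basis. (FD f x v \<bullet> b) *\<^sub>R FD g (f x) b)"
        using has_derivative_linear[OF g] by (simp only: linear_sum linear_cmul)
      finally show ?thesis .
    qed
    with has_derivative_compose[OF f g] show ?thesis by simp
  qed
  have k: "Ck_on k S f" using Suc.prems(1) Ck_on_SucD by blast
  show ?case
  proof (rule Ck_on_SucI[OF assms(1) der])
    fix v
    show "Ck_on k S (\<lambda>x. \<Sum>b\<in>Basis. (FD f x v \<bullet> b) *\<^sub>R FD g (f x) b)"
    proof (intro Ck_on_sum[OF assms(1)] Ck_on_bilinear[OF assms(1) bounded_bilinear_scaleR])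
      fix b
      show "Ck_on k S (\<lambda>x. FD f x v \<bullet> b)"
        by (rule Ck_on_bounded_linear[OF assms(1) bounded_linear_inner_left]) (use Suc.prems(1) in auto)
      show "Ck_on k S (\<lambda>x. FD g (f x) b)"
        using Suc.IH[OF k] Suc.prems(2) by auto
    qed
  qed auto
qed

lemma Ck_on_mult:
  fixes f g :: "'a::real_normed_vector \<Rightarrow> real"
  shows "open S \<Longrightarrow> Ck_on k S f \<Longrightarrow> Ck_on k S g \<Longrightarrow> Ck_on k S (\<lambda>x. f x * g x)"
  by (rule Ck_on_bilinear[OF _ bounded_bilinear_mult])

lemma Ck_on_prod:
  fixes f :: "'i \<Rightarrow> 'a::real_normed_vector \<Rightarrow> real"
  assumes "open S" "\<And>i. i \<in> I \<Longrightarrow> Ck_on k S (f i)"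
  shows "Ck_on k S (\<lambda>x. \<Prod>i\<in>I. f i x)"
  using assms(2)
  by (induction I rule: infinite_finite_induct) (auto simp: Ck_on_const intro!: Ck_on_mult[OF assms(1)])

text \<open>The derivative \<open>- f' / f\<^sup>2\<close> is built from \<open>f'\<close> and \<open>1 / f\<close>, so the regularity of \<open>1 / f\<close> improves by
  induction up to that of \<open>f\<close>.\<close>

lemma Ck_on_inverse:
  fixes f :: "'a::real_normed_vector \<Rightarrow> real"
  assumes "open S" "Ck_on k S f" "\<And>x. x \<in> S \<Longrightarrow> f x \<noteq> 0"
  shows "Ck_on k S (\<lambda>x. inverse (f x))"
  using assms(2)
proof (induction k)
  case 0
  then show ?case using assms(3) by (auto intro!: continuous_on_inverse)
next
  case (Suc k)
  have k: "Ck_on k S (\<lambda>x. inverse (f x))" using Suc Ck_on_SucD by blast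
  show ?case
  proof (rule Ck_on_SucI[OF assms(1)])
    fix x assume x: "x \<in> S"
    show "((\<lambda>x. inverse (f x)) has_derivative (\<lambda>h. (-1) * (inverse (f x) * FD f x h * inverse (f x)))) (at x)"
      using Deriv.has_derivative_inverse[OF assms(3)[OF x] Ck_on_has_derivative[OF Suc.prems x]] by simp
  next
    fix v
    show "Ck_on k S (\<lambda>x. (-1) * (inverse (f x) * FD f x v * inverse (f x)))"
      using Suc.prems by (intro Ck_on_mult[OF assms(1)] Ck_on_const k) auto
  qed
qed

lemma bounded_linear_axis: "bounded_linear (\<lambda>a::'a::euclidean_space. axis i a :: 'a^'n)"
  unfolding linear_conv_bounded_linear[symmetric]
  by (rule linearI) (auto simp: vec_eq_iff axis_def)

lemma Ck_on_vec:
  fixes f :: "'n::finite \<Rightarrow> 'a::real_normed_vector \<Rightarrow> 'b::euclidean_space"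
  assumes "open S" "\<And>i. Ck_on k S (f i)"
  shows "Ck_on k S (\<lambda>x. \<chi> i. f i x)"
proof -
  have "(\<Sum>i\<in>UNIV. axis i (f i x)) = (\<chi> i. f i x)" for x
    by (simp add: vec_eq_iff axis_def sum.delta')
  moreover have "Ck_on k S (\<lambda>x. \<Sum>i\<in>UNIV. axis i (f i x))"
    by (rule Ck_on_sum[OF assms(1) Ck_on_bounded_linear[OF assms(1) bounded_linear_axis assms(2)]])
  ultimately show ?thesis by simp
qed

lemma Ck_on_vec_nth:
  fixes f :: "'a::real_normed_vector \<Rightarrow> 'b::real_normed_vector^'n"
  shows "open S \<Longrightarrow> Ck_on k S f \<Longrightarrow> Ck_on k S (\<lambda>x. f x $ i)"
  by (rule Ck_on_bounded_linear[OF _ bounded_linear_vec_nth])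

lemma Ck_on_det:
  fixes M :: "'a::real_normed_vector \<Rightarrow> real^'n^'n"
  assumes "open S" "\<And>i j. Ck_on k S (\<lambda>x. M x $ i $ j)"
  shows "Ck_on k S (\<lambda>x. det (M x))"
  unfolding det_def
  by (intro Ck_on_sum[OF assms(1)] Ck_on_mult[OF assms(1)] Ck_on_prod[OF assms(1)] Ck_on_const assms(2))

text \<open>Cramer's rule expresses the solution of a linear system by polynomials in the coefficients and
  one division, so that it depends on parameters as regularly as the system does.\<close>

lemma Ck_on_inv_linear:
  fixes L :: "'a::real_normed_vector \<Rightarrow> real^'n \<Rightarrow> real^'n"
  assumes S: "open S" and lin: "\<And>x. x \<in> S \<Longrightarrow> linear (L x)" and inj: "\<And>x. x \<in> S \<Longrightarrow> inj (L x)"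
    and Ck: "\<And>v. Ck_on k S (\<lambda>x. L x v)"
  shows "Ck_on k S (\<lambda>x. inv_into UNIV (L x) v)"
proof -
  let ?A = "\<lambda>x. (\<chi> i j. L x (axis j 1) $ i)"
  let ?N = "\<lambda>x l. \<chi> i j. if j = l then v $ i else L x (axis j 1) $ i"
  have A: "?A x *v w = L x w" if "x \<in> S" for x w
    using fun_cong[OF matrix_vector_mul(2)[OF lin[OF that]], of w] by (simp add: matrix_def)
  have d0: "det (?A x) \<noteq> 0" if "x \<in> S" for x
  proof -
    have "(*v) (?A x) = L x" using A[OF that] by (rule ext)
    then have "inj ((*v) (?A x))" using inj[OF that] by simp
    then have "invertible (?A x)"
      unfolding invertible_left_inverse matrix_left_invertible_injective by simp
    then show ?thesis by (simp add: invertible_det_nz)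
  qed
  have C: "Ck_on k S (\<lambda>x. \<chi> l. det (?N x l) * inverse (det (?A x)))"
  proof (intro Ck_on_vec S Ck_on_mult Ck_on_inverse d0)
    show "Ck_on k S (\<lambda>x. det (?N x l))" for l
    proof (rule Ck_on_det[OF S])
      fix i j
      show "Ck_on k S (\<lambda>x. ?N x l $ i $ j)"
        using Ck_on_vec_nth[OF S Ck[of "axis j 1"]] by (cases "j = l") (auto simp: Ck_on_const)
    qed
    show "Ck_on k S (\<lambda>x. det (?A x))"
      using Ck_on_vec_nth[OF S Ck] by (intro Ck_on_det[OF S]) auto
  qed auto
  show ?thesis
  proof (rule Ck_on_cong[OF S _ C])
    fix x assume x: "x \<in> S"
    have "surj (L x)" using linear_injective_imp_surjective lin inj x by blast
    then have "?A x *v (inv_into UNIV (L x) v) = v" by (simp add: A x surj_f_inv_f)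
    then show "(\<chi> l. det (?N x l) * inverse (det (?A x))) = inv_into UNIV (L x) v"
      using cramer[OF d0[OF x], of "inv_into UNIV (L x) v" v] by (simp add: divide_inverse cong: if_cong)
  qed
qed

lemma Ck_on_Pair:
  fixes f :: "'a::real_normed_vector \<Rightarrow> 'b::real_normed_vector" and g :: "'a \<Rightarrow> 'c::real_normed_vector"
  assumes "open S" "Ck_on k S f" "Ck_on k S g"
  shows "Ck_on k S (\<lambda>x. (f x, g x))"
proof -
  have "Ck_on k S (\<lambda>x. (f x, 0) + (0, g x))"
    by (intro Ck_on_add assms(1) Ck_on_bounded_linear[OF assms(1) _ assms(2)]
        Ck_on_bounded_linear[OF assms(1) _ assms(3)] bounded_linear_Pair bounded_linear_ident bounded_linear_zero)
  then show ?thesis by simp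
qed

lemma Ck_on_id: "open S \<Longrightarrow> Ck_on k S (\<lambda>x. x)"
proof (cases k)
  case (Suc l)
  assume "open S"
  then show ?thesis unfolding Suc
    by (rule Ck_on_SucI) (auto intro: has_derivative_ident Ck_on_const)
qed auto


lemma smooth_on_subset: "smooth_on S f \<Longrightarrow> T \<subseteq> S \<Longrightarrow> smooth_on T f"
  unfolding smooth_on_def using Ck_on_subset by blast

lemma smooth_on_cong: "open S \<Longrightarrow> (\<And>y. y \<in> S \<Longrightarrow> f y = g y) \<Longrightarrow> smooth_on S f \<Longrightarrow> smooth_on S g"
  unfolding smooth_on_def using Ck_on_cong[of S f g] by simp

lemma smooth_on_continuous: "smooth_on S f \<Longrightarrow> continuous_on S f"
  unfolding smooth_on_def by (metis Ck_on.simps(1))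

lemma smooth_on_has_derivative: "smooth_on S f \<Longrightarrow> x \<in> S \<Longrightarrow> (f has_derivative FD f x) (at x)"
  unfolding smooth_on_def using Ck_on_has_derivative by blast

lemma smooth_on_linear_FD: "smooth_on S f \<Longrightarrow> x \<in> S \<Longrightarrow> linear (FD f x)"
  using smooth_on_has_derivative has_derivative_linear by blast

lemma smooth_on_FD: "smooth_on S f \<Longrightarrow> smooth_on S (\<lambda>x. FD f x v)"
  unfolding smooth_on_def by (metis Ck_on.simps(2))

lemma smooth_on_local:
  assumes "\<And>x. x \<in> S \<Longrightarrow> \<exists>U. open U \<and> x \<in> U \<and> smooth_on U f"
  shows "smooth_on S f"
proof -
  have "Ck_on k S f" if "\<And>x. x \<in> S \<Longrightarrow> \<exists>U. open U \<and> x \<in> U \<and> Ck_on k U f" for k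
    using that
  proof (induction k arbitrary: f)
    case 0
    have "isCont f x" if "x \<in> S" for x
      using 0[OF that] by (auto simp: continuous_on_eq_continuous_at)
    then show ?case by (simp add: continuous_at_imp_continuous_on)
  next
    case (Suc k)
    show ?case
    proof (simp, intro conjI ballI allI)
      fix x assume "x \<in> S"
      from Suc.prems[OF this] show "f differentiable (at x)" by auto
    next
      fix v show "Ck_on k S (\<lambda>x. FD f x v)"
      proof (rule Suc.IH)
        fix x assume "x \<in> S"
        from Suc.prems[OF this] show "\<exists>U. open U \<and> x \<in> U \<and> Ck_on k U (\<lambda>x. FD f x v)" by auto
      qed
    qed
  qed
  then show ?thesis using assms unfolding smooth_on_def by blast
qed

lemma smooth_on_const: "smooth_on S (\<lambda>x. c)"
  unfolding smooth_on_def by (intro allI Ck_on_const)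

lemma smooth_on_id: "open S \<Longrightarrow> smooth_on S (\<lambda>x. x)"
  unfolding smooth_on_def by (intro allI) (rule Ck_on_id, auto)

lemma smooth_on_bounded_linear:
  "open S \<Longrightarrow> bounded_linear T \<Longrightarrow> smooth_on S f \<Longrightarrow> smooth_on S (\<lambda>x. T (f x))"
  unfolding smooth_on_def by (intro allI) (rule Ck_on_bounded_linear, auto)

lemma smooth_on_linear:
  fixes T :: "'b::euclidean_space \<Rightarrow> 'c::real_normed_vector"
  shows "open S \<Longrightarrow> linear T \<Longrightarrow> smooth_on S f \<Longrightarrow> smooth_on S (\<lambda>x. T (f x))"
  using smooth_on_bounded_linear linear_conv_bounded_linear by blast

lemma smooth_on_bilinear:
  "open S \<Longrightarrow> bounded_bilinear B \<Longrightarrow> smooth_on S f \<Longrightarrow> smooth_on S g \<Longrightarrow> smooth_on S (\<lambda>x. B (f x) (g x))"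
  unfolding smooth_on_def by (intro allI) (rule Ck_on_bilinear, auto)

lemmas smooth_on_scaleR = smooth_on_bilinear[OF _ bounded_bilinear_scaleR]
lemmas smooth_on_vec_nth = smooth_on_bounded_linear[OF _ bounded_linear_vec_nth]
lemmas smooth_on_inner_left = smooth_on_bounded_linear[OF _ bounded_linear_inner_left]
lemmas smooth_on_fst = smooth_on_bounded_linear[OF _ bounded_linear_fst]
lemmas smooth_on_snd = smooth_on_bounded_linear[OF _ bounded_linear_snd]
lemmas smooth_on_minus = smooth_on_bounded_linear[OF _ bounded_linear_minus[OF bounded_linear_ident]]

lemma smooth_on_add: "open S \<Longrightarrow> smooth_on S f \<Longrightarrow> smooth_on S g \<Longrightarrow> smooth_on S (\<lambda>x. f x + g x)"
  unfolding smooth_on_def by (intro allI) (rule Ck_on_add, auto)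

lemma smooth_on_diff: "open S \<Longrightarrow> smooth_on S f \<Longrightarrow> smooth_on S g \<Longrightarrow> smooth_on S (\<lambda>x. f x - g x)"
  unfolding diff_conv_add_uminus by (intro smooth_on_add smooth_on_minus)

lemma smooth_on_sum: "open S \<Longrightarrow> (\<And>i. i \<in> I \<Longrightarrow> smooth_on S (f i)) \<Longrightarrow> smooth_on S (\<lambda>x. \<Sum>i\<in>I. f i x)"
  unfolding smooth_on_def by (intro allI) (rule Ck_on_sum, auto)

lemma smooth_on_Pair: "open S \<Longrightarrow> smooth_on S f \<Longrightarrow> smooth_on S g \<Longrightarrow> smooth_on S (\<lambda>x. (f x, g x))"
  unfolding smooth_on_def by (intro allI Ck_on_Pair) auto

lemma smooth_on_vec:
  fixes f :: "'n::finite \<Rightarrow> 'a::real_normed_vector \<Rightarrow> 'b::euclidean_space"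
  shows "open S \<Longrightarrow> (\<And>i. smooth_on S (f i)) \<Longrightarrow> smooth_on S (\<lambda>x. \<chi> i. f i x)"
  unfolding smooth_on_def by (intro allI) (rule Ck_on_vec, auto)

lemma smooth_on_compose:
  fixes f :: "'a::real_normed_vector \<Rightarrow> 'b::euclidean_space"
  shows "open S \<Longrightarrow> open T \<Longrightarrow> f ` S \<subseteq> T \<Longrightarrow> smooth_on S f \<Longrightarrow> smooth_on T g \<Longrightarrow> smooth_on S (\<lambda>x. g (f x))"
  unfolding smooth_on_def by (intro allI) (rule Ck_on_compose, auto)

lemma smooth_on_inv_linear:
  fixes L :: "'a::real_normed_vector \<Rightarrow> real^'n \<Rightarrow> real^'n"
  shows "open S \<Longrightarrow> (\<And>x. x \<in> S \<Longrightarrow> linear (L x)) \<Longrightarrow> (\<And>x. x \<in> S \<Longrightarrow> inj (L x)) \<Longrightarrow>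
    (\<And>v. smooth_on S (\<lambda>x. L x v)) \<Longrightarrow> smooth_on S (\<lambda>x. inv_into UNIV (L x) v)"
  unfolding smooth_on_def by (intro allI) (rule Ck_on_inv_linear, auto)

lemma linear_on_Basis:
  fixes v :: "'b::euclidean_space"
  assumes "linear T"
  shows "T v = (\<Sum>b\<in>Basis. (v \<bullet> b) *\<^sub>R T b)"
proof -
  have "T v = T (\<Sum>b\<in>Basis. (v \<bullet> b) *\<^sub>R b)" by (simp add: euclidean_representation)
  also have "\<dots> = (\<Sum>b\<in>Basis. (v \<bullet> b) *\<^sub>R T b)" using assms by (simp only: linear_sum linear_cmul)
  finally show ?thesis .
qed

text \<open>The regularity of a family of linear maps is given for fixed arguments. An argument that varies is
  expanded in the basis.\<close>

lemma smooth_on_linear_apply: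
  fixes v :: "'a::real_normed_vector \<Rightarrow> 'b::euclidean_space"
  assumes S: "open S" and "\<And>x. x \<in> S \<Longrightarrow> linear (T x)" "\<And>b. smooth_on S (\<lambda>x. T x b)" "smooth_on S v"
  shows "smooth_on S (\<lambda>x. T x (v x))"
proof (rule smooth_on_cong[OF S])
  show "(\<Sum>b\<in>Basis. (v x \<bullet> b) *\<^sub>R T x b) = T x (v x)" if "x \<in> S" for x
    by (rule linear_on_Basis[OF assms(2)[OF that], symmetric])
  show "smooth_on S (\<lambda>x. \<Sum>b\<in>Basis. (v x \<bullet> b) *\<^sub>R T x b)"
  proof (rule smooth_on_sum[OF S])
    fix b :: 'b
    show "smooth_on S (\<lambda>x. (v x \<bullet> b) *\<^sub>R T x b)"
      by (rule smooth_on_scaleR[OF S smooth_on_inner_left[OF S assms(4)] assms(3)])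
  qed
qed

lemma smooth_on_bilinear_apply:
  fixes v :: "'a::real_normed_vector \<Rightarrow> 'b::euclidean_space" and w :: "'a \<Rightarrow> 'c::euclidean_space"
  assumes S: "open S" and B: "\<And>x. x \<in> S \<Longrightarrow> bilinear (B x)" "\<And>b c. smooth_on S (\<lambda>x. B x b c)"
    and "smooth_on S v" "smooth_on S w"
  shows "smooth_on S (\<lambda>x. B x (v x) (w x))"
proof (rule smooth_on_linear_apply[OF S, of "\<lambda>x. B x (v x)"])
  show "smooth_on S (\<lambda>x. B x (v x) b)" for b
  proof (rule smooth_on_linear_apply[OF S, where T = "\<lambda>x y. B x y b"])
    show "linear (\<lambda>y. B x y b)" if "x \<in> S" for x using B(1)[OF that] by (simp add: bilinear_def)
  qed (rule assms)+
  show "linear (B x (v x))" if "x \<in> S" for x using B(1)[OF that] by (simp add: bilinear_def)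
qed (rule assms)


section \<open>Second derivatives and local inverses\<close>

lemma bounded_linear_imp_FD: "bounded_linear T \<Longrightarrow> FD T x = T"
  by (rule FD_eq[OF bounded_linear_imp_has_derivative])

lemma linear_imp_FD:
  fixes T :: "'a::euclidean_space \<Rightarrow> 'b::real_normed_vector"
  shows "linear T \<Longrightarrow> FD T x = T"
  using bounded_linear_imp_FD linear_conv_bounded_linear by blast

lemma FD_compose:
  assumes "smooth_on S f" "x \<in> S" "smooth_on T g" "f x \<in> T"
  shows "FD (\<lambda>y. g (f y)) x h = FD g (f x) (FD f x h)"
  by (rule fun_cong[OF FD_eq[OF has_derivative_compose[OF smooth_on_has_derivative[OF assms(1,2)]
      smooth_on_has_derivative[OF assms(3,4)]]]])

lemma bilinear_deriv2:
  fixes f :: "'a::real_normed_vector \<Rightarrow> 'b::real_normed_vector"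
  assumes S: "open S" "smooth_on S f" "x \<in> S"
  shows "bilinear (deriv2 f x)"
  unfolding bilinear_def
proof (intro conjI allI)
  fix k show "linear (\<lambda>h. deriv2 f x h k)"
    unfolding deriv2_def using smooth_on_linear_FD[OF smooth_on_FD[OF S(2)] S(3)] .
next
  fix h
  have d: "((\<lambda>y. FD f y k) has_derivative FD (\<lambda>y. FD f y k) x) (at x)" for k
    by (rule smooth_on_has_derivative[OF smooth_on_FD[OF S(2)] S(3)])
  have lin: "linear (FD f y)" if "y \<in> S" for y using smooth_on_linear_FD[OF S(2) that] .
  show "linear (\<lambda>k. deriv2 f x h k)"
  proof (rule linearI)
    fix k l :: 'a and c :: real
    have "FD (\<lambda>y. FD f y (k + l)) x = FD (\<lambda>y. FD f y k + FD f y l) x"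
      by (rule FD_cong[OF S(1,3)]) (simp add: linear_add[OF lin])
    also have "\<dots> = (\<lambda>h. FD (\<lambda>y. FD f y k) x h + FD (\<lambda>y. FD f y l) x h)"
      by (rule FD_eq[OF has_derivative_add[OF d d]])
    finally show "deriv2 f x h (k + l) = deriv2 f x h k + deriv2 f x h l"
      by (simp add: deriv2_def)
    have "FD (\<lambda>y. FD f y (c *\<^sub>R k)) x = FD (\<lambda>y. c *\<^sub>R FD f y k) x"
      by (rule FD_cong[OF S(1,3)]) (simp add: linear_cmul[OF lin])
    also have "\<dots> = (\<lambda>h. c *\<^sub>R FD (\<lambda>y. FD f y k) x h)"
      by (rule FD_eq[OF has_derivative_scaleR_right[OF d]])
    finally show "deriv2 f x h (c *\<^sub>R k) = c *\<^sub>R deriv2 f x h k"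
      by (simp add: deriv2_def)
  qed
qed

lemma smooth_on_deriv2: "smooth_on S f \<Longrightarrow> smooth_on S (\<lambda>x. deriv2 f x h k)"
  unfolding deriv2_def by (intro smooth_on_FD)

lemma deriv2_compose:
  fixes f :: "'a::real_normed_vector \<Rightarrow> 'b::euclidean_space" and g :: "'b \<Rightarrow> 'c::real_normed_vector"
  assumes S: "open S" "smooth_on S f" "x \<in> S" and T: "open T" "smooth_on T g" "f x \<in> T"
  shows "deriv2 (\<lambda>y. g (f y)) x h k = deriv2 g (f x) (FD f x h) (FD f x k) + FD g (f x) (deriv2 f x h k)"
proof -
  let ?U = "S \<inter> f -` T"
  have U: "open ?U" "x \<in> ?U"
    using S T continuous_open_preimage[OF smooth_on_continuous[OF S(2)] S(1) T(1)] by auto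
  have f: "(f has_derivative FD f x) (at x)" by (rule smooth_on_has_derivative[OF S(2,3)])
  have 1: "FD (\<lambda>y. g (f y)) y k = (\<Sum>b\<in>Basis. (FD f y k \<bullet> b) *\<^sub>R FD g (f y) b)" if "y \<in> ?U" for y
    using that by (subst FD_compose[OF S(2) _ T(2)]) (auto intro: linear_on_Basis[OF smooth_on_linear_FD[OF T(2)]])
  have d: "((\<lambda>y. \<Sum>b\<in>Basis. (FD f y k \<bullet> b) *\<^sub>R FD g (f y) b) has_derivative
     (\<lambda>h. \<Sum>b\<in>Basis. (FD f x k \<bullet> b) *\<^sub>R FD (\<lambda>z. FD g z b) (f x) (FD f x h) +
          (FD (\<lambda>y. FD f y k) x h \<bullet> b) *\<^sub>R FD g (f x) b)) (at x)"
    by (intro has_derivative_sum has_derivative_scaleR has_derivative_inner_left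
        smooth_on_has_derivative[OF smooth_on_FD[OF S(2)] S(3)]
        has_derivative_compose[OF f smooth_on_has_derivative[OF smooth_on_FD[OF T(2)] T(3)]])
  have "deriv2 (\<lambda>y. g (f y)) x h k = FD (\<lambda>y. \<Sum>b\<in>Basis. (FD f y k \<bullet> b) *\<^sub>R FD g (f y) b) x h"
    unfolding deriv2_def by (rule fun_cong[OF FD_cong[OF U 1]])
  also have "\<dots> = (\<Sum>b\<in>Basis. (FD f x k \<bullet> b) *\<^sub>R deriv2 g (f x) (FD f x h) b) +
      (\<Sum>b\<in>Basis. (deriv2 f x h k \<bullet> b) *\<^sub>R FD g (f x) b)"
    unfolding FD_eq[OF d] by (simp add: deriv2_def sum.distrib)
  also have "(\<Sum>b\<in>Basis. (FD f x k \<bullet> b) *\<^sub>R deriv2 g (f x) (FD f x h) b)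
     = deriv2 g (f x) (FD f x h) (FD f x k)"
    using bilinear_deriv2[OF T] by (intro linear_on_Basis[symmetric]) (simp add: bilinear_def)
  also have "(\<Sum>b\<in>Basis. (deriv2 f x h k \<bullet> b) *\<^sub>R FD g (f x) b) = FD g (f x) (deriv2 f x h k)"
    by (rule linear_on_Basis[OF smooth_on_linear_FD[OF T(2,3)], symmetric])
  finally show ?thesis .
qed

lemma FD_linear_compose:
  fixes T :: "'b::euclidean_space \<Rightarrow> 'c::real_normed_vector"
  assumes "linear T" "smooth_on S f" "x \<in> S"
  shows "FD (\<lambda>y. T (f y)) x h = T (FD f x h)"
  using FD_compose[OF assms(2,3), of UNIV T] linear_imp_FD[OF assms(1)]
    smooth_on_linear[OF open_UNIV assms(1) smooth_on_id[OF open_UNIV]] by simp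

lemma deriv2_linear_compose:
  fixes T :: "'b::euclidean_space \<Rightarrow> 'c::real_normed_vector"
  assumes "linear T" "open S" "smooth_on S f" "x \<in> S"
  shows "deriv2 (\<lambda>y. T (f y)) x h k = T (deriv2 f x h k)"
proof -
  have "deriv2 (\<lambda>y. T (f y)) x h k = FD (\<lambda>y. T (FD f y k)) x h"
    unfolding deriv2_def
    by (rule fun_cong[OF FD_cong[OF assms(2,4)]]) (simp add: FD_linear_compose[OF assms(1,3)])
  then show ?thesis
    by (simp add: deriv2_def FD_linear_compose[OF assms(1) smooth_on_FD[OF assms(3)] assms(4)])
qed

lemma has_real_derivative_on_line:
  fixes g :: "'a::real_normed_vector \<Rightarrow> real"
  assumes "smooth_on S g" "a + s *\<^sub>R h \<in> S"
  shows "((\<lambda>s. g (a + s *\<^sub>R h)) has_real_derivative FD g (a + s *\<^sub>R h) h) (at s)"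
proof -
  have "((\<lambda>s. a + s *\<^sub>R h) has_derivative (\<lambda>r. r *\<^sub>R h)) (at s)"
    by (auto intro!: derivative_eq_intros)
  from has_derivative_compose[OF this smooth_on_has_derivative[OF assms]]
  show ?thesis
    unfolding has_field_derivative_def
    by (simp add: linear_cmul[OF smooth_on_linear_FD[OF assms]] mult.commute[of _ "FD g (a + s *\<^sub>R h) h"])
qed

lemma second_difference_eq_deriv2:
  fixes f :: "'a::real_normed_vector \<Rightarrow> real"
  assumes S: "smooth_on S f" "ball x e \<subseteq> S" and t: "t > 0" "t * (norm h + norm k) < e"
  shows "\<exists>p\<in>ball x e. f (x + t *\<^sub>R h + t *\<^sub>R k) - f (x + t *\<^sub>R h) - f (x + t *\<^sub>R k) + f x
    = t * t * deriv2 f p k h"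
proof -
  have in_ball: "x + a *\<^sub>R h + b *\<^sub>R k \<in> ball x e" if "0 \<le> a" "a \<le> t" "0 \<le> b" "b \<le> t" for a b
  proof -
    have "norm (a *\<^sub>R h + b *\<^sub>R k) \<le> a * norm h + b * norm k"
      using norm_triangle_ineq[of "a *\<^sub>R h" "b *\<^sub>R k"] that by simp
    also have "\<dots> \<le> t * (norm h + norm k)"
      using that by (simp add: distrib_left add_mono mult_right_mono)
    finally have "norm (a *\<^sub>R h + b *\<^sub>R k) < e" using t by linarith
    moreover have "dist x (x + v) = norm v" for v by (simp add: dist_norm)
    ultimately show ?thesis by (simp add: add.assoc)
  qed
  have pS: "x + a *\<^sub>R h + b *\<^sub>R k \<in> S" "x + b *\<^sub>R k + a *\<^sub>R h \<in> S"
    if "0 \<le> a" "a \<le> t" "0 \<le> b" "b \<le> t" for a b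
    using in_ball[OF that] S(2) by (auto simp: algebra_simps)
  let ?\<phi> = "\<lambda>s. f (x + t *\<^sub>R k + s *\<^sub>R h) - f (x + s *\<^sub>R h)"
  have d\<phi>: "DERIV ?\<phi> s :> FD f (x + t *\<^sub>R k + s *\<^sub>R h) h - FD f (x + s *\<^sub>R h) h"
    if "0 \<le> s" "s \<le> t" for s
    using pS[of s t] pS[of s 0] that t(1)
    by (intro DERIV_diff has_real_derivative_on_line[OF S(1)]) auto
  obtain \<sigma> where \<sigma>: "0 < \<sigma>" "\<sigma> < t"
    and e1: "?\<phi> t - ?\<phi> 0 = (t - 0) * (FD f (x + t *\<^sub>R k + \<sigma> *\<^sub>R h) h - FD f (x + \<sigma> *\<^sub>R h) h)"
    using MVT2[OF t(1) d\<phi>] by blast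
  let ?\<psi> = "\<lambda>r. FD f (x + \<sigma> *\<^sub>R h + r *\<^sub>R k) h"
  have d\<psi>: "DERIV ?\<psi> r :> deriv2 f (x + \<sigma> *\<^sub>R h + r *\<^sub>R k) k h" if "0 \<le> r" "r \<le> t" for r
    unfolding deriv2_def
    using pS[of \<sigma> r] that \<sigma> by (intro has_real_derivative_on_line[OF smooth_on_FD[OF S(1)]]) auto
  obtain \<rho> where \<rho>: "0 < \<rho>" "\<rho> < t"
    and e2: "?\<psi> t - ?\<psi> 0 = (t - 0) * deriv2 f (x + \<sigma> *\<^sub>R h + \<rho> *\<^sub>R k) k h"
    using MVT2[OF t(1) d\<psi>] by blast
  have c: "x + t *\<^sub>R k + \<sigma> *\<^sub>R h = x + \<sigma> *\<^sub>R h + t *\<^sub>R k" "x + t *\<^sub>R k + t *\<^sub>R h = x + t *\<^sub>R h + t *\<^sub>R k"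
    by (simp_all add: algebra_simps)
  have e2': "FD f (x + \<sigma> *\<^sub>R h + t *\<^sub>R k) h - FD f (x + \<sigma> *\<^sub>R h) h =
      t * deriv2 f (x + \<sigma> *\<^sub>R h + \<rho> *\<^sub>R k) k h"
    using e2 by simp
  show ?thesis
  proof (rule bexI)
    show "x + \<sigma> *\<^sub>R h + \<rho> *\<^sub>R k \<in> ball x e" using in_ball[of \<sigma> \<rho>] \<sigma> \<rho> by simp
    show "f (x + t *\<^sub>R h + t *\<^sub>R k) - f (x + t *\<^sub>R h) - f (x + t *\<^sub>R k) + f x
      = t * t * deriv2 f (x + \<sigma> *\<^sub>R h + \<rho> *\<^sub>R k) k h"
      using e1 by (simp add: c e2')
  qed
qed

text \<open>The second difference of \<open>f\<close> along \<open>h\<close> and \<open>k\<close> is symmetric, and divided by \<open>t\<^sup>2\<close> it is a value of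
  either mixed second derivative at a point near \<open>x\<close>.\<close>

lemma deriv2_commute:
  fixes f :: "'a::real_normed_vector \<Rightarrow> 'b::euclidean_space"
  assumes S: "open S" "smooth_on S f" "x \<in> S"
  shows "deriv2 f x h k = deriv2 f x k h"
proof -
  have real: "deriv2 g x h k = deriv2 g x k h" if g: "smooth_on S g" for g :: "'a \<Rightarrow> real"
  proof (rule ccontr)
    assume ne: "\<not> ?thesis"
    define \<epsilon> where "\<epsilon> = \<bar>deriv2 g x h k - deriv2 g x k h\<bar> / 2"
    have \<epsilon>: "\<epsilon> > 0" using ne by (simp add: \<epsilon>_def)
    have cont: "isCont (\<lambda>y. deriv2 g y h' k') x" for h' k'
      using smooth_on_continuous[OF smooth_on_deriv2[OF g]] S by (simp add: continuous_on_eq_continuous_at)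
    have near: "\<exists>d>0. \<forall>y. dist y x < d \<longrightarrow> dist (deriv2 g y h' k') (deriv2 g x h' k') < \<epsilon>" for h' k'
      using cont[of h' k'] \<epsilon> unfolding continuous_at_eps_delta by blast
    obtain d1 where d1: "d1 > 0" "\<And>y. dist y x < d1 \<Longrightarrow> dist (deriv2 g y h k) (deriv2 g x h k) < \<epsilon>"
      using near by blast
    obtain d2 where d2: "d2 > 0" "\<And>y. dist y x < d2 \<Longrightarrow> dist (deriv2 g y k h) (deriv2 g x k h) < \<epsilon>"
      using near by blast
    obtain d3 where d3: "d3 > 0" "ball x d3 \<subseteq> S" using S openE by blast
    define e where "e = min d1 (min d2 d3)"
    have e: "e > 0" "ball x e \<subseteq> S" using d1 d2 d3 by (auto simp: e_def)
    define t where "t = e / (norm h + norm k + 1)"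
    have n: "norm h + norm k + 1 > 0" by (simp add: add_nonneg_pos)
    have t: "t > 0" using n e by (simp add: t_def)
    have "t * (norm h + norm k) < t * (norm h + norm k + 1)" using t by simp
    also have "\<dots> = e" using n by (simp add: t_def)
    finally have t': "t * (norm h + norm k) < e" .
    obtain p where p: "p \<in> ball x e"
      "g (x + t *\<^sub>R h + t *\<^sub>R k) - g (x + t *\<^sub>R h) - g (x + t *\<^sub>R k) + g x = t * t * deriv2 g p k h"
      using second_difference_eq_deriv2[OF g e(2) t t'] by blast
    obtain q where q: "q \<in> ball x e"
      "g (x + t *\<^sub>R k + t *\<^sub>R h) - g (x + t *\<^sub>R k) - g (x + t *\<^sub>R h) + g x = t * t * deriv2 g q h k"
      using second_difference_eq_deriv2[OF g e(2) t, of k h] t' by (auto simp: add.commute)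
    have "x + t *\<^sub>R k + t *\<^sub>R h = x + t *\<^sub>R h + t *\<^sub>R k" by (simp add: algebra_simps)
    then have "t * t * deriv2 g p k h = t * t * deriv2 g q h k"
      unfolding p(2)[symmetric] q(2)[symmetric] by (simp only: diff_right_commute)
    then have "deriv2 g p k h = deriv2 g q h k" using t by simp
    moreover have "dist (deriv2 g q h k) (deriv2 g x h k) < \<epsilon>" "dist (deriv2 g p k h) (deriv2 g x k h) < \<epsilon>"
      using d1(2) d2(2) p(1) q(1) by (auto simp: e_def dist_commute)
    ultimately show False unfolding \<epsilon>_def dist_real_def by argo
  qed
  show ?thesis
  proof (rule euclidean_eqI)
    fix b :: 'b
    have "deriv2 f x h k \<bullet> b = deriv2 (\<lambda>y. f y \<bullet> b) x h k" for h k
      by (rule deriv2_linear_compose[OF _ S, symmetric]) (simp add: bounded_linear.linear bounded_linear_inner_left)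
    then show "deriv2 f x h k \<bullet> b = deriv2 f x k h \<bullet> b"
      using real[OF smooth_on_inner_left[OF S(1,2)]] by simp
  qed
qed

text \<open>The inverse function theorem gives the derivative of the inverse \<open>g\<close> as the inverse of
  \<open>D f \<circ> g\<close>. By Cramer's rule it is as regular as \<open>g\<close>, whose regularity therefore improves by induction.\<close>

lemma smooth_local_inverse:
  fixes f :: "real^'n \<Rightarrow> real^'n"
  assumes S: "open S" "smooth_on S f" "x \<in> S" and inj: "inj (FD f x)"
  obtains N M g where "open N" "x \<in> N" "N \<subseteq> S" "open M" "homeomorphism N M f g" "smooth_on M g"
    "\<And>y. y \<in> N \<Longrightarrow> inj (FD f y)"
proof -
  let ?f' = "\<lambda>y. Blinfun (FD f y)"
  have bl: "bounded_linear (FD f y)" if "y \<in> S" for y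
    using smooth_on_has_derivative[OF S(2) that] has_derivative_bounded_linear by blast
  have app: "blinfun_apply (?f' y) = FD f y" if "y \<in> S" for y
    by (rule bounded_linear_Blinfun_apply[OF bl[OF that]])
  have der: "(f has_derivative blinfun_apply (?f' y)) (at y)" if "y \<in> S" for y
    unfolding app[OF that] by (rule smooth_on_has_derivative[OF S(2) that])
  have cont: "continuous_on S ?f'"
  proof (rule continuous_on_blinfun_componentwise)
    fix i :: "real^'n"
    have "continuous_on S (\<lambda>y. FD f y i)" by (rule smooth_on_continuous[OF smooth_on_FD[OF S(2)]])
    then show "continuous_on S (\<lambda>y. blinfun_apply (?f' y) i)"
      by (rule continuous_on_eq) (simp add: app)
  qed
  obtain L where L: "linear L" "L \<circ> FD f x = id"
    using linear_injective_left_inverse[OF smooth_on_linear_FD[OF S(2,3)] inj] by blast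
  have inv: "Blinfun L o\<^sub>L ?f' x = id_blinfun"
    using L(2) by (intro blinfun_eqI)
      (simp add: app[OF S(3)] bounded_linear_Blinfun_apply[OF linear_conv_bounded_linear[THEN iffD1, OF L(1)]]
        fun_eq_iff)
  obtain N M g g' where *: "open N" "N \<subseteq> S" "x \<in> N" "open M" "f x \<in> M" and hom: "homeomorphism N M f g"
    and g: "\<And>y. y \<in> M \<Longrightarrow> (g has_derivative (g' y)) (at y)"
    and g': "\<And>y. y \<in> M \<Longrightarrow> g' y = inv_into UNIV (blinfun_apply (?f' (g y)))"
    and bij: "\<And>y. y \<in> M \<Longrightarrow> bij (blinfun_apply (?f' (g y)))"
    using inverse_function_theorem[OF S(1) der cont S(3) inv] by metis
  have gN: "g y \<in> N" "g y \<in> S" if "y \<in> M" for y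
    using hom that *(2) by (auto simp: homeomorphism_def)
  have injg: "inj (FD f (g y))" if "y \<in> M" for y
    using bij[OF that] app[OF gN(2)[OF that]] by (simp add: bij_is_inj)
  have "smooth_on M g"
    unfolding smooth_on_def
  proof
    fix k show "Ck_on k M g"
    proof (induction k)
      case 0
      then show ?case using hom by (simp add: homeomorphism_def)
    next
      case (Suc k)
      show ?case
      proof (rule Ck_on_SucI[OF *(4) g])
        fix v
        have "Ck_on k M (\<lambda>y. inv_into UNIV (FD f (g y)) v)"
        proof (rule Ck_on_inv_linear[OF *(4)])
          fix w
          show "Ck_on k M (\<lambda>y. FD f (g y) w)"
            by (rule Ck_on_compose[OF *(4) S(1) _ Suc.IH])
              (use gN smooth_on_FD[OF S(2)] in \<open>auto simp: smooth_on_def\<close>)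
        qed (use injg gN smooth_on_linear_FD[OF S(2)] in auto)
        then show "Ck_on k M (\<lambda>y. g' y v)"
          by (rule Ck_on_cong[OF *(4), rotated]) (simp add: g' app[OF gN(2)])
      qed
    qed
  qed
  moreover have "inj (FD f y)" if "y \<in> N" for y
    using injg[of "f y"] hom that by (auto simp: homeomorphism_def)
  ultimately show ?thesis using that * hom by blast
qed


section \<open>Coordinates of 2-jets\<close>

lemma linear_eq_on_axes:
  fixes f g :: "real^'n \<Rightarrow> 'b::real_vector"
  assumes "linear f" "linear g" "\<And>i. f (axis i 1) = g (axis i 1)"
  shows "f = g"
  by (rule linear_eq_stdbasis[OF assms(1,2)]) (use assms(3) in \<open>auto simp: Basis_vec_def\<close>)

lemma bilinear_eq_on_axes:
  fixes f g :: "real^'n \<Rightarrow> real^'n \<Rightarrow> 'b::real_vector"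
  assumes "bilinear f" "bilinear g" "\<And>i j. f (axis i 1) (axis j 1) = g (axis i 1) (axis j 1)"
  shows "f = g"
proof (rule ext)
  fix h
  have "(\<lambda>h. f h (axis j 1)) = (\<lambda>h. g h (axis j 1))" for j
    using assms by (intro linear_eq_on_axes) (auto simp: bilinear_def)
  then have "f h (axis j 1) = g h (axis j 1)" for j by metis
  then show "f h = g h"
    using assms by (intro linear_eq_on_axes) (auto simp: bilinear_def)
qed

text \<open>The coefficients \<open>u\<^sub>i\<close> and \<open>u\<^sub>i\<^sub>j\<close> of a jet, as a linear and as a symmetric bilinear map.\<close>

definition lin_of :: "'v^'n \<Rightarrow> real^'n \<Rightarrow> 'v::euclidean_space" where
  "lin_of p h = (\<Sum>i\<in>UNIV. h $ i *\<^sub>R p $ i)"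

definition bil_of :: "'v^('n uprod) \<Rightarrow> real^'n \<Rightarrow> real^'n \<Rightarrow> 'v::euclidean_space" where
  "bil_of q h k = (\<Sum>i\<in>UNIV. \<Sum>j\<in>UNIV. (h $ i * k $ j) *\<^sub>R q $ (Upair i j))"

lemma linear_lin_of: "linear (lin_of p)"
  unfolding lin_of_def
  by (rule linearI) (simp_all add: scaleR_add_left sum.distrib scaleR_sum_right)

lemma lin_of_axis: "lin_of p (axis i 1) = p $ i"
  unfolding lin_of_def by (simp add: axis_def if_distrib[where f="\<lambda>r. r *\<^sub>R _"] sum.delta' cong: if_cong)

lemma bilinear_bil_of: "bilinear (bil_of q)"
  unfolding bilinear_def bil_of_def
  by (auto intro!: linearI simp: scaleR_add_left sum.distrib scaleR_sum_right distrib_left distrib_right mult_ac)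

lemma bil_of_axis: "bil_of q (axis i 1) (axis j 1) = q $ (Upair i j)"
proof -
  have "bil_of q h k = (\<Sum>i\<in>UNIV. h $ i *\<^sub>R (\<Sum>j\<in>UNIV. k $ j *\<^sub>R q $ (Upair i j)))" for h k
    by (simp add: bil_of_def scaleR_sum_right)
  then show ?thesis
    by (simp add: axis_def if_distrib[where f="\<lambda>r. r *\<^sub>R _"] sum.delta' cong: if_cong)
qed

lemma bil_of_commute: "bil_of q h k = bil_of q k h"
proof -
  have "(h $ i * k $ j) *\<^sub>R q $ (Upair i j) = (k $ j * h $ i) *\<^sub>R q $ (Upair j i)" for i j
  proof -
    have "Upair i j = Upair j i" by simp
    then show ?thesis by (simp only: mult.commute)
  qed
  then show ?thesis unfolding bil_of_def by (subst sum.swap) simp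
qed

lemma smooth_on_lin_of: "open S \<Longrightarrow> smooth_on S f \<Longrightarrow> smooth_on S (\<lambda>x. lin_of (f x) h)"
  unfolding lin_of_def by (intro smooth_on_sum smooth_on_scaleR smooth_on_const smooth_on_vec_nth) auto

lemma smooth_on_bil_of: "open S \<Longrightarrow> smooth_on S f \<Longrightarrow> smooth_on S (\<lambda>x. bil_of (f x) h k)"
  unfolding bil_of_def by (intro smooth_on_sum smooth_on_scaleR smooth_on_const smooth_on_vec_nth) auto

lemma partial_eq: "partial i f x = FD f x (axis i 1)"
  by (simp add: partial_def)

lemma partial_partial_eq: "partial i (partial j f) x = deriv2 f x (axis i 1) (axis j 1)"
proof -
  have "partial j f = (\<lambda>y. FD f y (axis j 1))" by (rule ext) (simp add: partial_def)
  then show ?thesis by (simp add: partial_def deriv2_def)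
qed

lemma partial2_Upair:
  fixes f :: "real^'n \<Rightarrow> 'v::euclidean_space"
  assumes "open S" "smooth_on S f" "x \<in> S"
  shows "partial2 (Upair i j) f x = deriv2 f x (axis i 1) (axis j 1)"
proof -
  define ab where "ab = (SOME ab. Upair i j = Upair (fst ab) (snd ab))"
  have "Upair i j = Upair (fst ab) (snd ab)"
    unfolding ab_def by (rule someI[of "\<lambda>ab. Upair i j = Upair (fst ab) (snd ab)" "(i, j)"]) simp
  then have "fst ab = i \<and> snd ab = j \<or> fst ab = j \<and> snd ab = i" by auto
  moreover have "partial2 (Upair i j) f x = deriv2 f x (axis (fst ab) 1) (axis (snd ab) 1)"
    unfolding partial2_def ab_def[symmetric] by (simp add: partial_partial_eq)
  ultimately show ?thesis using deriv2_commute[OF assms] by auto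
qed

text \<open>The common form of the coordinates in \<open>jet_chart\<close> and in \<open>subjet_chart\<close>.\<close>

definition coords2 :: "real^'n \<Rightarrow> (real^'n \<Rightarrow> 'v::euclidean_space) \<Rightarrow> (real^'n) \<times> 'v \<times> ('v^'n) \<times> ('v^('n uprod))" where
  "coords2 x f = (x, f x, (\<chi> i. partial i f x), (\<chi> \<sigma>. partial2 \<sigma> f x))"

lemma coords2_eq_iff:
  fixes f :: "real^'n \<Rightarrow> 'v::euclidean_space"
  assumes S: "open S" "smooth_on S f" "x \<in> S"
  shows "coords2 x f = (y, z, p, q) \<longleftrightarrow> y = x \<and> z = f x \<and> lin_of p = FD f x \<and> bil_of q = deriv2 f x"
proof -
  have "lin_of p = FD f x \<longleftrightarrow> p = (\<chi> i. partial i f x)"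
  proof
    assume "lin_of p = FD f x"
    then show "p = (\<chi> i. partial i f x)" by (simp add: vec_eq_iff partial_eq) (metis lin_of_axis)
  next
    assume "p = (\<chi> i. partial i f x)"
    then show "lin_of p = FD f x"
      by (intro linear_eq_on_axes linear_lin_of smooth_on_linear_FD[OF S(2,3)]) (simp add: lin_of_axis partial_eq)
  qed
  moreover have "bil_of q = deriv2 f x \<longleftrightarrow> q = (\<chi> \<sigma>. partial2 \<sigma> f x)"
  proof
    assume b: "bil_of q = deriv2 f x"
    show "q = (\<chi> \<sigma>. partial2 \<sigma> f x)"
      unfolding vec_eq_iff
    proof
      fix \<sigma> :: "'n uprod"
      obtain i j where \<sigma>: "\<sigma> = Upair i j" by (metis uprod_exhaust)
      have "q $ Upair i j = bil_of q (axis i 1) (axis j 1)" by (simp add: bil_of_axis)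
      then show "q $ \<sigma> = (\<chi> \<sigma>. partial2 \<sigma> f x) $ \<sigma>" by (simp add: \<sigma> b partial2_Upair[OF S])
    qed
  next
    assume "q = (\<chi> \<sigma>. partial2 \<sigma> f x)"
    then show "bil_of q = deriv2 f x"
      by (intro bilinear_eq_on_axes bilinear_bil_of bilinear_deriv2[OF S]) (simp add: bil_of_axis partial2_Upair[OF S])
  qed
  ultimately show ?thesis by (auto simp: coords2_def)
qed

text \<open>A representative of the 2-jet with these coordinates.\<close>

definition quadratic :: "(real^'n) \<times> 'v \<times> ('v^'n) \<times> ('v^('n uprod)) \<Rightarrow> real^'n \<Rightarrow> 'v::euclidean_space" where
  "quadratic = (\<lambda>(x, z, p, q) y. z + lin_of p (y - x) + (1/2) *\<^sub>R bil_of q (y - x) (y - x))"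

lemma bounded_bilinear_bil_of: "bounded_bilinear (bil_of q)"
  using bilinear_bil_of bilinear_conv_bounded_bilinear by blast

lemma bounded_linear_lin_of: "bounded_linear (lin_of p)"
  using linear_lin_of linear_conv_bounded_linear by blast

lemma smooth_on_quadratic: "smooth_on UNIV (quadratic w)"
proof -
  obtain x z p q where w: "w = (x, z, p, q)" by (metis prod_cases4)
  have d: "smooth_on UNIV (\<lambda>y. y - x)"
    by (rule smooth_on_diff[OF open_UNIV smooth_on_id[OF open_UNIV] smooth_on_const])
  show ?thesis
    unfolding w quadratic_def prod.case
    by (intro smooth_on_add[OF open_UNIV] smooth_on_const smooth_on_linear[OF open_UNIV linear_lin_of d]
        smooth_on_bounded_linear[OF open_UNIV bounded_linear_scaleR_right
          smooth_on_bilinear[OF open_UNIV bounded_bilinear_bil_of d d]])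
qed

lemma FD_quadratic:
  fixes p :: "'v::euclidean_space^'n"
  shows "FD (quadratic (x, z, p, q)) y h = lin_of p h + bil_of q h (y - x)"
proof -
  have dx: "((\<lambda>y. y - x) has_derivative (\<lambda>h. h)) (at y)" by (auto intro!: derivative_eq_intros)
  note L = bounded_linear.has_derivative[OF bounded_linear_lin_of dx]
    and B = bounded_bilinear.FDERIV[OF bounded_bilinear_bil_of dx dx]
  have "(quadratic (x, z, p, q) has_derivative
      (\<lambda>h. 0 + lin_of p h + (1/2) *\<^sub>R (bil_of q (y - x) h + bil_of q h (y - x)))) (at y)"
    unfolding quadratic_def prod.case
    by (intro has_derivative_add has_derivative_const has_derivative_scaleR_right L B)
  then have "FD (quadratic (x, z, p, q)) y h = 0 + lin_of p h + (1/2) *\<^sub>R (bil_of q (y - x) h + bil_of q h (y - x))"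
    by (simp only: FD_eq)
  then show ?thesis unfolding bil_of_commute[of q "y - x" h] by (simp add: scaleR_2[symmetric])
qed

lemma deriv2_quadratic:
  fixes p :: "'v::euclidean_space^'n"
  shows "deriv2 (quadratic (x, z, p, q)) y h k = bil_of q h k"
proof -
  have dx: "((\<lambda>y. y - x) has_derivative (\<lambda>h. h)) (at y)" by (auto intro!: derivative_eq_intros)
  have "((\<lambda>y. lin_of p k + bil_of q k (y - x)) has_derivative (\<lambda>h. 0 + bil_of q k h)) (at y)"
    by (intro has_derivative_add has_derivative_const
        bounded_linear.has_derivative[OF bounded_bilinear.bounded_linear_right[OF bounded_bilinear_bil_of] dx])
  then show ?thesis unfolding deriv2_def FD_quadratic by (simp add: FD_eq bil_of_commute[of q k h])
qed

lemma coords2_quadratic: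
  fixes w :: "(real^'n) \<times> 'v::euclidean_space \<times> ('v^'n) \<times> ('v^('n uprod))"
  shows "coords2 (fst w) (quadratic w) = w"
proof -
  obtain x z p q where w: "w = (x, z, p, q)" by (metis prod_cases4)
  have "lin_of p 0 = 0" "bil_of q h 0 = 0" for h
    using linear_0[OF linear_lin_of] bilinear_rzero[OF bilinear_bil_of] by auto
  then have "coords2 x (quadratic (x, z, p, q)) = (x, z, p, q)"
    unfolding coords2_eq_iff[OF open_UNIV smooth_on_quadratic UNIV_I]
    by (simp add: fun_eq_iff FD_quadratic deriv2_quadratic) (simp add: quadratic_def)
  then show ?thesis by (simp add: w)
qed


section \<open>Charts\<close>

abbreviation cinv :: "('a, 'v) chart \<Rightarrow> 'v \<Rightarrow> 'a" where
  "cinv c \<equiv> inv_into (fst c) (snd c)"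

abbreviation transition :: "('a, 'v) chart \<Rightarrow> ('a, 'v) chart \<Rightarrow> 'v \<Rightarrow> 'v" where
  "transition c d \<equiv> in_charts c d (\<lambda>p. p)"

locale atlas =
  fixes A :: "('e::{t2_space, second_countable_topology}, 'v::euclidean_space) chart set"
  assumes manifold: "smooth_manifold A"
begin

lemma is_chart: "c \<in> A \<Longrightarrow> is_chart c"
  using manifold by (simp add: smooth_manifold_def)

lemma chart_at: obtains c where "c \<in> A" "p \<in> fst c"
proof -
  have "p \<in> \<Union> (fst ` A)" using manifold by (simp add: smooth_manifold_def)
  then show ?thesis using that by blast
qed

context
  fixes c assumes c: "c \<in> A"
begin

lemma open_domain: "open (fst c)" and open_range: "open (snd c ` fst c)"
  and homeo_chart: "homeomorphism (fst c) (snd c ` fst c) (snd c) (cinv c)"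
  using is_chart[OF c] by (auto simp: is_chart_def)

lemma cinv_chart: "p \<in> fst c \<Longrightarrow> cinv c (snd c p) = p"
  using homeo_chart by (auto simp: homeomorphism_def)

lemma inj_on_chart: "inj_on (snd c) (fst c)"
  using cinv_chart by (metis inj_onI)

lemma chart_cinv: "z \<in> snd c ` fst c \<Longrightarrow> snd c (cinv c z) = z"
  and cinv_domain: "z \<in> snd c ` fst c \<Longrightarrow> cinv c z \<in> fst c"
  by (auto simp: cinv_chart)

lemma continuous_chart: "continuous_on (fst c) (snd c)"
  and continuous_cinv: "continuous_on (snd c ` fst c) (cinv c)"
  using homeo_chart by (auto simp: homeomorphism_def)

lemma open_chart_image: "open U \<Longrightarrow> open (snd c ` (fst c \<inter> U))"
proof -
  assume "open U"
  have "snd c ` (fst c \<inter> U) = snd c ` fst c \<inter> cinv c -` U"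
    by (auto simp: cinv_chart)
  then show ?thesis
    using continuous_open_preimage[OF continuous_cinv open_range \<open>open U\<close>] by simp
qed

lemma open_chart_preimage: "open V \<Longrightarrow> open (fst c \<inter> snd c -` V)"
  using continuous_open_preimage[OF continuous_chart open_domain] .

lemma transition_chart: "p \<in> fst c \<Longrightarrow> transition c d (snd c p) = snd d p"
  by (simp add: in_charts_def cinv_chart)

end

lemma smooth_transition: "c \<in> A \<Longrightarrow> d \<in> A \<Longrightarrow> smooth_on (snd c ` (fst c \<inter> fst d)) (transition c d)"
  using manifold by (simp add: smooth_manifold_def compatible_def)

lemma open_overlap: "c \<in> A \<Longrightarrow> d \<in> A \<Longrightarrow> open (snd c ` (fst c \<inter> fst d))"
  using open_chart_image open_domain by blast

lemma FD_transition_inverse: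
  assumes c: "c \<in> A" and d: "d \<in> A" and p: "p \<in> fst c" "p \<in> fst d"
  shows "FD (transition d c) (snd d p) (FD (transition c d) (snd c p) h) = h"
proof -
  let ?S = "snd c ` (fst c \<inter> fst d)"
  have "FD (transition d c) (snd d p) (FD (transition c d) (snd c p) h)
      = FD (\<lambda>z. transition d c (transition c d z)) (snd c p) h"
    by (subst FD_compose[OF smooth_transition[OF c d] _ smooth_transition[OF d c]])
      (use p in \<open>auto simp: transition_chart[OF c]\<close>)
  also have "\<dots> = FD (\<lambda>z. z) (snd c p) h"
    by (rule fun_cong[OF FD_cong[OF open_overlap[OF c d]]])
      (use p in \<open>auto simp: transition_chart[OF c] transition_chart[OF d]\<close>)
  finally show ?thesis by simp
qed

lemma inj_FD_transition:
  assumes "c \<in> A" "d \<in> A" "p \<in> fst c" "p \<in> fst d"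
  shows "inj (FD (transition c d) (snd c p))"
  by (rule inj_on_inverseI[of _ "FD (transition d c) (snd d p)"]) (use FD_transition_inverse assms in auto)

text \<open>Since the atlas is maximal, a chart followed by a local diffeomorphism is a chart. This supplies
  the charts in which submanifolds are straightened.\<close>

lemma chart_change_coordinates:
  assumes c: "c \<in> A" and W: "open W" "W \<subseteq> snd c ` fst c" and f: "smooth_on W f" "open (f ` W)"
    and g: "smooth_on (f ` W) g" "\<And>z. z \<in> W \<Longrightarrow> g (f z) = z"
  shows "(fst c \<inter> snd c -` W, \<lambda>p. f (snd c p)) \<in> A" (is "?c \<in> A")
proof -
  have dom: "open (fst ?c)" using open_chart_preimage[OF c W(1)] by simp
  have im: "snd ?c ` fst ?c = f ` W"
    using W(2) by force
  have inv: "cinv ?c z = cinv c (g z)" if "z \<in> f ` W" for z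
  proof -
    obtain p where p: "p \<in> fst c" "snd c p \<in> W" "z = f (snd c p)" using \<open>z \<in> f ` W\<close> W(2) by force
    have inj: "inj_on (snd ?c) (fst ?c)"
      using g(2) inj_on_chart[OF c] by (auto simp: inj_on_def) metis
    have "cinv ?c z = p" using p by (intro inv_into_f_eq[OF inj]) auto
    then show ?thesis using p g(2) cinv_chart[OF c] by simp
  qed
  have gW: "g ` f ` W \<subseteq> W" using g(2) by auto
  have hom: "homeomorphism (fst ?c) (snd ?c ` fst ?c) (snd ?c) (cinv ?c)"
    unfolding im
  proof (rule homeomorphismI)
    have "continuous_on (fst ?c) (snd c)" using continuous_chart[OF c] continuous_on_subset by fastforce
    then show "continuous_on (fst ?c) (snd ?c)"
      using continuous_on_compose2[OF smooth_on_continuous[OF f(1)]] by auto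
    have "continuous_on (f ` W) (\<lambda>z. cinv c (g z))"
      using continuous_on_compose2[OF continuous_cinv[OF c] smooth_on_continuous[OF g(1)]] gW W(2) by blast
    then show "continuous_on (f ` W) (cinv ?c)" by (rule continuous_on_eq) (rule inv[symmetric])
  next
    show "snd ?c ` fst ?c \<subseteq> f ` W" by auto
    have gc: "g z \<in> snd c ` fst c" if "z \<in> f ` W" for z using that gW W(2) by blast
    show "cinv ?c ` f ` W \<subseteq> fst ?c"
    proof (rule image_subsetI)
      fix z assume z: "z \<in> f ` W"
      then show "cinv ?c z \<in> fst ?c"
        using inv[OF z] cinv_domain[OF c gc[OF z]] chart_cinv[OF c gc[OF z]] gW by auto
    qed
    show "cinv ?c (snd ?c p) = p" if "p \<in> fst ?c" for p
      using that inv[of "f (snd c p)"] g(2) cinv_chart[OF c] by auto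
    show "snd ?c (cinv ?c z) = z" if z: "z \<in> f ` W" for z
      using inv[OF z] chart_cinv[OF c gc[OF z]] z g(2) by auto
  qed
  have chart: "is_chart ?c"
    unfolding is_chart_def using dom hom f(2) im by simp
  have "compatible ?c d" if d: "d \<in> A" for d
  proof -
    have O: "open (snd c ` (fst c \<inter> (fst ?c \<inter> fst d)))"
      using open_chart_image[OF c] dom open_domain[OF d] by blast
    have o: "snd c ` (fst c \<inter> (fst ?c \<inter> fst d)) = snd c ` (fst ?c \<inter> fst d)"
      by (rule arg_cong[of _ _ "image (snd c)"]) auto
    have im2: "snd ?c ` (fst ?c \<inter> fst d) = f ` W \<inter> g -` (snd c ` (fst ?c \<inter> fst d))" (is "?L = ?R")
    proof
      show "?L \<subseteq> ?R" using g(2) by auto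
      show "?R \<subseteq> ?L" using g(2) by force
    qed
    have O2: "open (snd ?c ` (fst ?c \<inter> fst d))"
      unfolding im2 using O o f(2)
      by (simp add: continuous_open_preimage[OF smooth_on_continuous[OF g(1)] f(2)])
    have 1: "smooth_on (snd ?c ` (fst ?c \<inter> fst d)) (transition ?c d)"
    proof (rule smooth_on_cong[OF O2])
      show "smooth_on (snd ?c ` (fst ?c \<inter> fst d)) (\<lambda>z. transition c d (g z))"
        by (rule smooth_on_compose[OF O2 open_overlap[OF c d] _ smooth_on_subset[OF g(1)] smooth_transition[OF c d]])
          (use g(2) in auto)
    qed (use g(2) inv im in \<open>auto simp: in_charts_def\<close>)
    have O3: "open (snd d ` (fst d \<inter> (fst ?c \<inter> fst d)))"
      using open_chart_image[OF d] dom open_domain[OF d] by blast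
    have "fst d \<inter> (fst ?c \<inter> fst d) = fst ?c \<inter> fst d" by auto
    with O3 have O4: "open (snd d ` (fst ?c \<inter> fst d))" by simp
    have 2: "smooth_on (snd d ` (fst ?c \<inter> fst d)) (transition d ?c)"
    proof (rule smooth_on_cong[OF O4])
      show "smooth_on (snd d ` (fst ?c \<inter> fst d)) (\<lambda>z. f (transition d c z))"
        by (rule smooth_on_compose[OF O4 W(1) _ smooth_on_subset[OF smooth_transition[OF d c]] f(1)])
          (auto simp: transition_chart[OF d])
    qed (auto simp: in_charts_def)
    show ?thesis unfolding compatible_def using 1 2 by simp
  qed
  moreover have "\<forall>c. is_chart c \<and> (\<forall>d\<in>A. compatible c d) \<longrightarrow> c \<in> A"
    using manifold unfolding smooth_manifold_def by (elim conjE)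
  ultimately show ?thesis using chart by blast
qed

end


section \<open>Tangent vectors, smooth maps and contact transformations\<close>

lemma smooth_on_has_vector_derivative:
  fixes f :: "real \<Rightarrow> 'b::real_normed_vector"
  assumes "smooth_on S f" "t \<in> S"
  shows "(f has_vector_derivative FD f t 1) (at t)"
proof -
  have d: "(f has_derivative FD f t) (at t)" by (rule smooth_on_has_derivative[OF assms])
  have "FD f t = (\<lambda>r. r *\<^sub>R FD f t 1)"
  proof
    fix r :: real
    show "FD f t r = r *\<^sub>R FD f t 1" using linear_cmul[OF has_derivative_linear[OF d], of r 1] by simp
  qed
  then show ?thesis unfolding has_vector_derivative_def using d by simp
qed

lemma tangent_vectorsE:
  assumes "v \<in> tangent_vectors c S a"
  obtains \<gamma> \<epsilon> where "\<epsilon> > 0" "\<gamma> (0::real) = a" "\<And>t. t \<in> {-\<epsilon><..<\<epsilon>} \<Longrightarrow> \<gamma> t \<in> S \<inter> fst c"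
    "smooth_on {-\<epsilon><..<\<epsilon>} (\<lambda>t. snd c (\<gamma> t))" "((\<lambda>t. snd c (\<gamma> t)) has_vector_derivative v) (at 0)"
proof -
  obtain \<gamma> \<epsilon> where *: "\<epsilon> > 0" "\<gamma> (0::real) = a" "\<And>t. t \<in> {-\<epsilon><..<\<epsilon>} \<Longrightarrow> \<gamma> t \<in> S \<inter> fst c"
    "smooth_on {-\<epsilon><..<\<epsilon>} (snd c \<circ> \<gamma>)" "v = vector_derivative (snd c \<circ> \<gamma>) (at 0)"
    using assms unfolding tangent_vectors_def by blast
  have "((snd c \<circ> \<gamma>) has_vector_derivative FD (snd c \<circ> \<gamma>) 0 1) (at 0)"
    by (rule smooth_on_has_vector_derivative[OF *(4)]) (use *(1) in auto)
  then have "((snd c \<circ> \<gamma>) has_vector_derivative v) (at 0)"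
    using *(5) vector_derivative_at by metis
  then show ?thesis using that * by (simp add: comp_def)
qed

lemma tangent_vectorsI:
  assumes "\<epsilon> > 0" "\<gamma> (0::real) = a" "\<And>t. t \<in> {-\<epsilon><..<\<epsilon>} \<Longrightarrow> \<gamma> t \<in> S \<inter> fst c"
    "smooth_on {-\<epsilon><..<\<epsilon>} (\<lambda>t. snd c (\<gamma> t))" "((\<lambda>t. snd c (\<gamma> t)) has_vector_derivative v) (at 0)"
  shows "v \<in> tangent_vectors c S a"
proof -
  have "v = vector_derivative (snd c \<circ> \<gamma>) (at 0)"
    using vector_derivative_at[OF assms(5)] by (simp add: comp_def)
  then show ?thesis
    unfolding tangent_vectors_def using assms by (auto simp: comp_def intro!: exI[of _ \<gamma>] exI[of _ \<epsilon>])
qed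

lemma tangent_vectors_mono: "S \<subseteq> T \<Longrightarrow> tangent_vectors c S a \<subseteq> tangent_vectors c T a"
  unfolding tangent_vectors_def by blast

lemma real_interval_in_open:
  fixes g :: "real \<Rightarrow> 'v::topological_space"
  assumes "\<epsilon> > 0" "continuous_on {-\<epsilon><..<\<epsilon>} g" "open U" "g 0 \<in> U"
  obtains \<delta> where "0 < \<delta>" "\<delta> \<le> \<epsilon>" "\<And>t. t \<in> {-\<delta><..<\<delta>} \<Longrightarrow> g t \<in> U"
proof -
  have "open ({-\<epsilon><..<\<epsilon>} \<inter> g -` U)" by (rule continuous_open_preimage[OF assms(2) _ assms(3)]) simp
  moreover have "0 \<in> {-\<epsilon><..<\<epsilon>} \<inter> g -` U" using assms by auto
  ultimately obtain \<delta> where "\<delta> > 0" "ball 0 \<delta> \<subseteq> {-\<epsilon><..<\<epsilon>} \<inter> g -` U" using openE by blast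
  then show ?thesis
    by (intro that[of "min \<delta> \<epsilon>"]) (use assms(1) in \<open>auto simp: subset_iff dist_real_def\<close>)
qed

text \<open>Only the part of a curve near time zero matters.\<close>

lemma tangent_vectors_local:
  assumes v: "v \<in> tangent_vectors c S a" and U: "open U" "snd c a \<in> U"
  shows "v \<in> tangent_vectors c {b \<in> S \<inter> fst c. snd c b \<in> U} a"
proof -
  obtain \<gamma> \<epsilon> where *: "\<epsilon> > 0" "\<gamma> (0::real) = a" "\<And>t. t \<in> {-\<epsilon><..<\<epsilon>} \<Longrightarrow> \<gamma> t \<in> S \<inter> fst c"
    "smooth_on {-\<epsilon><..<\<epsilon>} (\<lambda>t. snd c (\<gamma> t))" "((\<lambda>t. snd c (\<gamma> t)) has_vector_derivative v) (at 0)"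
    by (rule tangent_vectorsE[OF v]) (rule that)
  obtain \<delta> where \<delta>: "0 < \<delta>" "\<delta> \<le> \<epsilon>" "\<And>t. t \<in> {-\<delta><..<\<delta>} \<Longrightarrow> snd c (\<gamma> t) \<in> U"
    using real_interval_in_open[OF *(1) smooth_on_continuous[OF *(4)] U(1)] U(2) *(2) by metis
  show ?thesis
    by (rule tangent_vectorsI[OF \<delta>(1) *(2) _ smooth_on_subset[OF *(4)] *(5)]) (use \<delta> *(3) in auto)
qed


lemma in_charts_apply: "inj_on (snd c) (fst c) \<Longrightarrow> a \<in> fst c \<Longrightarrow> in_charts c d f (snd c a) = snd d (f a)"
  by (simp add: in_charts_def)

abbreviation coord_domain :: "('a, 'v) chart \<Rightarrow> ('b, 'w) chart \<Rightarrow> 'a set \<Rightarrow> ('a \<Rightarrow> 'b) \<Rightarrow> 'v set" where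
  "coord_domain c d X f \<equiv> snd c ` {a \<in> fst c \<inter> X. f a \<in> fst d}"

lemma smooth_mapD:
  assumes "smooth_map J K X f" "c \<in> jet_charts J" "d \<in> jet_charts K"
  shows "open (coord_domain c d X f)" "smooth_on (coord_domain c d X f) (in_charts c d f)"
  using assms by (auto simp: smooth_map_def Let_def)

lemma smooth_map_cong:
  assumes f: "smooth_map J K X f" and eq: "\<And>a. a \<in> X \<Longrightarrow> f a = g a"
    and inj: "\<And>c. c \<in> jet_charts J \<Longrightarrow> inj_on (snd c) (fst c)"
  shows "smooth_map J K X g"
proof -
  have "open (coord_domain c d X g)" "smooth_on (coord_domain c d X g) (in_charts c d g)"
    if "c \<in> jet_charts J" "d \<in> jet_charts K" for c d
  proof -
    have dom: "coord_domain c d X f = coord_domain c d X g"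
      by (rule arg_cong[of _ _ "image (snd c)"]) (use eq in auto)
    show "open (coord_domain c d X g)" using smooth_mapD(1)[OF f that] unfolding dom .
    then show "smooth_on (coord_domain c d X g) (in_charts c d g)"
      by (rule smooth_on_cong[OF _ _ smooth_mapD(2)[OF f that, unfolded dom]])
        (auto simp: in_charts_apply[OF inj[OF that(1)]] eq)
  qed
  moreover have "X \<subseteq> jets J" "f ` X \<subseteq> jets K" using f by (auto simp: smooth_map_def)
  moreover from this have "g ` X \<subseteq> jets K" using eq by force
  ultimately show ?thesis unfolding smooth_map_def Let_def by blast
qed

lemma differential_cong:
  assumes f: "smooth_map J K X f" and eq: "\<And>a. a \<in> X \<Longrightarrow> f a = g a"
    and c: "c \<in> jet_charts J" "inj_on (snd c) (fst c)" and d: "d \<in> jet_charts K"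
    and a: "a \<in> X" "a \<in> fst c" "f a \<in> fst d"
  shows "differential c d f a = differential c d g a"
  unfolding differential_def
  by (rule FD_cong[OF smooth_mapD(1)[OF f c(1) d]]) (use a in \<open>auto simp: in_charts_apply[OF c(2)] eq\<close>)

lemma linear_differential:
  assumes f: "smooth_map J K X f" and c: "c \<in> jet_charts J" and d: "d \<in> jet_charts K"
    and a: "a \<in> X" "a \<in> fst c" "f a \<in> fst d"
  shows "linear (differential c d f a)"
  unfolding differential_def
  by (rule smooth_on_linear_FD[OF smooth_mapD(2)[OF f c d]]) (use a in auto)

lemma differential_compose:
  assumes f: "smooth_map J J' X f" and g: "smooth_map J' K Y g"
    and c: "c \<in> jet_charts J" "inj_on (snd c) (fst c)" and e: "e \<in> jet_charts J'" "inj_on (snd e) (fst e)"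
    and d: "d \<in> jet_charts K"
    and a: "a \<in> X" "a \<in> fst c" "f a \<in> fst e" "f a \<in> Y" "g (f a) \<in> fst d"
  shows "differential c d (\<lambda>a. g (f a)) a v = differential e d g (f a) (differential c e f a v)"
proof -
  let ?V = "coord_domain c e X f" and ?W = "coord_domain e d Y g"
  note V = smooth_mapD[OF f c(1) e(1)] and W = smooth_mapD[OF g e(1) d]
  let ?U = "?V \<inter> in_charts c e f -` ?W"
  have U: "open ?U" by (rule continuous_open_preimage[OF smooth_on_continuous[OF V(2)] V(1) W(1)])
  have aV: "snd c a \<in> ?V" using a by auto
  have fa: "in_charts c e f (snd c a) = snd e (f a)" by (rule in_charts_apply[OF c(2) a(2)])
  have aW: "in_charts c e f (snd c a) \<in> ?W" unfolding fa using a by auto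
  have "in_charts c d (\<lambda>a. g (f a)) w = in_charts e d g (in_charts c e f w)" if w: "w \<in> ?U" for w
    using w by (auto simp: in_charts_apply[OF c(2)] in_charts_apply[OF e(2)] dest!: inj_onD[OF e(2)])
  then have "differential c d (\<lambda>a. g (f a)) a v = FD (\<lambda>w. in_charts e d g (in_charts c e f w)) (snd c a) v"
    unfolding differential_def using aV aW by (intro fun_cong[OF FD_cong[OF U]]) auto
  also have "\<dots> = FD (in_charts e d g) (snd e (f a)) (FD (in_charts c e f) (snd c a) v)"
    by (subst FD_compose[OF V(2) aV W(2) aW]) (simp add: fa)
  finally show ?thesis by (simp add: differential_def)
qed

lemma differential_tangent:
  fixes c :: "('a, 'v::euclidean_space) chart" and d :: "('b, 'w::euclidean_space) chart"
  assumes f: "smooth_map J K X f" and c: "c \<in> jet_charts J" "inj_on (snd c) (fst c)" and d: "d \<in> jet_charts K"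
    and a: "a \<in> X" "a \<in> fst c" "f a \<in> fst d" and v: "v \<in> tangent_vectors c S a"
  shows "differential c d f a v \<in> tangent_vectors d (f ` (S \<inter> X)) (f a)"
proof -
  let ?V = "coord_domain c d X f"
  note V = smooth_mapD[OF f c(1) d]
  have aV: "snd c a \<in> ?V" using a by auto
  obtain \<gamma> \<epsilon> where *: "\<epsilon> > 0" "\<gamma> (0::real) = a"
    "\<And>t. t \<in> {-\<epsilon><..<\<epsilon>} \<Longrightarrow> \<gamma> t \<in> {b \<in> S \<inter> fst c. snd c b \<in> ?V} \<inter> fst c"
    "smooth_on {-\<epsilon><..<\<epsilon>} (\<lambda>t. snd c (\<gamma> t))" "((\<lambda>t. snd c (\<gamma> t)) has_vector_derivative v) (at 0)"
    by (rule tangent_vectorsE[OF tangent_vectors_local[OF v V(1) aV]]) (rule that)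
  have \<gamma>: "\<gamma> t \<in> S \<inter> X" "\<gamma> t \<in> fst c" "f (\<gamma> t) \<in> fst d" if "t \<in> {-\<epsilon><..<\<epsilon>}" for t
    using *(3)[OF that] inj_onD[OF c(2)] by blast+
  have eq: "in_charts c d f (snd c (\<gamma> t)) = snd d (f (\<gamma> t))" if "t \<in> {-\<epsilon><..<\<epsilon>}" for t
    by (rule in_charts_apply[OF c(2) \<gamma>(2)[OF that]])
  have sm: "smooth_on {-\<epsilon><..<\<epsilon>} (\<lambda>t. in_charts c d f (snd c (\<gamma> t)))"
    by (rule smooth_on_compose[OF _ V(1) _ *(4) V(2)]) (use \<gamma> in auto)
  have "((\<lambda>t. in_charts c d f (snd c (\<gamma> t))) has_vector_derivative differential c d f a v) (at 0)"
  proof -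
    have "(in_charts c d f has_derivative differential c d f a) (at (snd c (\<gamma> 0)))"
      unfolding differential_def *(2) by (rule smooth_on_has_derivative[OF V(2) aV])
    from has_derivative_compose[OF *(5)[unfolded has_vector_derivative_def] this]
    show ?thesis
      unfolding has_vector_derivative_def
      by (simp add: linear_cmul[OF linear_differential[OF f c(1) d a]])
  qed
  then have der: "((\<lambda>t. snd d (f (\<gamma> t))) has_vector_derivative differential c d f a v) (at 0)"
    by (rule has_vector_derivative_transform_within_open[of _ _ _ "{-\<epsilon><..<\<epsilon>}"]) (use *(1) eq in auto)
  show ?thesis
  proof (rule tangent_vectorsI[where \<gamma> = "\<lambda>t. f (\<gamma> t)", OF *(1) _ _ _ der])
    show "smooth_on {-\<epsilon><..<\<epsilon>} (\<lambda>t. snd d (f (\<gamma> t)))"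
      by (rule smooth_on_cong[OF _ eq sm]) auto
  qed (use * \<gamma> in auto)
qed


text \<open>That the identity is smooth means that the changes of coordinates are smooth and defined on open
  sets.\<close>

locale jet_manifold =
  fixes J :: "('a, 'v::euclidean_space) jet_space"
  assumes cover: "\<Union> (fst ` jet_charts J) = jets J"
    and inj_on_jet_chart: "c \<in> jet_charts J \<Longrightarrow> inj_on (snd c) (fst c)"
    and smooth_map_id: "smooth_map J J (jets J) (\<lambda>a. a)"
begin

lemma jet_chart_exists: assumes "a \<in> jets J" obtains c where "c \<in> jet_charts J" "a \<in> fst c"
  using assms cover by blast

lemma domain_subset: "c \<in> jet_charts J \<Longrightarrow> a \<in> fst c \<Longrightarrow> a \<in> jets J"
  using cover by blast

text \<open>Any other chart differs from an adapted one by a change of coordinates, which is smooth.\<close>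

lemma smooth_map_from_adapted_charts:
  fixes K :: "('b, 'w::euclidean_space) jet_space"
  assumes X: "X \<subseteq> jets J" "f ` X \<subseteq> jets K"
    and ad: "\<And>d. d \<in> jet_charts K \<Longrightarrow> \<exists>c\<in>jet_charts J. {a \<in> X. f a \<in> fst d} \<subseteq> fst c \<and>
      open (coord_domain c d X f) \<and> smooth_on (coord_domain c d X f) (in_charts c d f)"
  shows "smooth_map J K X f"
proof -
  have "open (coord_domain c d X f) \<and> smooth_on (coord_domain c d X f) (in_charts c d f)"
    if c: "c \<in> jet_charts J" and d: "d \<in> jet_charts K" for c d
  proof -
    obtain e where e: "e \<in> jet_charts J" "{a \<in> X. f a \<in> fst d} \<subseteq> fst e"
      and W: "open (coord_domain e d X f)" "smooth_on (coord_domain e d X f) (in_charts e d f)"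
      using ad[OF d] by blast
    let ?V = "coord_domain c e (jets J) (\<lambda>a. a)"
    note V = smooth_mapD[OF smooth_map_id c e(1)]
    have "coord_domain c d X f = ?V \<inter> in_charts c e (\<lambda>a. a) -` coord_domain e d X f" (is "?L = ?R")
    proof
      show "?L \<subseteq> ?R" using X e(2) by (auto simp: in_charts_apply[OF inj_on_jet_chart[OF c]])
      show "?R \<subseteq> ?L"
        using inj_onD[OF inj_on_jet_chart[OF e(1)]]
        by (auto simp: in_charts_apply[OF inj_on_jet_chart[OF c]]) (metis (mono_tags, lifting) IntI imageI mem_Collect_eq)
    qed
    then have o: "open (coord_domain c d X f)"
      using continuous_open_preimage[OF smooth_on_continuous[OF V(2)] V(1) W(1)] by simp
    have "smooth_on (coord_domain c d X f) (\<lambda>w. in_charts e d f (in_charts c e (\<lambda>a. a) w))"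
    proof (rule smooth_on_compose[OF o W(1) _ smooth_on_subset[OF V(2)] W(2)])
      show "in_charts c e (\<lambda>a. a) ` coord_domain c d X f \<subseteq> coord_domain e d X f"
        using e(2) by (auto simp: in_charts_apply[OF inj_on_jet_chart[OF c]])
      show "coord_domain c d X f \<subseteq> ?V" using X e(2) by auto
    qed
    then have "smooth_on (coord_domain c d X f) (in_charts c d f)"
      by (rule smooth_on_cong[OF o, rotated])
        (use e(2) in \<open>auto simp: in_charts_apply[OF inj_on_jet_chart[OF c]] in_charts_apply[OF inj_on_jet_chart[OF e(1)]]\<close>)
    with o show ?thesis by blast
  qed
  then show ?thesis using X unfolding smooth_map_def Let_def by blast
qed

lemma smooth_map_compose:
  fixes K :: "('b, 'w::euclidean_space) jet_space"
  assumes f: "smooth_map J J (jets J) f" and g: "smooth_map J K (jets J) g"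
  shows "smooth_map J K (jets J) (\<lambda>a. g (f a))"
proof -
  have fJ: "f ` jets J \<subseteq> jets J" and gJ: "g ` jets J \<subseteq> jets K" using f g by (auto simp: smooth_map_def)
  have "open (coord_domain c d (jets J) (\<lambda>a. g (f a))) \<and>
      smooth_on (coord_domain c d (jets J) (\<lambda>a. g (f a))) (in_charts c d (\<lambda>a. g (f a)))"
    if c: "c \<in> jet_charts J" and d: "d \<in> jet_charts K" for c d
  proof -
    let ?V = "coord_domain c d (jets J) (\<lambda>a. g (f a))"
    have nbhd: "\<exists>U. open U \<and> w \<in> U \<and> U \<subseteq> ?V \<and> smooth_on U (in_charts c d (\<lambda>a. g (f a)))" if w: "w \<in> ?V" for w
    proof -
      obtain a where a: "a \<in> fst c" "a \<in> jets J" "g (f a) \<in> fst d" "w = snd c a" using w by auto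
      obtain e where e: "e \<in> jet_charts J" "f a \<in> fst e" using jet_chart_exists fJ a(2) by blast
      note inj = inj_on_jet_chart[OF c] inj_on_jet_chart[OF e(1)]
      note V = smooth_mapD[OF f c e(1)] and W = smooth_mapD[OF g e(1) d]
      let ?U = "coord_domain c e (jets J) f \<inter> in_charts c e f -` coord_domain e d (jets J) g"
      have U: "open ?U" by (rule continuous_open_preimage[OF smooth_on_continuous[OF V(2)] V(1) W(1)])
      have U_eq: "\<exists>b. b \<in> fst c \<inter> jets J \<and> f b \<in> fst e \<and> g (f b) \<in> fst d \<and> y = snd c b" if "y \<in> ?U" for y
        using that inj_onD[OF inj(2)] by (auto simp: in_charts_apply[OF inj(1)]) metis
      have "w \<in> ?U" using a e fJ by (auto simp: in_charts_apply[OF inj(1)])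
      moreover have "?U \<subseteq> ?V" using U_eq by blast
      moreover have "smooth_on ?U (\<lambda>w. in_charts e d g (in_charts c e f w))"
        by (rule smooth_on_compose[OF U W(1) _ smooth_on_subset[OF V(2)] W(2)]) auto
      then have "smooth_on ?U (in_charts c d (\<lambda>a. g (f a)))"
      proof (rule smooth_on_cong[OF U, rotated])
        fix y assume "y \<in> ?U"
        then obtain b where "b \<in> fst c" "f b \<in> fst e" "y = snd c b" using U_eq by blast
        then show "in_charts e d g (in_charts c e f y) = in_charts c d (\<lambda>a. g (f a)) y"
          by (simp add: in_charts_apply[OF inj(1)] in_charts_apply[OF inj(2)])
      qed
      ultimately show ?thesis using U by blast
    qed
    have "open ?V" by (subst open_subopen) (use nbhd in blast)
    moreover have "smooth_on ?V (in_charts c d (\<lambda>a. g (f a)))"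
      by (rule smooth_on_local) (use nbhd in blast)
    ultimately show ?thesis by blast
  qed
  then show ?thesis using fJ gJ unfolding smooth_map_def Let_def by (simp add: image_subset_iff)
qed

lemma differential_inverse:
  assumes f: "smooth_map J J (jets J) f" and g: "smooth_map J J (jets J) g"
    and gf: "\<And>a. a \<in> jets J \<Longrightarrow> g (f a) = a"
    and c: "c \<in> jet_charts J" and d: "d \<in> jet_charts J" and a: "a \<in> fst c" "f a \<in> fst d"
  shows "differential d c g (f a) (differential c d f a v) = v"
proof -
  have aJ: "a \<in> jets J" "f a \<in> jets J" using domain_subset[OF c a(1)] domain_subset[OF d a(2)] .
  note inj = inj_on_jet_chart[OF c] inj_on_jet_chart[OF d]
  have "differential d c g (f a) (differential c d f a v) = differential c c (\<lambda>a. g (f a)) a v"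
    using a aJ gf by (intro differential_compose[OF f g c inj(1) d inj(2) c, symmetric]) auto
  also have "\<dots> = differential c c (\<lambda>a. a) a v"
    by (rule fun_cong[OF differential_cong[OF smooth_map_compose[OF f g] gf c inj(1) c]]) (use a aJ gf in auto)
  also have "\<dots> = FD (\<lambda>w. w) (snd c a) v"
    unfolding differential_def
    by (rule fun_cong[OF FD_cong[OF smooth_mapD(1)[OF smooth_map_id c c]]])
      (use a aJ in \<open>auto simp: in_charts_apply[OF inj(1)]\<close>)
  finally show ?thesis by simp
qed

text \<open>The inclusions for a map and for its inverse together give the equality of the planes.\<close>

lemma contact_transformationI:
  assumes f: "smooth_map J J (jets J) f" and g: "smooth_map J J (jets J) g"
    and inv: "\<And>a. a \<in> jets J \<Longrightarrow> g (f a) = a" "\<And>a. a \<in> jets J \<Longrightarrow> f (g a) = a"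
    and cf: "\<And>a c d. c \<in> jet_charts J \<Longrightarrow> d \<in> jet_charts J \<Longrightarrow> a \<in> fst c \<Longrightarrow> f a \<in> fst d \<Longrightarrow>
       differential c d f a ` cartan J c a \<subseteq> cartan J d (f a)"
    and cg: "\<And>a c d. c \<in> jet_charts J \<Longrightarrow> d \<in> jet_charts J \<Longrightarrow> a \<in> fst c \<Longrightarrow> g a \<in> fst d \<Longrightarrow>
       differential c d g a ` cartan J c a \<subseteq> cartan J d (g a)"
  shows "contact_transformation J f"
  unfolding contact_transformation_def
proof (intro conjI ballI impI)
  have fJ: "f ` jets J \<subseteq> jets J" and gJ: "g ` jets J \<subseteq> jets J" using f g by (auto simp: smooth_map_def)
  show bij: "bij_betw f (jets J) (jets J)"
    by (rule bij_betw_byWitness[of _ g]) (use inv fJ gJ in auto)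
  have "inv_into (jets J) f a = g a" if "a \<in> jets J" for a
    using that bij inv gJ by (intro inv_into_f_eq) (auto simp: bij_betw_def)
  then show "smooth_map J J (jets J) (inv_into (jets J) f)"
    by (intro smooth_map_cong[OF g _ inj_on_jet_chart]) auto
  fix a c d assume a: "a \<in> jets J" and c: "c \<in> jet_charts J" and d: "d \<in> jet_charts J"
    and ac: "a \<in> fst c \<and> f a \<in> fst d"
  show "differential c d f a ` cartan J c a = cartan J d (f a)"
  proof
    show "differential c d f a ` cartan J c a \<subseteq> cartan J d (f a)" using cf[OF c d] ac by blast
    show "cartan J d (f a) \<subseteq> differential c d f a ` cartan J c a"
    proof
      fix v assume v: "v \<in> cartan J d (f a)"
      have "differential d c g (f a) v \<in> cartan J c a"
        using cg[OF d c, of "f a"] ac inv(1)[OF a] v by auto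
      moreover have "differential c d f a (differential d c g (f a) v) = v"
        using differential_inverse[OF g f inv(2) d c, of "f a" v] ac inv(1)[OF a] by simp
      ultimately show "v \<in> differential c d f a ` cartan J c a" by (metis imageI)
    qed
  qed
qed (rule f)

lemma contact_transformationD:
  assumes f: "contact_transformation J f"
  defines "g \<equiv> inv_into (jets J) f"
  shows "smooth_map J J (jets J) f" "smooth_map J J (jets J) g"
    "\<And>a. a \<in> jets J \<Longrightarrow> g (f a) = a" "\<And>a. a \<in> jets J \<Longrightarrow> f (g a) = a"
    "\<And>a c d. c \<in> jet_charts J \<Longrightarrow> d \<in> jet_charts J \<Longrightarrow> a \<in> fst c \<Longrightarrow> f a \<in> fst d \<Longrightarrow>
       differential c d f a ` cartan J c a \<subseteq> cartan J d (f a)"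
    "\<And>a c d. c \<in> jet_charts J \<Longrightarrow> d \<in> jet_charts J \<Longrightarrow> a \<in> fst c \<Longrightarrow> g a \<in> fst d \<Longrightarrow>
       differential c d g a ` cartan J c a \<subseteq> cartan J d (g a)"
proof -
  have bij: "bij_betw f (jets J) (jets J)" using f by (simp add: contact_transformation_def)
  show smf: "smooth_map J J (jets J) f" and smg: "smooth_map J J (jets J) g"
    using f by (auto simp: contact_transformation_def g_def)
  show gf: "\<And>a. a \<in> jets J \<Longrightarrow> g (f a) = a" and fg: "\<And>a. a \<in> jets J \<Longrightarrow> f (g a) = a"
    using bij by (auto simp: g_def bij_betw_def inv_into_f_f f_inv_into_f)
  have eq: "differential c d f a ` cartan J c a = cartan J d (f a)"
    if "c \<in> jet_charts J" "d \<in> jet_charts J" "a \<in> fst c" "f a \<in> fst d" for a c d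
    using f that domain_subset[OF that(1,3)] unfolding contact_transformation_def by blast
  then show "\<And>a c d. c \<in> jet_charts J \<Longrightarrow> d \<in> jet_charts J \<Longrightarrow> a \<in> fst c \<Longrightarrow> f a \<in> fst d \<Longrightarrow>
       differential c d f a ` cartan J c a \<subseteq> cartan J d (f a)" by blast
  fix a c d assume c: "c \<in> jet_charts J" and d: "d \<in> jet_charts J" and a: "a \<in> fst c" "g a \<in> fst d"
  have aJ: "a \<in> jets J" by (rule domain_subset[OF c a(1)])
  have "cartan J c a = differential d c f (g a) ` cartan J d (g a)"
    using eq[OF d c a(2)] fg[OF aJ] a(1) by simp
  then show "differential c d g a ` cartan J c a \<subseteq> cartan J d (g a)"
    using differential_inverse[OF smf smg gf d c a(2)] fg[OF aJ] a(1) by auto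
qed

lemma contact_transformation_compose:
  assumes f: "contact_transformation J f" and h: "contact_transformation J h"
  shows "contact_transformation J (\<lambda>a. h (f a))"
proof -
  note F = contact_transformationD[OF f] and H = contact_transformationD[OF h]
  let ?f' = "inv_into (jets J) f" and ?h' = "inv_into (jets J) h"
  have maps: "f a \<in> jets J" "h a \<in> jets J" "?f' a \<in> jets J" "?h' a \<in> jets J" if "a \<in> jets J" for a
    using F(1,2) H(1,2) that by (auto simp: smooth_map_def)
  have comp: "differential c d (\<lambda>a. q (p a)) a ` cartan J c a \<subseteq> cartan J d (q (p a))"
    if p: "smooth_map J J (jets J) p" and q: "smooth_map J J (jets J) q"
      and cp: "\<And>a c d. c \<in> jet_charts J \<Longrightarrow> d \<in> jet_charts J \<Longrightarrow> a \<in> fst c \<Longrightarrow> p a \<in> fst d \<Longrightarrow>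
       differential c d p a ` cartan J c a \<subseteq> cartan J d (p a)"
      and cq: "\<And>a c d. c \<in> jet_charts J \<Longrightarrow> d \<in> jet_charts J \<Longrightarrow> a \<in> fst c \<Longrightarrow> q a \<in> fst d \<Longrightarrow>
       differential c d q a ` cartan J c a \<subseteq> cartan J d (q a)"
      and c: "c \<in> jet_charts J" and d: "d \<in> jet_charts J" and a: "a \<in> fst c" "q (p a) \<in> fst d"
    for p q c d a
  proof -
    have aJ: "a \<in> jets J" by (rule domain_subset[OF c a(1)])
    then have pa: "p a \<in> jets J" using p unfolding smooth_map_def by blast
    obtain e where e: "e \<in> jet_charts J" "p a \<in> fst e" using jet_chart_exists pa by blast
    have "differential c d (\<lambda>a. q (p a)) a v = differential e d q (p a) (differential c e p a v)" for v
      by (rule differential_compose[OF p q c inj_on_jet_chart[OF c] e(1) inj_on_jet_chart[OF e(1)] d])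
        (use aJ pa a e in auto)
    then show ?thesis using cp[OF c e(1) a(1) e(2)] cq[OF e(1) d e(2) a(2)] by (auto simp: image_subset_iff)
  qed
  show ?thesis
  proof (rule contact_transformationI)
    show "smooth_map J J (jets J) (\<lambda>a. h (f a))" by (rule smooth_map_compose[OF F(1) H(1)])
    show "smooth_map J J (jets J) (\<lambda>a. ?f' (?h' a))" by (rule smooth_map_compose[OF H(2) F(2)])
  qed (use maps F(3,4) H(3,4) comp[OF F(1) H(1) F(5) H(5)] comp[OF H(2) F(2) H(6) F(6)] in auto)
qed

lemma contact_transformation_inv_into:
  assumes f: "contact_transformation J f"
  shows "contact_transformation J (inv_into (jets J) f)"
  using contact_transformationD[OF f] by (intro contact_transformationI[of _ f]) auto

lemma contact_transformation_cong:
  assumes f: "contact_transformation J f" and eq: "\<And>a. a \<in> jets J \<Longrightarrow> f a = g a"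
  shows "contact_transformation J g"
proof -
  note F = contact_transformationD[OF f]
  let ?f' = "inv_into (jets J) f"
  have maps: "?f' a \<in> jets J" if "a \<in> jets J" for a
    using F(2) that by (auto simp: smooth_map_def)
  show ?thesis
  proof (rule contact_transformationI)
    show "smooth_map J J (jets J) g" by (rule smooth_map_cong[OF F(1) eq inj_on_jet_chart])
    show "smooth_map J J (jets J) ?f'" by (rule F(2))
    fix a c d assume c: "c \<in> jet_charts J" and d: "d \<in> jet_charts J" and a: "a \<in> fst c" "g a \<in> fst d"
    have aJ: "a \<in> jets J" by (rule domain_subset[OF c a(1)])
    have "differential c d f a = differential c d g a"
      by (rule differential_cong[OF F(1) eq c inj_on_jet_chart[OF c] d]) (use a aJ eq in auto)
    then show "differential c d g a ` cartan J c a \<subseteq> cartan J d (g a)"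
      using F(5)[OF c d a(1)] a(2) eq[OF aJ] by simp
  next
    show "?f' (g a) = a" if "a \<in> jets J" for a using F(3)[OF that] eq[OF that] by simp
    show "g (?f' a) = a" if "a \<in> jets J" for a using F(4)[OF that] eq[OF maps[OF that]] by simp
  qed (rule F(6))
qed

lemma contact_transformation_id: "contact_transformation J (\<lambda>a. a)"
  if "\<And>a c d. c \<in> jet_charts J \<Longrightarrow> d \<in> jet_charts J \<Longrightarrow> a \<in> fst c \<Longrightarrow> a \<in> fst d \<Longrightarrow>
       differential c d (\<lambda>a. a) a ` cartan J c a \<subseteq> cartan J d a"
  by (rule contact_transformationI[OF smooth_map_id smooth_map_id]) (use that in auto)

text \<open>The symmetries form a subgroup of the group of bijections, whose elements are extensional
  functions. Hence all constructions are followed by a restriction to the jets.\<close>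

lemma group_external_symmetry_group:
  assumes S: "S \<subseteq> jets J" and id: "contact_transformation J (\<lambda>a. a)"
  shows "group (external_symmetry_group J S)"
proof -
  let ?H = "{\<Phi> \<in> extensional (jets J). external_symmetry J S \<Phi>}"
  have bij: "bij_betw \<Phi> (jets J) (jets J)" if "external_symmetry J S \<Phi>" for \<Phi>
    using that by (simp add: external_symmetry_def contact_transformation_def)
  then have H: "?H \<subseteq> carrier (BijGroup (jets J))" by (auto simp: BijGroup_def Bij_def)
  have "subgroup ?H (BijGroup (jets J))"
  proof
    show "?H \<subseteq> carrier (BijGroup (jets J))" by (rule H)
    show "\<one>\<^bsub>BijGroup (jets J)\<^esub> \<in> ?H"
    proof -
      have "contact_transformation J (\<lambda>a\<in>jets J. a)"
        by (rule contact_transformation_cong[OF id]) simp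
      moreover have "(\<lambda>a\<in>jets J. a) ` S = S" using S by (auto simp: restrict_def subset_iff image_iff)
      ultimately show ?thesis by (simp add: BijGroup_def external_symmetry_def)
    qed
    fix f h assume f: "f \<in> ?H" and h: "h \<in> ?H"
    have "contact_transformation J (compose (jets J) f h)"
      by (rule contact_transformation_cong[OF contact_transformation_compose[of h f]])
        (use f h in \<open>auto simp: external_symmetry_def compose_def\<close>)
    moreover have "compose (jets J) f h ` S = f ` h ` S"
      unfolding image_image by (rule image_cong) (use S in \<open>auto simp: compose_def\<close>)
    moreover have "f \<otimes>\<^bsub>BijGroup (jets J)\<^esub> h = compose (jets J) f h"
      using f h H by (auto simp: BijGroup_def)
    ultimately show "f \<otimes>\<^bsub>BijGroup (jets J)\<^esub> h \<in> ?H" using f h by (simp add: external_symmetry_def)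
  next
    fix f assume f: "f \<in> ?H"
    then have "inv\<^bsub>BijGroup (jets J)\<^esub> f = (\<lambda>a\<in>jets J. inv_into (jets J) f a)"
      using H by (intro inv_BijGroup) (auto simp: BijGroup_def)
    moreover have "contact_transformation J (\<lambda>a\<in>jets J. inv_into (jets J) f a)"
      by (rule contact_transformation_cong[OF contact_transformation_inv_into[of f]])
        (use f in \<open>auto simp: external_symmetry_def\<close>)
    moreover have "(\<lambda>a\<in>jets J. inv_into (jets J) f a) ` S = S"
    proof -
      have fS: "f ` S = S" and inj: "inj_on f (jets J)" using f bij by (auto simp: external_symmetry_def bij_betw_def)
      have "(\<lambda>a\<in>jets J. inv_into (jets J) f a) ` f ` S = S"
        unfolding image_image
      proof -
        have "(\<lambda>a\<in>jets J. inv_into (jets J) f a) (f a) = a" if "a \<in> S" for a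
          using that S fS inj by (auto simp: inv_into_f_f subset_iff)
        then show "(\<lambda>x. (\<lambda>a\<in>jets J. inv_into (jets J) f a) (f x)) ` S = S" by simp
      qed
      then show ?thesis using fS by simp
    qed
    ultimately show "inv\<^bsub>BijGroup (jets J)\<^esub> f \<in> ?H" by (simp add: external_symmetry_def)
  qed
  then show ?thesis
    unfolding external_symmetry_group_def using subgroup.subgroup_is_group group_BijGroup by blast
qed

end


section \<open>Jets of maps\<close>

text \<open>The ordering of an unordered pair that is chosen in the definition of \<open>partial2\<close>.\<close>

definition rep1 :: "'n uprod \<Rightarrow> 'n" where
  "rep1 \<sigma> = fst (SOME ij. \<sigma> = Upair (fst ij) (snd ij))"

definition rep2 :: "'n uprod \<Rightarrow> 'n" where
  "rep2 \<sigma> = snd (SOME ij. \<sigma> = Upair (fst ij) (snd ij))"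

lemma Upair_rep: "Upair (rep1 \<sigma>) (rep2 \<sigma>) = \<sigma>"
proof -
  obtain i j where "\<sigma> = Upair i j" by (metis uprod_exhaust)
  then have "\<exists>ij. \<sigma> = Upair (fst ij) (snd ij)" by (intro exI[of _ "(i, j)"]) simp
  from someI_ex[OF this] show ?thesis by (simp add: rep1_def rep2_def)
qed

text \<open>By the symmetry of second derivatives, only the chosen ordering of each pair of indices has to be
  compared.\<close>

lemma coords2_eqI:
  fixes f :: "real^'n \<Rightarrow> 'v::euclidean_space"
  assumes S: "open S" "smooth_on S f" "x \<in> S"
    and "z = f x" "\<And>i. p $ i = FD f x (axis i 1)" "\<And>\<sigma>. q $ \<sigma> = deriv2 f x (axis (rep1 \<sigma>) 1) (axis (rep2 \<sigma>) 1)"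
  shows "coords2 x f = (x, z, p, q)"
proof -
  have "partial2 \<sigma> f x = q $ \<sigma>" for \<sigma>
    using partial2_Upair[OF S, of "rep1 \<sigma>" "rep2 \<sigma>"] assms(6) by (simp add: Upair_rep)
  then show ?thesis using assms by (simp add: coords2_def vec_eq_iff partial_eq)
qed

text \<open>A representative of the jet with the coordinates \<open>w\<close>.\<close>

abbreviation quad_section :: "('e, 'v::euclidean_space) chart \<Rightarrow> (real^'n) \<times> 'v \<times> ('v^'n) \<times> ('v^('n uprod)) \<Rightarrow> real^'n \<Rightarrow> 'e" where
  "quad_section c w \<equiv> \<lambda>y. cinv c (quadratic w y)"

context atlas
begin

lemma smooth_param_chartI:
  assumes c: "c \<in> A" and N: "open N" "s ` N \<subseteq> fst c" "smooth_on N (snd c \<circ> s)"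
  shows "smooth_param A N s"
proof -
  have "continuous_on N (\<lambda>y. cinv c ((snd c \<circ> s) y))"
    by (rule continuous_on_compose2[OF continuous_cinv[OF c] smooth_on_continuous[OF N(3)]]) (use N(2) in auto)
  then have cont: "continuous_on N s"
    by (rule continuous_on_eq) (use N(2) in \<open>auto simp: cinv_chart[OF c]\<close>)
  have "smooth_on (N \<inter> s -` fst d) (snd d \<circ> s)" if d: "d \<in> A" for d
  proof -
    have o: "open (N \<inter> s -` fst d)" by (rule continuous_open_preimage[OF cont N(1) open_domain[OF d]])
    have "smooth_on (N \<inter> s -` fst d) (\<lambda>y. transition c d ((snd c \<circ> s) y))"
      by (rule smooth_on_compose[OF o open_overlap[OF c d] _ smooth_on_subset[OF N(3)] smooth_transition[OF c d]])
        (use N(2) in auto)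
    then show ?thesis
      by (rule smooth_on_cong[OF o, rotated]) (use N(2) in \<open>auto simp: image_subset_iff transition_chart[OF c]\<close>)
  qed
  then show ?thesis using cont N(1) by (simp add: smooth_param_def)
qed

lemma smooth_near_chartI:
  assumes "c \<in> A" "open N" "x \<in> N" "s ` N \<subseteq> fst c" "smooth_on N (snd c \<circ> s)"
  shows "smooth_near A x s"
  using smooth_param_chartI assms unfolding smooth_near_def by blast

lemma smooth_near_chartE:
  assumes c: "c \<in> A" and s: "smooth_near A x s" "s x \<in> fst c"
  obtains N where "open N" "x \<in> N" "s ` N \<subseteq> fst c" "smooth_on N (snd c \<circ> s)" "\<And>y. y \<in> N \<Longrightarrow> smooth_near A y s"
proof -
  obtain N where N: "x \<in> N" "smooth_param A N s" using s(1) by (auto simp: smooth_near_def)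
  then have o: "open (N \<inter> s -` fst c)" "smooth_on (N \<inter> s -` fst c) (snd c \<circ> s)"
    using continuous_open_preimage[of N s "fst c"] open_domain[OF c] c by (auto simp: smooth_param_def)
  show ?thesis by (rule that[of "N \<inter> s -` fst c"]) (use o N s in \<open>auto simp: smooth_near_def\<close>)
qed

lemma chart_change_of_param:
  assumes c: "c \<in> A" and d: "d \<in> A" and s: "smooth_near A x s" "s x \<in> fst c" "s x \<in> fst d"
  shows "FD (snd d \<circ> s) x h = FD (transition c d) (snd c (s x)) (FD (snd c \<circ> s) x h)" (is "?P1")
    and "deriv2 (snd d \<circ> s) x h k = deriv2 (transition c d) (snd c (s x)) (FD (snd c \<circ> s) x h) (FD (snd c \<circ> s) x k)
          + FD (transition c d) (snd c (s x)) (deriv2 (snd c \<circ> s) x h k)" (is "?P2")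
proof -
  obtain N where N: "open N" "x \<in> N" "s ` N \<subseteq> fst c" "smooth_on N (snd c \<circ> s)" "\<And>y. y \<in> N \<Longrightarrow> smooth_near A y s"
    using smooth_near_chartE[OF c s(1,2)] by blast
  have z: "(snd c \<circ> s) x \<in> snd c ` (fst c \<inter> fst d)" using s by auto
  have eq: "(snd d \<circ> s) y = transition c d ((snd c \<circ> s) y)" if "y \<in> N" for y
    using N(3) that by (auto simp: image_subset_iff transition_chart[OF c])
  have "FD (snd d \<circ> s) x = FD (\<lambda>y. transition c d ((snd c \<circ> s) y)) x"
    by (rule FD_cong[OF N(1,2) eq])
  then show ?P1 using FD_compose[OF N(4,2) smooth_transition[OF c d] z] by (simp add: comp_def)
  have "deriv2 (snd d \<circ> s) x = deriv2 (\<lambda>y. transition c d ((snd c \<circ> s) y)) x"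
    by (rule deriv2_cong[OF N(1,2) eq])
  then show ?P2 using deriv2_compose[OF N(1,4,2) open_overlap[OF c d] smooth_transition[OF c d] z] by (simp add: comp_def)
qed

text \<open>The second-order chain rule for a change of the chart of the target shows that one chart suffices.\<close>

lemma same_2jet_iff:
  assumes c: "c \<in> A" and s: "smooth_near A x s" "s x \<in> fst c" and t: "smooth_near A x t"
  shows "same_2jet A x s t \<longleftrightarrow> s x = t x \<and> FD (snd c \<circ> s) x = FD (snd c \<circ> t) x \<and>
    deriv2 (snd c \<circ> s) x = deriv2 (snd c \<circ> t) x"
proof
  assume st: "same_2jet A x s t"
  then have eq: "s x = t x" by (simp add: same_2jet_def)
  obtain N where N: "open N" "x \<in> N" "smooth_on N (snd c \<circ> s)" using smooth_near_chartE[OF c s] by metis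
  obtain M where M: "open M" "x \<in> M" "smooth_on M (snd c \<circ> t)"
    using smooth_near_chartE[OF c t] s(2) eq by metis
  have 1: "FD (snd c \<circ> s) x (axis i 1) = FD (snd c \<circ> t) x (axis i 1)" for i
    using st c s(2) by (simp add: same_2jet_def partial_eq)
  have 2: "deriv2 (snd c \<circ> s) x (axis i 1) (axis j 1) = deriv2 (snd c \<circ> t) x (axis i 1) (axis j 1)" for i j
    using st c s(2) unfolding same_2jet_def partial_partial_eq by blast
  have "FD (snd c \<circ> s) x = FD (snd c \<circ> t) x"
    by (rule linear_eq_on_axes[OF smooth_on_linear_FD[OF N(3,2)] smooth_on_linear_FD[OF M(3,2)] 1])
  moreover have "deriv2 (snd c \<circ> s) x = deriv2 (snd c \<circ> t) x"
    by (rule bilinear_eq_on_axes[OF bilinear_deriv2[OF N(1,3,2)] bilinear_deriv2[OF M(1,3,2)] 2])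
  ultimately show "s x = t x \<and> FD (snd c \<circ> s) x = FD (snd c \<circ> t) x \<and>
    deriv2 (snd c \<circ> s) x = deriv2 (snd c \<circ> t) x" using eq by blast
next
  assume *: "s x = t x \<and> FD (snd c \<circ> s) x = FD (snd c \<circ> t) x \<and> deriv2 (snd c \<circ> s) x = deriv2 (snd c \<circ> t) x"
  show "same_2jet A x s t"
    unfolding same_2jet_def partial_partial_eq unfolding partial_eq
  proof (intro conjI ballI impI allI)
    fix d assume d: "d \<in> A" "s x \<in> fst d"
    have t': "t x \<in> fst c" "t x \<in> fst d" using s d * by auto
    note S = chart_change_of_param[OF c d(1) s d(2)] and T = chart_change_of_param[OF c d(1) t t']
    show "FD (snd d \<circ> s) x (axis i 1) = FD (snd d \<circ> t) x (axis i 1)" for i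
      unfolding S T using * by simp
    show "deriv2 (snd d \<circ> s) x (axis i 1) (axis j 1) = deriv2 (snd d \<circ> t) x (axis i 1) (axis j 1)" for i j
      unfolding S T using * by simp
  qed (use * in simp)
qed

lemma same_2jet_refl: "same_2jet A x s s"
  by (simp add: same_2jet_def)

lemma same_2jet_sym: "same_2jet A x s t \<Longrightarrow> same_2jet A x t s"
  by (simp add: same_2jet_def)

lemma same_2jet_trans: "same_2jet A x s t \<Longrightarrow> same_2jet A x t u \<Longrightarrow> same_2jet A x s u"
  by (simp add: same_2jet_def)

lemma fst_jet [simp]: "fst (jet A x s) = x"
  by (simp add: jet_def)

lemma jet_eqI: "same_2jet A x s t \<Longrightarrow> jet A x s = jet A x t"
  unfolding jet_def using same_2jet_sym same_2jet_trans by blast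

lemma jet_eq_iff: "smooth_near A x s \<Longrightarrow> smooth_near A x t \<Longrightarrow> jet A x s = jet A x t \<longleftrightarrow> same_2jet A x s t"
  using jet_eqI same_2jet_refl unfolding jet_def by blast

lemma in_jetD:
  assumes "t \<in> snd (jet A x s)"
  shows "smooth_near A x t" "same_2jet A x s t" "t x = s x" "jet A x t = jet A x s"
  using assms jet_eqI by (auto simp: jet_def same_2jet_def)

lemma in_jet_self: "smooth_near A x s \<Longrightarrow> s \<in> snd (jet A x s)"
  by (simp add: jet_def same_2jet_refl)

lemma J2prE:
  assumes "\<theta> \<in> J2pr A"
  obtains s where "smooth_near A (fst \<theta>) s" "\<theta> = jet A (fst \<theta>) s"
  using assms unfolding J2pr_def by auto

lemma in_J2pr: "smooth_near A x s \<Longrightarrow> jet A x s \<in> J2pr A"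
  by (auto simp: J2pr_def)

text \<open>The representative chosen in the definitions of \<open>jet_chart\<close> and \<open>prolong\<close>.\<close>

lemma some_section:
  assumes "smooth_near A x s"
  defines "t \<equiv> SOME t. t \<in> snd (jet A x s)"
  shows "smooth_near A x t" "t x = s x" "jet A x t = jet A x s"
proof -
  have "t \<in> snd (jet A x s)" unfolding t_def by (rule someI[of "\<lambda>t. t \<in> snd (jet A x s)", OF in_jet_self[OF assms(1)]])
  then show "smooth_near A x t" "t x = s x" "jet A x t = jet A x s" using in_jetD by auto
qed

lemma in_jet_chart:
  assumes s: "smooth_near A x s"
  shows "jet A x s \<in> fst (jet_chart A c) \<longleftrightarrow> s x \<in> fst c"
proof
  assume "jet A x s \<in> fst (jet_chart A c)"
  then obtain y t where y: "smooth_near A y t" "t y \<in> fst c" "jet A x s = jet A y t"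
    unfolding jet_chart_def by auto
  then have "y = x" by (metis fst_jet)
  with y have t: "smooth_near A x t" "t x \<in> fst c" "jet A x s = jet A x t" by auto
  then have "same_2jet A x s t" using s jet_eq_iff by blast
  then show "s x \<in> fst c" using t(2) by (simp add: same_2jet_def)
qed (use s in \<open>auto simp: jet_chart_def\<close>)

lemma jet_chartE:
  assumes "\<theta> \<in> fst (jet_chart A c)"
  obtains s where "smooth_near A (fst \<theta>) s" "s (fst \<theta>) \<in> fst c" "\<theta> = jet A (fst \<theta>) s"
  using assms unfolding jet_chart_def by auto

lemma same_2jet_coords2:
  assumes c: "c \<in> A" and s: "smooth_near A x s" "s x \<in> fst c" and t: "smooth_near A x t" "t x \<in> fst c"
  shows "same_2jet A x s t \<longleftrightarrow> coords2 x (snd c \<circ> s) = coords2 x (snd c \<circ> t)"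
proof -
  obtain N where N: "open N" "x \<in> N" "smooth_on N (snd c \<circ> s)" using smooth_near_chartE[OF c s] by metis
  obtain M where M: "open M" "x \<in> M" "smooth_on M (snd c \<circ> t)" using smooth_near_chartE[OF c t] by metis
  obtain y z p q where w: "coords2 x (snd c \<circ> t) = (y, z, p, q)" by (metis prod_cases4)
  have tt: "y = x" "z = snd c (t x)" "lin_of p = FD (snd c \<circ> t) x" "bil_of q = deriv2 (snd c \<circ> t) x"
    using w unfolding coords2_eq_iff[OF M(1,3,2)] by auto
  have "coords2 x (snd c \<circ> s) = coords2 x (snd c \<circ> t) \<longleftrightarrow>
      y = x \<and> z = (snd c \<circ> s) x \<and> lin_of p = FD (snd c \<circ> s) x \<and> bil_of q = deriv2 (snd c \<circ> s) x"
    unfolding w by (rule coords2_eq_iff[OF N(1,3,2)])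
  moreover have "s x = t x \<longleftrightarrow> z = (snd c \<circ> s) x"
    using inj_on_eq_iff[OF inj_on_chart[OF c] s(2) t(2)] tt(2) by auto
  ultimately show ?thesis
    unfolding same_2jet_iff[OF c s t(1)] tt(1,3,4) eq_commute[of "FD (snd c \<circ> t) x"] eq_commute[of "deriv2 (snd c \<circ> t) x"]
    by blast
qed

lemma jet_coords:
  assumes c: "c \<in> A" and s: "smooth_near A x s" "s x \<in> fst c"
  shows "snd (jet_chart A c) (jet A x s) = coords2 x (snd c \<circ> s)"
proof -
  note t = some_section[OF s(1)]
  let ?t = "SOME t. t \<in> snd (jet A x s)"
  have "coords2 x (snd c \<circ> ?t) = coords2 x (snd c \<circ> s)"
    using same_2jet_coords2[OF c t(1) _ s] jet_eq_iff[OF t(1) s(1)] t s(2) by metis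
  then show ?thesis by (simp add: jet_chart_def Let_def coords2_def)
qed

lemma inj_on_jet_chart: assumes c: "c \<in> A" shows "inj_on (snd (jet_chart A c)) (fst (jet_chart A c))"
proof (rule inj_onI)
  fix \<theta> \<theta>' assume \<theta>: "\<theta> \<in> fst (jet_chart A c)" and \<theta>': "\<theta>' \<in> fst (jet_chart A c)"
    and eq: "snd (jet_chart A c) \<theta> = snd (jet_chart A c) \<theta>'"
  obtain s where s: "smooth_near A (fst \<theta>) s" "s (fst \<theta>) \<in> fst c" "\<theta> = jet A (fst \<theta>) s" using jet_chartE[OF \<theta>] .
  obtain t where t: "smooth_near A (fst \<theta>') t" "t (fst \<theta>') \<in> fst c" "\<theta>' = jet A (fst \<theta>') t" using jet_chartE[OF \<theta>'] .
  have eq': "coords2 (fst \<theta>) (snd c \<circ> s) = coords2 (fst \<theta>') (snd c \<circ> t)"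
    using eq jet_coords[OF c s(1,2)] jet_coords[OF c t(1,2)] s(3) t(3) by simp
  then have f: "fst \<theta> = fst \<theta>'" by (simp add: coords2_def)
  then have "same_2jet A (fst \<theta>) s t" using same_2jet_coords2[OF c s(1,2)] t eq' by simp
  then show "\<theta> = \<theta>'" using jet_eqI s(3) t(3) f by metis
qed

lemma quad_section:
  assumes c: "c \<in> A" and w: "fst (snd w) \<in> snd c ` fst c"
  shows "smooth_near A (fst w) (quad_section c w)" "quad_section c w (fst w) \<in> fst c"
    "snd (jet_chart A c) (jet A (fst w) (quad_section c w)) = w"
    "jet A (fst w) (quad_section c w) \<in> fst (jet_chart A c)"
proof -
  let ?N = "quadratic w -` (snd c ` fst c)"
  have N: "open ?N" using continuous_open_preimage[OF smooth_on_continuous[OF smooth_on_quadratic] open_UNIV open_range[OF c]] by simp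
  have q: "quadratic w (fst w) = fst (snd w)"
    using arg_cong[OF coords2_quadratic[of w], of "\<lambda>w. fst (snd w)"] by (simp add: coords2_def)
  then have x: "fst w \<in> ?N" using w by simp
  have eq: "quadratic w y = (snd c \<circ> quad_section c w) y" if "y \<in> ?N" for y
    using that by (simp add: chart_cinv[OF c])
  have sm: "smooth_on ?N (snd c \<circ> quad_section c w)"
    by (rule smooth_on_cong[OF N eq smooth_on_subset[OF smooth_on_quadratic]]) auto
  show 1: "smooth_near A (fst w) (quad_section c w)"
    by (rule smooth_near_chartI[OF c N x _ sm]) (use cinv_domain[OF c] in auto)
  show 2: "quad_section c w (fst w) \<in> fst c" using x cinv_domain[OF c] by simp
  obtain y z p q where e: "coords2 (fst w) (quadratic w) = (y, z, p, q)" by (metis prod_cases4)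
  have tt: "y = fst w" "z = quadratic w (fst w)" "lin_of p = FD (quadratic w) (fst w)" "bil_of q = deriv2 (quadratic w) (fst w)"
    using e unfolding coords2_eq_iff[OF open_UNIV smooth_on_quadratic UNIV_I] by auto
  have "coords2 (fst w) (snd c \<circ> quad_section c w) = coords2 (fst w) (quadratic w)"
    unfolding e coords2_eq_iff[OF N sm x]
  proof (intro conjI)
    show "z = (snd c \<circ> quad_section c w) (fst w)" using tt(2) eq[OF x] by (rule trans)
    have "FD (quadratic w) (fst w) = FD (snd c \<circ> quad_section c w) (fst w)" by (rule FD_cong[OF N x eq])
    with tt(3) show "lin_of p = FD (snd c \<circ> quad_section c w) (fst w)" by (rule trans)
    have "deriv2 (quadratic w) (fst w) = deriv2 (snd c \<circ> quad_section c w) (fst w)" by (rule deriv2_cong[OF N x eq])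
    with tt(4) show "bil_of q = deriv2 (snd c \<circ> quad_section c w) (fst w)" by (rule trans)
  qed (rule tt(1))
  then show "snd (jet_chart A c) (jet A (fst w) (quad_section c w)) = w"
    using jet_coords[OF c 1 2] by (simp add: coords2_quadratic)
  show "jet A (fst w) (quad_section c w) \<in> fst (jet_chart A c)" using in_jet_chart[OF 1] 2 by simp
qed

lemma base_point_coords:
  assumes c: "c \<in> A" and \<theta>: "\<theta> \<in> fst (jet_chart A c)"
  shows "fst (snd (jet_chart A c) \<theta>) = fst \<theta>" "fst (snd (snd (jet_chart A c) \<theta>)) \<in> snd c ` fst c"
proof -
  obtain s where s: "smooth_near A (fst \<theta>) s" "s (fst \<theta>) \<in> fst c" "\<theta> = jet A (fst \<theta>) s" using jet_chartE[OF \<theta>] .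
  then show "fst (snd (jet_chart A c) \<theta>) = fst \<theta>" "fst (snd (snd (jet_chart A c) \<theta>)) \<in> snd c ` fst c"
    using jet_coords[OF c s(1,2)] by (auto simp: coords2_def)
qed

lemma jet_coords_iff:
  assumes c: "c \<in> A" and s: "smooth_near A x s" "s x \<in> fst c"
  shows "snd (jet_chart A c) (jet A x s) = (y, z, p, q) \<longleftrightarrow>
    y = x \<and> z = snd c (s x) \<and> lin_of p = FD (snd c \<circ> s) x \<and> bil_of q = deriv2 (snd c \<circ> s) x"
proof -
  obtain N where N: "open N" "x \<in> N" "smooth_on N (snd c \<circ> s)" using smooth_near_chartE[OF c s] by metis
  show ?thesis using coords2_eq_iff[OF N(1,3,2)] by (simp add: jet_coords[OF c s])
qed

text \<open>The second-order chain rule for the composition with the transition function.\<close>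

lemma transition_jet_chart:
  assumes c: "c \<in> A" and d: "d \<in> A" and \<theta>: "\<theta> \<in> fst (jet_chart A c)" "\<theta> \<in> fst (jet_chart A d)"
    and w: "snd (jet_chart A c) \<theta> = (x, z, p, q)"
  shows "snd (jet_chart A d) \<theta> = (x, transition c d z, (\<chi> i. FD (transition c d) z (p $ i)),
    (\<chi> \<sigma>. deriv2 (transition c d) z (p $ rep1 \<sigma>) (p $ rep2 \<sigma>) + FD (transition c d) z (q $ \<sigma>)))"
proof -
  obtain s where s: "smooth_near A (fst \<theta>) s" "s (fst \<theta>) \<in> fst c" "\<theta> = jet A (fst \<theta>) s" using jet_chartE[OF \<theta>(1)] .
  have sd: "s (fst \<theta>) \<in> fst d" using in_jet_chart[OF s(1)] \<theta>(2) s(3) by metis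
  have "x = fst \<theta>" and z: "z = snd c (s (fst \<theta>))"
    and pq: "lin_of p = FD (snd c \<circ> s) (fst \<theta>)" "bil_of q = deriv2 (snd c \<circ> s) (fst \<theta>)"
    using w s(3) jet_coords_iff[OF c s(1,2)] by metis+
  have p: "p $ i = FD (snd c \<circ> s) (fst \<theta>) (axis i 1)" for i by (simp add: pq(1)[symmetric] lin_of_axis)
  have q: "q $ \<sigma> = deriv2 (snd c \<circ> s) (fst \<theta>) (axis (rep1 \<sigma>) 1) (axis (rep2 \<sigma>) 1)" for \<sigma>
    by (simp add: pq(2)[symmetric] bil_of_axis Upair_rep)
  obtain N where N: "open N" "fst \<theta> \<in> N" "s ` N \<subseteq> fst d" "smooth_on N (snd d \<circ> s)"
    using smooth_near_chartE[OF d s(1) sd] by metis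
  have "coords2 (fst \<theta>) (snd d \<circ> s) = (fst \<theta>, transition c d z, (\<chi> i. FD (transition c d) z (p $ i)),
    (\<chi> \<sigma>. deriv2 (transition c d) z (p $ rep1 \<sigma>) (p $ rep2 \<sigma>) + FD (transition c d) z (q $ \<sigma>)))"
    by (rule coords2_eqI[OF N(1,4,2)])
      (auto simp: z p q chart_change_of_param[OF c d s(1,2) sd] transition_chart[OF c s(2)])
  then show ?thesis using jet_coords[OF d s(1) sd] s(3) \<open>x = fst \<theta>\<close> by simp
qed

end


section \<open>The affine group and its prolonged action\<close>

text \<open>Prolongation involves the inverse of \<open>g\<close> only, so it is the linear part \<open>N\<close> of this inverse that
  enters the formulas for jets.\<close>

lemma AffE:
  fixes g :: "real^'n \<Rightarrow> real^'n"
  assumes "g \<in> carrier Aff"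
  obtains N b where "linear N" "inj N" "inv_into UNIV g = (\<lambda>y. N y + b)"
    "\<And>x. inv_into UNIV g (g x) = x" "\<And>y. g (inv_into UNIV g y) = y" "inv_into UNIV g \<in> carrier Aff"
proof -
  obtain M a where g: "g = (\<lambda>x. M *v x + a)" and M: "invertible M" using assms by (auto simp: Aff_def)
  then obtain M' where MM: "M ** M' = mat 1" "M' ** M = mat 1" unfolding invertible_def by blast
  let ?N = "\<lambda>y. M' *v y"
  let ?h = "\<lambda>y. ?N y + - (M' *v a)"
  have hg: "?h (g x) = x" for x
    by (simp add: g matrix_vector_right_distrib matrix_vector_mul_assoc MM)
  have gh: "g (?h y) = y" for y
    by (simp add: g matrix_vector_mul_assoc MM matrix_vector_mult_diff_distrib)
  have inv: "inv_into UNIV g = ?h"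
    by (rule inv_unique_comp) (use hg gh in \<open>simp_all add: fun_eq_iff\<close>)
  have inj: "inj ?N"
    by (rule inj_on_inverseI[of _ "\<lambda>x. M *v x"]) (simp add: matrix_vector_mul_assoc MM)
  have "invertible M'" using MM unfolding invertible_def by blast
  then have "inv_into UNIV g \<in> carrier Aff"
    unfolding inv Aff_def partial_object.select_convs by blast
  then show ?thesis
    by (intro that[of ?N "- (M' *v a)"]) (use inj inv hg gh in auto)
qed

lemma group_Aff: "group (Aff :: (real^'n \<Rightarrow> real^'n) monoid)"
proof (rule groupI)
  fix f g :: "real^'n \<Rightarrow> real^'n" assume "f \<in> carrier Aff" "g \<in> carrier Aff"
  then obtain M a M' a' where *: "f = (\<lambda>x. M *v x + a)" "invertible M" "g = (\<lambda>x. M' *v x + a')" "invertible M'"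
    by (auto simp: Aff_def)
  have "f \<circ> g = (\<lambda>x. (M ** M') *v x + (M *v a' + a))"
    by (auto simp: * fun_eq_iff matrix_vector_right_distrib matrix_vector_mul_assoc)
  then show "f \<otimes>\<^bsub>Aff\<^esub> g \<in> carrier Aff" using invertible_mult[OF *(2,4)] by (auto simp: Aff_def)
next
  have "id = (\<lambda>x. mat 1 *v x + (0::real^'n))" by auto
  moreover have "invertible (mat 1 :: real^'n^'n)" unfolding invertible_def by (metis matrix_mul_lid)
  ultimately have "id \<in> {\<lambda>x. M *v x + (b::real^'n) |M b. invertible M}" by blast
  then show "\<one>\<^bsub>Aff\<^esub> \<in> (carrier Aff :: (real^'n \<Rightarrow> real^'n) set)"
    by (simp add: Aff_def)
next
  fix g :: "real^'n \<Rightarrow> real^'n" assume "g \<in> carrier Aff"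
  from AffE[OF this] obtain h where "h \<in> carrier Aff" "\<And>x. h (g x) = x" by metis
  then show "\<exists>h\<in>carrier Aff. h \<otimes>\<^bsub>Aff\<^esub> g = \<one>\<^bsub>Aff\<^esub>" by (intro bexI[of _ h]) (auto simp: Aff_def)
qed (auto simp: Aff_def comp_assoc)

text \<open>The equation \<open>S_pr\<close> without indices, for arbitrary vectors of the parameter space.\<close>

definition geodesic_eq ::
  "('e, 'v::euclidean_space) christoffel \<Rightarrow> (real^'n, real^'n) christoffel \<Rightarrow> ('e, 'v) chart \<Rightarrow> real^'n \<Rightarrow> (real^'n \<Rightarrow> 'e) \<Rightarrow> bool" where
  "geodesic_eq \<Gamma> \<Theta> c x s \<longleftrightarrow> (\<forall>h k. deriv2 (snd c \<circ> s) x h k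
     + \<Gamma> c (snd c (s x)) (FD (snd c \<circ> s) x h) (FD (snd c \<circ> s) x k) = FD (snd c \<circ> s) x (\<Theta> std_chart x h k))"

context atlas
begin

text \<open>The transition functions of the jet coordinates are polynomials in the derivatives of the section,
  with coefficients given by the derivatives of the transition functions of the target.\<close>

lemma jet_manifold_J2pr: "jet_manifold (J2pr_space A :: (('n::finite, 'e) jet, _) jet_space)"
proof
  show "\<Union> (fst ` jet_charts (J2pr_space A :: (('n, 'e) jet, _) jet_space)) = jets (J2pr_space A)"
    (is "?L = _")
  proof
    show "?L \<subseteq> jets (J2pr_space A)" by (auto simp: J2pr_space_def jet_chart_def J2pr_def)
    show "jets (J2pr_space A) \<subseteq> ?L"
    proof
      fix \<theta> :: "('n, 'e) jet" assume "\<theta> \<in> jets (J2pr_space A)"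
      then have "\<theta> \<in> J2pr A" by (simp add: J2pr_space_def)
      then obtain s where s: "smooth_near A (fst \<theta>) s" "\<theta> = jet A (fst \<theta>) s" by (rule J2prE)
      obtain c where "c \<in> A" "s (fst \<theta>) \<in> fst c" by (rule chart_at)
      then have "\<theta> \<in> fst (jet_chart A c)" using in_jet_chart[OF s(1)] s(2) by metis
      then show "\<theta> \<in> ?L" using \<open>c \<in> A\<close> by (auto simp: J2pr_space_def)
    qed
  qed
  show "inj_on (snd c) (fst c)" if "c \<in> jet_charts (J2pr_space A)" for c :: "(('n, 'e) jet, _) chart"
    using that inj_on_jet_chart by (auto simp: J2pr_space_def)
  show "smooth_map (J2pr_space A) (J2pr_space A) (jets (J2pr_space A)) (\<lambda>a :: ('n, 'e) jet. a)"
  proof -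
    have "open (coord_domain (jet_chart A c) (jet_chart A d) (J2pr A) (\<lambda>a :: ('n, 'e) jet. a)) \<and>
      smooth_on (coord_domain (jet_chart A c) (jet_chart A d) (J2pr A) (\<lambda>a :: ('n, 'e) jet. a))
        (in_charts (jet_chart A c) (jet_chart A d) (\<lambda>a. a))"
      if c: "c \<in> A" and d: "d \<in> A" for c d
    proof -
      let ?V = "coord_domain (jet_chart A c) (jet_chart A d) (J2pr A) (\<lambda>a :: ('n, 'e) jet. a)"
      let ?Z = "snd c ` (fst c \<inter> fst d)"
      have V: "?V = {w. fst (snd w) \<in> ?Z}"
      proof (intro equalityI subsetI)
        fix w assume "w \<in> ?V"
        then obtain \<theta> where \<theta>: "\<theta> \<in> fst (jet_chart A c)" "\<theta> \<in> fst (jet_chart A d)" "w = snd (jet_chart A c) \<theta>" by auto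
        obtain s where s: "smooth_near A (fst \<theta>) s" "s (fst \<theta>) \<in> fst c" "\<theta> = jet A (fst \<theta>) s" using jet_chartE[OF \<theta>(1)] .
        have "s (fst \<theta>) \<in> fst d" using in_jet_chart[OF s(1)] \<theta>(2) s(3) by metis
        moreover have "fst (snd w) = snd c (s (fst \<theta>))"
          using jet_coords[OF c s(1,2)] s(3) \<theta>(3) by (simp add: coords2_def)
        ultimately show "w \<in> {w. fst (snd w) \<in> ?Z}" using s(2) by simp
      next
        fix w :: "(real^'n) \<times> 'v \<times> ('v^'n) \<times> ('v^('n uprod))" assume "w \<in> {w. fst (snd w) \<in> ?Z}"
        then obtain p where p: "p \<in> fst c" "p \<in> fst d" "fst (snd w) = snd c p" by auto
        then have z: "fst (snd w) \<in> snd c ` fst c" by auto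
        note q = quad_section[OF c z]
        have "quadratic w (fst w) = fst (snd w)"
          using arg_cong[OF coords2_quadratic[of w], of "\<lambda>w. fst (snd w)"] by (simp add: coords2_def)
        then have "quad_section c w (fst w) = p" using p by (simp add: cinv_chart[OF c])
        then have "jet A (fst w) (quad_section c w) \<in> fst (jet_chart A d)" using in_jet_chart[OF q(1)] p by simp
        then show "w \<in> ?V" using q in_J2pr[OF q(1)] by force
      qed
      have c1: "continuous_on UNIV (\<lambda>w :: (real^'n) \<times> 'v \<times> ('v^'n) \<times> ('v^('n uprod)). fst (snd w))"
        by (intro continuous_intros)
      have o: "open ?V"
        unfolding V using continuous_open_preimage[OF c1 open_UNIV open_overlap[OF c d]] by (simp add: vimage_def)
      let ?\<tau> = "transition c d"
      have z: "smooth_on ?V (\<lambda>w. fst (snd w))" and p: "smooth_on ?V (\<lambda>w. fst (snd (snd w)) $ i)"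
        and q: "smooth_on ?V (\<lambda>w. snd (snd (snd w)) $ \<sigma>)" for i \<sigma>
        by (intro smooth_on_vec_nth smooth_on_fst smooth_on_snd smooth_on_id o)+
      have \<tau>: "smooth_on ?V (\<lambda>w. f (fst (snd w)))" if "smooth_on ?Z f" for f :: "'v \<Rightarrow> 'v"
        by (rule smooth_on_compose[OF o open_overlap[OF c d] _ z that]) (use V in auto)
      have "smooth_on ?V (\<lambda>w. (fst w, ?\<tau> (fst (snd w)), (\<chi> i. FD ?\<tau> (fst (snd w)) (fst (snd (snd w)) $ i)),
        (\<chi> \<sigma>. deriv2 ?\<tau> (fst (snd w)) (fst (snd (snd w)) $ rep1 \<sigma>) (fst (snd (snd w)) $ rep2 \<sigma>)
          + FD ?\<tau> (fst (snd w)) (snd (snd (snd w)) $ \<sigma>))))"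
      proof (intro smooth_on_Pair[OF o] smooth_on_vec[OF o] smooth_on_add[OF o])
        have lin: "linear (FD ?\<tau> (fst (snd w)))" if "w \<in> ?V" for w
          using that V smooth_on_linear_FD[OF smooth_transition[OF c d]] by blast
        have bil: "bilinear (deriv2 ?\<tau> (fst (snd w)))" if "w \<in> ?V" for w
          using that V bilinear_deriv2[OF open_overlap[OF c d] smooth_transition[OF c d]] by blast
        show "smooth_on ?V (\<lambda>w. FD ?\<tau> (fst (snd w)) (fst (snd (snd w)) $ i))" for i
          by (rule smooth_on_linear_apply[OF o lin \<tau>[OF smooth_on_FD[OF smooth_transition[OF c d]]] p])
        show "smooth_on ?V (\<lambda>w. FD ?\<tau> (fst (snd w)) (snd (snd (snd w)) $ \<sigma>))" for \<sigma>
          by (rule smooth_on_linear_apply[OF o lin \<tau>[OF smooth_on_FD[OF smooth_transition[OF c d]]] q])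
        show "smooth_on ?V (\<lambda>w. deriv2 ?\<tau> (fst (snd w)) (fst (snd (snd w)) $ rep1 \<sigma>) (fst (snd (snd w)) $ rep2 \<sigma>))" for \<sigma>
          by (rule smooth_on_bilinear_apply[OF o bil \<tau>[OF smooth_on_deriv2[OF smooth_transition[OF c d]]] p p])
        show "smooth_on ?V (\<lambda>w. ?\<tau> (fst (snd w)))" by (rule \<tau>[OF smooth_transition[OF c d]])
      qed (intro smooth_on_fst smooth_on_id o)
      then have "smooth_on ?V (in_charts (jet_chart A c) (jet_chart A d) (\<lambda>a. a))"
      proof (rule smooth_on_cong[OF o, rotated])
        fix w assume "w \<in> ?V"
        then obtain \<theta> where \<theta>: "\<theta> \<in> fst (jet_chart A c)" "\<theta> \<in> fst (jet_chart A d)" "w = snd (jet_chart A c) \<theta>" by auto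
        obtain x z p q where w: "snd (jet_chart A c) \<theta> = (x, z, p, q)" by (metis prod_cases4)
        show "(fst w, ?\<tau> (fst (snd w)), (\<chi> i. FD ?\<tau> (fst (snd w)) (fst (snd (snd w)) $ i)),
          (\<chi> \<sigma>. deriv2 ?\<tau> (fst (snd w)) (fst (snd (snd w)) $ rep1 \<sigma>) (fst (snd (snd w)) $ rep2 \<sigma>)
          + FD ?\<tau> (fst (snd w)) (snd (snd (snd w)) $ \<sigma>))) = in_charts (jet_chart A c) (jet_chart A d) (\<lambda>a. a) w"
          unfolding \<theta>(3) in_charts_apply[OF inj_on_jet_chart[OF c] \<theta>(1)]
          unfolding transition_jet_chart[OF c d \<theta>(1,2) w] w by simp
      qed
      with o show ?thesis by blast
    qed
    then show ?thesis by (auto simp: smooth_map_def J2pr_space_def)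
  qed
qed

text \<open>The second derivative of an affine map vanishes, so the second-order chain rule has a single term.\<close>

lemma affine_reparam:
  fixes N :: "real^'n \<Rightarrow> real^'n"
  assumes c: "c \<in> A" and s: "smooth_near A x s" "s x \<in> fst c" and N: "linear N" and y: "N y + b = x"
  defines "t \<equiv> s \<circ> (\<lambda>y. N y + b)"
  shows "smooth_near A y t" "FD (snd c \<circ> t) y h = FD (snd c \<circ> s) x (N h)"
    "deriv2 (snd c \<circ> t) y h k = deriv2 (snd c \<circ> s) x (N h) (N k)"
proof -
  let ?f = "\<lambda>y. N y + b"
  obtain U where U: "open U" "x \<in> U" "s ` U \<subseteq> fst c" "smooth_on U (snd c \<circ> s)" using smooth_near_chartE[OF c s] by metis
  have f: "smooth_on UNIV ?f"
    by (intro smooth_on_add[OF open_UNIV] smooth_on_const smooth_on_linear[OF open_UNIV N] smooth_on_id open_UNIV)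
  have "open (?f -` U)" using continuous_open_preimage[OF smooth_on_continuous[OF f] open_UNIV U(1)] by simp
  moreover have yU: "y \<in> ?f -` U" using y U(2) by simp
  moreover have tc: "snd c \<circ> t = (\<lambda>y. (snd c \<circ> s) (?f y))" by (auto simp: t_def)
  moreover have "smooth_on (?f -` U) (snd c \<circ> t)"
    unfolding tc by (rule smooth_on_compose[OF \<open>open (?f -` U)\<close> U(1) _ smooth_on_subset[OF f] U(4)]) auto
  ultimately show "smooth_near A y t"
    using U(3) by (intro smooth_near_chartI[OF c, of "?f -` U"]) (auto simp: t_def)
  have d: "FD ?f z = N" for z
    by (rule FD_eq) (use bounded_linear_imp_has_derivative[OF N[unfolded linear_conv_bounded_linear], of "at z"]
        in \<open>auto intro!: derivative_eq_intros\<close>)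
  have d2: "deriv2 ?f z h k = 0" for z h k
    by (simp add: deriv2_def d)
  have fy: "?f y \<in> U" using yU by simp
  show "FD (snd c \<circ> t) y h = FD (snd c \<circ> s) x (N h)"
    unfolding tc using FD_compose[OF f UNIV_I U(4) fy] by (simp add: d y)
  show "deriv2 (snd c \<circ> t) y h k = deriv2 (snd c \<circ> s) x (N h) (N k)"
    unfolding tc using deriv2_compose[OF open_UNIV f UNIV_I U(1,4) fy] linear_0[OF smooth_on_linear_FD[OF U(4,2)]]
    by (simp add: d d2 y)
qed

lemma affine_reparam_same_2jet:
  fixes N :: "real^'n \<Rightarrow> real^'n"
  assumes s: "smooth_near A x s" and t: "smooth_near A x t" and st: "same_2jet A x s t" and N: "linear N" and y: "N y + b = x"
  shows "same_2jet A y (s \<circ> (\<lambda>y. N y + b)) (t \<circ> (\<lambda>y. N y + b))"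
proof -
  obtain c where c: "c \<in> A" "s x \<in> fst c" by (rule chart_at)
  have tx: "t x \<in> fst c" using st c(2) by (simp add: same_2jet_def)
  note S = affine_reparam[OF c(1) s c(2) N y] and T = affine_reparam[OF c(1) t tx N y]
  have *: "s x = t x \<and> FD (snd c \<circ> s) x = FD (snd c \<circ> t) x \<and> deriv2 (snd c \<circ> s) x = deriv2 (snd c \<circ> t) x"
    using st same_2jet_iff[OF c(1) s c(2) t] by blast
  have sy: "(s \<circ> (\<lambda>y. N y + b)) y \<in> fst c" using c(2) y by simp
  show ?thesis
    unfolding same_2jet_iff[OF c(1) S(1) sy T(1)]
    using * y by (auto simp: fun_eq_iff S(2,3) T(2,3) simp del: comp_apply) (simp add: y)
qed

lemma prolong_jet:
  assumes g: "g \<in> carrier Aff" and s: "smooth_near A x s"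
  shows "prolong A g (jet A x s) = jet A (g x) (s \<circ> inv_into UNIV g)"
    "smooth_near A (g x) (s \<circ> inv_into UNIV g)"
proof -
  obtain N b where N: "linear N" "inv_into UNIV g = (\<lambda>y. N y + b)" "\<And>x. inv_into UNIV g (g x) = x"
    using AffE[OF g] by metis
  have y: "N (g x) + b = x" using N(2,3) by metis
  let ?t = "SOME t. t \<in> snd (jet A x s)"
  note t = some_section[OF s]
  have "same_2jet A x ?t s" using jet_eq_iff[OF t(1) s] t(3) by blast
  then have "same_2jet A (g x) (?t \<circ> inv_into UNIV g) (s \<circ> inv_into UNIV g)"
    unfolding N(2) using affine_reparam_same_2jet[OF t(1) s _ N(1) y] by blast
  then show "prolong A g (jet A x s) = jet A (g x) (s \<circ> inv_into UNIV g)"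
    using in_J2pr[OF s] by (simp add: prolong_def jet_eqI)
  obtain c where c: "c \<in> A" "s x \<in> fst c" by (rule chart_at)
  show "smooth_near A (g x) (s \<circ> inv_into UNIV g)"
    unfolding N(2) by (rule affine_reparam(1)[OF c(1) s c(2) N(1) y])
qed

lemma prolong_compose:
  assumes g: "g \<in> carrier Aff" and h: "h \<in> carrier Aff" and \<theta>: "\<theta> \<in> J2pr A"
  shows "prolong A g (prolong A h \<theta>) = prolong A (g \<circ> h) \<theta>" "prolong A h \<theta> \<in> J2pr A"
proof -
  obtain s where s: "smooth_near A (fst \<theta>) s" "\<theta> = jet A (fst \<theta>) s" using J2prE[OF \<theta>] .
  have gh: "g \<circ> h \<in> carrier Aff"
    using monoid.m_closed[OF group.is_monoid[OF group_Aff] g h] by (simp add: Aff_def)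
  note P = prolong_jet[OF h s(1)]
  have "bij g" "bij h" using AffE[OF g] AffE[OF h] by (metis bijI')+
  then have inv: "inv_into UNIV (g \<circ> h) = inv_into UNIV h \<circ> inv_into UNIV g" by (rule o_inv_distrib)
  have "prolong A g (prolong A h (jet A (fst \<theta>) s)) = prolong A (g \<circ> h) (jet A (fst \<theta>) s)"
    unfolding P(1) prolong_jet(1)[OF g P(2)] prolong_jet(1)[OF gh s(1)] inv by (simp add: comp_assoc)
  then show "prolong A g (prolong A h \<theta>) = prolong A (g \<circ> h) \<theta>" using s(2) by simp
  have "prolong A h (jet A (fst \<theta>) s) \<in> J2pr A" unfolding P(1) by (rule in_J2pr[OF P(2)])
  then show "prolong A h \<theta> \<in> J2pr A" using s(2) by simp
qed

lemma prolong_id: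
  assumes "\<theta> \<in> J2pr A"
  shows "prolong A id \<theta> = \<theta>"
proof -
  obtain s where s: "smooth_near A (fst \<theta>) s" "\<theta> = jet A (fst \<theta>) s" using J2prE[OF assms] .
  have "id \<in> carrier Aff" using monoid.one_closed[OF group.is_monoid[OF group_Aff]] by (simp add: Aff_def)
  from prolong_jet(1)[OF this s(1)] have "prolong A id (jet A (fst \<theta>) s) = jet A (fst \<theta>) s"
    by (simp only: id_apply inv_id comp_id)
  then show ?thesis using s(2) by simp
qed

lemma smooth_map_prolong:
  assumes g: "(g :: real^'n \<Rightarrow> real^'n) \<in> carrier Aff"
  shows "smooth_map (J2pr_space A) (J2pr_space A) (J2pr A) (prolong A g)"
proof -
  interpret J: jet_manifold "J2pr_space A :: (('n, 'e) jet, _) jet_space" by (rule jet_manifold_J2pr)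
  obtain N b where N: "linear N" "inv_into UNIV g = (\<lambda>y. N y + b)" "\<And>x. inv_into UNIV g (g x) = x"
    using AffE[OF g] by metis
  obtain M a where "g = (\<lambda>x. M *v x + a)" using g by (auto simp: Aff_def)
  then have gx: "g y = M *v y + a" for y by simp
  have stay: "prolong A g \<theta> \<in> fst (jet_chart A c) \<longleftrightarrow> \<theta> \<in> fst (jet_chart A c)" if \<theta>: "\<theta> \<in> J2pr A" for \<theta> c
  proof -
    obtain s where s: "smooth_near A (fst \<theta>) s" "\<theta> = jet A (fst \<theta>) s" using J2prE[OF \<theta>] .
    note P = prolong_jet[OF g s(1)]
    have "prolong A g \<theta> \<in> fst (jet_chart A c) \<longleftrightarrow> s (fst \<theta>) \<in> fst c"
      using in_jet_chart[OF P(2), of c] P(1) s(2) N(3) by simp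
    then show ?thesis using in_jet_chart[OF s(1), of c] s(2) by simp
  qed
  have "\<exists>c\<in>jet_charts (J2pr_space A). {\<theta> \<in> J2pr A. prolong A g \<theta> \<in> fst d} \<subseteq> fst c \<and>
      open (coord_domain c d (J2pr A) (prolong A g)) \<and>
      smooth_on (coord_domain c d (J2pr A) (prolong A g)) (in_charts c d (prolong A g))"
    if "d \<in> jet_charts (J2pr_space A)" for d :: "(('n, 'e) jet, _) chart"
  proof -
    obtain c where c: "c \<in> A" "d = jet_chart A c" using \<open>d \<in> _\<close> by (auto simp: J2pr_space_def)
    let ?V = "coord_domain d d (J2pr A) (prolong A g)"
    have "?V = coord_domain d d (jets (J2pr_space A)) (\<lambda>a. a)"
      using stay[of _ c] c(2) by (intro arg_cong[of _ _ "image (snd d)"]) (auto simp: J2pr_space_def)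
    then have o: "open ?V" using smooth_mapD(1)[OF J.smooth_map_id that that] by simp
    have p: "smooth_on ?V (\<lambda>w. lin_of (fst (snd (snd w))) h)" and q: "smooth_on ?V (\<lambda>w. bil_of (snd (snd (snd w))) h k)"
      for h k by (intro smooth_on_lin_of smooth_on_bil_of smooth_on_fst smooth_on_snd smooth_on_id o)+
    have "smooth_on ?V (\<lambda>w. M *v fst w + a)"
      by (intro smooth_on_add o smooth_on_const smooth_on_linear[OF o matrix_vector_mul_linear] smooth_on_fst smooth_on_id)
    then have x: "smooth_on ?V (\<lambda>w. g (fst w))"
      by (rule smooth_on_cong[OF o, rotated]) (simp add: gx)
    have "smooth_on ?V (\<lambda>w. (g (fst w), fst (snd w), (\<chi> i. lin_of (fst (snd (snd w))) (N (axis i 1))),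
        (\<chi> \<sigma>. bil_of (snd (snd (snd w))) (N (axis (rep1 \<sigma>) 1)) (N (axis (rep2 \<sigma>) 1)))))"
      by (intro smooth_on_Pair[OF o] smooth_on_vec[OF o] p q x smooth_on_fst smooth_on_snd smooth_on_id o)
    then have "smooth_on ?V (in_charts d d (prolong A g))"
    proof (rule smooth_on_cong[OF o, rotated])
      fix w assume "w \<in> ?V"
      then obtain \<theta> where \<theta>: "\<theta> \<in> fst (jet_chart A c)" "w = snd (jet_chart A c) \<theta>" using c(2) by auto
      obtain s where s: "smooth_near A (fst \<theta>) s" "s (fst \<theta>) \<in> fst c" "\<theta> = jet A (fst \<theta>) s" using jet_chartE[OF \<theta>(1)] .
      obtain x z p q where w: "snd (jet_chart A c) \<theta> = (x, z, p, q)" by (metis prod_cases4)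
      have e: "x = fst \<theta>" "z = snd c (s (fst \<theta>))" "lin_of p = FD (snd c \<circ> s) (fst \<theta>)" "bil_of q = deriv2 (snd c \<circ> s) (fst \<theta>)"
        using jet_coords_iff[OF c(1) s(1,2), of x z p q] w s(3) by simp_all
      note P = prolong_jet[OF g s(1)]
      have y: "N (g (fst \<theta>)) + b = fst \<theta>" using N(2,3) by metis
      note R = affine_reparam[OF c(1) s(1,2) N(1) y, folded N(2)]
      have Pc: "(s \<circ> inv_into UNIV g) (g (fst \<theta>)) \<in> fst c" using s(2) N(3) by simp
      obtain U where U: "open U" "g (fst \<theta>) \<in> U" "smooth_on U (snd c \<circ> (s \<circ> inv_into UNIV g))"
        using smooth_near_chartE[OF c(1) P(2) Pc] by metis
      have "snd (jet_chart A c) (prolong A g \<theta>) = coords2 (g (fst \<theta>)) (snd c \<circ> (s \<circ> inv_into UNIV g))"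
        using jet_coords[OF c(1) P(2) Pc] P(1) s(3) by metis
      also have "\<dots> = (g x, z, (\<chi> i. lin_of p (N (axis i 1))), (\<chi> \<sigma>. bil_of q (N (axis (rep1 \<sigma>) 1)) (N (axis (rep2 \<sigma>) 1))))"
        unfolding e(1) by (rule coords2_eqI[OF U(1,3,2)]) (simp_all add: e R(2,3) N(3))
      finally have P': "snd (jet_chart A c) (prolong A g \<theta>) =
        (g x, z, (\<chi> i. lin_of p (N (axis i 1))), (\<chi> \<sigma>. bil_of q (N (axis (rep1 \<sigma>) 1)) (N (axis (rep2 \<sigma>) 1))))" .
      show "(g (fst w), fst (snd w), (\<chi> i. lin_of (fst (snd (snd w))) (N (axis i 1))),
        (\<chi> \<sigma>. bil_of (snd (snd (snd w))) (N (axis (rep1 \<sigma>) 1)) (N (axis (rep2 \<sigma>) 1)))) = in_charts d d (prolong A g) w"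
        unfolding c(2) \<theta>(2) in_charts_apply[OF inj_on_jet_chart[OF c(1)] \<theta>(1)] unfolding w P' by simp
    qed
    moreover have "{\<theta> \<in> J2pr A. prolong A g \<theta> \<in> fst d} \<subseteq> fst d" using stay[of _ c] c(2) by blast
    ultimately show ?thesis using o that by blast
  qed
  then have "smooth_map (J2pr_space A) (J2pr_space A) (J2pr A) (prolong A g)"
    by (intro J.smooth_map_from_adapted_charts)
      (auto simp: J2pr_space_def prolong_compose(2)[OF g g])
  then show ?thesis .
qed

end


section \<open>Symmetries of the equation of parametrized submanifolds\<close>

lemma lin_of_linear: "linear L \<Longrightarrow> lin_of (\<chi> i. L (axis i 1)) = L"
  by (intro linear_eq_on_axes linear_lin_of) (simp_all add: lin_of_axis)

lemma bil_of_bilinear: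
  fixes B :: "real^'n \<Rightarrow> real^'n \<Rightarrow> 'v::euclidean_space"
  assumes B: "bilinear B" "\<And>h k. B h k = B k h"
  shows "bil_of (\<chi> \<sigma>. B (axis (rep1 \<sigma>) 1) (axis (rep2 \<sigma>) 1)) = B"
proof (intro bilinear_eq_on_axes bilinear_bil_of B(1))
  fix i j :: 'n
  have "Upair (rep1 (Upair i j)) (rep2 (Upair i j)) = Upair i j" by (rule Upair_rep)
  then have "rep1 (Upair i j) = i \<and> rep2 (Upair i j) = j \<or> rep1 (Upair i j) = j \<and> rep2 (Upair i j) = i"
    by auto
  then show "bil_of (\<chi> \<sigma>. B (axis (rep1 \<sigma>) 1) (axis (rep2 \<sigma>) 1)) (axis i 1) (axis j 1) = B (axis i 1) (axis j 1)"
    using B(2) by (auto simp: bil_of_axis)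
qed

lemma bilinear_compose_linear:
  assumes "bilinear B" "linear f"
  shows "bilinear (\<lambda>h k. B (f h) (f k))"
  unfolding bilinear_def
proof (intro conjI allI)
  have B: "linear (\<lambda>y. B x y)" "linear (\<lambda>y. B y x)" for x using assms(1) by (auto simp: bilinear_def)
  show "linear (\<lambda>k. B (f h) (f k))" "linear (\<lambda>k. B (f k) (f h))" for h
    using linear_compose[OF assms(2) B(1), of "f h"] linear_compose[OF assms(2) B(2), of "f h"] by (simp_all add: comp_def)
qed

lemma linear_compose_bilinear:
  assumes "bilinear B" "linear f"
  shows "bilinear (\<lambda>h k. f (B h k))"
  unfolding bilinear_def
proof (intro conjI allI)
  show "linear (\<lambda>k. f (B h k))" for h
    using linear_compose[of "B h" f] assms by (simp add: comp_def bilinear_def)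
  show "linear (\<lambda>h. f (B h k))" for k
    using linear_compose[of "\<lambda>h. B h k" f] assms by (simp add: comp_def bilinear_def)
qed

lemma linear_image_span_subset:
  assumes "linear D" "D ` U \<subseteq> span U'"
  shows "D ` span U \<subseteq> span U'"
  using assms linear_span_image[OF assms(1), of U] span_minimal[OF assms(2)] by auto

context atlas
begin

lemma cartan_J2pr: "cartan (J2pr_space A) c \<theta> = span (\<Union>s\<in>snd \<theta>. tangent_vectors c (prolonged_section A s) \<theta>)"
  by (simp add: J2pr_space_def)

lemma cartan_identity:
  assumes c: "c \<in> jet_charts (J2pr_space A)" and d: "d \<in> jet_charts (J2pr_space A)"
    and \<theta>: "(\<theta> :: ('n::finite, 'e) jet) \<in> fst c" "\<theta> \<in> fst d"
  shows "differential c d (\<lambda>a. a) \<theta> ` cartan (J2pr_space A) c \<theta> \<subseteq> cartan (J2pr_space A) d \<theta>"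
proof -
  interpret J: jet_manifold "J2pr_space A :: (('n, 'e) jet, _) jet_space" by (rule jet_manifold_J2pr)
  note D = J.smooth_map_id c J.inj_on_jet_chart[OF c] d
  have \<theta>J: "\<theta> \<in> jets (J2pr_space A)" by (rule J.domain_subset[OF c \<theta>(1)])
  show ?thesis
    unfolding cartan_J2pr
  proof (rule linear_image_span_subset[OF linear_differential[OF J.smooth_map_id c d \<theta>J \<theta>]], rule image_subsetI)
    fix v assume "v \<in> (\<Union>s\<in>snd \<theta>. tangent_vectors c (prolonged_section A s) \<theta>)"
    then obtain s where s: "s \<in> snd \<theta>" "v \<in> tangent_vectors c (prolonged_section A s) \<theta>" by blast
    have "differential c d (\<lambda>a. a) \<theta> v \<in> tangent_vectors d (prolonged_section A s) \<theta>"
      using differential_tangent[OF D \<theta>J \<theta> s(2)] tangent_vectors_mono[of "(\<lambda>a. a) ` (prolonged_section A s \<inter> jets (J2pr_space A))"] by blast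
    then show "differential c d (\<lambda>a. a) \<theta> v \<in> span (\<Union>s\<in>snd \<theta>. tangent_vectors d (prolonged_section A s) \<theta>)"
      using s(1) by (intro span_base) blast
  qed
qed

lemma contact_transformation_identity:
  "contact_transformation (J2pr_space A :: (('n::finite, 'e) jet, _) jet_space) (\<lambda>a. a)"
  by (rule jet_manifold.contact_transformation_id[OF jet_manifold_J2pr cartan_identity])

text \<open>Reparametrizing a section reparametrizes its prolongation.\<close>

lemma prolong_cartan:
  fixes g :: "real^'n \<Rightarrow> real^'n"
  assumes g: "g \<in> carrier Aff" and c: "c \<in> jet_charts (J2pr_space A)" and d: "d \<in> jet_charts (J2pr_space A)"
    and \<theta>: "\<theta> \<in> fst c" "prolong A g \<theta> \<in> fst d"
  shows "differential c d (prolong A g) \<theta> ` cartan (J2pr_space A) c \<theta> \<subseteq> cartan (J2pr_space A) d (prolong A g \<theta>)"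
proof -
  interpret J: jet_manifold "J2pr_space A :: (('n, 'e) jet, _) jet_space" by (rule jet_manifold_J2pr)
  note sm = smooth_map_prolong[OF g]
  have \<theta>J: "\<theta> \<in> J2pr A" using J.domain_subset[OF c \<theta>(1)] by (simp add: J2pr_space_def)
  obtain s0 where s0: "smooth_near A (fst \<theta>) s0" "\<theta> = jet A (fst \<theta>) s0" using J2prE[OF \<theta>J] .
  show ?thesis
    unfolding cartan_J2pr
  proof (rule linear_image_span_subset[OF linear_differential[OF sm c d \<theta>J \<theta>]], rule image_subsetI)
    fix v assume "v \<in> (\<Union>s\<in>snd \<theta>. tangent_vectors c (prolonged_section A s) \<theta>)"
    then obtain s where s: "s \<in> snd \<theta>" "v \<in> tangent_vectors c (prolonged_section A s) \<theta>" by blast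
    have s': "smooth_near A (fst \<theta>) s" "\<theta> = jet A (fst \<theta>) s" using in_jetD[of s "fst \<theta>" s0] s(1) s0(2) by auto
    note P = prolong_jet[OF g s'(1)]
    have "prolong A g ` (prolonged_section A s \<inter> J2pr A) \<subseteq> prolonged_section A (s \<circ> inv_into UNIV g)"
      using prolong_jet[OF g] by (auto simp: prolonged_section_def)
    then have "differential c d (prolong A g) \<theta> v \<in> tangent_vectors d (prolonged_section A (s \<circ> inv_into UNIV g)) (prolong A g \<theta>)"
      by (rule subsetD[OF tangent_vectors_mono differential_tangent[OF sm c J.inj_on_jet_chart[OF c] d \<theta>J \<theta> s(2)]])
    moreover have "s \<circ> inv_into UNIV g \<in> snd (prolong A g \<theta>)"
      using in_jet_self[OF P(2)] P(1) s'(2) by simp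
    ultimately show "differential c d (prolong A g) \<theta> v
        \<in> span (\<Union>s\<in>snd (prolong A g \<theta>). tangent_vectors d (prolonged_section A s) (prolong A g \<theta>))"
      by (intro span_base) blast
  qed
qed

lemma prolong_inverse:
  assumes g: "g \<in> carrier Aff" and \<theta>: "\<theta> \<in> J2pr A"
  shows "prolong A (inv_into UNIV g) (prolong A g \<theta>) = \<theta>" "prolong A g (prolong A (inv_into UNIV g) \<theta>) = \<theta>"
proof -
  obtain h where h: "inv_into UNIV g = h" "h \<in> carrier Aff" "\<And>x. h (g x) = x" "\<And>y. g (h y) = y"
    using AffE[OF g] by metis
  have "h \<circ> g = id" "g \<circ> h = id" using h(3,4) by auto
  then show "prolong A (inv_into UNIV g) (prolong A g \<theta>) = \<theta>" "prolong A g (prolong A (inv_into UNIV g) \<theta>) = \<theta>"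
    unfolding h(1) using prolong_compose(1)[OF h(2) g \<theta>] prolong_compose(1)[OF g h(2) \<theta>] prolong_id[OF \<theta>] by simp_all
qed

lemma contact_transformation_prolong:
  fixes g :: "real^'n \<Rightarrow> real^'n"
  assumes g: "g \<in> carrier Aff"
  shows "contact_transformation (J2pr_space A) (prolong A g)"
proof -
  have h: "inv_into UNIV g \<in> carrier Aff" using AffE[OF g] by metis
  have J: "jets (J2pr_space A :: (('n, 'e) jet, _) jet_space) = J2pr A" by (simp add: J2pr_space_def)
  show ?thesis
    by (rule jet_manifold.contact_transformationI[OF jet_manifold_J2pr, of _ "prolong A (inv_into UNIV g)"])
      (simp_all only: J smooth_map_prolong[OF g] smooth_map_prolong[OF h] prolong_inverse[OF g]
        prolong_cartan[OF g] prolong_cartan[OF h])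
qed

end

locale connections = atlas A
  for A :: "('e::{t2_space, second_countable_topology}, 'v::euclidean_space) chart set" +
  fixes \<Gamma> :: "('e, 'v) christoffel" and \<Theta> :: "(real^'n, real^'n) christoffel"
  assumes conn: "linear_connection A \<Gamma>" and tf: "torsion_free A \<Gamma>"
    and conn': "linear_connection {std_chart} \<Theta>" and tf': "torsion_free {std_chart} \<Theta>"
begin

lemma bilinear_christoffel: "c \<in> A \<Longrightarrow> z \<in> snd c ` fst c \<Longrightarrow> bilinear (\<Gamma> c z)"
  and smooth_christoffel: "c \<in> A \<Longrightarrow> smooth_on (snd c ` fst c) (\<lambda>z. \<Gamma> c z v w)"
  using conn by (auto simp: linear_connection_def)

lemma christoffel_sym: "c \<in> A \<Longrightarrow> z \<in> snd c ` fst c \<Longrightarrow> \<Gamma> c z v w = \<Gamma> c z w v"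
  using tf unfolding torsion_free_def by blast

lemma christoffel_transition:
  assumes "c \<in> A" "d \<in> A" "z \<in> snd c ` (fst c \<inter> fst d)"
  shows "FD (transition c d) z (\<Gamma> c z v w) = deriv2 (transition c d) z v w
    + \<Gamma> d (transition c d z) (FD (transition c d) z v) (FD (transition c d) z w)"
  using conn assms unfolding linear_connection_def deriv2_def Let_def by blast

lemma bilinear_param: "bilinear (\<Theta> std_chart x)"
  and smooth_param_christoffel: "smooth_on UNIV (\<lambda>x. \<Theta> std_chart x v w)"
  and param_sym: "\<Theta> std_chart x v w = \<Theta> std_chart x w v"
proof -
  show "bilinear (\<Theta> std_chart x)" "smooth_on UNIV (\<lambda>x. \<Theta> std_chart x v w)" "\<Theta> std_chart x v w = \<Theta> std_chart x w v"
    using conn' tf' by (auto simp: linear_connection_def torsion_free_def std_chart_def)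
qed

text \<open>The second derivative of the transition function in the chain rule cancels against the one in the
  transformation law of the Christoffel symbols.\<close>

lemma geodesic_eq_transition:
  assumes c: "c \<in> A" and d: "d \<in> A" and s: "smooth_near A x s" "s x \<in> fst c" "s x \<in> fst d"
    and eq: "geodesic_eq \<Gamma> \<Theta> c x s"
  shows "geodesic_eq \<Gamma> \<Theta> d x s"
  unfolding geodesic_eq_def
proof (intro allI)
  fix h k
  let ?u = "snd c \<circ> s" let ?\<tau> = "transition c d" let ?z = "snd c (s x)"
  have z: "?z \<in> snd c ` (fst c \<inter> fst d)" using s by blast
  have lin: "linear (FD ?\<tau> ?z)" by (rule smooth_on_linear_FD[OF smooth_transition[OF c d] z])
  have "deriv2 (snd d \<circ> s) x h k + \<Gamma> d (snd d (s x)) (FD (snd d \<circ> s) x h) (FD (snd d \<circ> s) x k)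
     = FD ?\<tau> ?z (deriv2 ?u x h k) + FD ?\<tau> ?z (\<Gamma> c ?z (FD ?u x h) (FD ?u x k))"
    unfolding chart_change_of_param[OF c d s] christoffel_transition[OF c d z] transition_chart[OF c s(2)]
    by simp
  also have "\<dots> = FD ?\<tau> ?z (FD ?u x (\<Theta> std_chart x h k))"
    using eq by (simp add: geodesic_eq_def flip: linear_add[OF lin])
  finally show "deriv2 (snd d \<circ> s) x h k + \<Gamma> d (snd d (s x)) (FD (snd d \<circ> s) x h) (FD (snd d \<circ> s) x k)
     = FD (snd d \<circ> s) x (\<Theta> std_chart x h k)"
    unfolding chart_change_of_param(1)[OF c d s] .
qed

text \<open>Both sides of \<open>geodesic_eq\<close> are bilinear in \<open>h\<close> and \<open>k\<close>, so basis vectors suffice.\<close>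

lemma geodesic_eq_axes:
  assumes c: "c \<in> A" and s: "smooth_near A x s" "s x \<in> fst c"
  shows "geodesic_eq \<Gamma> \<Theta> c x s \<longleftrightarrow> (let u = snd c \<circ> s in
     \<forall>\<xi> \<zeta>. partial \<xi> (partial \<zeta> u) x + \<Gamma> c (u x) (partial \<xi> u x) (partial \<zeta> u x)
          - (\<Sum>\<eta>\<in>UNIV. \<Theta> std_chart x (axis \<xi> 1) (axis \<zeta> 1) $ \<eta> *\<^sub>R partial \<eta> u x) = 0)"
proof -
  let ?u = "snd c \<circ> s"
  obtain N where N: "open N" "x \<in> N" "smooth_on N ?u" using smooth_near_chartE[OF c s] by metis
  have lin: "linear (FD ?u x)" by (rule smooth_on_linear_FD[OF N(3,2)])
  have sum: "(\<Sum>\<eta>\<in>UNIV. v $ \<eta> *\<^sub>R FD ?u x (axis \<eta> 1)) = FD ?u x v" for v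
    using fun_cong[OF lin_of_linear[OF lin], of v] by (simp add: lin_of_def)
  have bd: "bilinear (deriv2 ?u x)" by (rule bilinear_deriv2[OF N(1,3,2)])
  have bg: "bilinear (\<Gamma> c (snd c (s x)))" by (rule bilinear_christoffel[OF c]) (use s in blast)
  let ?L = "\<lambda>h k. deriv2 ?u x h k + \<Gamma> c (snd c (s x)) (FD ?u x h) (FD ?u x k)"
  let ?R = "\<lambda>h k. FD ?u x (\<Theta> std_chart x h k)"
  have L: "bilinear ?L"
    using bd bilinear_compose_linear[OF bg lin] unfolding bilinear_def by (auto intro!: linear_compose_add)
  have R: "bilinear ?R"
    by (rule linear_compose_bilinear[OF bilinear_param lin])
  have "geodesic_eq \<Gamma> \<Theta> c x s \<longleftrightarrow> ?L = ?R" by (auto simp: geodesic_eq_def fun_eq_iff)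
  also have "\<dots> \<longleftrightarrow> (\<forall>i j. ?L (axis i 1) (axis j 1) = ?R (axis i 1) (axis j 1))"
    using bilinear_eq_on_axes[OF L R] by metis
  finally show ?thesis
    unfolding Let_def partial_partial_eq unfolding partial_eq sum by simp
qed

lemma S_pr_iff:
  assumes c: "c \<in> A" and s: "smooth_near A x s" "s x \<in> fst c"
  shows "jet A x s \<in> S_pr A \<Gamma> \<Theta> \<longleftrightarrow> inj (FD (snd c \<circ> s) x) \<and> geodesic_eq \<Gamma> \<Theta> c x s"
proof
  assume "jet A x s \<in> S_pr A \<Gamma> \<Theta>"
  then obtain y t where t: "jet A x s = jet A y t" "smooth_near A y t" "immersive_at A y t"
    and eq: "\<forall>c\<in>A. t y \<in> fst c \<longrightarrow> (let u = snd c \<circ> t in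
        \<forall>\<xi> \<zeta>. partial \<xi> (partial \<zeta> u) y + \<Gamma> c (u y) (partial \<xi> u y) (partial \<zeta> u y)
          - (\<Sum>\<eta>\<in>UNIV. \<Theta> std_chart y (axis \<xi> 1) (axis \<zeta> 1) $ \<eta> *\<^sub>R partial \<eta> u y) = 0)"
    unfolding S_pr_def by blast
  have y: "y = x" using t(1) fst_jet by metis
  note t = t[unfolded y] and eq = eq[unfolded y]
  have st: "same_2jet A x s t" using t jet_eq_iff s(1) by blast
  then have *: "s x = t x" "FD (snd c \<circ> s) x = FD (snd c \<circ> t) x" "deriv2 (snd c \<circ> s) x = deriv2 (snd c \<circ> t) x"
    using same_2jet_iff[OF c s t(2)] by auto
  have tc: "t x \<in> fst c" using s(2) *(1) by simp
  have "geodesic_eq \<Gamma> \<Theta> c x t" using geodesic_eq_axes[OF c t(2) tc] eq c tc by blast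
  then have "geodesic_eq \<Gamma> \<Theta> c x s" unfolding geodesic_eq_def * .
  moreover have "inj (FD (snd c \<circ> s) x)" using t(3) c tc * by (simp add: immersive_at_def)
  ultimately show "inj (FD (snd c \<circ> s) x) \<and> geodesic_eq \<Gamma> \<Theta> c x s" by blast
next
  assume *: "inj (FD (snd c \<circ> s) x) \<and> geodesic_eq \<Gamma> \<Theta> c x s"
  have "immersive_at A x s"
    unfolding immersive_at_def
  proof (intro ballI impI)
    fix d assume d: "d \<in> A" "s x \<in> fst d"
    have "FD (snd d \<circ> s) x = FD (transition c d) (snd c (s x)) \<circ> FD (snd c \<circ> s) x"
      using chart_change_of_param(1)[OF c d(1) s d(2)] by (auto simp: fun_eq_iff)
    then show "inj (FD (snd d \<circ> s) x)"
      using * inj_FD_transition[OF c d(1) s(2) d(2)] by (simp add: inj_compose)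
  qed
  moreover have "let u = snd d \<circ> s in
        \<forall>\<xi> \<zeta>. partial \<xi> (partial \<zeta> u) x + \<Gamma> d (u x) (partial \<xi> u x) (partial \<zeta> u x)
          - (\<Sum>\<eta>\<in>UNIV. \<Theta> std_chart x (axis \<xi> 1) (axis \<zeta> 1) $ \<eta> *\<^sub>R partial \<eta> u x) = 0"
    if d: "d \<in> A" "s x \<in> fst d" for d
    using geodesic_eq_axes[OF d(1) s(1) d(2)] geodesic_eq_transition[OF c d(1) s d(2)] * by blast
  ultimately show "jet A x s \<in> S_pr A \<Gamma> \<Theta>" using s(1) unfolding S_pr_def by blast
qed

lemma S_pr_subset: "S_pr A \<Gamma> \<Theta> \<subseteq> ImmJ2pr A" "S_pr A \<Gamma> \<Theta> \<subseteq> J2pr A"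
  unfolding S_pr_def ImmJ2pr_def J2pr_def by blast+

text \<open>The equation is solved for the second derivatives, and torsion-freeness makes their values symmetric.\<close>

lemma S_pr_jet_exists:
  fixes x :: "real^'n"
  assumes c: "c \<in> A" and z: "z \<in> snd c ` fst c" and L: "linear L" "inj L"
  obtains s where "smooth_near A x s" "s x \<in> fst c" "snd c (s x) = z" "FD (snd c \<circ> s) x = L"
    "jet A x s \<in> S_pr A \<Gamma> \<Theta>"
proof -
  let ?B = "\<lambda>h k. L (\<Theta> std_chart x h k) - \<Gamma> c z (L h) (L k)"
  have 1: "bilinear (\<lambda>h k. L (\<Theta> std_chart x h k))"
    by (rule linear_compose_bilinear[OF bilinear_param L(1)])
  have 2: "bilinear (\<lambda>h k. \<Gamma> c z (L h) (L k))"
    by (rule bilinear_compose_linear[OF bilinear_christoffel[OF c z] L(1)])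
  have B: "bilinear ?B" using 1 2 unfolding bilinear_def by (auto intro!: linear_compose_sub)
  have sym: "?B h k = ?B k h" for h k using param_sym christoffel_sym[OF c z] by metis
  let ?w = "(x, z, (\<chi> i. L (axis i 1)), (\<chi> \<sigma>. ?B (axis (rep1 \<sigma>) 1) (axis (rep2 \<sigma>) 1)))"
  let ?s = "quad_section c ?w"
  have "fst (snd ?w) \<in> snd c ` fst c" using z by simp
  note q = quad_section[OF c this, unfolded fst_conv]
  note q' = q(3)[unfolded jet_coords_iff[OF c q(1,2)] lin_of_linear[OF L(1)] bil_of_bilinear[OF B sym]]
  have d: "snd c (?s x) = z" "FD (snd c \<circ> ?s) x = L" "deriv2 (snd c \<circ> ?s) x h k = ?B h k" for h k
    using q' by (metis (lifting))+
  have "geodesic_eq \<Gamma> \<Theta> c x ?s"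
    unfolding geodesic_eq_def d by simp
  then have "jet A x ?s \<in> S_pr A \<Gamma> \<Theta>"
    using S_pr_iff[OF c q(1,2)] d(2) L(2) by metis
  then show ?thesis using that[of ?s] q(1,2) d(1,2) by blast
qed

text \<open>Without the term of \<open>\<Theta>\<close> the equation is the vanishing of a bilinear form in \<open>h\<close> and \<open>k\<close>, and the
  prolongation substitutes \<open>N h\<close> and \<open>N k\<close>.\<close>

lemma prolong_in_S_pr:
  assumes zero: "\<And>x v w. \<Theta> std_chart x v w = 0" and g: "g \<in> carrier Aff" and \<theta>: "\<theta> \<in> S_pr A \<Gamma> \<Theta>"
  shows "prolong A g \<theta> \<in> S_pr A \<Gamma> \<Theta>"
proof -
  obtain s where s: "smooth_near A (fst \<theta>) s" "\<theta> = jet A (fst \<theta>) s"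
    using \<theta> S_pr_subset(2) J2prE by blast
  obtain c where c: "c \<in> A" "s (fst \<theta>) \<in> fst c" by (rule chart_at)
  obtain N b where N: "linear N" "inj N" "inv_into UNIV g = (\<lambda>y. N y + b)" "\<And>x. inv_into UNIV g (g x) = x"
    using AffE[OF g] by metis
  have y: "N (g (fst \<theta>)) + b = fst \<theta>" using N(3,4) by metis
  note P = prolong_jet[OF g s(1)]
  note R = affine_reparam[OF c(1) s(1) c(2) N(1) y, folded N(3)]
  let ?t = "s \<circ> inv_into UNIV g"
  have tc: "?t (g (fst \<theta>)) \<in> fst c" using c(2) N(4) by simp
  have S: "inj (FD (snd c \<circ> s) (fst \<theta>))" "geodesic_eq \<Gamma> \<Theta> c (fst \<theta>) s"
    using S_pr_iff[OF c(1) s(1) c(2)] \<theta> s(2) by auto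
  obtain U where U: "open U" "fst \<theta> \<in> U" "smooth_on U (snd c \<circ> s)" using smooth_near_chartE[OF c(1) s(1) c(2)] by metis
  have 0: "FD (snd c \<circ> s) (fst \<theta>) 0 = 0" by (rule linear_0[OF smooth_on_linear_FD[OF U(3,2)]])
  have "FD (snd c \<circ> ?t) (g (fst \<theta>)) = FD (snd c \<circ> s) (fst \<theta>) \<circ> N" by (auto simp: fun_eq_iff R(2))
  then have "inj (FD (snd c \<circ> ?t) (g (fst \<theta>)))" using S(1) N(2) by (simp add: inj_compose)
  moreover have "geodesic_eq \<Gamma> \<Theta> c (g (fst \<theta>)) ?t"
    using S(2) unfolding geodesic_eq_def R(2,3) zero linear_0[OF N(1)] 0 by (simp add: N(4))
  ultimately have "jet A (g (fst \<theta>)) ?t \<in> S_pr A \<Gamma> \<Theta>" using S_pr_iff[OF c(1) P(2) tc] by blast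
  then show ?thesis using P(1) s(2) by simp
qed

lemma prolong_image_S_pr:
  assumes zero: "\<And>x v w. \<Theta> std_chart x v w = 0" and g: "g \<in> carrier Aff"
  shows "prolong A g ` S_pr A \<Gamma> \<Theta> = S_pr A \<Gamma> \<Theta>"
proof
  have h: "inv_into UNIV g \<in> carrier Aff" using AffE[OF g] by metis
  show "prolong A g ` S_pr A \<Gamma> \<Theta> \<subseteq> S_pr A \<Gamma> \<Theta>" using prolong_in_S_pr[OF zero g] by blast
  show "S_pr A \<Gamma> \<Theta> \<subseteq> prolong A g ` S_pr A \<Gamma> \<Theta>"
  proof
    fix \<theta> assume \<theta>: "\<theta> \<in> S_pr A \<Gamma> \<Theta>"
    then have "prolong A g (prolong A (inv_into UNIV g) \<theta>) = \<theta>" using prolong_inverse(2)[OF g] S_pr_subset(2) by blast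
    then show "\<theta> \<in> prolong A g ` S_pr A \<Gamma> \<Theta>" using prolong_in_S_pr[OF zero h \<theta>] by (metis imageI)
  qed
qed

text \<open>Under the homothety with centre \<open>x\<close> and ratio \<open>2\<close>, the terms of the equation that are quadratic
  in the derivatives scale with \<open>1/4\<close>, but the linear term with \<open>1/2\<close>.\<close>

lemma param_flat_if_symmetric:
  fixes x :: "real^'n"
  assumes sym: "\<And>g. g \<in> carrier Aff \<Longrightarrow> prolong A g ` S_pr A \<Gamma> \<Theta> \<subseteq> S_pr A \<Gamma> \<Theta>"
    and L: "linear (L :: real^'n \<Rightarrow> 'v)" "inj L"
  shows "\<Theta> std_chart x v w = 0"
proof -
  obtain c where c: "c \<in> A" "undefined \<in> fst c" by (rule chart_at)
  then have z: "snd c undefined \<in> snd c ` fst c" by blast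
  obtain s where s: "smooth_near A x s" "s x \<in> fst c" "FD (snd c \<circ> s) x = L" "jet A x s \<in> S_pr A \<Gamma> \<Theta>"
    using S_pr_jet_exists[OF c(1) z L] by metis
  \<comment> \<open>The homothety \<open>y \<mapsto> 2 y - x\<close>, which fixes \<open>x\<close>.\<close>
  let ?g = "\<lambda>y. (2 *\<^sub>R mat 1 :: real^'n^'n) *v y + (- x)"
  let ?N = "\<lambda>y::real^'n. (1/2) *\<^sub>R y"
  have gy: "(2 *\<^sub>R mat 1 :: real^'n^'n) *v y = 2 *\<^sub>R y" for y by (metis scaleR_matrix_vector_assoc matrix_vector_mul_lid)
  have "invertible (2 *\<^sub>R mat 1 :: real^'n^'n)"
    unfolding invertible_left_inverse matrix_left_invertible_injective
    by (rule injI) (simp add: gy)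
  then have g: "?g \<in> carrier Aff" unfolding Aff_def partial_object.select_convs by blast
  have inv: "inv_into UNIV ?g = (\<lambda>y. ?N y + (1/2) *\<^sub>R x)"
    by (rule inv_unique_comp) (simp_all add: fun_eq_iff gy scaleR_right_diff_distrib scaleR_right_distrib)
  have gx: "?g x = x" unfolding gy by (simp add: scaleR_2)
  have N: "linear ?N" by (rule linearI) (simp_all add: scaleR_right_distrib)
  have y: "?N x + (1/2) *\<^sub>R x = x" by (simp flip: scaleR_left_distrib)
  let ?t = "s \<circ> (\<lambda>y. ?N y + (1/2) *\<^sub>R x)"
  note R = affine_reparam[OF c(1) s(1,2) N y]
  have "prolong A ?g (jet A x s) = jet A x ?t" using prolong_jet(1)[OF g s(1)] unfolding inv gx .
  then have t: "jet A x ?t \<in> S_pr A \<Gamma> \<Theta>" using sym[OF g] s(4) by (metis image_subset_iff)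
  have tx: "?t x = s x" using y by simp
  have tc: "?t x \<in> fst c" using s(2) tx by simp
  have zc: "snd c (s x) \<in> snd c ` fst c" using s(2) by blast
  obtain U where U: "open U" "x \<in> U" "smooth_on U (snd c \<circ> s)" using smooth_near_chartE[OF c(1) s(1,2)] by metis
  let ?X = "deriv2 (snd c \<circ> s) x v w" and ?Y = "\<Gamma> c (snd c (s x)) (L v) (L w)" and ?\<theta> = "\<Theta> std_chart x v w"
  have e1: "?X + ?Y = L ?\<theta>"
    using S_pr_iff[OF c(1) s(1,2)] s(4) by (simp add: geodesic_eq_def s(3))
  have "geodesic_eq \<Gamma> \<Theta> c x ?t" using S_pr_iff[OF c(1) R(1) tc] t by blast
  then have "deriv2 (snd c \<circ> s) x (?N v) (?N w) + \<Gamma> c (snd c (s x)) (L (?N v)) (L (?N w)) = L (?N ?\<theta>)"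
    unfolding geodesic_eq_def R(2,3) tx s(3) by blast
  then have e2: "(1/4) *\<^sub>R ?X + (1/4) *\<^sub>R ?Y = (1/2) *\<^sub>R L ?\<theta>"
    by (simp add: linear_cmul[OF L(1)] bilinear_lmul[OF bilinear_deriv2[OF U(1,3,2)]] bilinear_rmul[OF bilinear_deriv2[OF U(1,3,2)]]
        bilinear_lmul[OF bilinear_christoffel[OF c(1) zc]] bilinear_rmul[OF bilinear_christoffel[OF c(1) zc]])
  have "(1/4) *\<^sub>R L ?\<theta> = (1/2) *\<^sub>R L ?\<theta>" using e2 unfolding e1[symmetric] by (simp add: scaleR_right_distrib)
  then have "L ?\<theta> = 0" by simp
  then show ?thesis using linear_injective_0[OF L(1)] L(2) by blast
qed

lemma group_hom_prolong:
  assumes zero: "\<And>x v w. \<Theta> std_chart x v w = 0"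
  shows "group_hom Aff (external_symmetry_group (J2pr_space A) (S_pr A \<Gamma> \<Theta>)) (prolong A)"
proof -
  have J: "jets (J2pr_space A :: (('n, 'e) jet, _) jet_space) = J2pr A" by (simp add: J2pr_space_def)
  let ?G = "external_symmetry_group (J2pr_space A) (S_pr A \<Gamma> \<Theta>)"
  have grp: "group ?G"
    by (rule jet_manifold.group_external_symmetry_group[OF jet_manifold_J2pr _ contact_transformation_identity])
      (use S_pr_subset(2) J in simp)
  have ext: "external_symmetry (J2pr_space A) (S_pr A \<Gamma> \<Theta>) (prolong A g)" if "g \<in> carrier Aff" for g :: "real^'n \<Rightarrow> real^'n"
    unfolding external_symmetry_def using contact_transformation_prolong[OF that] prolong_image_S_pr[OF zero that] by blast
  have extensional: "prolong A g \<in> extensional (J2pr A)" for g :: "real^'n \<Rightarrow> real^'n" by (simp add: prolong_def)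
  have Bij: "prolong A g \<in> Bij (J2pr A)" if "g \<in> carrier Aff" for g :: "real^'n \<Rightarrow> real^'n"
    using ext[OF that] extensional J by (simp add: external_symmetry_def contact_transformation_def Bij_def)
  have "prolong A \<in> hom Aff ?G"
  proof (rule homI)
    fix g :: "real^'n \<Rightarrow> real^'n" assume "g \<in> carrier Aff"
    then show "prolong A g \<in> carrier ?G" using ext extensional J by (simp add: external_symmetry_group_def)
  next
    fix g h :: "real^'n \<Rightarrow> real^'n" assume g: "g \<in> carrier Aff" and h: "h \<in> carrier Aff"
    have "compose (J2pr A) (prolong A g) (prolong A h) = prolong A (g \<circ> h)"
      by (rule extensionalityI[of _ "J2pr A"]) (use extensional prolong_compose[OF g h] in \<open>auto simp: compose_def\<close>)
    then show "prolong A (g \<otimes>\<^bsub>Aff\<^esub> h) = prolong A g \<otimes>\<^bsub>?G\<^esub> prolong A h"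
      using Bij[OF g] Bij[OF h] J by (simp add: external_symmetry_group_def BijGroup_def Aff_def)
  qed
  then show ?thesis
    unfolding group_hom_def group_hom_axioms_def using group_Aff grp by blast
qed

text \<open>The prolongation moves the base point of the jets of constant maps by \<open>g\<close>.\<close>

lemma inj_on_prolong: "inj_on (prolong A) (carrier (Aff :: (real^'n \<Rightarrow> real^'n) monoid))"
proof (rule inj_onI, rule ext)
  fix g h :: "real^'n \<Rightarrow> real^'n" and x :: "real^'n"
  assume g: "g \<in> carrier Aff" and h: "h \<in> carrier Aff" and eq: "prolong A g = prolong A h"
  obtain c where c: "c \<in> A" "undefined \<in> fst c" by (rule chart_at)
  have "smooth_near A x (\<lambda>y. undefined)"
    by (rule smooth_near_chartI[OF c(1) open_UNIV]) (use c(2) in \<open>auto simp: comp_def smooth_on_const\<close>)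
  from prolong_jet(1)[OF g this] prolong_jet(1)[OF h this] eq show "g x = h x" by (metis fst_jet)
qed

end


section \<open>Embeddings and sections of linear projections\<close>

context atlas
begin

lemma immersive_atI:
  assumes c: "c \<in> A" and s: "smooth_near A x s" "s x \<in> fst c" and inj: "inj (FD (snd c \<circ> s) x)"
  shows "immersive_at A x s"
  unfolding immersive_at_def
proof (intro ballI impI)
  fix d assume d: "d \<in> A" "s x \<in> fst d"
  have "FD (snd d \<circ> s) x = FD (transition c d) (snd c (s x)) \<circ> FD (snd c \<circ> s) x"
    using chart_change_of_param(1)[OF c d(1) s d(2)] by (auto simp: fun_eq_iff)
  then show "inj (FD (snd d \<circ> s) x)"
    using inj inj_FD_transition[OF c d(1) s(2) d(2)] by (simp add: inj_compose)
qed

lemma immersive_atD: "immersive_at A x s \<Longrightarrow> c \<in> A \<Longrightarrow> s x \<in> fst c \<Longrightarrow> inj (FD (snd c \<circ> s) x)"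
  by (simp add: immersive_at_def)

lemma homeomorphism_inv_into:
  assumes "homeomorphism N T s k"
  shows "homeomorphism N (s ` N) s (inv_into N s)"
proof -
  have T: "T = s ` N" using assms by (auto simp: homeomorphism_def)
  have inj: "inj_on s N" using assms by (metis homeomorphism_apply1 inj_onI)
  have eq: "inv_into N s q = k q" if "q \<in> s ` N" for q
    using that assms inj by (auto simp: homeomorphism_def)
  show ?thesis
    using assms unfolding T
    by (rule homeomorphism_cong) (auto simp: eq)
qed

lemma embedding_onI:
  assumes c: "c \<in> A" and N: "open N" "s ` N \<subseteq> fst c" "smooth_on N (snd c \<circ> s)"
    and inj: "\<And>y. y \<in> N \<Longrightarrow> inj (FD (snd c \<circ> s) y)"
    and k: "continuous_on (s ` N) k" "\<And>y. y \<in> N \<Longrightarrow> k (s y) = y"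
  shows "embedding_on A N s"
proof -
  have sp: "smooth_param A N s" by (rule smooth_param_chartI[OF c N])
  then have "continuous_on N s" by (simp add: smooth_param_def)
  then have "homeomorphism N (s ` N) s k" using k by (auto intro!: homeomorphismI)
  moreover have "immersive_at A y s" if "y \<in> N" for y
    using that sp N(2) by (intro immersive_atI[OF c _ _ inj]) (auto simp: smooth_near_def)
  ultimately show ?thesis using sp homeomorphism_inv_into unfolding embedding_on_def by blast
qed

lemma embedding_onD:
  assumes "embedding_on A N s"
  shows "open N" "y \<in> N \<Longrightarrow> smooth_near A y s" "y \<in> N \<Longrightarrow> immersive_at A y s"
  using assms by (auto simp: embedding_on_def smooth_param_def smooth_near_def)

lemma embedding_on_open_image:
  assumes s: "embedding_on A N s" and U: "open U" "U \<subseteq> N"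
  obtains W where "open W" "s ` U = s ` N \<inter> W"
proof -
  have hom: "homeomorphism N (s ` N) s (inv_into N s)" using s by (simp add: embedding_on_def)
  have "openin (top_of_set N) U" using U embedding_onD(1)[OF s] by (simp add: open_openin_trans)
  then have "openin (top_of_set (s ` N)) (s ` U)" by (rule homeomorphism_imp_open_map[OF hom])
  then show ?thesis using that by (auto simp: openin_open)
qed

text \<open>Graphs over any choice of independent coordinates, and over other linear projections. With
  \<open>R = fst\<close> the section is \<open>y \<mapsto> (y, f y)\<close>.\<close>

definition section_near ::
  "('e, 'v) chart \<Rightarrow> ('v \<Rightarrow> real^'n) \<Rightarrow> 'e set \<Rightarrow> 'e \<Rightarrow> (real^'n \<Rightarrow> 'v) \<Rightarrow> bool" where
  "section_near c R L p u \<longleftrightarrow> p \<in> L \<and> (\<exists>W N. open W \<and> p \<in> W \<and> W \<subseteq> fst c \<and>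
     open N \<and> (\<lambda>q. R (snd c q)) ` W \<subseteq> N \<and> smooth_on N u \<and> (\<forall>y\<in>N. R (u y) = y) \<and>
     L \<inter> W = {q \<in> W. snd c q = u (R (snd c q))})"

lemma section_near_local:
  assumes "section_near c R (L \<inter> V) p u" "open V"
  shows "section_near c R L p u"
proof -
  obtain W N where "p \<in> L \<inter> V" "open W" "p \<in> W" "W \<subseteq> fst c" "open N" "(\<lambda>q. R (snd c q)) ` W \<subseteq> N"
    "smooth_on N u" "\<forall>y\<in>N. R (u y) = y" "L \<inter> V \<inter> W = {q \<in> W. snd c q = u (R (snd c q))}"
    using assms(1) unfolding section_near_def by blast
  then show ?thesis
    unfolding section_near_def using assms(2)
    by (intro conjI exI[of _ "W \<inter> V"] exI[of _ N]) auto
qed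

text \<open>If \<open>R\<close> is injective on the tangent space of the image of an embedding, the inverse function
  theorem turns the embedding into a section of \<open>R\<close>.\<close>

lemma section_near_of_embedding:
  fixes s :: "real^'n \<Rightarrow> 'e" and R :: "'v \<Rightarrow> real^'n"
  assumes c: "c \<in> A" and s: "embedding_on A N s" "x \<in> N" "s x \<in> fst c"
    and R: "linear R" "inj (\<lambda>h. R (FD (snd c \<circ> s) x h))"
  obtains u where "section_near c R (s ` N) (s x) u"
proof -
  obtain U where U: "open U" "x \<in> U" "s ` U \<subseteq> fst c" "smooth_on U (snd c \<circ> s)"
    using smooth_near_chartE[OF c embedding_onD(2)[OF s(1,2)] s(3)] by metis
  let ?O = "U \<inter> N" let ?v = "\<lambda>y. R ((snd c \<circ> s) y)"
  have O: "open ?O" "x \<in> ?O" using U s(2) embedding_onD(1)[OF s(1)] by auto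
  have sm: "smooth_on ?O (snd c \<circ> s)" by (rule smooth_on_subset[OF U(4)]) auto
  have v: "smooth_on ?O ?v" by (rule smooth_on_linear[OF O(1) R(1) sm])
  have "FD ?v x = (\<lambda>h. R (FD (snd c \<circ> s) x h))" using FD_linear_compose[OF R(1) sm O(2)] by (rule ext)
  with R(2) have inj: "inj (FD ?v x)" by simp
  obtain N1 M g where N1: "open N1" "x \<in> N1" "N1 \<subseteq> ?O" and M: "open M" and hom: "homeomorphism N1 M ?v g"
    and g: "smooth_on M g" by (rule smooth_local_inverse[OF O(1) v O(2) inj]) (rule that)
  have gv: "g (?v y) = y" "?v y \<in> M" if "y \<in> N1" for y using hom that by (auto simp: homeomorphism_def)
  have vg: "?v (g y) = y" "g y \<in> N1" if "y \<in> M" for y using hom that by (auto simp: homeomorphism_def)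
  define u where "u y = (snd c \<circ> s) (g y)" for y
  have u: "smooth_on M u"
    unfolding u_def by (rule smooth_on_compose[OF M O(1) _ g sm]) (use vg N1(3) in auto)
  obtain W0 where W0: "open W0" "s ` N1 = s ` N \<inter> W0"
    using embedding_on_open_image[OF s(1) N1(1)] N1(3) by blast
  have cont: "continuous_on (fst c) (\<lambda>q. R (snd c q))"
    by (rule continuous_on_compose2[OF linear_continuous_on[OF R(1)[unfolded linear_conv_bounded_linear]] continuous_chart[OF c] subset_UNIV])
  let ?W = "W0 \<inter> (fst c \<inter> (\<lambda>q. R (snd c q)) -` M)"
  have W: "open ?W" using continuous_open_preimage[OF cont open_domain[OF c] M] W0(1) by blast
  have "s ` N \<inter> ?W = {q \<in> ?W. snd c q = u (R (snd c q))}"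
  proof (intro equalityI subsetI)
    fix q assume q: "q \<in> s ` N \<inter> ?W"
    then obtain y where y: "y \<in> N1" "q = s y" using W0(2) by blast
    then show "q \<in> {q \<in> ?W. snd c q = u (R (snd c q))}" using q gv(1)[OF y(1)] by (simp add: u_def)
  next
    fix q assume q: "q \<in> {q \<in> ?W. snd c q = u (R (snd c q))}"
    let ?y = "g (R (snd c q))"
    have y: "?y \<in> N1" using q vg(2) by blast
    then have "s ?y \<in> fst c" "s ?y \<in> s ` N" using U(3) N1(3) by auto
    moreover have "snd c q = snd c (s ?y)" using q by (simp add: u_def)
    ultimately show "q \<in> s ` N \<inter> ?W" using q inj_onD[OF inj_on_chart[OF c], of q "s ?y"] by auto
  qed
  moreover have "s x \<in> ?W" using W0(2) N1(2) s(3) gv(2)[OF N1(2)] by auto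
  moreover have "\<forall>y\<in>M. R (u y) = y" using vg by (simp add: u_def)
  ultimately have "section_near c R (s ` N) (s x) u"
    unfolding section_near_def using W M u s(2) by (intro conjI exI[of _ ?W] exI[of _ M]) auto
  then show ?thesis by (rule that)
qed

text \<open>Composed with a left inverse \<open>R\<close> of its derivative, an immersion becomes a local diffeomorphism.
  The inverse of the latter, composed with \<open>R\<close>, inverts the immersion continuously on its image.\<close>

lemma embedding_exists:
  fixes s :: "real^'n \<Rightarrow> 'e"
  assumes s: "smooth_near A x s" "immersive_at A x s"
  obtains N where "x \<in> N" "embedding_on A N s"
proof -
  obtain c where c: "c \<in> A" "s x \<in> fst c" by (rule chart_at)
  obtain U where U: "open U" "x \<in> U" "s ` U \<subseteq> fst c" "smooth_on U (snd c \<circ> s)"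
    using smooth_near_chartE[OF c(1) s(1) c(2)] by metis
  have lin: "linear (FD (snd c \<circ> s) x)" by (rule smooth_on_linear_FD[OF U(4,2)])
  obtain R where R: "linear R" "R \<circ> FD (snd c \<circ> s) x = id"
    using linear_injective_left_inverse[OF lin immersive_atD[OF s(2) c]] by blast
  let ?v = "\<lambda>y. R ((snd c \<circ> s) y)"
  have v: "smooth_on U ?v" by (rule smooth_on_linear[OF U(1) R(1) U(4)])
  have FDv: "FD ?v y h = R (FD (snd c \<circ> s) y h)" if "y \<in> U" for y h by (rule FD_linear_compose[OF R(1) U(4) that])
  have "FD ?v x = id" using FDv[OF U(2)] R(2) by (auto simp: fun_eq_iff)
  then have inj: "inj (FD ?v x)" by simp
  obtain N M g where N: "open N" "x \<in> N" "N \<subseteq> U" and M: "open M" and hom: "homeomorphism N M ?v g"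
    and g: "smooth_on M g" and inj: "\<And>y. y \<in> N \<Longrightarrow> inj (FD ?v y)"
    by (rule smooth_local_inverse[OF U(1) v U(2) inj]) (rule that)
  have sN: "s ` N \<subseteq> fst c" using U(3) N(3) by auto
  have contv: "continuous_on (s ` N) (\<lambda>q. R (snd c q))"
    using continuous_on_compose2[OF linear_continuous_on[OF R(1)[unfolded linear_conv_bounded_linear]] continuous_chart[OF c(1)] subset_UNIV]
      continuous_on_subset sN by blast
  have "embedding_on A N s"
  proof (rule embedding_onI[OF c(1) N(1) sN smooth_on_subset[OF U(4) N(3)]])
    fix y assume y: "y \<in> N"
    then have yU: "y \<in> U" using N(3) by blast
    show "inj (FD (snd c \<circ> s) y)"
      using inj[OF y] FDv[OF yU] unfolding inj_def by metis
    show "g (R (snd c (s y))) = y" using hom y by (auto simp: homeomorphism_def)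
  next
    show "continuous_on (s ` N) (\<lambda>q. g (R (snd c q)))"
      by (rule continuous_on_compose2[OF smooth_on_continuous[OF g] contv]) (use hom in \<open>auto simp: homeomorphism_def\<close>)
  qed
  then show ?thesis using that N(2) by blast
qed

text \<open>A map with values in \<open>L\<close> factors through the section, which determines its derivatives up to
  order two.\<close>

lemma section_near_param:
  fixes s :: "real^'n \<Rightarrow> 'e" and R :: "'v \<Rightarrow> real^'k" and u :: "real^'k \<Rightarrow> 'v"
  assumes c: "c \<in> A" and R: "linear R" and sec: "section_near c R L p u"
    and s: "smooth_near A x s" "s x = p" "open U" "x \<in> U" "s ` U \<subseteq> L"
  defines "v \<equiv> snd c \<circ> s"
  shows "\<And>h. FD v x h = FD u (R (v x)) (R (FD v x h))"
    and "\<And>h k. deriv2 v x h k = deriv2 u (R (v x)) (R (FD v x h)) (R (FD v x k)) + FD u (R (v x)) (R (deriv2 v x h k))"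
    and "inj (FD v x) \<Longrightarrow> inj (\<lambda>h. R (FD v x h))"
    and "v x = u (R (v x))"
proof -
  obtain W N where W: "open W" "p \<in> W" "W \<subseteq> fst c" and N: "open N" "(\<lambda>q. R (snd c q)) ` W \<subseteq> N" "smooth_on N u"
    and LW: "L \<inter> W = {q \<in> W. snd c q = u (R (snd c q))}"
    using sec unfolding section_near_def by blast
  have pc: "s x \<in> fst c" using W s(2) by blast
  obtain V where V: "open V" "x \<in> V" "s ` V \<subseteq> fst c" "smooth_on V v"
    using smooth_near_chartE[OF c s(1) pc] unfolding v_def by metis
  have cont: "continuous_on V (\<lambda>y. cinv c (v y))"
    by (rule continuous_on_compose2[OF continuous_cinv[OF c] smooth_on_continuous[OF V(4)]]) (use V(3) in \<open>auto simp: v_def\<close>)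
  have sv: "cinv c (v y) = s y" if "y \<in> V" for y using V(3) that by (auto simp: v_def cinv_chart[OF c])
  let ?T = "U \<inter> (V \<inter> (\<lambda>y. cinv c (v y)) -` W)"
  have T: "open ?T" "x \<in> ?T"
    using continuous_open_preimage[OF cont V(1) W(1)] s V(2) W(2) sv[OF V(2)] by auto
  have sW: "s y \<in> L \<inter> W" if "y \<in> ?T" for y using that sv s(5) by auto
  have eq: "v y = u (R (v y))" and RN: "R (v y) \<in> N" if "y \<in> ?T" for y
    using sW[OF that] LW N(2) by (auto simp: v_def)
  have vT: "smooth_on ?T v" by (rule smooth_on_subset[OF V(4)]) auto
  have Rv: "smooth_on ?T (\<lambda>y. R (v y))" by (rule smooth_on_linear[OF T(1) R vT])
  note FR = FD_linear_compose[OF R vT T(2)] and DR = deriv2_linear_compose[OF R T(1) vT T(2)]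
  have F: "FD v x = FD (\<lambda>y. u (R (v y))) x" by (rule FD_cong[OF T eq])
  have D: "deriv2 v x = deriv2 (\<lambda>y. u (R (v y))) x" by (rule deriv2_cong[OF T eq])
  show 1: "FD v x h = FD u (R (v x)) (R (FD v x h))" for h
    using fun_cong[OF F, of h] unfolding FD_compose[OF Rv T(2) N(3) RN[OF T(2)]] FR .
  show "deriv2 v x h k = deriv2 u (R (v x)) (R (FD v x h)) (R (FD v x k)) + FD u (R (v x)) (R (deriv2 v x h k))" for h k
    using fun_cong[OF fun_cong[OF D, of h], of k]
    unfolding deriv2_compose[OF T(1) Rv T(2) N(1,3) RN[OF T(2)]] FR DR .
  show "inj (\<lambda>h. R (FD v x h))" if "inj (FD v x)"
  proof (rule injI)
    fix h k assume "R (FD v x h) = R (FD v x k)"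
    then have "FD v x h = FD v x k" using 1[of h] 1[of k] by simp
    then show "h = k" using that by (simp add: inj_eq)
  qed
  show "v x = u (R (v x))" by (rule eq[OF T(2)])
qed

end

text \<open>The range of \<open>L\<close> and its orthogonal complement together give an isomorphism from the product space.
  Its inverse is \<open>P\<close>.\<close>

lemma straighten_injective_linear:
  fixes L :: "real^'n \<Rightarrow> (real^'n) \<times> (real^'m)"
  assumes L: "linear L" "inj L"
  obtains P :: "(real^'n) \<times> (real^'m) \<Rightarrow> (real^'n) \<times> (real^'m)" where "linear P" "inj P" "\<And>h. fst (P (L h)) = h"
proof -
  let ?C = "{y. \<forall>x\<in>range L. orthogonal x y}"
  have sL: "subspace (range L)" by (rule linear_subspace_image[OF L(1) subspace_UNIV])
  have sC: "subspace ?C"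
    unfolding subspace_def by (auto simp: orthogonal_def inner_add_right)
  have "dim (range L) = CARD('n)"
    using dim_image_eq[OF L(1), of UNIV] L(2) by (simp add: span_UNIV)
  moreover have "dim ?C + dim (range L) = CARD('n) + CARD('m)"
    using dim_subspace_orthogonal_to_vectors[OF sL subspace_UNIV subset_UNIV] by simp
  ultimately have "dim (UNIV :: (real^'m) set) = dim ?C" by simp
  from subspace_isomorphism[OF subspace_UNIV sC this]
  obtain T :: "real^'m \<Rightarrow> _" where T: "linear T" "range T = ?C" "inj T" by blast
  define Q where "Q z = L (fst z) + T (snd z)" for z
  have lQ: "linear Q"
    unfolding Q_def by (intro linear_compose_add linear_compose[OF linear_fst L(1), unfolded comp_def] linear_compose[OF linear_snd T(1), unfolded comp_def])
  have "inj Q"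
    unfolding linear_injective_0[OF lQ]
  proof (intro allI impI)
    fix z assume "Q z = 0"
    then have e: "T (snd z) = - L (fst z)" by (simp add: Q_def eq_neg_iff_add_eq_0 add.commute)
    have "T (snd z) \<in> ?C" using T(2) by blast
    then have "orthogonal (L (fst z)) (T (snd z))" by blast
    then have "L (fst z) = 0" by (simp add: e orthogonal_def)
    then have "fst z = 0" "snd z = 0"
      using e linear_injective_0[OF L(1)] linear_injective_0[OF T(1)] L(2) T(3) by auto
    then show "z = 0" by (simp add: prod_eq_iff)
  qed
  then obtain P where P: "linear P" "P \<circ> Q = id" using linear_injective_left_inverse[OF lQ] by blast
  have "Q \<circ> P = id" using linear_inverse_left[OF P(1) lQ] P(2) by simp
  then have "inj P" by (metis inj_on_id inj_on_imageI2)
  moreover have "fst (P (L h)) = h" for h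
    using fun_cong[OF P(2), of "(h, 0)"] linear_0[OF T(1)] by (simp add: Q_def)
  ultimately show ?thesis by (intro that[OF P(1)])
qed


section \<open>Submanifolds as graphs\<close>

locale split_atlas = atlas A
  for A :: "('e::{t2_space, second_countable_topology}, (real^'n) \<times> (real^'m)) chart set"
begin

lemma section_near_graph:
  assumes "graph_near c L p f"
  shows "section_near c fst L p (\<lambda>y. (y, f y))"
proof -
  obtain W N where W: "p \<in> L" "open W" "p \<in> W" "W \<subseteq> fst c" "open N" "(fst \<circ> snd c) ` W \<subseteq> N" "smooth_on N f"
    "L \<inter> W = {q \<in> W. snd (snd c q) = f (fst (snd c q))}"
    using assms unfolding graph_near_def by blast
  have "smooth_on N (\<lambda>y. (y, f y))" by (intro smooth_on_Pair smooth_on_id W)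
  moreover have "(\<lambda>q. fst (snd c q)) ` W \<subseteq> N" using W(6) by (simp add: comp_def)
  moreover have "L \<inter> W = {q \<in> W. snd c q = (fst (snd c q), f (fst (snd c q)))}"
    unfolding W(8) by (simp add: prod_eq_iff)
  ultimately show ?thesis unfolding section_near_def using W(1-5) by auto
qed

lemma graph_near_section:
  assumes "section_near c fst L p u"
  shows "graph_near c L p (\<lambda>y. snd (u y))"
proof -
  obtain W N where W: "p \<in> L" "open W" "p \<in> W" "W \<subseteq> fst c" "open N" "(\<lambda>q. fst (snd c q)) ` W \<subseteq> N" "smooth_on N u"
    "\<forall>y\<in>N. fst (u y) = y" "L \<inter> W = {q \<in> W. snd c q = u (fst (snd c q))}"
    using assms unfolding section_near_def by blast
  have "smooth_on N (\<lambda>y. snd (u y))" by (intro smooth_on_snd W)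
  moreover have "L \<inter> W = {q \<in> W. snd (snd c q) = snd (u (fst (snd c q)))}"
    unfolding W(9) using W(6,8) by (auto simp: prod_eq_iff image_subset_iff)
  ultimately show ?thesis unfolding graph_near_def comp_def using W(1-6) by auto
qed

lemma graph_near_local:
  fixes c :: "('e, (real^'n) \<times> (real^'m)) chart"
  assumes "graph_near c (L \<inter> V) p f" "open V"
  shows "graph_near c L p f"
  by (rule graph_near_section[OF section_near_local[OF section_near_graph[OF assms(1)] assms(2)], unfolded snd_conv])

lemma linear_chart_change:
  assumes c: "c \<in> A" and P: "linear P" "inj P"
  shows "(fst c, \<lambda>p. P (snd c p)) \<in> A"
proof -
  obtain g where g: "linear g" "g \<circ> P = id" using linear_injective_left_inverse[OF P] by blast
  have gP: "g (P z) = z" for z using g(2) by (metis comp_apply id_apply)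
  have surj: "surj P" using linear_injective_imp_surjective P by blast
  have "open (P ` (snd c ` fst c))" by (rule open_surjective_linear_image[OF open_range[OF c] P(1) surj])
  then have "(fst c \<inter> snd c -` (snd c ` fst c), \<lambda>p. P (snd c p)) \<in> A"
    by (intro chart_change_coordinates[OF c open_range[OF c] subset_refl, of P g] smooth_on_linear[OF _ P(1)]
        smooth_on_linear[OF _ g(1)] smooth_on_id open_range[OF c]) (auto simp: gP)
  moreover have "fst c \<inter> snd c -` (snd c ` fst c) = fst c" by auto
  ultimately show ?thesis by simp
qed

text \<open>A linear change of coordinates makes the tangent space of the image transversal to the dependent
  directions.\<close>

lemma graph_chart_exists:
  assumes s: "smooth_near A x s" "immersive_at A x s"
  obtains c where "c \<in> A" "s x \<in> fst c" "inj (\<lambda>h::real^'n. fst (FD (snd c \<circ> s) x h))"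
proof -
  obtain c where c: "c \<in> A" "s x \<in> fst c" by (rule chart_at)
  obtain U where U: "open U" "x \<in> U" "smooth_on U (snd c \<circ> s)" using smooth_near_chartE[OF c(1) s(1) c(2)] by metis
  have lin: "linear (FD (snd c \<circ> s) x)" by (rule smooth_on_linear_FD[OF U(3,2)])
  obtain P :: "(real^'n) \<times> (real^'m) \<Rightarrow> (real^'n) \<times> (real^'m)" where P: "linear P" "inj P" "\<And>h. fst (P (FD (snd c \<circ> s) x h)) = h"
    by (rule straighten_injective_linear[OF lin immersive_atD[OF s(2) c]]) (rule that)
  let ?d = "(fst c, \<lambda>p. P (snd c p))"
  have "FD (snd ?d \<circ> s) x h = P (FD (snd c \<circ> s) x h)" for h
    using FD_linear_compose[OF P(1) U(3,2)] by (simp add: comp_def)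
  then have "inj (\<lambda>h. fst (FD (snd ?d \<circ> s) x h))" using P(3) by (simp add: inj_def)
  then show ?thesis using that[of ?d] linear_chart_change[OF c(1) P(1,2)] c(2) by simp
qed

text \<open>The shear \<open>(y, w) \<mapsto> (y, w - f y)\<close> is a diffeomorphism that maps the graph of \<open>f\<close> to the
  coordinate plane.\<close>

lemma straighten_graph:
  assumes c: "c \<in> A" and gr: "graph_near c L p f"
  obtains e where "e \<in> A" "p \<in> fst e" "snd e ` (L \<inter> fst e) = {z \<in> snd e ` fst e. snd z = 0}"
proof -
  obtain W N where W: "open W" "p \<in> W" "W \<subseteq> fst c" and N: "open N" "(fst \<circ> snd c) ` W \<subseteq> N" "smooth_on N f"
    and LW: "L \<inter> W = {q \<in> W. snd (snd c q) = f (fst (snd c q))}"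
    using gr unfolding graph_near_def by blast
  let ?Z = "snd c ` W"
  have Z: "open ?Z" using open_chart_image[OF c W(1)] W(3) by (simp add: Int_absorb1)
  have ZN: "fst z \<in> N" if "z \<in> ?Z" for z using that N(2) by auto
  let ?\<phi> = "\<lambda>z. (fst z, snd z - f (fst z))" and ?\<psi> = "\<lambda>z. (fst z, snd z + f (fst z))"
  have NU: "open (N \<times> (UNIV :: (real^'m) set))" using N(1) by (simp add: open_Times)
  have f1: "smooth_on S (\<lambda>z. f (fst z))" if "open S" "fst ` S \<subseteq> N" for S :: "((real^'n) \<times> (real^'m)) set"
    by (rule smooth_on_compose[OF that(1) N(1) that(2) smooth_on_fst[OF that(1) smooth_on_id[OF that(1)]] N(3)])
  have \<phi>: "smooth_on ?Z ?\<phi>"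
    by (intro smooth_on_Pair[OF Z] smooth_on_diff[OF Z] smooth_on_fst smooth_on_snd smooth_on_id Z f1) (use ZN in auto)
  have \<psi>': "smooth_on S ?\<psi>" if S: "open S" "fst ` S \<subseteq> N" for S :: "((real^'n) \<times> (real^'m)) set"
    by (intro smooth_on_Pair[OF S(1)] smooth_on_add[OF S(1)] smooth_on_fst smooth_on_snd smooth_on_id S f1)
  have im: "?\<phi> ` ?Z = (N \<times> UNIV) \<inter> ?\<psi> -` ?Z"
  proof (intro equalityI subsetI)
    fix z assume "z \<in> (N \<times> UNIV) \<inter> ?\<psi> -` ?Z"
    then have "?\<psi> z \<in> ?Z" by blast
    moreover have "z = ?\<phi> (?\<psi> z)" by simp
    ultimately show "z \<in> ?\<phi> ` ?Z" by (rule rev_image_eqI)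
  qed (use ZN in auto)
  have o: "open (?\<phi> ` ?Z)"
    unfolding im by (rule continuous_open_preimage[OF smooth_on_continuous[OF \<psi>'[OF NU]] NU Z]) auto
  have "(fst c \<inter> snd c -` ?Z, \<lambda>q. ?\<phi> (snd c q)) \<in> A"
    by (rule chart_change_coordinates[OF c Z _ \<phi> o \<psi>'[OF o]]) (use W(3) N(2) in \<open>auto simp: image_subset_iff\<close>)
  moreover have "fst c \<inter> snd c -` ?Z = W" using W(3) inj_onD[OF inj_on_chart[OF c]] by blast
  ultimately have e: "(W, \<lambda>q. ?\<phi> (snd c q)) \<in> A" by simp
  have "(\<lambda>q. ?\<phi> (snd c q)) ` (L \<inter> W) = {z \<in> (\<lambda>q. ?\<phi> (snd c q)) ` W. snd z = 0}"
  proof (intro equalityI subsetI)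
    fix z assume "z \<in> (\<lambda>q. ?\<phi> (snd c q)) ` (L \<inter> W)"
    then obtain q where q: "q \<in> L \<inter> W" "z = ?\<phi> (snd c q)" by blast
    then have "q \<in> W" "snd z = 0" unfolding LW by simp_all
    then show "z \<in> {z \<in> (\<lambda>q. ?\<phi> (snd c q)) ` W. snd z = 0}" using q(2) by blast
  next
    fix z assume "z \<in> {z \<in> (\<lambda>q. ?\<phi> (snd c q)) ` W. snd z = 0}"
    then obtain q where q: "q \<in> W" "z = ?\<phi> (snd c q)" "snd z = 0" by blast
    then have "q \<in> L \<inter> W" unfolding LW by simp
    then show "z \<in> (\<lambda>q. ?\<phi> (snd c q)) ` (L \<inter> W)" using q(2) by blast
  qed
  then show ?thesis using that[OF e] W(2) by simp
qed

lemma embedded_submanifoldI: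
  "(\<And>p. p \<in> L \<Longrightarrow> \<exists>c\<in>A. \<exists>f. graph_near c L p f) \<Longrightarrow> embedded_submanifold A L"
  unfolding embedded_submanifold_def
proof
  fix p assume L: "\<And>p. p \<in> L \<Longrightarrow> \<exists>c\<in>A. \<exists>f. graph_near c L p f" and "p \<in> L"
  then obtain c f where "c \<in> A" "graph_near c L p f" by blast
  from straighten_graph[OF this] obtain e
    where "e \<in> A" "p \<in> fst e" "snd e ` (L \<inter> fst e) = {z \<in> snd e ` fst e. snd z = 0}" .
  then show "\<exists>c\<in>A. p \<in> fst c \<and> snd c ` (L \<inter> fst c) = {z \<in> snd c ` fst c. snd z = 0}" by blast
qed

lemma embedded_submanifold_graph:
  assumes L: "embedded_submanifold A L" "p \<in> L"
  obtains c f where "c \<in> A" "graph_near c L p f"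
proof -
  obtain c where c: "c \<in> A" "p \<in> fst c" and s: "snd c ` (L \<inter> fst c) = {z \<in> snd c ` fst c. snd z = 0}"
    using L unfolding embedded_submanifold_def by blast
  have "q \<in> L \<longleftrightarrow> snd (snd c q) = 0" if q: "q \<in> fst c" for q
  proof
    assume "snd (snd c q) = 0"
    then have "snd c q \<in> snd c ` (L \<inter> fst c)" using s q by blast
    then show "q \<in> L" using q inj_onD[OF inj_on_chart[OF c(1)]] by blast
  qed (use s q in blast)
  then have "graph_near c L p (\<lambda>y. 0)"
    unfolding graph_near_def using L(2) c open_domain[OF c(1)] smooth_on_const[of UNIV]
    by (intro conjI exI[of _ "fst c"] exI[of _ UNIV]) auto
  then show ?thesis using that c(1) by blast
qed

lemma graph_parametrization:
  assumes c: "c \<in> A" and gr: "graph_near c L p f"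
  defines "s \<equiv> \<lambda>y. cinv c (y, f y)" and "x \<equiv> fst (snd c p)"
  obtains U W where "x \<in> U" "embedding_on A U s" "s x = p" "open W" "p \<in> W" "s ` U = L \<inter> W" "W \<subseteq> fst c"
    "\<And>y. y \<in> U \<Longrightarrow> snd c (s y) = (y, f y)" "smooth_on U f"
proof -
  obtain W N where W: "open W" "p \<in> W" "W \<subseteq> fst c" and N: "open N" "(fst \<circ> snd c) ` W \<subseteq> N" "smooth_on N f"
    and LW: "L \<inter> W = {q \<in> W. snd (snd c q) = f (fst (snd c q))}" and p: "p \<in> L"
    using gr unfolding graph_near_def by blast
  let ?Z = "snd c ` W" let ?\<gamma> = "\<lambda>y. (y, f y)"
  have Z: "open ?Z" using open_chart_image[OF c W(1)] W(3) by (simp add: Int_absorb1)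
  have \<gamma>N: "smooth_on N ?\<gamma>" by (intro smooth_on_Pair smooth_on_id N)
  let ?U = "N \<inter> ?\<gamma> -` ?Z"
  have U: "open ?U" by (rule continuous_open_preimage[OF smooth_on_continuous[OF \<gamma>N] N(1) Z])
  have \<gamma>: "smooth_on ?U ?\<gamma>" by (rule smooth_on_subset[OF \<gamma>N]) auto
  have sW: "s y \<in> W" and cs: "snd c (s y) = (y, f y)" if "y \<in> ?U" for y
  proof -
    obtain q where q: "q \<in> W" "(y, f y) = snd c q" using \<open>y \<in> ?U\<close> by auto
    then have "s y = q" using W(3) by (auto simp: s_def cinv_chart[OF c])
    then show "s y \<in> W" "snd c (s y) = (y, f y)" using q by auto
  qed
  have ret: "fst (snd c q) \<in> ?U \<and> s (fst (snd c q)) = q" if "q \<in> L \<inter> W" for q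
  proof -
    have "snd c q = ?\<gamma> (fst (snd c q))" using that LW by (simp add: prod_eq_iff)
    moreover have "fst (snd c q) \<in> N" "snd c q \<in> ?Z" "cinv c (snd c q) = q" using that N(2) W(3) cinv_chart[OF c] by auto
    ultimately show ?thesis by (simp add: s_def)
  qed
  have im: "s ` ?U = L \<inter> W"
  proof (intro equalityI subsetI)
    fix q assume "q \<in> s ` ?U"
    then obtain y where "y \<in> ?U" "q = s y" by blast
    then show "q \<in> L \<inter> W" unfolding LW using sW[of y] cs[of y] by simp
  next
    fix q assume "q \<in> L \<inter> W"
    then have r: "fst (snd c q) \<in> ?U \<and> s (fst (snd c q)) = q" by (rule ret)
    show "q \<in> s ` ?U"
    proof (rule image_eqI)
      show "q = s (fst (snd c q))" by (rule conjunct2[OF r, symmetric])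
    qed (rule conjunct1[OF r])
  qed
  have sm: "smooth_on ?U (snd c \<circ> s)" by (rule smooth_on_cong[OF U _ \<gamma>]) (simp add: cs)
  have FD: "fst (FD (snd c \<circ> s) y h) = h" if y: "y \<in> ?U" for y h
  proof -
    have "fst (FD (snd c \<circ> s) y h) = FD (\<lambda>y. fst ((snd c \<circ> s) y)) y h"
      by (rule FD_linear_compose[OF linear_fst sm y, symmetric])
    also have "\<dots> = FD (\<lambda>y. y) y h" by (rule fun_cong[OF FD_cong[OF U y]]) (simp add: cs)
    finally show ?thesis by simp
  qed
  have sc: "s ` ?U \<subseteq> fst c" using sW W(3) by blast
  have "embedding_on A ?U s"
  proof (rule embedding_onI[OF c U sc sm])
    show "inj (FD (snd c \<circ> s) y)" if "y \<in> ?U" for y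
      by (rule inj_on_inverseI[of _ fst]) (rule FD[OF that])
    have "continuous_on (s ` ?U) (snd c)" using continuous_on_subset[OF continuous_chart[OF c] sc] .
    then show "continuous_on (s ` ?U) (\<lambda>q. fst (snd c q))" by (rule continuous_on_fst)
    show "fst (snd c (s y)) = y" if "y \<in> ?U" for y using cs[OF that] by simp
  qed
  moreover have "x \<in> ?U" "s x = p" using ret[of p] p W(2) by (auto simp: x_def)
  moreover have "smooth_on ?U f" by (rule smooth_on_subset[OF N(3)]) auto
  ultimately show ?thesis using that[of ?U W] W im cs by blast
qed

lemma
  fixes f :: "real^'n \<Rightarrow> real^'m"
  assumes U: "open U" "x \<in> U" "smooth_on U f" and cs: "\<And>y. y \<in> U \<Longrightarrow> snd c (s y) = (y, f y)"
  shows FD_graph_section: "FD (snd c \<circ> s) x k = (k, FD f x k)"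
    and deriv2_graph_section: "deriv2 (snd c \<circ> s) x k l = (0, deriv2 f x k l)"
proof -
  let ?u = "\<lambda>y. (y, f y)"
  have u: "smooth_on U ?u" by (intro smooth_on_Pair smooth_on_id U)
  have "FD ?u x k = (k, FD f x k)"
    using FD_linear_compose[OF linear_fst u U(2), of k] FD_linear_compose[OF linear_snd u U(2), of k]
    by (simp add: prod_eq_iff)
  then show "FD (snd c \<circ> s) x k = (k, FD f x k)"
    using FD_cong[OF U(1,2), of "snd c \<circ> s" ?u] cs by simp
  have "deriv2 (\<lambda>y. y) x k l = 0" by (simp add: deriv2_def)
  then have "deriv2 ?u x k l = (0, deriv2 f x k l)"
    using deriv2_linear_compose[OF linear_fst U(1) u U(2), of k l] deriv2_linear_compose[OF linear_snd U(1) u U(2), of k l]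
    by (simp add: prod_eq_iff)
  then show "deriv2 (snd c \<circ> s) x k l = (0, deriv2 f x k l)"
    using deriv2_cong[OF U(1,2), of "snd c \<circ> s" ?u] cs by simp
qed

lemma embedded_submanifold_image:
  assumes s: "embedding_on A N (s :: real^'n \<Rightarrow> 'e)"
  shows "embedded_submanifold A (s ` N)"
proof (rule embedded_submanifoldI)
  fix p assume "p \<in> s ` N"
  then obtain x where x: "x \<in> N" "p = s x" by blast
  obtain c where c: "c \<in> A" "s x \<in> fst c" "inj (\<lambda>h. fst (FD (snd c \<circ> s) x h))"
    using graph_chart_exists[OF embedding_onD(2,3)[OF s x(1)]] by metis
  obtain u where "section_near c fst (s ` N) (s x) u"
    by (rule section_near_of_embedding[OF c(1) s x(1) c(2) linear_fst c(3)])
  then show "\<exists>c\<in>A. \<exists>f. graph_near c (s ` N) p f" using graph_near_section c(1) x(2) by blast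
qed

lemma graph_of_embedding:
  assumes c: "c \<in> A" and s: "embedding_on A N (s :: real^'n \<Rightarrow> 'e)" "x \<in> N" "s x \<in> fst c" "inj (\<lambda>h. fst (FD (snd c \<circ> s) x h))"
  obtains f where "graph_near c (s ` N) (s x) f"
  using section_near_of_embedding[OF c s(1-3) linear_fst s(4)] graph_near_section by metis

lemma graph_near_smooth:
  assumes "graph_near c L p f"
  obtains N where "open N" "fst (snd c p) \<in> N" "smooth_on N f"
  using assms unfolding graph_near_def by auto

lemma graph_near_value:
  assumes "graph_near c L p f"
  shows "f (fst (snd c p)) = snd (snd c p)"
proof -
  obtain W where "p \<in> L" "p \<in> W" "L \<inter> W = {q \<in> W. snd (snd c q) = f (fst (snd c q))}"
    using assms unfolding graph_near_def by blast
  then have "p \<in> {q \<in> W. snd (snd c q) = f (fst (snd c q))}" by blast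
  then show ?thesis by simp
qed

text \<open>If \<open>v = (a, b)\<close> parametrizes a part of the graph of \<open>f\<close>, then \<open>b = f \<circ> a\<close>. Differentiating this
  twice gives the following equations, which determine \<open>Df\<close> and \<open>D\<^sup>2f\<close> once \<open>Da\<close> is invertible.\<close>

lemma graph_near_param:
  fixes s :: "real^'k \<Rightarrow> 'e"
  assumes c: "c \<in> A" and gr: "graph_near c L p f"
    and s: "smooth_near A x s" "s x = p" "open U" "x \<in> U" "s ` U \<subseteq> L"
  defines "v \<equiv> snd c \<circ> s" and "y \<equiv> fst (snd c p)"
  shows "snd (FD v x h) = FD f y (fst (FD v x h))"
    and "snd (deriv2 v x h k) = deriv2 f y (fst (FD v x h)) (fst (FD v x k)) + FD f y (fst (deriv2 v x h k))"
    and "inj (FD v x) \<Longrightarrow> inj (\<lambda>h. fst (FD v x h))"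
    and "snd (snd c p) = f y"
proof -
  obtain N where N: "open N" "y \<in> N" "smooth_on N f" unfolding y_def by (rule graph_near_smooth[OF gr])
  let ?u = "\<lambda>y. (y, f y)"
  have u: "smooth_on N ?u" by (intro smooth_on_Pair smooth_on_id N)
  have vx: "fst (v x) = y" using s(2) by (simp add: v_def y_def)
  have F: "snd (FD ?u z h) = FD f z h" if "z \<in> N" for z h
    using FD_linear_compose[OF linear_snd u that, of h] by simp
  have D: "snd (deriv2 ?u y h k) = deriv2 f y h k" for h k
    using deriv2_linear_compose[OF linear_snd N(1) u N(2), of h k] by simp
  note P = section_near_param[OF c linear_fst section_near_graph[OF gr] s, folded v_def, unfolded vx]
  show "snd (FD v x h) = FD f y (fst (FD v x h))" using arg_cong[OF P(1), of snd h] F[OF N(2)] by simp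
  show "snd (deriv2 v x h k) = deriv2 f y (fst (FD v x h)) (fst (FD v x k)) + FD f y (fst (deriv2 v x h k))"
    using arg_cong[OF P(2), of snd h k] F[OF N(2)] D by simp
  show "inj (FD v x) \<Longrightarrow> inj (\<lambda>h. fst (FD v x h))" by (rule P(3))
  show "snd (snd c p) = f y" using P(4) s(2) vx by (metis comp_apply snd_conv v_def)
qed

text \<open>Two graphs through a common point have equal values there, so only the derivatives are compared.\<close>

definition same_graph_jet :: "(real^'n \<Rightarrow> real^'m) \<Rightarrow> (real^'n \<Rightarrow> real^'m) \<Rightarrow> real^'n \<Rightarrow> bool" where
  "same_graph_jet f f' x \<longleftrightarrow> FD f x = FD f' x \<and> deriv2 f x = deriv2 f' x"

lemma contact2_iff:
  "contact2 A p L L' \<longleftrightarrow> (\<exists>c\<in>A. \<exists>f f'. graph_near c L p f \<and> graph_near c L' p f' \<and> same_graph_jet f f' (fst (snd c p)))"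
proof -
  have "(let x = fst (snd c p) in (\<forall>i. partial i f x = partial i f' x) \<and>
        (\<forall>i j. partial i (partial j f) x = partial i (partial j f') x)) \<longleftrightarrow> same_graph_jet f f' (fst (snd c p))"
    if g: "graph_near c L p f" "graph_near c L' p f'" for c f f'
  proof -
    obtain N where N: "open N" "fst (snd c p) \<in> N" "smooth_on N f" by (rule graph_near_smooth[OF g(1)])
    obtain M where M: "open M" "fst (snd c p) \<in> M" "smooth_on M f'" by (rule graph_near_smooth[OF g(2)])
    show ?thesis
      unfolding Let_def partial_partial_eq same_graph_jet_def unfolding partial_eq
      using linear_eq_on_axes[OF smooth_on_linear_FD[OF N(3,2)] smooth_on_linear_FD[OF M(3,2)]]
        bilinear_eq_on_axes[OF bilinear_deriv2[OF N(1,3,2)] bilinear_deriv2[OF M(1,3,2)]] by metis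
  qed
  then show ?thesis unfolding contact2_def by (intro bex_cong refl ex_cong1) blast
qed

text \<open>Two parametrizations with the same 2-jet parametrize submanifolds with the same graph jets: the
  equations of the second-order chain rule determine the jet of the graph from that of the
  parametrization.\<close>

lemma same_graph_jet_of_params:
  fixes s s' :: "real^'n \<Rightarrow> 'e"
  assumes c: "c \<in> A" and gr: "graph_near c L p f" "graph_near c L' p f'"
    and s: "smooth_near A x s" "s x = p" "open U" "x \<in> U" "s ` U \<subseteq> L"
    and s': "smooth_near A x s'" "s' x = p" "open U'" "x \<in> U'" "s' ` U' \<subseteq> L'"
    and jet: "FD (snd c \<circ> s) x = FD (snd c \<circ> s') x" "deriv2 (snd c \<circ> s) x = deriv2 (snd c \<circ> s') x"
    and inj: "inj (FD (snd c \<circ> s) x)"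
  shows "same_graph_jet f f' (fst (snd c p))"
proof -
  note P = graph_near_param[OF c gr(1) s] and P' = graph_near_param[OF c gr(2) s']
  let ?a = "\<lambda>h. fst (FD (snd c \<circ> s) x h)" let ?y = "fst (snd c p)"
  have "p \<in> fst c" using gr(1) by (auto simp: graph_near_def)
  then have sc: "s x \<in> fst c" using s(2) by simp
  obtain O1 where O1: "open O1" "x \<in> O1" "smooth_on O1 (snd c \<circ> s)" using smooth_near_chartE[OF c s(1) sc] by metis
  have "linear ?a" using linear_compose[OF smooth_on_linear_FD[OF O1(3,2)] linear_fst] by (simp add: comp_def)
  then have surj: "surj ?a" using P(3)[OF inj] linear_injective_imp_surjective by blast
  have F: "FD f ?y k = FD f' ?y k" for k
  proof -
    obtain h where "k = ?a h" using surjD[OF surj] by blast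
    then show ?thesis using P(1)[of h] P'(1)[of h] jet by metis
  qed
  have "deriv2 f ?y k l = deriv2 f' ?y k l" for k l
  proof -
    obtain h where h: "k = ?a h" using surjD[OF surj] by blast
    obtain h' where h': "l = ?a h'" using surjD[OF surj] by blast
    have "snd (deriv2 (snd c \<circ> s) x h h') = deriv2 f' ?y k l + FD f' ?y (fst (deriv2 (snd c \<circ> s) x h h'))"
      unfolding h h' jet by (rule P'(2))
    moreover have "snd (deriv2 (snd c \<circ> s) x h h') = deriv2 f ?y k l + FD f ?y (fst (deriv2 (snd c \<circ> s) x h h'))"
      unfolding h h' by (rule P(2))
    ultimately show ?thesis by (simp add: F)
  qed
  with F show ?thesis by (auto simp: same_graph_jet_def fun_eq_iff)
qed

text \<open>Contact in one chart gives parametrizations with the same 2-jet, and equality of 2-jets is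
  independent of the chart. So contact is visible in every chart in which one of the submanifolds is a graph.\<close>

lemma contact2_graph:
  assumes ct: "contact2 A p L L'" and d: "d \<in> A" and h: "graph_near d L p h"
  obtains h' where "graph_near d L' p h'" "\<And>h'. graph_near d L' p h' \<Longrightarrow> same_graph_jet h h' (fst (snd d p))"
proof -
  obtain c f f' where c: "c \<in> A" and f: "graph_near c L p f" and f': "graph_near c L' p f'"
    and jet: "same_graph_jet f f' (fst (snd c p))" using ct contact2_iff by blast
  let ?x = "fst (snd c p)" let ?s = "\<lambda>y. cinv c (y, f y)" and ?s' = "\<lambda>y. cinv c (y, f' y)"
  obtain U W where U: "?x \<in> U" "embedding_on A U ?s" "?s ?x = p" "open W" "p \<in> W" "?s ` U = L \<inter> W" "W \<subseteq> fst c"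
    "\<And>y. y \<in> U \<Longrightarrow> snd c (?s y) = (y, f y)" "smooth_on U f"
    by (rule graph_parametrization[OF c f]) (rule that)
  obtain U' W' where U': "?x \<in> U'" "embedding_on A U' ?s'" "?s' ?x = p" "open W'" "p \<in> W'" "?s' ` U' = L' \<inter> W'" "W' \<subseteq> fst c"
    "\<And>y. y \<in> U' \<Longrightarrow> snd c (?s' y) = (y, f' y)" "smooth_on U' f'"
    by (rule graph_parametrization[OF c f']) (rule that)
  note E = embedding_onD[OF U(2)] and E' = embedding_onD[OF U'(2)]
  have F: "FD (snd c \<circ> ?s) ?x k = (k, FD f ?x k)" "deriv2 (snd c \<circ> ?s) ?x k l = (0, deriv2 f ?x k l)" for k l
    using FD_graph_section[OF E(1) U(1,9,8)] deriv2_graph_section[OF E(1) U(1,9,8)] by simp_all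
  have F': "FD (snd c \<circ> ?s') ?x k = (k, FD f' ?x k)" "deriv2 (snd c \<circ> ?s') ?x k l = (0, deriv2 f' ?x k l)" for k l
    using FD_graph_section[OF E'(1) U'(1,9,8)] deriv2_graph_section[OF E'(1) U'(1,9,8)] by simp_all
  have pc: "p \<in> fst c" "p \<in> fst d" using U(5,7) h by (auto simp: graph_near_def)
  have eq: "FD (snd c \<circ> ?s) ?x = FD (snd c \<circ> ?s') ?x" "deriv2 (snd c \<circ> ?s) ?x = deriv2 (snd c \<circ> ?s') ?x"
    using jet by (auto simp: fun_eq_iff F F' same_graph_jet_def)
  have sx: "?s ?x \<in> fst c" "?s ?x \<in> fst d" "?s' ?x \<in> fst c" "?s' ?x \<in> fst d" using pc U(3) U'(3) by simp_all
  note T = chart_change_of_param[OF c d E(2)[OF U(1)] sx(1,2)] and T' = chart_change_of_param[OF c d E'(2)[OF U'(1)] sx(3,4)]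
  have eqd: "FD (snd d \<circ> ?s) ?x = FD (snd d \<circ> ?s') ?x" "deriv2 (snd d \<circ> ?s) ?x = deriv2 (snd d \<circ> ?s') ?x"
    using eq U(3) U'(3) by (auto simp: fun_eq_iff T T')
  have inj: "inj (FD (snd d \<circ> ?s) ?x)" by (rule immersive_atD[OF E(3)[OF U(1)] d sx(2)])
  have sL: "?s ` U \<subseteq> L" "?s' ` U' \<subseteq> L'" using U(6) U'(6) by auto
  note P = graph_near_param[OF d h E(2)[OF U(1)] U(3) E(1) U(1) sL(1)]
  have "inj (\<lambda>h. fst (FD (snd d \<circ> ?s') ?x h))" using P(3)[OF inj] eqd(1) by simp
  from graph_of_embedding[OF d U'(2,1) sx(4) this]
  obtain h' where "graph_near d (L' \<inter> W') p h'" using U'(3,6) by auto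
  then have "graph_near d L' p h'" by (rule graph_near_local[OF _ U'(4)])
  moreover have "same_graph_jet h h' (fst (snd d p))" if "graph_near d L' p h'" for h'
    by (rule same_graph_jet_of_params[OF d h that E(2)[OF U(1)] U(3) E(1) U(1) sL(1) E'(2)[OF U'(1)] U'(3) E'(1) U'(1) sL(2) eqd inj])
  ultimately show ?thesis by (rule that)
qed

lemma contact2_sym: "contact2 A p L L' \<Longrightarrow> contact2 A p L' L"
  unfolding contact2_iff same_graph_jet_def by metis

lemma contact2_refl: "embedded_submanifold A L \<Longrightarrow> p \<in> L \<Longrightarrow> contact2 A p L L"
  unfolding contact2_iff same_graph_jet_def using embedded_submanifold_graph by metis

lemma contact2_trans:
  assumes "contact2 A p L L'" "contact2 A p L' L''"
  shows "contact2 A p L L''"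
proof -
  obtain c f' f'' where c: "c \<in> A" "graph_near c L' p f'" "graph_near c L'' p f''" "same_graph_jet f' f'' (fst (snd c p))"
    using assms(2) contact2_iff by blast
  obtain f where "graph_near c L p f" "same_graph_jet f' f (fst (snd c p))"
    using contact2_graph[OF contact2_sym[OF assms(1)] c(1,2)] by metis
  then show ?thesis unfolding contact2_iff using c by (auto simp: same_graph_jet_def)
qed

lemma contact2_mem: "contact2 A p L L' \<Longrightarrow> p \<in> L" "contact2 A p L L' \<Longrightarrow> p \<in> L'"
  by (auto simp: contact2_iff graph_near_def)

lemma fst_subjet [simp]: "fst (subjet A p L) = p"
  by (simp add: subjet_def)

lemma in_subjet: "L' \<in> snd (subjet A p L) \<longleftrightarrow> embedded_submanifold A L' \<and> contact2 A p L L'"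
  by (simp add: subjet_def)

lemma subjet_eqI: "contact2 A p L L' \<Longrightarrow> subjet A p L = subjet A p L'"
  unfolding subjet_def using contact2_trans contact2_sym by blast

lemma subjet_eqD:
  assumes "subjet A p L = subjet A p' L'" "embedded_submanifold A L'" "p' \<in> L'"
  shows "p = p'" "contact2 A p L L'"
  using assms contact2_refl in_subjet fst_subjet by metis+

lemma in_subjet_chart:
  assumes L: "embedded_submanifold A L" "p \<in> L" and c: "c \<in> A"
  shows "subjet A p L \<in> fst (subjet_chart A c) \<longleftrightarrow> (\<exists>f. graph_near c L p f)"
proof
  assume "subjet A p L \<in> fst (subjet_chart A c)"
  then obtain p' L' f where *: "subjet A p L = subjet A p' L'" "embedded_submanifold A L'" "graph_near c L' p' f"
    unfolding subjet_chart_def by auto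
  then have "p' \<in> L'" by (simp add: graph_near_def)
  from subjet_eqD[OF *(1,2) this] have "p = p'" "contact2 A p L' L" using contact2_sym by blast+
  then show "\<exists>f. graph_near c L p f" using contact2_graph[OF _ c] *(3) by metis
next
  assume ex: "\<exists>f. graph_near c L p f"
  then have "p \<in> fst c" by (auto simp: graph_near_def)
  then show "subjet A p L \<in> fst (subjet_chart A c)"
    using L ex unfolding subjet_chart_def fst_conv by blast
qed

lemma subjet_coords:
  assumes L: "embedded_submanifold A L" and c: "c \<in> A" and f: "graph_near c L p f"
  shows "snd (subjet_chart A c) (subjet A p L) = coords2 (fst (snd c p)) f"
proof -
  have p: "p \<in> L" using f by (simp add: graph_near_def)
  let ?P = "\<lambda>f. \<exists>L'\<in>snd (subjet A p L). graph_near c L' p f"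
  define g where "g = (SOME f. ?P f)"
  have "\<exists>f. ?P f" using L contact2_refl[OF L p] f in_subjet by blast
  then have "?P g" unfolding g_def by (rule someI_ex)
  then obtain L' where L': "contact2 A p L L'" "graph_near c L' p g" using in_subjet by blast
  have jet: "same_graph_jet f g (fst (snd c p))" using contact2_graph[OF L'(1) c f] L'(2) by metis
  obtain N where N: "open N" "fst (snd c p) \<in> N" "smooth_on N f" by (rule graph_near_smooth[OF f])
  obtain M where M: "open M" "fst (snd c p) \<in> M" "smooth_on M g" by (rule graph_near_smooth[OF L'(2)])
  have "f (fst (snd c p)) = snd (snd c p)" "g (fst (snd c p)) = snd (snd c p)"
    using graph_near_value[OF f] graph_near_value[OF L'(2)] by simp_all
  moreover have "partial2 \<sigma> f (fst (snd c p)) = partial2 \<sigma> g (fst (snd c p))" for \<sigma>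
    using jet partial2_Upair[OF N(1,3,2), of "rep1 \<sigma>" "rep2 \<sigma>"] partial2_Upair[OF M(1,3,2), of "rep1 \<sigma>" "rep2 \<sigma>"]
    by (simp add: Upair_rep same_graph_jet_def)
  ultimately have "coords2 (fst (snd c p)) g = coords2 (fst (snd c p)) f"
    using jet by (simp add: coords2_def partial_eq same_graph_jet_def)
  then show ?thesis by (simp add: subjet_chart_def Let_def coords2_def g_def)
qed

end


section \<open>The second fundamental form\<close>

text \<open>The part of the equation \<open>geodesic_eq\<close> normal to the submanifold, which no longer involves the
  connection \<open>\<Theta>\<close>: the left-hand side of that equation is tangent.\<close>

definition normal_eq ::
  "('e, 'v::euclidean_space) christoffel \<Rightarrow> ('e, 'v) chart \<Rightarrow> real^'n \<Rightarrow> (real^'n \<Rightarrow> 'e) \<Rightarrow> bool" where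
  "normal_eq \<Gamma> c x s \<longleftrightarrow> (\<forall>h k. deriv2 (snd c \<circ> s) x h k
     + \<Gamma> c (snd c (s x)) (FD (snd c \<circ> s) x h) (FD (snd c \<circ> s) x k) \<in> range (FD (snd c \<circ> s) x))"

context atlas
begin

lemma section_nearE:
  fixes \<sigma> :: "real^'n \<Rightarrow> 'v"
  assumes c: "c \<in> A" and R: "linear R" and sec: "section_near c R L p \<sigma>"
  obtains W M where "open W" "p \<in> L \<inter> W" "W \<subseteq> fst c" "open M" "smooth_on M \<sigma>"
    "\<And>m. m \<in> M \<Longrightarrow> R (\<sigma> m) = m" "\<And>m k. m \<in> M \<Longrightarrow> R (FD \<sigma> m k) = k"
    "\<And>m. m \<in> M \<Longrightarrow> cinv c (\<sigma> m) \<in> L \<inter> W" "\<And>m. m \<in> M \<Longrightarrow> snd c (cinv c (\<sigma> m)) = \<sigma> m"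
    "\<And>q. q \<in> L \<inter> W \<Longrightarrow> R (snd c q) \<in> M" "\<And>q. q \<in> L \<inter> W \<Longrightarrow> \<sigma> (R (snd c q)) = snd c q"
proof -
  obtain W N where W: "p \<in> L" "open W" "p \<in> W" "W \<subseteq> fst c" and N': "open N" "(\<lambda>q. R (snd c q)) ` W \<subseteq> N"
    "smooth_on N \<sigma>" "\<forall>y\<in>N. R (\<sigma> y) = y" and LW: "L \<inter> W = {q \<in> W. snd c q = \<sigma> (R (snd c q))}"
    using sec unfolding section_near_def by blast
  have N: "open N" "\<And>q. q \<in> W \<Longrightarrow> R (snd c q) \<in> N" "smooth_on N \<sigma>" "\<And>y. y \<in> N \<Longrightarrow> R (\<sigma> y) = y"
    using N' by auto
  have Z: "open (snd c ` W)" using open_chart_image[OF c W(2)] W(4) by (simp add: Int_absorb1)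
  let ?M = "N \<inter> \<sigma> -` (snd c ` W)"
  have M: "open ?M" by (rule continuous_open_preimage[OF smooth_on_continuous[OF N(3)] N(1) Z])
  have sm: "smooth_on ?M \<sigma>" by (rule smooth_on_subset[OF N(3)]) auto
  have in_LW: "cinv c (\<sigma> m) \<in> L \<inter> W \<and> snd c (cinv c (\<sigma> m)) = \<sigma> m" if m: "m \<in> ?M" for m
  proof -
    obtain q where q: "q \<in> W" "\<sigma> m = snd c q" using m by auto
    then have i: "cinv c (\<sigma> m) = q" using W(4) cinv_chart[OF c] by auto
    have "R (snd c q) = m" using N(4)[of m] m unfolding q(2) by blast
    then have "q \<in> L \<inter> W" unfolding LW using q by simp
    then show ?thesis using i q(2) by simp
  qed
  have ret: "R (snd c q) \<in> ?M \<and> \<sigma> (R (snd c q)) = snd c q" if q: "q \<in> L \<inter> W" for q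
  proof -
    have "q \<in> W" "snd c q = \<sigma> (R (snd c q))" using q unfolding LW by simp_all
    then show ?thesis using N(2)[of q] by auto
  qed
  have FD: "R (FD \<sigma> m k) = k" if m: "m \<in> ?M" for m k
  proof -
    have "R (FD \<sigma> m k) = FD (\<lambda>y. R (\<sigma> y)) m k" by (rule FD_linear_compose[OF R sm m, symmetric])
    also have "\<dots> = FD (\<lambda>y. y) m k" by (rule fun_cong[OF FD_cong[OF M m]]) (use N(4) in auto)
    finally show ?thesis by simp
  qed
  show ?thesis
    by (rule that[of W ?M]) (use W M sm N(4) FD in_LW ret in \<open>simp_all\<close>)
qed

text \<open>A curve in the image of the section \<open>\<sigma>\<close> is the image under \<open>\<sigma>\<close> of its projection by \<open>R\<close>, so the
  tangent space is the range of \<open>D\<sigma>\<close>.\<close>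

lemma tangent_vectors_section:
  fixes \<sigma> :: "real^'n \<Rightarrow> 'v"
  assumes c: "c \<in> A" and R: "linear R" and W: "open W" "W \<subseteq> fst c" and M: "open M" "smooth_on M \<sigma>"
    and M_LW: "\<And>m. m \<in> M \<Longrightarrow> cinv c (\<sigma> m) \<in> L \<inter> W" "\<And>m. m \<in> M \<Longrightarrow> snd c (cinv c (\<sigma> m)) = \<sigma> m"
    and LW_M: "\<And>q. q \<in> L \<inter> W \<Longrightarrow> R (snd c q) \<in> M" "\<And>q. q \<in> L \<inter> W \<Longrightarrow> \<sigma> (R (snd c q)) = snd c q"
    and q: "q \<in> L \<inter> W"
  shows "v \<in> tangent_vectors c L q \<Longrightarrow> v = FD \<sigma> (R (snd c q)) (R v)"
    and "FD \<sigma> (R (snd c q)) k \<in> tangent_vectors c L q"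
proof -
  let ?m = "R (snd c q)"
  have m: "?m \<in> M" "\<sigma> ?m = snd c q" using LW_M q by auto
  have Z: "open (snd c ` W)" using open_chart_image[OF c W(1)] W(2) by (simp add: Int_absorb1)
  have lin: "linear (FD \<sigma> ?m)" by (rule smooth_on_linear_FD[OF M(2) m(1)])
  show "v = FD \<sigma> ?m (R v)" if v: "v \<in> tangent_vectors c L q"
  proof -
    have "snd c q \<in> snd c ` W" using q by blast
    from tangent_vectors_local[OF v Z this]
    obtain \<gamma> \<epsilon> where \<gamma>: "\<epsilon> > 0" "\<gamma> (0::real) = q"
      "\<And>t. t \<in> {-\<epsilon><..<\<epsilon>} \<Longrightarrow> \<gamma> t \<in> {b \<in> L \<inter> fst c. snd c b \<in> snd c ` W} \<inter> fst c"
      "smooth_on {-\<epsilon><..<\<epsilon>} (\<lambda>t. snd c (\<gamma> t))" "((\<lambda>t. snd c (\<gamma> t)) has_vector_derivative v) (at 0)"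
      by (rule tangent_vectorsE) (rule that)
    have eq: "snd c (\<gamma> t) = \<sigma> (R (snd c (\<gamma> t)))" if t: "t \<in> {-\<epsilon><..<\<epsilon>}" for t
    proof -
      obtain b where "b \<in> W" "snd c (\<gamma> t) = snd c b" and L: "\<gamma> t \<in> L" "\<gamma> t \<in> fst c" using \<gamma>(3)[OF t] by blast
      then have "\<gamma> t \<in> W" using inj_onD[OF inj_on_chart[OF c], of "\<gamma> t" b] W(2) by auto
      then show ?thesis using LW_M(2) L(1) by simp
    qed
    have R0: "(\<sigma> has_derivative FD \<sigma> ?m) (at (R (snd c (\<gamma> 0))))"
      unfolding \<gamma>(2) by (rule smooth_on_has_derivative[OF M(2) m(1)])
    have R': "bounded_linear R" using R linear_conv_bounded_linear by blast
    from has_derivative_compose[OF bounded_linear.has_derivative[OF R' \<gamma>(5)[unfolded has_vector_derivative_def]] R0]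
    have "((\<lambda>t. \<sigma> (R (snd c (\<gamma> t)))) has_vector_derivative FD \<sigma> ?m (R v)) (at 0)"
      unfolding has_vector_derivative_def by (simp add: linear_cmul[OF R] linear_cmul[OF lin])
    then have "((\<lambda>t. snd c (\<gamma> t)) has_vector_derivative FD \<sigma> ?m (R v)) (at 0)"
      by (rule has_vector_derivative_transform_within_open[of _ _ _ "{-\<epsilon><..<\<epsilon>}"]) (use \<gamma>(1) eq in auto)
    then show ?thesis by (rule vector_derivative_unique_at[OF \<gamma>(5)])
  qed
  have line: "smooth_on UNIV (\<lambda>t::real. ?m + t *\<^sub>R k)"
    by (intro smooth_on_add[OF open_UNIV] smooth_on_scaleR[OF open_UNIV] smooth_on_const smooth_on_id open_UNIV)
  obtain \<delta> where \<delta>: "\<delta> > 0" "\<And>t::real. t \<in> {-\<delta><..<\<delta>} \<Longrightarrow> ?m + t *\<^sub>R k \<in> M"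
    by (rule real_interval_in_open[OF zero_less_one _ M(1), of "\<lambda>t. ?m + t *\<^sub>R k"])
      (use m(1) in \<open>auto intro!: continuous_intros\<close>)
  show "FD \<sigma> ?m k \<in> tangent_vectors c L q"
  proof (rule tangent_vectorsI[OF \<delta>(1), where \<gamma> = "\<lambda>t. cinv c (\<sigma> (?m + t *\<^sub>R k))"])
    show "cinv c (\<sigma> (?m + 0 *\<^sub>R k)) = q" using m(2) q W(2) cinv_chart[OF c] by auto
    show "cinv c (\<sigma> (?m + t *\<^sub>R k)) \<in> L \<inter> fst c" if "t \<in> {-\<delta><..<\<delta>}" for t
      using M_LW(1)[OF \<delta>(2)[OF that]] W(2) by blast
    have eq: "\<sigma> (?m + t *\<^sub>R k) = snd c (cinv c (\<sigma> (?m + t *\<^sub>R k)))" if "t \<in> {-\<delta><..<\<delta>}" for t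
      using M_LW(2)[OF \<delta>(2)[OF that]] by simp
    have "smooth_on {-\<delta><..<\<delta>} (\<lambda>t. \<sigma> (?m + t *\<^sub>R k))"
      by (rule smooth_on_compose[OF _ M(1) _ smooth_on_subset[OF line subset_UNIV] M(2)]) (use \<delta>(2) in auto)
    then show "smooth_on {-\<delta><..<\<delta>} (\<lambda>t. snd c (cinv c (\<sigma> (?m + t *\<^sub>R k))))"
      by (rule smooth_on_cong[OF _ eq, rotated 2]) auto
    have d0: "((\<lambda>t::real. ?m + t *\<^sub>R k) has_derivative (\<lambda>t. t *\<^sub>R k)) (at 0)"
      by (auto intro!: derivative_eq_intros)
    have s0: "(\<sigma> has_derivative FD \<sigma> ?m) (at (?m + 0 *\<^sub>R k))"
      using smooth_on_has_derivative[OF M(2) m(1)] by simp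
    from has_derivative_compose[OF d0 s0]
    have "((\<lambda>t. \<sigma> (?m + t *\<^sub>R k)) has_vector_derivative FD \<sigma> ?m k) (at 0)"
      unfolding has_vector_derivative_def by (simp add: linear_cmul[OF lin])
    then show "((\<lambda>t. snd c (cinv c (\<sigma> (?m + t *\<^sub>R k)))) has_vector_derivative FD \<sigma> ?m k) (at 0)"
      by (rule has_vector_derivative_transform_within_open[of _ _ _ "{-\<delta><..<\<delta>}"]) (use \<delta>(1) eq in auto)
  qed
qed

end

text \<open>The product rule, for the tangent field \<open>D\<sigma> \<eta>\<close> along the image of \<open>\<sigma>\<close> that corresponds to the field
  \<open>\<eta>\<close> on the parameters.\<close>

lemma FD_derivative_apply:
  fixes \<sigma> :: "'a::euclidean_space \<Rightarrow> 'b::real_normed_vector"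
  assumes S: "open S" "smooth_on S \<sigma>" "x \<in> S" and \<eta>: "smooth_on S \<eta>"
  shows "FD (\<lambda>y. FD \<sigma> y (\<eta> y)) x h = deriv2 \<sigma> x h (\<eta> x) + FD \<sigma> x (FD \<eta> x h)"
proof -
  have lin: "linear (FD \<sigma> y)" if "y \<in> S" for y by (rule smooth_on_linear_FD[OF S(2) that])
  have eq: "FD \<sigma> y (\<eta> y) = (\<Sum>b\<in>Basis. (\<eta> y \<bullet> b) *\<^sub>R FD \<sigma> y b)" if "y \<in> S" for y
    by (rule linear_on_Basis[OF lin[OF that]])
  have d: "((\<lambda>y. \<Sum>b\<in>Basis. (\<eta> y \<bullet> b) *\<^sub>R FD \<sigma> y b) has_derivative
     (\<lambda>h. \<Sum>b\<in>Basis. (\<eta> x \<bullet> b) *\<^sub>R FD (\<lambda>y. FD \<sigma> y b) x h + (FD \<eta> x h \<bullet> b) *\<^sub>R FD \<sigma> x b)) (at x)"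
    by (intro has_derivative_sum has_derivative_scaleR has_derivative_inner_left
        smooth_on_has_derivative[OF \<eta> S(3)] smooth_on_has_derivative[OF smooth_on_FD[OF S(2)] S(3)])
  have "FD (\<lambda>y. FD \<sigma> y (\<eta> y)) x h = FD (\<lambda>y. \<Sum>b\<in>Basis. (\<eta> y \<bullet> b) *\<^sub>R FD \<sigma> y b) x h"
    by (rule fun_cong[OF FD_cong[OF S(1,3) eq]])
  also have "\<dots> = (\<Sum>b\<in>Basis. (\<eta> x \<bullet> b) *\<^sub>R deriv2 \<sigma> x h b) + (\<Sum>b\<in>Basis. (FD \<eta> x h \<bullet> b) *\<^sub>R FD \<sigma> x b)"
    unfolding FD_eq[OF d] by (simp add: deriv2_def sum.distrib)
  also have "(\<Sum>b\<in>Basis. (\<eta> x \<bullet> b) *\<^sub>R deriv2 \<sigma> x h b) = deriv2 \<sigma> x h (\<eta> x)"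
    using bilinear_deriv2[OF S] by (intro linear_on_Basis[symmetric]) (simp add: bilinear_def)
  also have "(\<Sum>b\<in>Basis. (FD \<eta> x h \<bullet> b) *\<^sub>R FD \<sigma> x b) = FD \<sigma> x (FD \<eta> x h)"
    by (rule linear_on_Basis[OF lin[OF S(3)], symmetric])
  finally show ?thesis .
qed

lemma subspace_add_right_cancel:
  assumes "subspace S" "b \<in> S"
  shows "a + b \<in> S \<longleftrightarrow> a \<in> S"
  using subspace_add[OF assms(1) _ assms(2), of a] subspace_diff[OF assms(1) _ assms(2), of "a + b"] by auto

context connections
begin

text \<open>Tangent fields \<open>X\<close> and \<open>Y\<close> have the form \<open>D\<sigma> \<xi>\<close> and \<open>D\<sigma> \<eta>\<close> along \<open>L\<close>, where \<open>\<sigma>\<close> is a section of \<open>R\<close>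
  with image \<open>L\<close>; then \<open>D Y X\<close> is \<open>D\<^sup>2\<sigma> (\<xi>, \<eta>)\<close> up to a tangent vector.\<close>

lemma sff_section_iff:
  fixes \<sigma> :: "real^'k \<Rightarrow> 'v"
  assumes c: "c \<in> A" and R: "linear R" and sec: "section_near c R L p \<sigma>"
  defines "z \<equiv> snd c p" and "m \<equiv> R (snd c p)"
  shows "(\<forall>W X Y. open W \<and> z \<in> W \<and> W \<subseteq> snd c ` fst c \<and> smooth_on W X \<and> smooth_on W Y \<and>
        (\<forall>q\<in>L \<inter> fst c. snd c q \<in> W \<longrightarrow>
           X (snd c q) \<in> tangent_vectors c L q \<and> Y (snd c q) \<in> tangent_vectors c L q) \<longrightarrow>
         FD Y z (X z) + \<Gamma> c z (X z) (Y z) \<in> tangent_vectors c L p)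
    \<longleftrightarrow> (\<forall>h k. deriv2 \<sigma> m h k + \<Gamma> c z (FD \<sigma> m h) (FD \<sigma> m k) \<in> range (FD \<sigma> m))" (is "?sff \<longleftrightarrow> ?normal")
proof -
  obtain W M where W: "open W" "p \<in> L \<inter> W" "W \<subseteq> fst c" and M: "open M" "smooth_on M \<sigma>"
    and RM: "\<And>m. m \<in> M \<Longrightarrow> R (\<sigma> m) = m" "\<And>m k. m \<in> M \<Longrightarrow> R (FD \<sigma> m k) = k"
    and M_LW: "\<And>m. m \<in> M \<Longrightarrow> cinv c (\<sigma> m) \<in> L \<inter> W" "\<And>m. m \<in> M \<Longrightarrow> snd c (cinv c (\<sigma> m)) = \<sigma> m"
    and LW_M: "\<And>q. q \<in> L \<inter> W \<Longrightarrow> R (snd c q) \<in> M" "\<And>q. q \<in> L \<inter> W \<Longrightarrow> \<sigma> (R (snd c q)) = snd c q"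
    by (rule section_nearE[OF c R sec]) (rule that)
  have T1: "v = FD \<sigma> (R (snd c q)) (R v)" if "q \<in> L \<inter> W" "v \<in> tangent_vectors c L q" for q v
    by (rule tangent_vectors_section(1)[OF c R W(1,3) M M_LW LW_M that])
  have T2: "FD \<sigma> (R (snd c q)) k \<in> tangent_vectors c L q" if "q \<in> L \<inter> W" for q k
    by (rule tangent_vectors_section(2)[OF c R W(1,3) M M_LW LW_M that])
  have m: "m \<in> M" "\<sigma> m = z" using LW_M[OF W(2)] by (auto simp: m_def z_def)
  have Tp: "v = FD \<sigma> m (R v)" if "v \<in> tangent_vectors c L p" for v using T1[OF W(2) that] by (simp add: m_def)
  have Tp': "FD \<sigma> m k \<in> tangent_vectors c L p" for k using T2[OF W(2)] by (simp add: m_def)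
  have lin: "linear (FD \<sigma> m)" by (rule smooth_on_linear_FD[OF M(2) m(1)])
  have Z: "open (snd c ` W)" using open_chart_image[OF c W(1)] W(3) by (simp add: Int_absorb1)
  have in_W: "q \<in> L \<inter> W" if "q \<in> L \<inter> fst c" "snd c q \<in> snd c ` W" for q
    using that W(3) inj_onD[OF inj_on_chart[OF c], of q] by blast
  show ?thesis
  proof
    assume sff: ?sff
    show ?normal
    proof (intro allI)
      fix h k
      have R': "continuous_on UNIV R" using R by (simp add: linear_continuous_on linear_conv_bounded_linear)
      let ?V = "snd c ` W \<inter> R -` M"
      let ?F = "\<lambda>k z. FD \<sigma> (R z) k"
      have V: "open ?V" using open_Int[OF Z continuous_open_preimage[OF R' open_UNIV M(1)]] by simp
      have RV: "smooth_on ?V R" by (rule smooth_on_linear[OF V R smooth_on_id[OF V]])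
      have F: "smooth_on ?V (?F k)" for k
        by (rule smooth_on_compose[OF V M(1) _ RV smooth_on_FD[OF M(2)]]) auto
      have zV: "z \<in> ?V" using W(2) m(1) by (auto simp: z_def m_def)
      have Ft: "?F k (snd c q) \<in> tangent_vectors c L q" if "q \<in> L \<inter> fst c" "snd c q \<in> ?V" for q k
        using T2[OF in_W] that by blast
      have "FD (?F k) z (?F h z) + \<Gamma> c z (?F h z) (?F k z) \<in> tangent_vectors c L p"
        using sff[rule_format, of ?V "?F h" "?F k"] V zV F Ft W(3) by blast
      moreover have "FD (?F k) z (?F h z) = deriv2 \<sigma> m h k"
      proof -
        have Rz: "R z \<in> M" using zV by blast
        have "FD (?F k) z (?F h z) = FD (\<lambda>y. FD \<sigma> y k) (R z) (FD R z (?F h z))"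
          by (rule FD_compose[OF RV zV smooth_on_FD[OF M(2)] Rz])
        also have "FD R z (?F h z) = h" using linear_imp_FD[OF R] RM(2)[OF Rz] by simp
        finally show ?thesis by (simp add: deriv2_def m_def z_def)
      qed
      moreover have "R z = m" by (simp add: m_def z_def)
      ultimately have "deriv2 \<sigma> m h k + \<Gamma> c z (FD \<sigma> m h) (FD \<sigma> m k) \<in> tangent_vectors c L p" by simp
      from Tp[OF this] show "deriv2 \<sigma> m h k + \<Gamma> c z (FD \<sigma> m h) (FD \<sigma> m k) \<in> range (FD \<sigma> m)" by blast
    qed
  next
    assume normal: ?normal
    show ?sff
    proof (intro allI impI, elim conjE)
      fix V X Y
      assume V: "open V" "z \<in> V" and X: "smooth_on V X" and Y: "smooth_on V Y"
        and XY: "\<forall>q\<in>L \<inter> fst c. snd c q \<in> V \<longrightarrow> X (snd c q) \<in> tangent_vectors c L q \<and> Y (snd c q) \<in> tangent_vectors c L q"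
      have XYp: "X z \<in> tangent_vectors c L p" "Y z \<in> tangent_vectors c L p"
        using XY V(2) W(2,3) unfolding z_def by blast+
      let ?O = "M \<inter> \<sigma> -` V"
      have O1: "open ?O" by (rule continuous_open_preimage[OF smooth_on_continuous[OF M(2)] M(1) V(1)])
      have mO: "m \<in> ?O" using m V(2) by simp
      have \<sigma>O: "smooth_on ?O \<sigma>" by (rule smooth_on_subset[OF M(2)]) auto
      let ?\<eta> = "\<lambda>y. R (Y (\<sigma> y))"
      have Y\<sigma>: "smooth_on ?O (\<lambda>y. Y (\<sigma> y))" by (rule smooth_on_compose[OF O1 V(1) _ \<sigma>O Y]) auto
      have \<eta>: "smooth_on ?O ?\<eta>" by (rule smooth_on_linear[OF O1 R Y\<sigma>])
      have eq: "Y (\<sigma> y) = FD \<sigma> y (?\<eta> y)" if y: "y \<in> ?O" for y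
      proof -
        let ?q = "cinv c (\<sigma> y)"
        have q: "?q \<in> L \<inter> W" "snd c ?q = \<sigma> y" using M_LW y by auto
        then have "Y (\<sigma> y) \<in> tangent_vectors c L ?q" using XY y W(3) by force
        from T1[OF q(1) this] show ?thesis using q(2) RM(1) y by simp
      qed
      let ?h = "R (X z)" and ?k = "R (Y z)"
      have Xz: "X z = FD \<sigma> m ?h" and Yz: "Y z = FD \<sigma> m ?k" using Tp XYp by auto
      have "FD Y z (X z) = FD (\<lambda>y. Y (\<sigma> y)) m ?h"
        using FD_compose[OF \<sigma>O mO Y, of ?h] V(2) m(2) Xz by simp
      also have "\<dots> = FD (\<lambda>y. FD \<sigma> y (?\<eta> y)) m ?h" by (rule fun_cong[OF FD_cong[OF O1 mO eq]])
      also have "\<dots> = deriv2 \<sigma> m ?h ?k + FD \<sigma> m (FD ?\<eta> m ?h)"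
        using FD_derivative_apply[OF O1 \<sigma>O mO \<eta>] m(2) by simp
      finally have "FD Y z (X z) + \<Gamma> c z (X z) (Y z)
          = (deriv2 \<sigma> m ?h ?k + \<Gamma> c z (FD \<sigma> m ?h) (FD \<sigma> m ?k)) + FD \<sigma> m (FD ?\<eta> m ?h)"
        using Xz Yz by simp
      moreover obtain w where "deriv2 \<sigma> m ?h ?k + \<Gamma> c z (FD \<sigma> m ?h) (FD \<sigma> m ?k) = FD \<sigma> m w" using normal by blast
      ultimately have "FD Y z (X z) + \<Gamma> c z (X z) (Y z) = FD \<sigma> m (w + FD ?\<eta> m ?h)"
        by (simp add: linear_add[OF lin])
      then show "FD Y z (X z) + \<Gamma> c z (X z) (Y z) \<in> tangent_vectors c L p" using Tp' by metis
    qed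
  qed
qed

text \<open>The transformation law of the Christoffel symbols makes \<open>D\<^sup>2u (h, k) + \<Gamma> (Du h, Du k)\<close> a vector,
  so its being tangent does not depend on the chart.\<close>

lemma normal_eq_transition:
  fixes s :: "real^'k \<Rightarrow> 'e"
  assumes c: "c \<in> A" and d: "d \<in> A" and s: "smooth_near A x s" "s x \<in> fst c" "s x \<in> fst d"
    and eq: "normal_eq \<Gamma> c x s"
  shows "normal_eq \<Gamma> d x s"
  unfolding normal_eq_def
proof (intro allI)
  fix h k
  let ?u = "snd c \<circ> s" let ?\<tau> = "transition c d" let ?z = "snd c (s x)"
  have z: "?z \<in> snd c ` (fst c \<inter> fst d)" using s by blast
  have lin: "linear (FD ?\<tau> ?z)" by (rule smooth_on_linear_FD[OF smooth_transition[OF c d] z])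
  obtain w where w: "deriv2 ?u x h k + \<Gamma> c ?z (FD ?u x h) (FD ?u x k) = FD ?u x w"
    using eq unfolding normal_eq_def by blast
  have "deriv2 (snd d \<circ> s) x h k + \<Gamma> d (snd d (s x)) (FD (snd d \<circ> s) x h) (FD (snd d \<circ> s) x k)
     = FD ?\<tau> ?z (deriv2 ?u x h k) + FD ?\<tau> ?z (\<Gamma> c ?z (FD ?u x h) (FD ?u x k))"
    unfolding chart_change_of_param[OF c d s] christoffel_transition[OF c d z] transition_chart[OF c s(2)]
    by simp
  also have "\<dots> = FD (snd d \<circ> s) x w"
    unfolding chart_change_of_param(1)[OF c d s] w[symmetric] linear_add[OF lin] ..
  finally show "deriv2 (snd d \<circ> s) x h k + \<Gamma> d (snd d (s x)) (FD (snd d \<circ> s) x h) (FD (snd d \<circ> s) x k)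
     \<in> range (FD (snd d \<circ> s) x)" by simp
qed

text \<open>By the second-order chain rule, a change of parametrization adds to the second derivatives only
  vectors tangent to the submanifold, so the normal component can be computed from any section.\<close>

lemma normal_eq_section:
  fixes s :: "real^'k \<Rightarrow> 'e" and \<sigma> :: "real^'k \<Rightarrow> 'v"
  assumes c: "c \<in> A" and R: "linear R" and sec: "section_near c R L p \<sigma>"
    and s: "smooth_near A x s" "s x = p" "open U" "x \<in> U" "s ` U \<subseteq> L" "inj (FD (snd c \<circ> s) x)"
  defines "z \<equiv> snd c p" and "m \<equiv> R (snd c p)"
  shows "normal_eq \<Gamma> c x s \<longleftrightarrow> (\<forall>h k. deriv2 \<sigma> m h k + \<Gamma> c z (FD \<sigma> m h) (FD \<sigma> m k) \<in> range (FD \<sigma> m))"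
proof -
  let ?v = "snd c \<circ> s"
  have vx: "R (?v x) = m" "?v x = z" using s(2) by (auto simp: m_def z_def)
  note P = section_near_param[OF c R sec s(1-5), unfolded vx(1)]
  let ?a = "\<lambda>h. R (FD ?v x h)"
  have "s x \<in> fst c" using sec s(2) by (auto simp: section_near_def)
  then obtain O1 where O1: "open O1" "x \<in> O1" "smooth_on O1 ?v" using smooth_near_chartE[OF c s(1)] by metis
  have "linear ?a" using linear_compose[OF smooth_on_linear_FD[OF O1(3,2)] R] by (simp add: comp_def)
  then have surj: "surj ?a" using P(3)[OF s(6)] linear_injective_imp_surjective by blast
  obtain W M where "p \<in> L \<inter> W" "smooth_on M \<sigma>" "\<And>q. q \<in> L \<inter> W \<Longrightarrow> R (snd c q) \<in> M"
    using section_nearE[OF c R sec] by metis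
  then have lin: "linear (FD \<sigma> m)" using smooth_on_linear_FD unfolding m_def by blast
  have rng: "range (FD ?v x) = range (FD \<sigma> m)"
  proof
    show "range (FD ?v x) \<subseteq> range (FD \<sigma> m)" using P(1) by blast
    show "range (FD \<sigma> m) \<subseteq> range (FD ?v x)"
    proof (rule image_subsetI)
      fix k
      obtain h where "k = ?a h" using surjD[OF surj] by blast
      then have "FD \<sigma> m k = FD ?v x h" by (simp only: P(1)[of h, symmetric])
      then show "FD \<sigma> m k \<in> range (FD ?v x)" by (rule range_eqI)
    qed
  qed
  have sub: "subspace (range (FD \<sigma> m))" by (rule linear_subspace_image[OF lin subspace_UNIV])
  have key: "deriv2 ?v x h k + \<Gamma> c z (FD ?v x h) (FD ?v x k) \<in> range (FD \<sigma> m) \<longleftrightarrow>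
    deriv2 \<sigma> m (?a h) (?a k) + \<Gamma> c z (FD \<sigma> m (?a h)) (FD \<sigma> m (?a k)) \<in> range (FD \<sigma> m)" for h k
  proof -
    let ?G = "\<Gamma> c z (FD ?v x h) (FD ?v x k)" and ?D = "deriv2 \<sigma> m (?a h) (?a k)" and ?F = "FD \<sigma> m (R (deriv2 ?v x h k))"
    have G: "\<Gamma> c z (FD \<sigma> m (?a h)) (FD \<sigma> m (?a k)) = ?G" by (simp only: P(1)[symmetric])
    have "deriv2 ?v x h k + ?G = (?D + ?F) + ?G" by (rule arg_cong[OF P(2), of "\<lambda>w. w + ?G"])
    also have "\<dots> = (?D + ?G) + ?F" by simp
    finally have eq: "deriv2 ?v x h k + ?G = (?D + ?G) + ?F" .
    show ?thesis unfolding G eq by (rule subspace_add_right_cancel[OF sub rangeI])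
  qed
  have sx: "snd c (s x) = z" using vx(2) by simp
  have "normal_eq \<Gamma> c x s \<longleftrightarrow> (\<forall>h k. deriv2 \<sigma> m (?a h) (?a k) + \<Gamma> c z (FD \<sigma> m (?a h)) (FD \<sigma> m (?a k)) \<in> range (FD \<sigma> m))"
    unfolding normal_eq_def rng sx key ..
  also have "\<dots> \<longleftrightarrow> (\<forall>h k. deriv2 \<sigma> m h k + \<Gamma> c z (FD \<sigma> m h) (FD \<sigma> m k) \<in> range (FD \<sigma> m))" (is "?l \<longleftrightarrow> ?r")
  proof
    assume l: ?l
    show ?r
    proof (intro allI)
      fix h k
      obtain h' where h': "h = ?a h'" using surjD[OF surj] by blast
      obtain k' where k': "k = ?a k'" using surjD[OF surj] by blast
      show "deriv2 \<sigma> m h k + \<Gamma> c z (FD \<sigma> m h) (FD \<sigma> m k) \<in> range (FD \<sigma> m)"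
        unfolding h' k' using l by blast
    qed
  qed blast
  finally show ?thesis .
qed

end


section \<open>Forgetting the parametrization\<close>

lemma linear_inverse_of_bij:
  fixes f :: "'a::euclidean_space \<Rightarrow> 'a"
  assumes "linear f" "inj f"
  shows "linear (inv_into UNIV f)"
proof -
  obtain g where g: "linear g" "g \<circ> f = id" using linear_injective_left_inverse[OF assms] by blast
  have "surj f" using linear_injective_imp_surjective assms by blast
  have "inv_into UNIV f y = g y" for y
  proof -
    obtain x where "y = f x" using surjD[OF \<open>surj f\<close>] by blast
    then show ?thesis using fun_cong[OF g(2), of x] assms(2) by simp
  qed
  then have "inv_into UNIV f = g" by (rule ext)
  then show ?thesis using g(1) by simp
qed

context split_atlas
begin

text \<open>Any two embeddings with the same 2-jet have images in second-order contact, so the image of the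
  jet under \<open>forget_param\<close> does not depend on the choices made in its definition.\<close>

lemma contact2_of_same_2jet:
  fixes s t :: "real^'n \<Rightarrow> 'e"
  assumes s: "embedding_on A N s" "x \<in> N" and t: "embedding_on A M t" "x \<in> M" and st: "same_2jet A x s t"
  shows "contact2 A (s x) (s ` N) (t ` M)"
proof -
  note E = embedding_onD[OF s(1)] and E' = embedding_onD[OF t(1)]
  obtain c where c: "c \<in> A" "s x \<in> fst c" "inj (\<lambda>h::real^'n. fst (FD (snd c \<circ> s) x h))"
    by (rule graph_chart_exists[OF E(2,3)[OF s(2)]]) (rule that)
  have eq: "s x = t x" "FD (snd c \<circ> s) x = FD (snd c \<circ> t) x" "deriv2 (snd c \<circ> s) x = deriv2 (snd c \<circ> t) x"
    using same_2jet_iff[OF c(1) E(2)[OF s(2)] c(2) E'(2)[OF t(2)]] st by blast+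
  have tc: "t x \<in> fst c" "inj (\<lambda>h. fst (FD (snd c \<circ> t) x h))" using c(2,3) eq by simp_all
  obtain f where f: "graph_near c (s ` N) (s x) f" by (rule graph_of_embedding[OF c(1) s c(2,3)]) (rule that)
  obtain f' where "graph_near c (t ` M) (t x) f'" by (rule graph_of_embedding[OF c(1) t tc]) (rule that)
  then have f': "graph_near c (t ` M) (s x) f'" by (simp only: eq(1))
  have "same_graph_jet f f' (fst (snd c (s x)))"
    by (rule same_graph_jet_of_params[OF c(1) f f' E(2)[OF s(2)] refl E(1) s(2) subset_refl
          E'(2)[OF t(2)] eq(1)[symmetric] E'(1) t(2) subset_refl eq(2,3) immersive_atD[OF E(3)[OF s(2)] c(1,2)]])
  then show ?thesis unfolding contact2_iff using c(1) f f' by blast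
qed

lemma forget_param_jet:
  fixes s :: "real^'n \<Rightarrow> 'e"
  assumes s: "embedding_on A N s" "x \<in> N"
  shows "forget_param A (jet A x s) = subjet A (s x) (s ` N)"
proof -
  let ?P = "\<lambda>tM. fst tM \<in> snd (jet A x s) \<and> fst (jet A x s) \<in> snd tM \<and> embedding_on A (snd tM) (fst tM)"
  have "s \<in> snd (jet A x s)" by (rule in_jet_self[OF embedding_onD(2)[OF s]])
  then have "?P (s, N)" using s by simp
  then have P: "?P (SOME tM. ?P tM)" by (rule someI)
  define t where "t = fst (SOME tM. ?P tM)"
  define M where "M = snd (SOME tM. ?P tM)"
  have t: "t \<in> snd (jet A x s)" "x \<in> M" "embedding_on A M t" using P by (simp_all add: t_def M_def)
  have "subjet A (s x) (s ` N) = subjet A (s x) (t ` M)"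
    by (rule subjet_eqI[OF contact2_of_same_2jet[OF s t(3,2) in_jetD(2)[OF t(1)]]])
  then show ?thesis
    using in_jetD(3)[OF t(1)] by (simp add: forget_param_def Let_def t_def M_def)
qed

lemma ImmJ2prE:
  assumes "\<theta> \<in> ImmJ2pr A"
  obtains s N where "embedding_on A N (s :: real^'n \<Rightarrow> 'e)" "fst \<theta> \<in> N" "\<theta> = jet A (fst \<theta>) s"
    "forget_param A \<theta> = subjet A (s (fst \<theta>)) (s ` N)"
proof -
  obtain s where s: "smooth_near A (fst \<theta>) s" "immersive_at A (fst \<theta>) s" "\<theta> = jet A (fst \<theta>) s"
    using assms unfolding ImmJ2pr_def by auto
  obtain N where N: "fst \<theta> \<in> N" "embedding_on A N s" by (rule embedding_exists[OF s(1,2)]) (rule that)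
  have "forget_param A (jet A (fst \<theta>) s) = subjet A (s (fst \<theta>)) (s ` N)" by (rule forget_param_jet[OF N(2,1)])
  then show ?thesis using that[OF N(2,1) s(3)] s(3) by simp
qed

lemma ImmJ2pr_subset: "ImmJ2pr A \<subseteq> J2pr A"
  unfolding ImmJ2pr_def J2pr_def by blast

lemma in_ImmJ2pr_chart:
  assumes c: "c \<in> A" and s: "smooth_near A x (s :: real^'n \<Rightarrow> 'e)" "s x \<in> fst c"
  shows "jet A x s \<in> ImmJ2pr A \<longleftrightarrow> inj (FD (snd c \<circ> s) x)"
proof
  assume "jet A x s \<in> ImmJ2pr A"
  then obtain y t where t: "jet A x s = jet A y t" "smooth_near A y t" "immersive_at A y t" unfolding ImmJ2pr_def by blast
  have y: "y = x" using t(1) fst_jet by metis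
  note t = t[unfolded y]
  have "same_2jet A x s t" using t(1) jet_eq_iff[OF s(1) t(2)] by blast
  then have "s x = t x" "FD (snd c \<circ> s) x = FD (snd c \<circ> t) x" using same_2jet_iff[OF c s t(2)] by blast+
  then show "inj (FD (snd c \<circ> s) x)" using immersive_atD[OF t(3) c] s(2) by simp
next
  assume "inj (FD (snd c \<circ> s) x)"
  then show "jet A x s \<in> ImmJ2pr A" using immersive_atI[OF c s] s(1) unfolding ImmJ2pr_def by blast
qed

lemma inj_on_subjet_chart: "c \<in> A \<Longrightarrow> inj_on (snd (subjet_chart A c)) (fst (subjet_chart A c))"
proof (rule inj_onI)
  fix \<theta> \<theta>' assume c: "c \<in> A" and \<theta>: "\<theta> \<in> fst (subjet_chart A c)" and \<theta>': "\<theta>' \<in> fst (subjet_chart A c)"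
    and eq: "snd (subjet_chart A c) \<theta> = snd (subjet_chart A c) \<theta>'"
  obtain p L f where L: "\<theta> = subjet A p L" "embedded_submanifold A L" "p \<in> fst c" "graph_near c L p f"
    using \<theta> unfolding subjet_chart_def by auto
  obtain p' L' f' where L': "\<theta>' = subjet A p' L'" "embedded_submanifold A L'" "p' \<in> fst c" "graph_near c L' p' f'"
    using \<theta>' unfolding subjet_chart_def by auto
  have co: "coords2 (fst (snd c p)) f = coords2 (fst (snd c p')) f'"
    using eq subjet_coords[OF L(2) c L(4)] subjet_coords[OF L'(2) c L'(4)] L(1) L'(1) by simp
  then have "fst (snd c p) = fst (snd c p')" "f (fst (snd c p)) = f' (fst (snd c p'))"
    using arg_cong[OF co, of fst] arg_cong[OF co, of "\<lambda>w. fst (snd w)"] unfolding coords2_def by simp_all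
  then have "snd c p = snd c p'" using graph_near_value[OF L(4)] graph_near_value[OF L'(4)] by (simp add: prod_eq_iff)
  then have pp: "p = p'" using inj_onD[OF inj_on_chart[OF c]] L(3) L'(3) by blast
  note L' = L'[folded pp] and co = co[folded pp]
  obtain N where N: "open N" "fst (snd c p) \<in> N" "smooth_on N f" by (rule graph_near_smooth[OF L(4)])
  obtain M where M: "open M" "fst (snd c p) \<in> M" "smooth_on M f'" by (rule graph_near_smooth[OF L'(4)])
  obtain y z P Q where e: "coords2 (fst (snd c p)) f = (y, z, P, Q)" by (metis prod_cases4)
  have "lin_of P = FD f (fst (snd c p))" "bil_of Q = deriv2 f (fst (snd c p))"
    using e unfolding coords2_eq_iff[OF N(1,3,2)] by auto
  moreover have "lin_of P = FD f' (fst (snd c p))" "bil_of Q = deriv2 f' (fst (snd c p))"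
    using e unfolding co coords2_eq_iff[OF M(1,3,2)] by auto
  ultimately have "same_graph_jet f f' (fst (snd c p))" by (simp add: same_graph_jet_def)
  then have "contact2 A p L L'" unfolding contact2_iff using c L(4) L'(4) by blast
  then show "\<theta> = \<theta>'" unfolding L(1) L'(1) pp[symmetric] by (rule subjet_eqI)
qed

text \<open>The relation between the coordinates of a jet and those of its image: if \<open>v = (a, b)\<close> parametrizes
  the graph of \<open>f\<close>, these are the equations obtained from \<open>b = f \<circ> a\<close> by differentiating twice.\<close>

definition graph_rel where
  "graph_rel P Q p q \<longleftrightarrow> (\<forall>h. lin_of p (fst (lin_of P h)) = snd (lin_of P h)) \<and>
     (\<forall>h k. bil_of q (fst (lin_of P h)) (fst (lin_of P k)) + lin_of p (fst (bil_of Q h k)) = snd (bil_of Q h k))"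

text \<open>Every vector is of the form \<open>fst (lin_of P h)\<close>, so the relation prescribes all values of \<open>lin_of p\<close>
  and then those of \<open>bil_of q\<close>.\<close>

lemma graph_rel_unique:
  fixes P :: "((real^'n) \<times> (real^'m))^'n"
  assumes "graph_rel P Q p q" "graph_rel P Q p' q'" and inj: "inj (\<lambda>h. fst (lin_of P h))"
  shows "p = p'" "q = q'"
proof -
  let ?a = "\<lambda>h. fst (lin_of P h)"
  have "linear ?a" using linear_compose[OF linear_lin_of linear_fst] by (simp add: comp_def)
  then have surj: "surj ?a" using inj linear_injective_imp_surjective by blast
  have F: "lin_of p k = lin_of p' k" for k
  proof -
    obtain h where "k = ?a h" using surjD[OF surj] by blast
    then show ?thesis using assms(1,2) by (simp add: graph_rel_def)
  qed
  then show "p = p'" by (simp add: vec_eq_iff flip: lin_of_axis)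
  have B: "bil_of q k l = bil_of q' k l" for k l
  proof -
    obtain h where h: "k = ?a h" using surjD[OF surj] by blast
    obtain h' where h': "l = ?a h'" using surjD[OF surj] by blast
    have "bil_of q k l + lin_of p (fst (bil_of Q h h')) = bil_of q' k l + lin_of p' (fst (bil_of Q h h'))"
      using assms(1,2) by (simp add: graph_rel_def h h')
    then show ?thesis by (simp add: F)
  qed
  have "q $ \<sigma> = q' $ \<sigma>" for \<sigma>
    using B[of "axis (rep1 \<sigma>) 1" "axis (rep2 \<sigma>) 1"] by (simp add: bil_of_axis Upair_rep)
  then show "q = q'" by (simp add: vec_eq_iff)
qed

lemma forget_param_in_chart:
  assumes c: "c \<in> A" and \<theta>: "\<theta> \<in> fst (jet_chart A c)" "\<theta> \<in> ImmJ2pr A" and w: "snd (jet_chart A c) \<theta> = (x, z, P, Q)"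
  shows "forget_param A \<theta> \<in> fst (subjet_chart A c) \<longleftrightarrow> inj (\<lambda>h::real^'n. fst (lin_of P h))"
    and "inj (\<lambda>h::real^'n. fst (lin_of P h)) \<Longrightarrow>
      snd (subjet_chart A c) (forget_param A \<theta>) = (y, \<phi>, p, q) \<longleftrightarrow> y = fst z \<and> \<phi> = snd z \<and> graph_rel P Q p q"
proof -
  obtain s N where s: "embedding_on A N s" "fst \<theta> \<in> N" "\<theta> = jet A (fst \<theta>) s"
    and fp: "forget_param A \<theta> = subjet A (s (fst \<theta>)) (s ` N)" by (rule ImmJ2prE[OF \<theta>(2)]) (rule that)
  note E = embedding_onD[OF s(1)]
  let ?x = "fst \<theta>" let ?v = "snd c \<circ> s"
  have sx: "smooth_near A ?x s" by (rule E(2)[OF s(2)])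
  have sc: "s ?x \<in> fst c" using in_jet_chart[OF sx, of c] \<theta>(1) s(3) by simp
  have L: "embedded_submanifold A (s ` N)" by (rule embedded_submanifold_image[OF s(1)])
  have wc: "z = snd c (s ?x)" "lin_of P = FD ?v ?x" "bil_of Q = deriv2 ?v ?x"
    using jet_coords_iff[OF c sx sc, of x z P Q] w s(3) by simp_all
  have pL: "s ?x \<in> s ` N" using s(2) by blast
  have iff: "(\<exists>f. graph_near c (s ` N) (s ?x) f) \<longleftrightarrow> inj (\<lambda>h. fst (lin_of P h))"
  proof
    assume "\<exists>f. graph_near c (s ` N) (s ?x) f"
    then obtain f where f: "graph_near c (s ` N) (s ?x) f" by blast
    from graph_near_param(3)[OF c f sx refl E(1) s(2) subset_refl immersive_atD[OF E(3)[OF s(2)] c sc]]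
    show "inj (\<lambda>h. fst (lin_of P h))" unfolding wc(2) .
  next
    assume "inj (\<lambda>h. fst (lin_of P h))"
    from graph_of_embedding[OF c s(1,2) sc this[unfolded wc(2)]]
    show "\<exists>f. graph_near c (s ` N) (s ?x) f" by blast
  qed
  then show "forget_param A \<theta> \<in> fst (subjet_chart A c) \<longleftrightarrow> inj (\<lambda>h. fst (lin_of P h))"
    unfolding fp in_subjet_chart[OF L pL c] .
  assume inj: "inj (\<lambda>h. fst (lin_of P h))"
  then obtain f where f: "graph_near c (s ` N) (s ?x) f" using iff by blast
  note G = graph_near_param[OF c f sx refl E(1) s(2) subset_refl, folded wc(1,2,3)]
  obtain M where M: "open M" "fst z \<in> M" "smooth_on M f" using graph_near_smooth[OF f] unfolding wc(1) by blast
  have co: "snd (subjet_chart A c) (forget_param A \<theta>) = coords2 (fst z) f"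
    unfolding fp subjet_coords[OF L c f] wc(1) ..
  have rel: "graph_rel P Q p' q'" if "lin_of p' = FD f (fst z)" "bil_of q' = deriv2 f (fst z)" for p' q'
    using G(1,2) by (simp add: graph_rel_def that)
  obtain y' \<phi>' p' q' where e: "coords2 (fst z) f = (y', \<phi>', p', q')" by (metis prod_cases4)
  then have e': "y' = fst z" "\<phi>' = f (fst z)" "lin_of p' = FD f (fst z)" "bil_of q' = deriv2 f (fst z)"
    unfolding coords2_eq_iff[OF M(1,3,2)] by auto
  have "snd z = f (fst z)" using G(4) unfolding wc(1) .
  show "snd (subjet_chart A c) (forget_param A \<theta>) = (y, \<phi>, p, q) \<longleftrightarrow> y = fst z \<and> \<phi> = snd z \<and> graph_rel P Q p q"
    unfolding co e
  proof
    assume "(y', \<phi>', p', q') = (y, \<phi>, p, q)"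
    then show "y = fst z \<and> \<phi> = snd z \<and> graph_rel P Q p q"
      using e'(1,2) \<open>snd z = f (fst z)\<close> rel[OF e'(3,4)] by auto
  next
    assume r: "y = fst z \<and> \<phi> = snd z \<and> graph_rel P Q p q"
    then have "p' = p" "q' = q" using graph_rel_unique[OF rel[OF e'(3,4)] _ inj] by blast+
    then show "(y', \<phi>', p', q') = (y, \<phi>, p, q)" using r e'(1,2) \<open>snd z = f (fst z)\<close> by simp
  qed
qed

lemma inj_fst_lin_of_iff:
  fixes P :: "((real^'n) \<times> (real^'m))^'n"
  shows "inj (\<lambda>h. fst (lin_of P h)) \<longleftrightarrow> det (\<chi> i j. fst (P $ j) $ i) \<noteq> 0"
proof -
  have "(*v) (\<chi> i j. fst (P $ j) $ i) = (\<lambda>h. fst (lin_of P h))"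
    by (rule ext) (simp add: lin_of_def matrix_vector_mult_def vec_eq_iff fst_sum mult.commute)
  then have "inj (\<lambda>h. fst (lin_of P h)) \<longleftrightarrow> inj ((*v) (\<chi> i j. fst (P $ j) $ i))" by simp
  also have "\<dots> \<longleftrightarrow> invertible (\<chi> i j. fst (P $ j) $ i)"
    unfolding invertible_left_inverse matrix_left_invertible_injective by simp
  finally show ?thesis by (simp add: invertible_det_nz)
qed

text \<open>Solving \<open>graph_rel\<close> for \<open>p\<close> and \<open>q\<close> requires only the inverse of \<open>h \<mapsto> fst (lin_of P h)\<close>, which by
  Cramer's rule depends smoothly on \<open>P\<close>. The set where it exists is open, as a determinant does not vanish there.\<close>

lemma smooth_map_forget_param:
  "smooth_map (J2pr_space A) (J2sub_space A) (ImmJ2pr A) (forget_param A)"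
proof -
  interpret J: jet_manifold "J2pr_space A :: (('n, 'e) jet, _) jet_space" by (rule jet_manifold_J2pr)
  let ?\<pi> = "forget_param A"
  have "\<exists>c\<in>jet_charts (J2pr_space A). {\<theta> \<in> ImmJ2pr A. ?\<pi> \<theta> \<in> fst d} \<subseteq> fst c \<and>
      open (coord_domain c d (ImmJ2pr A) ?\<pi>) \<and> smooth_on (coord_domain c d (ImmJ2pr A) ?\<pi>) (in_charts c d ?\<pi>)"
    if d': "d \<in> jet_charts (J2sub_space A)" for d
  proof -
    obtain c where c: "c \<in> A" "d = subjet_chart A c" using d' by (auto simp: J2sub_space_def)
    let ?c = "jet_chart A c" let ?V = "coord_domain ?c d (ImmJ2pr A) ?\<pi>"
    have sub: "{\<theta> \<in> ImmJ2pr A. ?\<pi> \<theta> \<in> fst d} \<subseteq> fst ?c"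
    proof
      fix \<theta> assume \<theta>: "\<theta> \<in> {\<theta> \<in> ImmJ2pr A. ?\<pi> \<theta> \<in> fst d}"
      then have im: "\<theta> \<in> ImmJ2pr A" by blast
      obtain s N where s: "embedding_on A N s" "fst \<theta> \<in> N" "\<theta> = jet A (fst \<theta>) s"
        and fp: "?\<pi> \<theta> = subjet A (s (fst \<theta>)) (s ` N)" by (rule ImmJ2prE[OF im]) (rule that)
      have "s (fst \<theta>) \<in> s ` N" using s(2) by blast
      then have "\<exists>f. graph_near c (s ` N) (s (fst \<theta>)) f"
        using \<theta> in_subjet_chart[OF embedded_submanifold_image[OF s(1)] _ c(1)] fp c(2) by auto
      then have "s (fst \<theta>) \<in> fst c" by (auto simp: graph_near_def)
      then show "\<theta> \<in> fst ?c" using in_jet_chart[OF embedding_onD(2)[OF s(1,2)]] s(3) by metis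
    qed
    let ?P = "\<lambda>w::(real^'n) \<times> ((real^'n) \<times> (real^'m)) \<times> (((real^'n) \<times> (real^'m))^'n) \<times> (((real^'n) \<times> (real^'m))^('n uprod)). fst (snd (snd w))"
    have V: "?V = {w. fst (snd w) \<in> snd c ` fst c} \<inter> {w. inj (\<lambda>h. fst (lin_of (?P w) h))}"
    proof (intro equalityI subsetI)
      fix w assume "w \<in> ?V"
      then obtain \<theta> where \<theta>: "\<theta> \<in> fst ?c" "\<theta> \<in> ImmJ2pr A" "?\<pi> \<theta> \<in> fst d" "w = snd ?c \<theta>" by auto
      obtain x z P Q where w: "snd ?c \<theta> = (x, z, P, Q)" by (metis prod_cases4)
      show "w \<in> {w. fst (snd w) \<in> snd c ` fst c} \<inter> {w. inj (\<lambda>h. fst (lin_of (?P w) h))}"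
        using base_point_coords(2)[OF c(1) \<theta>(1)] forget_param_in_chart(1)[OF c(1) \<theta>(1,2) w] \<theta>(3,4) c(2) w by simp
    next
      fix w assume w: "w \<in> {w. fst (snd w) \<in> snd c ` fst c} \<inter> {w. inj (\<lambda>h. fst (lin_of (?P w) h))}"
      then have z: "fst (snd w) \<in> snd c ` fst c" and inj: "inj (\<lambda>h. fst (lin_of (?P w) h))" by auto
      note q = quad_section[OF c(1) z]
      let ?\<theta> = "jet A (fst w) (quad_section c w)"
      obtain x z P Q where w4: "w = (x, z, P, Q)" by (metis prod_cases4)
      have "inj (lin_of P)"
      proof (rule injI)
        fix h k assume "lin_of P h = lin_of P k"
        then show "h = k" using injD[OF inj, of h k] by (simp add: w4)
      qed
      moreover have "lin_of P = FD (snd c \<circ> quad_section c w) (fst w)"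
        using jet_coords_iff[OF c(1) q(1,2), of x z P Q] q(3) w4 by simp
      ultimately have im: "?\<theta> \<in> ImmJ2pr A" using in_ImmJ2pr_chart[OF c(1) q(1,2)] by simp
      have "?\<pi> ?\<theta> \<in> fst d"
        using forget_param_in_chart(1)[OF c(1) q(4) im, of x z P Q] q(3) inj w4 c(2) by simp
      then show "w \<in> ?V" using q(3,4) im by (intro image_eqI[of _ _ ?\<theta>]) auto
    qed
    have o1: "open {w :: (real^'n) \<times> ((real^'n) \<times> (real^'m)) \<times> (((real^'n) \<times> (real^'m))^'n) \<times> (((real^'n) \<times> (real^'m))^('n uprod)). fst (snd w) \<in> snd c ` fst c}"
      using continuous_open_preimage[OF _ open_UNIV open_range[OF c(1)], of "\<lambda>w. fst (snd w)"]
      by (simp add: vimage_def continuous_on_fst continuous_on_snd continuous_on_id)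
    have "Ck_on 0 UNIV (\<lambda>w. det (\<chi> i j. fst (?P w $ j) $ i))"
    proof (rule Ck_on_det[OF open_UNIV])
      fix i j :: 'n
      have "smooth_on UNIV (\<lambda>w. fst (?P w $ j) $ i)"
        by (intro smooth_on_vec_nth smooth_on_fst smooth_on_snd smooth_on_id open_UNIV)
      then show "Ck_on 0 UNIV (\<lambda>w. (\<chi> i j. fst (?P w $ j) $ i) $ i $ j)" unfolding smooth_on_def by simp
    qed
    then have "continuous_on UNIV (\<lambda>w. det (\<chi> i j. fst (?P w $ j) $ i))" by simp
    then have "open ((\<lambda>w. det (\<chi> i j. fst (?P w $ j) $ i)) -` (- {0}))"
      by (intro open_vimage open_Compl closed_singleton)
    then have o2: "open {w. inj (\<lambda>h. fst (lin_of (?P w) h))}"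
      unfolding inj_fst_lin_of_iff vimage_def by simp
    have o: "open ?V" unfolding V by (rule open_Int[OF o1 o2])
    define a where "a w h = fst (lin_of (?P w) h)" for w h
    define \<alpha> where "\<alpha> w i = inv_into UNIV (a w) (axis i 1)" for w i
    have lin_a: "linear (a w)" for w
      unfolding a_def using linear_compose[OF linear_lin_of linear_fst] by (simp add: comp_def)
    have inj_a: "inj (a w)" if "w \<in> ?V" for w using that V unfolding a_def by blast
    have sP: "smooth_on ?V (\<lambda>w. lin_of (?P w) h)" and sQ: "smooth_on ?V (\<lambda>w. bil_of (snd (snd (snd w))) h k)" for h k
      by (intro smooth_on_lin_of smooth_on_bil_of smooth_on_fst smooth_on_snd smooth_on_id o)+
    have sinv: "smooth_on ?V (\<lambda>w. inv_into UNIV (a w) b)" for b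
    proof (rule smooth_on_inv_linear[OF o lin_a inj_a])
      show "smooth_on ?V (\<lambda>w. a w v)" for v unfolding a_def by (rule smooth_on_fst[OF o sP])
    qed
    then have s\<alpha>: "smooth_on ?V (\<lambda>w. \<alpha> w i)" for i unfolding \<alpha>_def .
    have surj_a: "a w (inv_into UNIV (a w) b) = b" if "w \<in> ?V" for w b
      using linear_injective_imp_surjective[OF lin_a inj_a[OF that]] by (simp add: surj_f_inv_f)
    have lin_inv: "linear (inv_into UNIV (a w))" if "w \<in> ?V" for w
      by (rule linear_inverse_of_bij[OF lin_a inj_a[OF that]])
    let ?Q = "\<lambda>w i j. bil_of (snd (snd (snd w))) (\<alpha> w i) (\<alpha> w j)"
    have sQ': "smooth_on ?V (\<lambda>w. ?Q w i j)" for i j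
      by (rule smooth_on_bilinear_apply[OF o bilinear_bil_of sQ s\<alpha> s\<alpha>])
    define G where "G w = (fst (fst (snd w)), snd (fst (snd w)), (\<chi> i. snd (lin_of (?P w) (\<alpha> w i))),
       (\<chi> \<sigma>. snd (?Q w (rep1 \<sigma>) (rep2 \<sigma>)) - snd (lin_of (?P w) (inv_into UNIV (a w) (fst (?Q w (rep1 \<sigma>) (rep2 \<sigma>)))))))" for w
    have "smooth_on ?V G"
      unfolding G_def
    proof (intro smooth_on_Pair[OF o] smooth_on_vec[OF o] smooth_on_diff[OF o])
      show "smooth_on ?V (\<lambda>w. snd (lin_of (?P w) (\<alpha> w i)))" for i
        by (rule smooth_on_snd[OF o smooth_on_linear_apply[OF o linear_lin_of sP s\<alpha>]])
      show "smooth_on ?V (\<lambda>w. snd (?Q w (rep1 \<sigma>) (rep2 \<sigma>)))" for \<sigma> by (rule smooth_on_snd[OF o sQ'])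
      show "smooth_on ?V (\<lambda>w. snd (lin_of (?P w) (inv_into UNIV (a w) (fst (?Q w (rep1 \<sigma>) (rep2 \<sigma>))))))" for \<sigma>
        by (rule smooth_on_snd[OF o smooth_on_linear_apply[OF o linear_lin_of sP
              smooth_on_linear_apply[OF o lin_inv sinv smooth_on_fst[OF o sQ']]]])
    qed (intro smooth_on_fst smooth_on_snd smooth_on_id o)+
    then have "smooth_on ?V (in_charts ?c d ?\<pi>)"
    proof (rule smooth_on_cong[OF o, rotated])
      fix w assume wV: "w \<in> ?V"
      then obtain \<theta> where \<theta>: "\<theta> \<in> fst ?c" "\<theta> \<in> ImmJ2pr A" "?\<pi> \<theta> \<in> fst d" "w = snd ?c \<theta>" by auto
      obtain x z P Q where w4: "w = (x, z, P, Q)" by (metis prod_cases4)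
      have w: "snd ?c \<theta> = (x, z, P, Q)" using \<theta>(4) w4 by simp
      have inj: "inj (\<lambda>h. fst (lin_of P h))" 
      proof -
        have "a w = (\<lambda>h. fst (lin_of P h))" by (rule ext) (simp add: a_def w4)
        then show ?thesis using inj_a[OF wV] by simp
      qed
      let ?i = "inv_into UNIV (a w)"
      have ia: "?i (fst (lin_of P h)) = h" for h
        using inv_into_f_f[OF inj_a[OF wV], of h] by (simp add: a_def w4)
      let ?p = "\<lambda>b. snd (lin_of P (?i b))"
      let ?q = "\<lambda>b b'. snd (bil_of Q (?i b) (?i b')) - ?p (fst (bil_of Q (?i b) (?i b')))"
      have lp: "linear ?p"
        using linear_compose[OF linear_compose[OF lin_inv[OF wV] linear_lin_of] linear_snd] by (simp add: comp_def)
      have bQ: "bilinear (\<lambda>b b'. bil_of Q (?i b) (?i b'))"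
        by (rule bilinear_compose_linear[OF bilinear_bil_of lin_inv[OF wV]])
      have bq: "bilinear ?q"
        using linear_compose_bilinear[OF bQ linear_snd] linear_compose_bilinear[OF linear_compose_bilinear[OF bQ linear_fst] lp]
        unfolding bilinear_def by (auto intro!: linear_compose_sub)
      have sym: "?q b b' = ?q b' b" for b b' by (simp only: bil_of_commute[of Q "?i b"])
      have p: "lin_of (\<chi> i. ?p (axis i 1)) = ?p" by (rule lin_of_linear[OF lp])
      have q: "bil_of (\<chi> \<sigma>. ?q (axis (rep1 \<sigma>) 1) (axis (rep2 \<sigma>) 1)) = ?q" by (rule bil_of_bilinear[OF bq sym])
      have "graph_rel P Q (\<chi> i. ?p (axis i 1)) (\<chi> \<sigma>. ?q (axis (rep1 \<sigma>) 1) (axis (rep2 \<sigma>) 1))"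
        unfolding graph_rel_def p q ia by simp
      then have "snd d (?\<pi> \<theta>) = (fst z, snd z, (\<chi> i. ?p (axis i 1)), (\<chi> \<sigma>. ?q (axis (rep1 \<sigma>) 1) (axis (rep2 \<sigma>) 1)))"
        unfolding c(2) forget_param_in_chart(2)[OF c(1) \<theta>(1,2) w inj] by simp
      also have "\<dots> = G w" unfolding G_def \<alpha>_def by (simp add: w4)
      finally show "G w = in_charts ?c d ?\<pi> w"
        unfolding \<theta>(4) in_charts_apply[OF inj_on_jet_chart[OF c(1)] \<theta>(1)] by simp
    qed
    then show ?thesis using o sub c(1) by (intro bexI[of _ ?c]) (auto simp: J2pr_space_def)
  qed
  moreover have "?\<pi> \<theta> \<in> J2sub A" if \<theta>: "\<theta> \<in> ImmJ2pr A" for \<theta>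
  proof -
    obtain s N where s: "embedding_on A N s" "fst \<theta> \<in> N"
      and fp: "?\<pi> \<theta> = subjet A (s (fst \<theta>)) (s ` N)" by (rule ImmJ2prE[OF \<theta>]) (rule that)
    then show ?thesis unfolding J2sub_def using embedded_submanifold_image[OF s(1)] by blast
  qed
  ultimately show ?thesis
    using ImmJ2pr_subset by (intro J.smooth_map_from_adapted_charts) (auto simp: J2pr_space_def J2sub_space_def)
qed

end


section \<open>The two equations in coordinates\<close>

locale geodesic_setting = split_atlas A + connections A \<Gamma> \<Theta>
  for A :: "('e::{t2_space, second_countable_topology}, (real^'n) \<times> (real^'m)) chart set"
    and \<Gamma> :: "('e, (real^'n) \<times> (real^'m)) christoffel"
    and \<Theta> :: "(real^'n, real^'n) christoffel"
begin

text \<open>Near \<open>s x\<close>, the submanifold is the image of a section of a linear projection. For it, the second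
  fundamental form and the normal part of the equation of \<open>s\<close> are given by the same expression.\<close>

lemma sff_iff_normal_eq:
  assumes s: "embedding_on A N (s :: real^'n \<Rightarrow> 'e)" "x \<in> N" and W: "open W" "s x \<in> W" "s ` N = L \<inter> W"
    and d: "d \<in> A" "s x \<in> fst d"
  shows "second_fundamental_form_vanishes A \<Gamma> L (s x) \<longleftrightarrow> normal_eq \<Gamma> d x s"
proof -
  note E = embedding_onD[OF s(1)]
  have loc: "(\<forall>V X Y. open V \<and> snd c (s x) \<in> V \<and> V \<subseteq> snd c ` fst c \<and> smooth_on V X \<and> smooth_on V Y \<and>
        (\<forall>q\<in>L \<inter> fst c. snd c q \<in> V \<longrightarrow>
           X (snd c q) \<in> tangent_vectors c L q \<and> Y (snd c q) \<in> tangent_vectors c L q) \<longrightarrow>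
         FD Y (snd c (s x)) (X (snd c (s x))) + \<Gamma> c (snd c (s x)) (X (snd c (s x))) (Y (snd c (s x))) \<in> tangent_vectors c L (s x))
      \<longleftrightarrow> normal_eq \<Gamma> c x s" if c: "c \<in> A" "s x \<in> fst c" for c
  proof -
    obtain U where U: "open U" "x \<in> U" "smooth_on U (snd c \<circ> s)" using smooth_near_chartE[OF c(1) E(2)[OF s(2)] c(2)] by metis
    have inj: "inj (FD (snd c \<circ> s) x)" by (rule immersive_atD[OF E(3)[OF s(2)] c])
    obtain R where R: "linear R" "R \<circ> FD (snd c \<circ> s) x = id"
      using linear_injective_left_inverse[OF smooth_on_linear_FD[OF U(3,2)] inj] by blast
    have "inj (\<lambda>h. R (FD (snd c \<circ> s) x h))"
    proof (rule inj_on_inverseI)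
      show "id (R (FD (snd c \<circ> s) x h)) = h" for h using fun_cong[OF R(2), of h] by simp
    qed
    then obtain \<sigma> where "section_near c R (s ` N) (s x) \<sigma>"
      by (rule section_near_of_embedding[OF c(1) s c(2) R(1)]) (rule that)
    then have sec: "section_near c R L (s x) \<sigma>" unfolding W(3) by (rule section_near_local[OF _ W(1)])
    have sL: "s ` N \<subseteq> L" using W(3) by blast
    show ?thesis
      unfolding normal_eq_section[OF c(1) R(1) sec E(2)[OF s(2)] refl E(1) s(2) sL inj]
      by (rule sff_section_iff[OF c(1) R(1) sec])
  qed
  have "second_fundamental_form_vanishes A \<Gamma> L (s x) \<longleftrightarrow> (\<forall>c\<in>A. s x \<in> fst c \<longrightarrow> normal_eq \<Gamma> c x s)"
    unfolding second_fundamental_form_vanishes_def Let_def using loc by (intro ball_cong refl imp_cong) blast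
  also have "\<dots> \<longleftrightarrow> normal_eq \<Gamma> d x s"
    using d normal_eq_transition[OF d(1) _ E(2)[OF s(2)] d(2)] by blast
  finally show ?thesis .
qed

text \<open>The vanishing of the second fundamental form is a condition on the 2-jet of a parametrization.\<close>

lemma sff_contact:
  assumes ct: "contact2 A p L L'" and sff: "second_fundamental_form_vanishes A \<Gamma> L p"
  shows "second_fundamental_form_vanishes A \<Gamma> L' p"
proof -
  obtain c f f' where c: "c \<in> A" and f: "graph_near c L p f" and f': "graph_near c L' p f'"
    and jet: "same_graph_jet f f' (fst (snd c p))" using ct contact2_iff by blast
  let ?x = "fst (snd c p)" let ?s = "\<lambda>y. cinv c (y, f y)" and ?s' = "\<lambda>y. cinv c (y, f' y)"
  obtain U W where U: "?x \<in> U" "embedding_on A U ?s" "?s ?x = p" "open W" "p \<in> W" "?s ` U = L \<inter> W" "W \<subseteq> fst c"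
    "\<And>y. y \<in> U \<Longrightarrow> snd c (?s y) = (y, f y)" "smooth_on U f"
    by (rule graph_parametrization[OF c f]) (rule that)
  obtain U' W' where U': "?x \<in> U'" "embedding_on A U' ?s'" "?s' ?x = p" "open W'" "p \<in> W'" "?s' ` U' = L' \<inter> W'" "W' \<subseteq> fst c"
    "\<And>y. y \<in> U' \<Longrightarrow> snd c (?s' y) = (y, f' y)" "smooth_on U' f'"
    by (rule graph_parametrization[OF c f']) (rule that)
  note F = FD_graph_section[OF embedding_onD(1)[OF U(2)] U(1,9,8)] deriv2_graph_section[OF embedding_onD(1)[OF U(2)] U(1,9,8)]
  note F' = FD_graph_section[OF embedding_onD(1)[OF U'(2)] U'(1,9,8)] deriv2_graph_section[OF embedding_onD(1)[OF U'(2)] U'(1,9,8)]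
  have eq: "FD (snd c \<circ> ?s) ?x = FD (snd c \<circ> ?s') ?x" "deriv2 (snd c \<circ> ?s) ?x = deriv2 (snd c \<circ> ?s') ?x"
    using jet by (auto simp: fun_eq_iff F F' same_graph_jet_def)
  have pc: "?s ?x \<in> fst c" "?s' ?x \<in> fst c" "?s ?x \<in> W" "?s' ?x \<in> W'" using U(3,5,7) U'(3,5) f by (auto simp: graph_near_def)
  have "normal_eq \<Gamma> c ?x ?s"
    using sff_iff_normal_eq[OF U(2,1,4) pc(3) U(6) c pc(1)] sff unfolding U(3) by blast
  then have "normal_eq \<Gamma> c ?x ?s'"
    unfolding normal_eq_def eq U(3) U'(3) .
  then show ?thesis
    using sff_iff_normal_eq[OF U'(2,1,4) pc(4) U'(6) c pc(2)] unfolding U'(3) by blast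
qed

lemma S_unparam_iff:
  assumes L: "embedded_submanifold A L" "p \<in> L"
  shows "subjet A p L \<in> S_unparam A \<Gamma> \<longleftrightarrow> second_fundamental_form_vanishes A \<Gamma> L p"
proof
  assume "subjet A p L \<in> S_unparam A \<Gamma>"
  then obtain p' L' where *: "subjet A p L = subjet A p' L'" "embedded_submanifold A L'" "p' \<in> L'"
    "second_fundamental_form_vanishes A \<Gamma> L' p'" unfolding S_unparam_def by blast
  from subjet_eqD[OF *(1-3)] have "p = p'" "contact2 A p L' L" using contact2_sym by blast+
  then show "second_fundamental_form_vanishes A \<Gamma> L p" using sff_contact *(4) by blast
qed (use L in \<open>auto simp: S_unparam_def\<close>)

text \<open>For the parametrization \<open>y \<mapsto> (y, f y)\<close>, the vector \<open>(0, D\<^sup>2f (h, k)) + \<Gamma> (v h, v k)\<close> with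
  \<open>v h = (h, Df h)\<close> is tangent to the graph if its second component is the image under \<open>Df\<close> of its first.\<close>

definition unparam_eq where
  "unparam_eq d z p q \<longleftrightarrow> (\<forall>h k. bil_of q h k + snd (\<Gamma> d z (h, lin_of p h) (k, lin_of p k))
     = lin_of p (fst (\<Gamma> d z (h, lin_of p h) (k, lin_of p k))))"

lemma S_unparam_coords:
  assumes d: "d \<in> A" and \<theta>: "\<theta> \<in> fst (subjet_chart A d)" and w: "snd (subjet_chart A d) \<theta> = (y, \<phi>, p, q)"
  shows "\<theta> \<in> S_unparam A \<Gamma> \<longleftrightarrow> unparam_eq d (y, \<phi>) p q" "(y, \<phi>) \<in> snd d ` fst d"
proof -
  obtain a L f where L: "\<theta> = subjet A a L" "embedded_submanifold A L" "a \<in> fst d" "graph_near d L a f"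
    using \<theta> unfolding subjet_chart_def by auto
  let ?x = "fst (snd d a)" let ?s = "\<lambda>y. cinv d (y, f y)"
  obtain U W where U: "?x \<in> U" "embedding_on A U ?s" "?s ?x = a" "open W" "a \<in> W" "?s ` U = L \<inter> W" "W \<subseteq> fst d"
    "\<And>y. y \<in> U \<Longrightarrow> snd d (?s y) = (y, f y)" "smooth_on U f"
    by (rule graph_parametrization[OF d L(4)]) (rule that)
  note o = embedding_onD(1)[OF U(2)]
  have aL: "a \<in> L" using L(4) by (simp add: graph_near_def)
  have e: "y = ?x" "\<phi> = f ?x" "lin_of p = FD f ?x" "bil_of q = deriv2 f ?x"
    using w subjet_coords[OF L(2) d L(4)] L(1) coords2_eq_iff[OF o U(9,1)] by auto
  have z: "(y, \<phi>) = snd d a" using e graph_near_value[OF L(4)] by (simp add: prod_eq_iff)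
  then show "(y, \<phi>) \<in> snd d ` fst d" using L(3) by blast
  have sx: "?s ?x \<in> fst d" "?s ?x \<in> W" using U(3,5) L(3) by auto
  have FDg: "FD (snd d \<circ> ?s) ?x = (\<lambda>h. (h, lin_of p h))"
    by (rule ext) (simp add: FD_graph_section[OF o U(1,9,8)] e(3))
  have D2g: "deriv2 (snd d \<circ> ?s) ?x h k = (0, bil_of q h k)" for h k
    by (simp add: deriv2_graph_section[OF o U(1,9,8)] e(4))
  have "\<theta> \<in> S_unparam A \<Gamma> \<longleftrightarrow> normal_eq \<Gamma> d ?x ?s"
    unfolding L(1) S_unparam_iff[OF L(2) aL]
    using sff_iff_normal_eq[OF U(2,1,4) sx(2) U(6) d sx(1)] unfolding U(3) .
  also have "\<dots> \<longleftrightarrow> (\<forall>h k. (0, bil_of q h k) + \<Gamma> d (y, \<phi>) (h, lin_of p h) (k, lin_of p k) \<in> range (\<lambda>h. (h, lin_of p h)))"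
    unfolding normal_eq_def FDg D2g unfolding U(3) unfolding z[symmetric] ..
  also have "\<dots> \<longleftrightarrow> unparam_eq d (y, \<phi>) p q"
    unfolding unparam_eq_def
  proof (intro iff_allI)
    fix h k
    let ?G = "\<Gamma> d (y, \<phi>) (h, lin_of p h) (k, lin_of p k)"
    have "(0, bil_of q h k) + ?G \<in> range (\<lambda>h. (h, lin_of p h)) \<longleftrightarrow> (\<exists>w. (fst ?G, bil_of q h k + snd ?G) = (w, lin_of p w))"
      by (auto simp: prod_eq_iff image_iff)
    then show "(0, bil_of q h k) + ?G \<in> range (\<lambda>h. (h, lin_of p h)) \<longleftrightarrow> bil_of q h k + snd ?G = lin_of p (fst ?G)"
      by simp
  qed
  finally show "\<theta> \<in> S_unparam A \<Gamma> \<longleftrightarrow> unparam_eq d (y, \<phi>) p q" .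
qed

lemma S_pr_coords:
  assumes c: "c \<in> A" and \<theta>: "\<theta> \<in> fst (jet_chart A c)" and w: "snd (jet_chart A c) \<theta> = (x, z, P, Q)"
  shows "\<theta> \<in> S_pr A \<Gamma> \<Theta> \<longleftrightarrow> inj (lin_of P) \<and>
    (\<forall>h k. bil_of Q h k + \<Gamma> c z (lin_of P h) (lin_of P k) = lin_of P (\<Theta> std_chart x h k))"
proof -
  obtain s where s: "smooth_near A (fst \<theta>) s" "s (fst \<theta>) \<in> fst c" "\<theta> = jet A (fst \<theta>) s" using jet_chartE[OF \<theta>] .
  have e: "x = fst \<theta>" "z = snd c (s (fst \<theta>))" "lin_of P = FD (snd c \<circ> s) (fst \<theta>)" "bil_of Q = deriv2 (snd c \<circ> s) (fst \<theta>)"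
    using jet_coords_iff[OF c s(1,2), of x z P Q] w s(3) by simp_all
  show ?thesis
    using S_pr_iff[OF c s(1,2)] s(3) unfolding geodesic_eq_def e by simp
qed

text \<open>Any vector of the form \<open>Du (\<Theta> (h, k))\<close> is tangent.\<close>

lemma forget_param_S_pr:
  assumes \<theta>: "\<theta> \<in> S_pr A \<Gamma> \<Theta>"
  shows "forget_param A \<theta> \<in> S_unparam A \<Gamma>"
proof -
  have "\<theta> \<in> ImmJ2pr A" using \<theta> S_pr_subset by blast
  then obtain s N where s: "embedding_on A N (s :: real^'n \<Rightarrow> 'e)" "fst \<theta> \<in> N" "\<theta> = jet A (fst \<theta>) s"
    and fp: "forget_param A \<theta> = subjet A (s (fst \<theta>)) (s ` N)" by (rule ImmJ2prE) (rule that)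
  note E = embedding_onD[OF s(1)]
  obtain c where c: "c \<in> A" "s (fst \<theta>) \<in> fst c" by (rule chart_at)
  have "geodesic_eq \<Gamma> \<Theta> c (fst \<theta>) s" using S_pr_iff[OF c(1) E(2)[OF s(2)] c(2)] \<theta> s(3) by simp
  then have "normal_eq \<Gamma> c (fst \<theta>) s" unfolding geodesic_eq_def normal_eq_def by (metis rangeI)
  then have "second_fundamental_form_vanishes A \<Gamma> (s ` N) (s (fst \<theta>))"
    using sff_iff_normal_eq[OF s(1,2) open_UNIV UNIV_I _ c, of "s ` N"] by simp
  then show ?thesis
    unfolding fp using S_unparam_iff[OF embedded_submanifold_image[OF s(1)]] s(2) by blast
qed

text \<open>A solution of \<open>S_unparam\<close> lifts to one of \<open>S_pr\<close> with prescribed parameter \<open>x\<close> and prescribed first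
  derivatives \<open>a\<close> of the independent coordinates: the normal part of the equation \<open>S_pr\<close> then holds,
  and the tangential part is solved for the second derivatives of the independent coordinates.
  Symmetry of both connections makes the solution symmetric.\<close>

definition lift_coords where
  "lift_coords d x a = (\<lambda>(y, \<phi>, p, q).
     let v = (\<lambda>h. (a h, lin_of p (a h))); m = (\<lambda>h k. a (\<Theta> std_chart x h k) - fst (\<Gamma> d (y, \<phi>) (v h) (v k)))
     in (x, (y, \<phi>), (\<chi> i. v (axis i 1)),
        (\<chi> \<sigma>. (m (axis (rep1 \<sigma>) 1) (axis (rep2 \<sigma>) 1),
           bil_of q (a (axis (rep1 \<sigma>) 1)) (a (axis (rep2 \<sigma>) 1)) + lin_of p (m (axis (rep1 \<sigma>) 1) (axis (rep2 \<sigma>) 1))))))"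

lemma lift_coords:
  assumes d: "d \<in> A" and z: "(y, \<phi>) \<in> snd d ` fst d" and a: "linear a" "inj (a :: real^'n \<Rightarrow> real^'n)"
    and eq: "unparam_eq d (y, \<phi>) p q"
  obtains P Q where "lift_coords d x a (y, \<phi>, p, q) = (x, (y, \<phi>), P, Q)" "\<And>h. lin_of P h = (a h, lin_of p (a h))"
    "\<And>h k. bil_of Q h k + \<Gamma> d (y, \<phi>) (lin_of P h) (lin_of P k) = lin_of P (\<Theta> std_chart x h k)"
    "graph_rel P Q p q" "inj (\<lambda>h. fst (lin_of P h))" "inj (lin_of P)"
proof -
  let ?v = "\<lambda>h. (a h, lin_of p (a h))" let ?z = "(y, \<phi>)"
  let ?m = "\<lambda>h k. a (\<Theta> std_chart x h k) - fst (\<Gamma> d ?z (?v h) (?v k))"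
  let ?B = "\<lambda>h k. (?m h k, bil_of q (a h) (a k) + lin_of p (?m h k))"
  let ?P = "\<chi> i. ?v (axis i 1)" and ?Q = "\<chi> \<sigma>. ?B (axis (rep1 \<sigma>) 1) (axis (rep2 \<sigma>) 1)"
  have lv: "linear ?v"
    by (rule linearI) (simp_all add: linear_add[OF a(1)] linear_cmul[OF a(1)] linear_add[OF linear_lin_of] linear_cmul[OF linear_lin_of])
  have P: "lin_of ?P = ?v" by (rule lin_of_linear[OF lv])
  have 1: "bilinear (\<lambda>h k. a (\<Theta> std_chart x h k))" by (rule linear_compose_bilinear[OF bilinear_param a(1)])
  have 2: "bilinear (\<lambda>h k. fst (\<Gamma> d ?z (?v h) (?v k)))"
    by (rule linear_compose_bilinear[OF bilinear_compose_linear[OF bilinear_christoffel[OF d z] lv] linear_fst])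
  have bm: "bilinear ?m" using 1 2 unfolding bilinear_def by (auto intro!: linear_compose_sub)
  have 3: "bilinear (\<lambda>h k. bil_of q (a h) (a k))" by (rule bilinear_compose_linear[OF bilinear_bil_of a(1)])
  have 4: "bilinear (\<lambda>h k. lin_of p (?m h k))" by (rule linear_compose_bilinear[OF bm linear_lin_of])
  have B: "bilinear ?B"
  proof -
    have 5: "bilinear (\<lambda>h k. bil_of q (a h) (a k) + lin_of p (?m h k))"
      using 3 4 unfolding bilinear_def by (auto intro!: linear_compose_add)
    have "linear (\<lambda>h. (f h, g h))" if "linear f" "linear g" for f :: "real^'n \<Rightarrow> real^'n" and g :: "real^'n \<Rightarrow> real^'m"
      by (rule linearI) (simp_all add: linear_add[OF that(1)] linear_add[OF that(2)] linear_cmul[OF that(1)] linear_cmul[OF that(2)])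
    then show ?thesis using bm 5 unfolding bilinear_def by blast
  qed
  have sm: "?m h k = ?m k h" for h k by (simp only: param_sym[of x h k] christoffel_sym[OF d z, of "?v h" "?v k"])
  have sym: "?B h k = ?B k h" for h k by (simp only: sm[of h k] bil_of_commute[of q "a h" "a k"])
  have Q: "bil_of ?Q = ?B" by (rule bil_of_bilinear[OF B sym])
  have "?B h k + \<Gamma> d ?z (?v h) (?v k) = ?v (\<Theta> std_chart x h k)" for h k
  proof -
    have "bil_of q (a h) (a k) + snd (\<Gamma> d ?z (?v h) (?v k)) = lin_of p (fst (\<Gamma> d ?z (?v h) (?v k)))"
      using eq unfolding unparam_eq_def by blast
    then show ?thesis by (simp add: prod_eq_iff linear_diff[OF linear_lin_of] algebra_simps)
  qed
  then have geo: "bil_of ?Q h k + \<Gamma> d ?z (lin_of ?P h) (lin_of ?P k) = lin_of ?P (\<Theta> std_chart x h k)" for h k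
    unfolding P Q .
  have rel: "graph_rel ?P ?Q p q" unfolding graph_rel_def P Q by simp
  have inj: "inj (\<lambda>h. fst (lin_of ?P h))" unfolding P using a(2) by simp
  have "inj (lin_of ?P)" unfolding P using a(2) by (auto simp: inj_def)
  then show ?thesis
    by (intro that[of ?P ?Q] geo rel inj) (simp_all add: P lift_coords_def Let_def)
qed

text \<open>The graph relation holds for the lift by construction, so the lift is mapped to the given jet.\<close>

lemma lift_jet:
  fixes x :: "real^'n"
  assumes d: "d \<in> A" and \<theta>: "\<theta> \<in> fst (subjet_chart A d)" "\<theta> \<in> S_unparam A \<Gamma>"
    and a: "linear a" "inj (a :: real^'n \<Rightarrow> real^'n)"
  defines "w \<equiv> lift_coords d x a (snd (subjet_chart A d) \<theta>)"
  defines "\<theta>' \<equiv> jet A x (quad_section d w)"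
  shows "\<theta>' \<in> S_pr A \<Gamma> \<Theta>" "\<theta>' \<in> fst (jet_chart A d)" "snd (jet_chart A d) \<theta>' = w" "forget_param A \<theta>' = \<theta>"
proof -
  obtain y \<phi> p q where e: "snd (subjet_chart A d) \<theta> = (y, \<phi>, p, q)" by (metis prod_cases4)
  note S = S_unparam_coords[OF d \<theta>(1) e]
  have eq: "unparam_eq d (y, \<phi>) p q" using S(1) \<theta>(2) by blast
  obtain P Q where w: "lift_coords d x a (y, \<phi>, p, q) = (x, (y, \<phi>), P, Q)" and P: "\<And>h. lin_of P h = (a h, lin_of p (a h))"
    and geo: "\<And>h k. bil_of Q h k + \<Gamma> d (y, \<phi>) (lin_of P h) (lin_of P k) = lin_of P (\<Theta> std_chart x h k)"
    and rel: "graph_rel P Q p q" and inj: "inj (\<lambda>h. fst (lin_of P h))" "inj (lin_of P)"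
    by (rule lift_coords[OF d S(2) a eq]) (rule that)
  have w': "w = (x, (y, \<phi>), P, Q)" by (simp add: w_def e w)
  have "fst (snd w) \<in> snd d ` fst d" using S(2) by (simp add: w')
  note q = quad_section[OF d this]
  have fw: "fst w = x" by (simp add: w')
  show dom: "\<theta>' \<in> fst (jet_chart A d)" and co: "snd (jet_chart A d) \<theta>' = w"
    using q(4,3) unfolding \<theta>'_def fw .
  show "\<theta>' \<in> S_pr A \<Gamma> \<Theta>" using S_pr_coords[OF d dom co[unfolded w']] inj(2) geo by blast
  then have im: "\<theta>' \<in> ImmJ2pr A" using S_pr_subset by blast
  note F = forget_param_in_chart[OF d dom im co[unfolded w']]
  have "snd (subjet_chart A d) (forget_param A \<theta>') = (y, \<phi>, p, q)" using F(2)[OF inj(1)] rel by simp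
  moreover have "forget_param A \<theta>' \<in> fst (subjet_chart A d)" using F(1) inj(1) by blast
  ultimately show "forget_param A \<theta>' = \<theta>" using inj_onD[OF inj_on_subjet_chart[OF d] _ _ \<theta>(1)] e by simp
qed

text \<open>The tangential part of the equation leaves no choice for the second derivatives of the independent
  coordinates, and those of the dependent ones follow by \<open>graph_rel\<close>.\<close>

lemma lift_coords_of_S_pr:
  assumes d: "d \<in> A" and \<theta>: "\<theta> \<in> S_pr A \<Gamma> \<Theta>" "\<theta> \<in> fst (jet_chart A d)" "forget_param A \<theta> \<in> fst (subjet_chart A d)"
  obtains a where "linear a" "inj (a :: real^'n \<Rightarrow> real^'n)"
    "\<And>h. a h = fst (lin_of (fst (snd (snd (snd (jet_chart A d) \<theta>)))) h)"
    "snd (jet_chart A d) \<theta> = lift_coords d (fst \<theta>) a (snd (subjet_chart A d) (forget_param A \<theta>))"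
proof -
  obtain x z P Q where w: "snd (jet_chart A d) \<theta> = (x, z, P, Q)" by (metis prod_cases4)
  have im: "\<theta> \<in> ImmJ2pr A" using \<theta>(1) S_pr_subset by blast
  note F = forget_param_in_chart[OF d \<theta>(2) im w]
  have inj: "inj (\<lambda>h. fst (lin_of P h))" using F(1) \<theta>(3) by blast
  obtain y \<phi> p q where e: "snd (subjet_chart A d) (forget_param A \<theta>) = (y, \<phi>, p, q)" by (metis prod_cases4)
  then have r: "y = fst z" "\<phi> = snd z" "graph_rel P Q p q" using F(2)[OF inj] by auto
  have z: "z = (y, \<phi>)" using r by simp
  let ?a = "\<lambda>h. fst (lin_of P h)"
  have la: "linear ?a" using linear_compose[OF linear_lin_of linear_fst] by (simp add: comp_def)
  have geo: "bil_of Q h k + \<Gamma> d z (lin_of P h) (lin_of P k) = lin_of P (\<Theta> std_chart x h k)" for h k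
    using S_pr_coords[OF d \<theta>(2) w] \<theta>(1) by blast
  have P: "lin_of P h = (?a h, lin_of p (?a h))" for h using r(3) by (simp add: graph_rel_def prod_eq_iff)
  have m: "fst (bil_of Q h k) = ?a (\<Theta> std_chart x h k) - fst (\<Gamma> d z (lin_of P h) (lin_of P k))" for h k
    unfolding geo[symmetric] by simp
  have Q: "bil_of Q h k = (fst (bil_of Q h k), bil_of q (?a h) (?a k) + lin_of p (fst (bil_of Q h k)))" for h k
    using r(3) by (simp add: graph_rel_def prod_eq_iff)
  have x: "x = fst \<theta>" using base_point_coords(1)[OF d \<theta>(2)] w by simp
  have "P $ i = (?a (axis i 1), lin_of p (?a (axis i 1)))" for i
    using P[of "axis i 1"] by (simp add: lin_of_axis)
  moreover have "Q $ \<sigma> = (?a (\<Theta> std_chart x (axis (rep1 \<sigma>) 1) (axis (rep2 \<sigma>) 1)) - fst (\<Gamma> d z (lin_of P (axis (rep1 \<sigma>) 1)) (lin_of P (axis (rep2 \<sigma>) 1))),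
     bil_of q (?a (axis (rep1 \<sigma>) 1)) (?a (axis (rep2 \<sigma>) 1)) + lin_of p (?a (\<Theta> std_chart x (axis (rep1 \<sigma>) 1) (axis (rep2 \<sigma>) 1)) - fst (\<Gamma> d z (lin_of P (axis (rep1 \<sigma>) 1)) (lin_of P (axis (rep2 \<sigma>) 1)))))" for \<sigma>
    using Q[of "axis (rep1 \<sigma>) 1" "axis (rep2 \<sigma>) 1"] unfolding m by (simp add: bil_of_axis Upair_rep)
  ultimately have "(x, z, P, Q) = lift_coords d x ?a (y, \<phi>, p, q)"
    unfolding lift_coords_def Let_def prod.case z P[symmetric] by (simp add: vec_eq_iff)
  then have "snd (jet_chart A d) \<theta> = lift_coords d (fst \<theta>) ?a (snd (subjet_chart A d) (forget_param A \<theta>))"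
    unfolding w e x .
  moreover have "?a h = fst (lin_of (fst (snd (snd (snd (jet_chart A d) \<theta>)))) h)" for h
    unfolding w by simp
  ultimately show ?thesis by (intro that[of ?a] la inj)
qed

lemma forget_param_image: "forget_param A ` S_pr A \<Gamma> \<Theta> = S_unparam A \<Gamma>"
proof
  show "forget_param A ` S_pr A \<Gamma> \<Theta> \<subseteq> S_unparam A \<Gamma>" using forget_param_S_pr by blast
  show "S_unparam A \<Gamma> \<subseteq> forget_param A ` S_pr A \<Gamma> \<Theta>"
  proof
    fix \<theta> assume \<theta>: "\<theta> \<in> S_unparam A \<Gamma>"
    then obtain p L where L: "\<theta> = subjet A p L" "embedded_submanifold A L" "p \<in> L" unfolding S_unparam_def by blast
    obtain d f where d: "d \<in> A" "graph_near d L p f" by (rule embedded_submanifold_graph[OF L(2,3)])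
    then have \<theta>d: "\<theta> \<in> fst (subjet_chart A d)" using in_subjet_chart[OF L(2,3)] L(1) by blast
    have "linear (\<lambda>h::real^'n. h)" "inj (\<lambda>h::real^'n. h)" by (simp_all add: linear_iff)
    note l = lift_jet[OF d(1) \<theta>d \<theta> this, of 0]
    show "\<theta> \<in> forget_param A ` S_pr A \<Gamma> \<Theta>" using imageI[OF l(1), of "forget_param A"] unfolding l(4) .
  qed
qed

end


section \<open>Tangent vectors of the equation of unparametrized submanifolds\<close>

lemma linear_vec_nth: "linear (\<lambda>v :: 'a::real_normed_vector^'n. v $ i)"
  by (rule bounded_linear.linear[OF bounded_linear_vec_nth])

lemma has_vector_derivative_linear:
  fixes T :: "'b::euclidean_space \<Rightarrow> 'c::real_normed_vector"
  assumes "linear T" "(g has_vector_derivative v) (at t)"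
  shows "((\<lambda>t. T (g t)) has_vector_derivative T v) (at t)"
  using bounded_linear.has_vector_derivative[OF _ assms(2)] assms(1) linear_conv_bounded_linear by blast

lemma has_vector_derivative_compose_smooth:
  assumes "smooth_on S f" "g t \<in> S" "(g has_vector_derivative v) (at t)"
  shows "((\<lambda>t. f (g t)) has_vector_derivative FD f (g t) v) (at t)"
proof -
  from has_derivative_compose[OF assms(3)[unfolded has_vector_derivative_def] smooth_on_has_derivative[OF assms(1,2)]]
  show ?thesis
    unfolding has_vector_derivative_def by (simp add: linear_cmul[OF smooth_on_linear_FD[OF assms(1,2)]])
qed

lemma has_vector_derivative_unique_near:
  assumes "\<epsilon> > 0" "\<And>t. t \<in> {-\<epsilon><..<\<epsilon>} \<Longrightarrow> f t = g t"
    and "(f has_vector_derivative v) (at (0::real))" "(g has_vector_derivative w) (at 0)"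
  shows "v = w"
proof -
  have "(g has_vector_derivative v) (at 0)"
    by (rule has_vector_derivative_transform_within_open[OF assms(3), of "{-\<epsilon><..<\<epsilon>}"]) (use assms(1,2) in auto)
  then show ?thesis by (rule vector_derivative_unique_at[OF _ assms(4)])
qed

context jet_manifold
begin

lemma differential_change_chart:
  fixes K :: "('b, 'w::euclidean_space) jet_space"
  assumes f: "smooth_map J K X f" and X: "X \<subseteq> jets J"
    and c: "c \<in> jet_charts J" and e: "e \<in> jet_charts J" and d: "d \<in> jet_charts K"
    and a: "a \<in> X" "a \<in> fst c" "a \<in> fst e" "f a \<in> fst d"
  shows "differential c d f a v = differential e d f a (differential c e (\<lambda>a. a) a v)"
  using differential_compose[OF smooth_map_id f c inj_on_jet_chart[OF c] e inj_on_jet_chart[OF e] d] a X by blast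

lemma tangent_vectors_change_chart:
  assumes S: "S \<subseteq> jets J" and c: "c \<in> jet_charts J" and e: "e \<in> jet_charts J" and a: "a \<in> fst c" "a \<in> fst e"
  shows "differential c e (\<lambda>a. a) a ` tangent_vectors c S a = tangent_vectors e S a"
proof
  have aJ: "a \<in> jets J" by (rule domain_subset[OF c a(1)])
  have im: "(\<lambda>a. a) ` (S \<inter> jets J) = S" using S by auto
  have push: "differential c e (\<lambda>a. a) a v \<in> tangent_vectors e S a"
    if "c \<in> jet_charts J" "e \<in> jet_charts J" "a \<in> fst c" "a \<in> fst e" "v \<in> tangent_vectors c S a" for c e v
    using differential_tangent[OF smooth_map_id that(1) inj_on_jet_chart[OF that(1)] that(2) aJ that(3-5)] unfolding im .
  show "differential c e (\<lambda>a. a) a ` tangent_vectors c S a \<subseteq> tangent_vectors e S a"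
    using push[OF c e a] by blast
  show "tangent_vectors e S a \<subseteq> differential c e (\<lambda>a. a) a ` tangent_vectors c S a"
  proof
    fix v assume v: "v \<in> tangent_vectors e S a"
    have "differential c e (\<lambda>a. a) a (differential e c (\<lambda>a. a) a v) = v"
      using differential_inverse[OF smooth_map_id smooth_map_id _ e c a(2,1)] by blast
    then show "v \<in> differential c e (\<lambda>a. a) a ` tangent_vectors c S a"
      using push[OF e c a(2,1) v] by (intro image_eqI[of v _ "differential e c (\<lambda>a. a) a v"]) auto
  qed
qed

end

context geodesic_setting
begin

lemma smooth_on_christoffel_apply:
  assumes d: "d \<in> A" and I: "open I" and z: "smooth_on I z" "z ` I \<subseteq> snd d ` fst d" and v: "smooth_on I v" and w: "smooth_on I w"
  shows "smooth_on I (\<lambda>t. \<Gamma> d (z t) (v t) (w t))"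
proof (rule smooth_on_bilinear_apply[OF I _ _ v w])
  show "bilinear (\<Gamma> d (z t))" if "t \<in> I" for t using bilinear_christoffel[OF d] that z(2) by blast
  show "smooth_on I (\<lambda>t. \<Gamma> d (z t) b c)" for b c
    by (rule smooth_on_compose[OF I open_range[OF d] z(2,1) smooth_christoffel[OF d]])
qed

lemma smooth_on_lift_coords:
  assumes d: "d \<in> A" and I: "open I" and g: "smooth_on I g" "\<And>t. t \<in> I \<Longrightarrow> (fst (g t), fst (snd (g t))) \<in> snd d ` fst d"
  shows "smooth_on I (\<lambda>t. lift_coords d x a (g t))"
proof -
  let ?z = "\<lambda>t. (fst (g t), fst (snd (g t)))" let ?p = "\<lambda>t. fst (snd (snd (g t)))" and ?q = "\<lambda>t. snd (snd (snd (g t)))"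
  let ?v = "\<lambda>h t. (a h, lin_of (?p t) (a h))"
  let ?m = "\<lambda>h k t. a (\<Theta> std_chart x h k) - fst (\<Gamma> d (?z t) (?v h t) (?v k t))"
  have z: "smooth_on I ?z" by (intro smooth_on_Pair[OF I] smooth_on_fst[OF I] smooth_on_snd[OF I] g(1))
  have zI: "?z ` I \<subseteq> snd d ` fst d" using g(2) by blast
  have p: "smooth_on I (\<lambda>t. lin_of (?p t) h)" for h
    by (intro smooth_on_lin_of[OF I] smooth_on_fst[OF I] smooth_on_snd[OF I] g(1))
  have q: "smooth_on I (\<lambda>t. bil_of (?q t) h k)" for h k
    by (intro smooth_on_bil_of[OF I] smooth_on_snd[OF I] g(1))
  have v: "smooth_on I (?v h)" for h by (intro smooth_on_Pair[OF I] smooth_on_const p)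
  have m: "smooth_on I (?m h k)" for h k
    by (intro smooth_on_diff[OF I] smooth_on_const smooth_on_fst[OF I] smooth_on_christoffel_apply[OF d I z zI] v)
  have pm: "smooth_on I (\<lambda>t. lin_of (?p t) (?m h k t))" for h k
    by (rule smooth_on_linear_apply[OF I linear_lin_of p m])
  have "smooth_on I (\<lambda>t. (x, ?z t, (\<chi> i. ?v (axis i 1) t),
        (\<chi> \<sigma>. (?m (axis (rep1 \<sigma>) 1) (axis (rep2 \<sigma>) 1) t,
           bil_of (?q t) (a (axis (rep1 \<sigma>) 1)) (a (axis (rep2 \<sigma>) 1)) + lin_of (?p t) (?m (axis (rep1 \<sigma>) 1) (axis (rep2 \<sigma>) 1) t)))))"
    by (intro smooth_on_Pair[OF I] smooth_on_const z smooth_on_vec[OF I] v m smooth_on_add[OF I] q pm)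
  then show ?thesis by (simp add: lift_coords_def Let_def case_prod_beta)
qed

text \<open>A curve of jets in \<open>S_unparam\<close> lifts to \<open>S_pr\<close> with constant base point and constant first
  derivatives of the independent coordinates, which are those of the jet \<open>\<theta>\<close>.\<close>

lemma tangent_S_unparam:
  assumes d: "d \<in> A" and \<theta>: "\<theta> \<in> S_pr A \<Gamma> \<Theta>" "\<theta> \<in> fst (jet_chart A d)" "forget_param A \<theta> \<in> fst (subjet_chart A d)"
  shows "differential (jet_chart A d) (subjet_chart A d) (forget_param A) \<theta> ` tangent_vectors (jet_chart A d) (S_pr A \<Gamma> \<Theta>) \<theta>
     = tangent_vectors (subjet_chart A d) (S_unparam A \<Gamma>) (forget_param A \<theta>)" (is "?D ` ?S = ?R")
proof
  let ?c = "jet_chart A d" and ?d = "subjet_chart A d" and ?\<pi> = "forget_param A"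
  have cJ: "?c \<in> jet_charts (J2pr_space A)" and dK: "?d \<in> jet_charts (J2sub_space A)"
    using d by (auto simp: J2pr_space_def J2sub_space_def)
  have im: "\<theta> \<in> ImmJ2pr A" using \<theta>(1) S_pr_subset by blast
  note inj = inj_on_jet_chart[OF d]
  note V = smooth_mapD[OF smooth_map_forget_param cJ dK]
  have "?\<pi> ` (S_pr A \<Gamma> \<Theta> \<inter> ImmJ2pr A) \<subseteq> S_unparam A \<Gamma>" using forget_param_S_pr by blast
  from tangent_vectors_mono[OF this] show "?D ` ?S \<subseteq> ?R"
    using differential_tangent[OF smooth_map_forget_param cJ inj dK im \<theta>(2,3)] by blast
  show "?R \<subseteq> ?D ` ?S"
  proof
    fix v assume "v \<in> ?R"
    then obtain \<gamma> \<epsilon> where \<gamma>: "\<epsilon> > 0" "\<gamma> (0::real) = ?\<pi> \<theta>" "\<And>t. t \<in> {-\<epsilon><..<\<epsilon>} \<Longrightarrow> \<gamma> t \<in> S_unparam A \<Gamma> \<inter> fst ?d"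
      "smooth_on {-\<epsilon><..<\<epsilon>} (\<lambda>t. snd ?d (\<gamma> t))" "((\<lambda>t. snd ?d (\<gamma> t)) has_vector_derivative v) (at 0)"
      by (rule tangent_vectorsE) (rule that)
    let ?I = "{-\<epsilon><..<\<epsilon>}"
    have I: "open ?I" "0 \<in> ?I" using \<gamma>(1) by auto
    obtain a where a: "linear a" "inj (a :: real^'n \<Rightarrow> real^'n)"
      and co: "snd ?c \<theta> = lift_coords d (fst \<theta>) a (snd ?d (?\<pi> \<theta>))"
      by (rule lift_coords_of_S_pr[OF d \<theta>]) (rule that)
    let ?w = "\<lambda>t. lift_coords d (fst \<theta>) a (snd ?d (\<gamma> t))"
    let ?\<eta> = "\<lambda>t. jet A (fst \<theta>) (quad_section d (?w t))"
    have \<eta>: "?\<eta> t \<in> S_pr A \<Gamma> \<Theta>" "?\<eta> t \<in> fst ?c" "snd ?c (?\<eta> t) = ?w t" "?\<pi> (?\<eta> t) = \<gamma> t" if t: "t \<in> ?I" for t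
    proof -
      have "\<gamma> t \<in> fst ?d" "\<gamma> t \<in> S_unparam A \<Gamma>" using \<gamma>(3)[OF t] by auto
      from lift_jet[OF d this a, of "fst \<theta>"]
      show "?\<eta> t \<in> S_pr A \<Gamma> \<Theta>" "?\<eta> t \<in> fst ?c" "snd ?c (?\<eta> t) = ?w t" "?\<pi> (?\<eta> t) = \<gamma> t" by blast+
    qed
    have \<eta>0: "?\<eta> 0 = \<theta>"
      by (rule inj_onD[OF inj _ \<eta>(2)[OF I(2)] \<theta>(2)]) (unfold \<eta>(3)[OF I(2)], unfold co \<gamma>(2), rule refl)
    have sw: "smooth_on ?I ?w"
    proof (rule smooth_on_lift_coords[OF d I(1) \<gamma>(4)])
      fix t assume "t \<in> ?I"
      then have "\<gamma> t \<in> fst ?d" using \<gamma>(3) by blast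
      then show "(fst (snd ?d (\<gamma> t)), fst (snd (snd ?d (\<gamma> t)))) \<in> snd d ` fst d"
        using S_unparam_coords(2)[OF d, of "\<gamma> t" "fst (snd ?d (\<gamma> t))" "fst (snd (snd ?d (\<gamma> t)))"] by (metis prod.collapse)
    qed
    let ?w' = "FD ?w 0 1"
    have dw: "(?w has_vector_derivative ?w') (at 0)" by (rule smooth_on_has_vector_derivative[OF sw I(2)])
    have eqw: "?w t = snd ?c (?\<eta> t)" if "t \<in> ?I" for t using \<eta>(3)[OF that] by simp
    have "?w' \<in> ?S"
    proof (rule tangent_vectorsI[where \<gamma> = "?\<eta>", OF \<gamma>(1) \<eta>0])
      show "?\<eta> t \<in> S_pr A \<Gamma> \<Theta> \<inter> fst ?c" if "t \<in> ?I" for t using \<eta>(1,2)[OF that] by blast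
      show "smooth_on ?I (\<lambda>t. snd ?c (?\<eta> t))" by (rule smooth_on_cong[OF I(1) eqw sw])
      show "((\<lambda>t. snd ?c (?\<eta> t)) has_vector_derivative ?w') (at 0)"
        by (rule has_vector_derivative_transform_within_open[OF dw I eqw])
    qed
    moreover have "?D ?w' = v"
    proof -
      have w0e: "?w 0 = snd ?c \<theta>" unfolding \<gamma>(2) by (rule co[symmetric])
      have w0: "?w 0 \<in> coord_domain ?c ?d (ImmJ2pr A) ?\<pi>"
        using im \<theta>(2,3) unfolding w0e by blast
      have e: "in_charts ?c ?d ?\<pi> (?w t) = snd ?d (\<gamma> t)" if "t \<in> ?I" for t
        using in_charts_apply[OF inj \<eta>(2)[OF that], of ?d ?\<pi>] unfolding \<eta>(3)[OF that] \<eta>(4)[OF that] .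
      have dd: "((\<lambda>t. in_charts ?c ?d ?\<pi> (?w t)) has_vector_derivative FD (in_charts ?c ?d ?\<pi>) (?w 0) ?w') (at 0)"
        by (rule has_vector_derivative_compose_smooth[OF V(2) w0 dw])
      have "FD (in_charts ?c ?d ?\<pi>) (?w 0) ?w' = v"
        by (rule has_vector_derivative_unique_near[OF \<gamma>(1) e dd \<gamma>(5)])
      then show ?thesis unfolding differential_def w0e .
    qed
    ultimately show "v \<in> ?D ` ?S" by (rule rev_image_eqI[OF _ sym])
  qed
qed

text \<open>The vectors of the Cartan distribution of the space of submanifolds: the derivatives of \<open>f\<close> and
  \<open>D f\<close> along a curve of jets of one graph are those of the functions themselves.\<close>

lemma cartan_J2sub_conditions:
  assumes d: "d \<in> A" and \<theta>: "\<theta> \<in> fst (subjet_chart A d)" and w: "snd (subjet_chart A d) \<theta> = (y, \<phi>, p, q)"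
    and v: "v \<in> cartan (J2sub_space A) (subjet_chart A d) \<theta>"
  shows "fst (snd v) = lin_of p (fst v)" "fst (snd (snd v)) $ i = bil_of q (fst v) (axis i 1)"
proof -
  let ?d = "subjet_chart A d"
  let ?C = "{v. fst (snd v) = lin_of p (fst v) \<and> (\<forall>i. fst (snd (snd v)) $ i = bil_of q (fst v) (axis i 1))}"
  have sub: "subspace ?C"
    unfolding subspace_def
    by (auto simp: linear_0[OF linear_lin_of] linear_add[OF linear_lin_of] linear_cmul[OF linear_lin_of]
        bilinear_lzero[OF bilinear_bil_of] bilinear_ladd[OF bilinear_bil_of] bilinear_lmul[OF bilinear_bil_of])
  have "v \<in> ?C" if L: "L \<in> snd \<theta>" and v: "v \<in> tangent_vectors ?d ((\<lambda>q. subjet A q L) ` L) \<theta>" for L v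
  proof -
    let ?a = "fst \<theta>"
    obtain b L0 where \<theta>': "\<theta> = subjet A b L0" "embedded_submanifold A L0" using \<theta> unfolding subjet_chart_def by auto
    have b: "?a = b" unfolding \<theta>'(1) by simp
    have ct0: "contact2 A b L0 L" and eL: "embedded_submanifold A L" using L unfolding \<theta>'(1) in_subjet by blast+
    have ct: "contact2 A ?a L0 L" unfolding b by (rule ct0)
    have aL: "?a \<in> L" by (rule contact2_mem(2)[OF ct])
    have \<theta>L: "subjet A ?a L = \<theta>" unfolding b by (rule trans[OF subjet_eqI[OF ct0, symmetric] \<theta>'(1)[symmetric]])
    obtain f where f: "graph_near d L ?a f" using in_subjet_chart[OF eL aL d] \<theta> unfolding \<theta>L by blast
    then obtain W N where W: "open W" "?a \<in> W" "W \<subseteq> fst d" and N: "open N" "(fst \<circ> snd d) ` W \<subseteq> N" "smooth_on N f"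
      and LW: "L \<inter> W = {q \<in> W. snd (snd d q) = f (fst (snd d q))}" unfolding graph_near_def by blast
    have gr: "graph_near d L q f" if "q \<in> L \<inter> W" for q
      unfolding graph_near_def using that W(1,3) N LW by (intro conjI exI[of _ W] exI[of _ N]) auto
    have Z: "open (snd d ` W)" using open_chart_image[OF d W(1)] W(3) by (simp add: Int_absorb1)
    let ?U = "{w :: (real^'n) \<times> (real^'m) \<times> ((real^'m)^'n) \<times> ((real^'m)^('n uprod)). (fst w, fst (snd w)) \<in> snd d ` W}"
    have "continuous_on UNIV (\<lambda>w :: (real^'n) \<times> (real^'m) \<times> ((real^'m)^'n) \<times> ((real^'m)^('n uprod)). (fst w, fst (snd w)))"
      by (intro continuous_intros)
    from continuous_open_preimage[OF this open_UNIV Z] have U: "open ?U" by (simp add: vimage_def)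
    have co: "snd ?d (subjet A q L) = coords2 (fst (snd d q)) g" "q \<in> fst d" "g (fst (snd d q)) = snd (snd d q)"
      if "graph_near d L q g" for q g
      using subjet_coords[OF eL d that] graph_near_value[OF that] that by (auto simp: graph_near_def)
    have "snd ?d \<theta> = coords2 (fst (snd d ?a)) f" using co(1)[OF f] unfolding \<theta>L .
    moreover have "(fst (coords2 (fst (snd d ?a)) f), fst (snd (coords2 (fst (snd d ?a)) f))) = snd d ?a"
      using co(3)[OF f] by (simp add: coords2_def)
    ultimately have "snd ?d \<theta> \<in> ?U" using W(2) by simp
    from tangent_vectors_local[OF v U this]
    obtain \<gamma> \<epsilon> where \<gamma>: "\<epsilon> > 0" "\<gamma> (0::real) = \<theta>"
      "\<And>t. t \<in> {-\<epsilon><..<\<epsilon>} \<Longrightarrow> \<gamma> t \<in> {b \<in> (\<lambda>q. subjet A q L) ` L \<inter> fst ?d. snd ?d b \<in> ?U} \<inter> fst ?d"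
      "smooth_on {-\<epsilon><..<\<epsilon>} (\<lambda>t. snd ?d (\<gamma> t))" "((\<lambda>t. snd ?d (\<gamma> t)) has_vector_derivative v) (at 0)"
      by (rule tangent_vectorsE) (rule that)
    let ?I = "{-\<epsilon><..<\<epsilon>}" let ?y = "\<lambda>t. fst (snd ?d (\<gamma> t))"
    have curve: "snd ?d (\<gamma> t) = coords2 (?y t) f \<and> ?y t \<in> N" if t: "t \<in> ?I" for t
    proof -
      obtain q where q: "q \<in> L" "\<gamma> t = subjet A q L" "\<gamma> t \<in> fst ?d" "snd ?d (\<gamma> t) \<in> ?U" using \<gamma>(3)[OF t] by blast
      obtain g where g: "graph_near d L q g" using in_subjet_chart[OF eL q(1) d] q(2,3) by auto
      have "(fst (snd ?d (\<gamma> t)), fst (snd (snd ?d (\<gamma> t)))) = snd d q"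
        unfolding q(2) co(1)[OF g] using co(3)[OF g] by (simp add: coords2_def)
      then obtain q' where "q' \<in> W" "snd d q = snd d q'" using q(4) by auto
      then have "q \<in> W" using inj_onD[OF inj_on_chart[OF d], of q q'] co(2)[OF g] W(3) by auto
      then have qLW: "q \<in> L \<inter> W" using q(1) by blast
      have e: "snd ?d (\<gamma> t) = coords2 (fst (snd d q)) f" unfolding q(2) by (rule co(1)[OF gr[OF qLW]])
      then have "?y t = fst (snd d q)" by (simp add: coords2_def)
      then show ?thesis using e \<open>q \<in> W\<close> N(2) by auto
    qed
    have I0: "0 \<in> ?I" using \<gamma>(1) by simp
    have y0: "?y 0 = y" using w \<gamma>(2) by simp
    have yN: "?y 0 \<in> N" using curve[OF I0] by blast
    have "coords2 y f = (y, \<phi>, p, q)" using curve[OF I0] w \<gamma>(2) by simp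
    then have pq: "lin_of p = FD f y" "bil_of q = deriv2 f y"
      using coords2_eq_iff[OF N(1,3)] yN y0 by auto
    have dy: "(?y has_vector_derivative fst v) (at 0)" by (rule has_vector_derivative_linear[OF linear_fst \<gamma>(5)])
    have "fst (snd v) = FD f y (fst v)"
    proof (rule has_vector_derivative_unique_near[OF \<gamma>(1)])
      show "((\<lambda>t. fst (snd (snd ?d (\<gamma> t)))) has_vector_derivative fst (snd v)) (at 0)"
        by (rule has_vector_derivative_linear[OF linear_fst has_vector_derivative_linear[OF linear_snd \<gamma>(5)]])
      show "((\<lambda>t. f (?y t)) has_vector_derivative FD f y (fst v)) (at 0)"
        using has_vector_derivative_compose_smooth[OF N(3) yN dy] unfolding y0 .
      show "fst (snd (snd ?d (\<gamma> t))) = f (?y t)" if "t \<in> ?I" for t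
        using arg_cong[OF conjunct1[OF curve[OF that]], of "\<lambda>w. fst (snd w)"] by (simp add: coords2_def)
    qed
    moreover have "fst (snd (snd v)) $ i = deriv2 f y (fst v) (axis i 1)" for i
    proof (rule has_vector_derivative_unique_near[OF \<gamma>(1)])
      show "((\<lambda>t. fst (snd (snd (snd ?d (\<gamma> t)))) $ i) has_vector_derivative fst (snd (snd v)) $ i) (at 0)"
        by (rule has_vector_derivative_linear[OF linear_vec_nth has_vector_derivative_linear[OF linear_fst
              has_vector_derivative_linear[OF linear_snd has_vector_derivative_linear[OF linear_snd \<gamma>(5)]]]])
      show "((\<lambda>t. FD f (?y t) (axis i 1)) has_vector_derivative deriv2 f y (fst v) (axis i 1)) (at 0)"
        using has_vector_derivative_compose_smooth[OF smooth_on_FD[OF N(3)] yN dy] unfolding y0 deriv2_def .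
      show "fst (snd (snd (snd ?d (\<gamma> t)))) $ i = FD f (?y t) (axis i 1)" if "t \<in> ?I" for t
        using arg_cong[OF conjunct1[OF curve[OF that]], of "\<lambda>w. fst (snd (snd w)) $ i"] by (simp add: coords2_def partial_eq)
    qed
    ultimately show ?thesis using pq by simp
  qed
  then have "cartan (J2sub_space A) ?d \<theta> \<subseteq> ?C"
    unfolding J2sub_space_def jet_space.select_convs by (intro span_minimal sub) blast
  then show "fst (snd v) = lin_of p (fst v)" "fst (snd (snd v)) $ i = bil_of q (fst v) (axis i 1)" using v by auto
qed

text \<open>The equation expresses the second derivatives by the other coordinates, hence the last component
  of a tangent vector by the others.\<close>

lemma tangent_S_unparam_determined:
  assumes d: "d \<in> A" and \<theta>: "\<theta> \<in> fst (subjet_chart A d)"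
    and v: "v \<in> tangent_vectors (subjet_chart A d) (S_unparam A \<Gamma>) \<theta>" "v' \<in> tangent_vectors (subjet_chart A d) (S_unparam A \<Gamma>) \<theta>"
    and eq: "fst v = fst v'" "fst (snd v) = fst (snd v')" "fst (snd (snd v)) = fst (snd (snd v'))"
  shows "v = v'"
proof -
  let ?d = "subjet_chart A d"
  let ?T = "\<lambda>w :: (real^'n) \<times> (real^'m) \<times> ((real^'m)^'n) \<times> ((real^'m)^('n uprod)). (fst w, fst (snd w), fst (snd (snd w)))"
  \<comment> \<open>\<open>F \<sigma>\<close> is the second derivative with index \<open>\<sigma>\<close> as a function of the coordinates of lower order.\<close>
  define F where "F \<sigma> u = (case u of (y, \<phi>, p) \<Rightarrow> let e = axis (rep1 \<sigma>) 1; e' = axis (rep2 \<sigma>) 1;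
     g = \<Gamma> d (y, \<phi>) (e, lin_of p e) (e', lin_of p e') in lin_of p (fst g) - snd g)" for \<sigma> :: "'n uprod" and u :: "(real^'n) \<times> (real^'m) \<times> ((real^'m)^'n)"
  let ?O = "{u :: (real^'n) \<times> (real^'m) \<times> ((real^'m)^'n). (fst u, fst (snd u)) \<in> snd d ` fst d}"
  have "continuous_on UNIV (\<lambda>u :: (real^'n) \<times> (real^'m) \<times> ((real^'m)^'n). (fst u, fst (snd u)))"
    by (intro continuous_intros)
  from continuous_open_preimage[OF this open_UNIV open_range[OF d]] have o: "open ?O" by (simp add: vimage_def)
  have F: "smooth_on ?O (F \<sigma>)" for \<sigma>
  proof -
    let ?e = "axis (rep1 \<sigma>) 1 :: real^'n" let ?e' = "axis (rep2 \<sigma>) 1 :: real^'n"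
    have p: "smooth_on ?O (\<lambda>u. lin_of (snd (snd u)) h)" for h
      by (intro smooth_on_lin_of[OF o] smooth_on_snd[OF o] smooth_on_id[OF o])
    have z: "smooth_on ?O (\<lambda>u. (fst u, fst (snd u)))"
      by (intro smooth_on_Pair[OF o] smooth_on_fst[OF o] smooth_on_snd[OF o] smooth_on_id[OF o])
    have g: "smooth_on ?O (\<lambda>u. \<Gamma> d (fst u, fst (snd u)) (?e, lin_of (snd (snd u)) ?e) (?e', lin_of (snd (snd u)) ?e'))"
      by (intro smooth_on_christoffel_apply[OF d o z] smooth_on_Pair[OF o] smooth_on_const p) blast
    show ?thesis
      unfolding F_def Let_def case_prod_beta
      by (rule smooth_on_diff[OF o smooth_on_linear_apply[OF o linear_lin_of p smooth_on_fst[OF o g]] smooth_on_snd[OF o g]])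
  qed
  have det: "snd (snd (snd v)) $ \<sigma> = FD (F \<sigma>) (?T (snd ?d \<theta>)) (?T v)"
    if v: "v \<in> tangent_vectors ?d (S_unparam A \<Gamma>) \<theta>" for v \<sigma>
  proof -
    obtain \<gamma> \<epsilon> where \<gamma>: "\<epsilon> > 0" "\<gamma> (0::real) = \<theta>" "\<And>t. t \<in> {-\<epsilon><..<\<epsilon>} \<Longrightarrow> \<gamma> t \<in> S_unparam A \<Gamma> \<inter> fst ?d"
      "smooth_on {-\<epsilon><..<\<epsilon>} (\<lambda>t. snd ?d (\<gamma> t))" "((\<lambda>t. snd ?d (\<gamma> t)) has_vector_derivative v) (at 0)"
      by (rule tangent_vectorsE[OF v]) (rule that)
    have e: "snd (snd (snd (snd ?d (\<gamma> t)))) $ \<sigma> = F \<sigma> (?T (snd ?d (\<gamma> t))) \<and> ?T (snd ?d (\<gamma> t)) \<in> ?O" if t: "t \<in> {-\<epsilon><..<\<epsilon>}" for t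
    proof -
      obtain y \<phi> p q where w: "snd ?d (\<gamma> t) = (y, \<phi>, p, q)" by (metis prod_cases4)
      have "\<gamma> t \<in> fst ?d" "\<gamma> t \<in> S_unparam A \<Gamma>" using \<gamma>(3)[OF t] by auto
      note S = S_unparam_coords[OF d this(1) w]
      have "unparam_eq d (y, \<phi>) p q" using S(1) \<open>\<gamma> t \<in> S_unparam A \<Gamma>\<close> by blast
      then have "bil_of q (axis (rep1 \<sigma>) 1) (axis (rep2 \<sigma>) 1) = F \<sigma> (y, \<phi>, p)"
        unfolding unparam_eq_def F_def Let_def prod.case eq_diff_eq by blast
      then show ?thesis using S(2) by (simp add: w bil_of_axis Upair_rep)
    qed
    have lT: "linear ?T" by (rule linearI) simp_all
    have I0: "0 \<in> {-\<epsilon><..<\<epsilon>}" using \<gamma>(1) by simp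
    have T0: "?T (snd ?d (\<gamma> 0)) \<in> ?O" using e[OF I0] by blast
    show ?thesis
    proof (rule has_vector_derivative_unique_near[OF \<gamma>(1)])
      show "((\<lambda>t. snd (snd (snd (snd ?d (\<gamma> t)))) $ \<sigma>) has_vector_derivative snd (snd (snd v)) $ \<sigma>) (at 0)"
        by (rule has_vector_derivative_linear[OF linear_vec_nth has_vector_derivative_linear[OF linear_snd
              has_vector_derivative_linear[OF linear_snd has_vector_derivative_linear[OF linear_snd \<gamma>(5)]]]])
      show "((\<lambda>t. F \<sigma> (?T (snd ?d (\<gamma> t)))) has_vector_derivative FD (F \<sigma>) (?T (snd ?d \<theta>)) (?T v)) (at 0)"
        using has_vector_derivative_compose_smooth[OF F T0 has_vector_derivative_linear[OF lT \<gamma>(5)]] unfolding \<gamma>(2) .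
      show "snd (snd (snd (snd ?d (\<gamma> t)))) $ \<sigma> = F \<sigma> (?T (snd ?d (\<gamma> t)))" if "t \<in> {-\<epsilon><..<\<epsilon>}" for t using e[OF that] by blast
    qed
  qed
  have "snd (snd (snd v)) = snd (snd (snd v'))"
    unfolding vec_eq_iff by (intro allI) (simp add: det[OF v(1)] det[OF v(2)] eq)
  with eq show ?thesis by (simp add: prod_eq_iff)
qed

end


section \<open>The fibres of the projection\<close>

context split_atlas
begin

lemma forget_param_domain:
  assumes c: "c \<in> A" and \<theta>: "\<theta> \<in> ImmJ2pr A" "forget_param A \<theta> \<in> fst (subjet_chart A c)"
  shows "\<theta> \<in> fst (jet_chart A c)"
proof -
  obtain s N where s: "embedding_on A N (s :: real^'n \<Rightarrow> 'e)" "fst \<theta> \<in> N" "\<theta> = jet A (fst \<theta>) s"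
    and fp: "forget_param A \<theta> = subjet A (s (fst \<theta>)) (s ` N)" by (rule ImmJ2prE[OF \<theta>(1)]) (rule that)
  have "s (fst \<theta>) \<in> s ` N" using s(2) by blast
  then have "\<exists>f. graph_near c (s ` N) (s (fst \<theta>)) f"
    using \<theta>(2) in_subjet_chart[OF embedded_submanifold_image[OF s(1)] _ c] unfolding fp by blast
  then have "s (fst \<theta>) \<in> fst c" by (auto simp: graph_near_def)
  then show ?thesis using in_jet_chart[OF embedding_onD(2)[OF s(1,2)]] s(3) by metis
qed

lemma prolong_coords:
  assumes c: "c \<in> A" and \<theta>: "\<theta> \<in> fst (jet_chart A c)" and w: "snd (jet_chart A c) \<theta> = (x, z, P, Q)"
    and g: "g \<in> carrier Aff" and N: "linear N" "inv_into UNIV g = (\<lambda>y. N y + b)" "\<And>x. inv_into UNIV g (g x) = x"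
  obtains P' Q' where "prolong A g \<theta> \<in> fst (jet_chart A c)" "snd (jet_chart A c) (prolong A g \<theta>) = (g x, z, P', Q')"
    "\<And>h. lin_of P' h = lin_of P (N h)" "\<And>h k. bil_of Q' h k = bil_of Q (N h) (N k)"
proof -
  obtain s where s: "smooth_near A (fst \<theta>) s" "s (fst \<theta>) \<in> fst c" "\<theta> = jet A (fst \<theta>) s" using jet_chartE[OF \<theta>] .
  have e: "x = fst \<theta>" "z = snd c (s (fst \<theta>))" "lin_of P = FD (snd c \<circ> s) (fst \<theta>)" "bil_of Q = deriv2 (snd c \<circ> s) (fst \<theta>)"
    using jet_coords_iff[OF c s(1,2), of x z P Q] w s(3) by simp_all
  note G = prolong_jet[OF g s(1)]
  have y: "N (g (fst \<theta>)) + b = fst \<theta>" using fun_cong[OF N(2), of "g (fst \<theta>)"] N(3) by simp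
  note R = affine_reparam[OF c s(1,2) N(1) y, folded N(2)]
  let ?t = "s \<circ> inv_into UNIV g"
  have tc: "?t (g (fst \<theta>)) \<in> fst c" using s(2) N(3) by simp
  have \<theta>': "prolong A g \<theta> = jet A (g (fst \<theta>)) ?t" using G(1) s(3) by simp
  obtain y' z' P' Q' where w': "snd (jet_chart A c) (prolong A g \<theta>) = (y', z', P', Q')" by (metis prod_cases4)
  then have "y' = g (fst \<theta>)" "z' = snd c (?t (g (fst \<theta>)))" "lin_of P' = FD (snd c \<circ> ?t) (g (fst \<theta>))" "bil_of Q' = deriv2 (snd c \<circ> ?t) (g (fst \<theta>))"
    unfolding \<theta>' jet_coords_iff[OF c G(2) tc] by auto
  then have "y' = g x" "z' = z" "\<And>h. lin_of P' h = lin_of P (N h)" "\<And>h k. bil_of Q' h k = bil_of Q (N h) (N k)"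
    using e R(2,3) N(3) by simp_all
  moreover have "prolong A g \<theta> \<in> fst (jet_chart A c)" unfolding \<theta>' using in_jet_chart[OF G(2)] tc by blast
  ultimately show ?thesis using that[of P' Q'] w' by simp
qed

text \<open>A linear change of parameters substitutes \<open>N h\<close> and \<open>N k\<close> in \<open>graph_rel\<close>, whose solution \<open>(p, q)\<close>
  thus remains the same.\<close>

lemma forget_param_prolong:
  assumes g: "g \<in> carrier Aff" and \<theta>: "\<theta> \<in> ImmJ2pr A"
  shows "prolong A g \<theta> \<in> ImmJ2pr A" "forget_param A (prolong A g \<theta>) = forget_param A \<theta>"
proof -
  obtain s M where s: "embedding_on A M (s :: real^'n \<Rightarrow> 'e)" "fst \<theta> \<in> M"
    and fp: "forget_param A \<theta> = subjet A (s (fst \<theta>)) (s ` M)" by (rule ImmJ2prE[OF \<theta>]) (rule that)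
  have pL: "s (fst \<theta>) \<in> s ` M" using s(2) by blast
  obtain c f where c: "c \<in> A" and f: "graph_near c (s ` M) (s (fst \<theta>)) f"
    by (rule embedded_submanifold_graph[OF embedded_submanifold_image[OF s(1)] pL])
  have dom: "forget_param A \<theta> \<in> fst (subjet_chart A c)"
    unfolding fp using in_subjet_chart[OF embedded_submanifold_image[OF s(1)] pL c] f by blast
  have \<theta>c: "\<theta> \<in> fst (jet_chart A c)" by (rule forget_param_domain[OF c \<theta> dom])
  obtain x z P Q where w: "snd (jet_chart A c) \<theta> = (x, z, P, Q)" by (metis prod_cases4)
  note F = forget_param_in_chart[OF c \<theta>c \<theta> w]
  have inj: "inj (\<lambda>h. fst (lin_of P h))" using F(1) dom by blast
  obtain N b where N: "linear N" "inj N" "inv_into UNIV g = (\<lambda>y. N y + b)" "\<And>x. inv_into UNIV g (g x) = x"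
    by (rule AffE[OF g]) (rule that)
  obtain P' Q' where d': "prolong A g \<theta> \<in> fst (jet_chart A c)" and w': "snd (jet_chart A c) (prolong A g \<theta>) = (g x, z, P', Q')"
    and P': "\<And>h. lin_of P' h = lin_of P (N h)" and Q': "\<And>h k. bil_of Q' h k = bil_of Q (N h) (N k)"
    by (rule prolong_coords[OF c \<theta>c w g N(1,3,4)]) (rule that)
  have inj': "inj (\<lambda>h. fst (lin_of P' h))"
    unfolding P' using inj_compose[OF inj N(2)] by (simp add: comp_def)
  show im: "prolong A g \<theta> \<in> ImmJ2pr A"
  proof -
    obtain t where t: "smooth_near A (fst (prolong A g \<theta>)) t" "t (fst (prolong A g \<theta>)) \<in> fst c"
      "prolong A g \<theta> = jet A (fst (prolong A g \<theta>)) t" using jet_chartE[OF d'] .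
    have "lin_of P' = FD (snd c \<circ> t) (fst (prolong A g \<theta>))"
      using jet_coords_iff[OF c t(1,2), of "g x" z P' Q'] w' t(3) by simp
    moreover have "inj (lin_of P')"
    proof (rule injI)
      fix h k assume "lin_of P' h = lin_of P' k"
      then show "h = k" using injD[OF inj', of h k] by simp
    qed
    ultimately have "jet A (fst (prolong A g \<theta>)) t \<in> ImmJ2pr A" using in_ImmJ2pr_chart[OF c t(1,2)] by simp
    then show ?thesis using t(3) by simp
  qed
  note F' = forget_param_in_chart[OF c d' im w']
  obtain y \<phi> p q where e: "snd (subjet_chart A c) (forget_param A \<theta>) = (y, \<phi>, p, q)" by (metis prod_cases4)
  then have r: "y = fst z" "\<phi> = snd z" "graph_rel P Q p q" using F(2)[OF inj] by blast+
  have "graph_rel P' Q' p q" using r(3) unfolding graph_rel_def P' Q' by blast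
  then have e': "snd (subjet_chart A c) (forget_param A (prolong A g \<theta>)) = (y, \<phi>, p, q)" using F'(2)[OF inj'] r by blast
  have dom': "forget_param A (prolong A g \<theta>) \<in> fst (subjet_chart A c)" using F'(1) inj' by blast
  show "forget_param A (prolong A g \<theta>) = forget_param A \<theta>"
    by (rule inj_onD[OF inj_on_subjet_chart[OF c] _ dom' dom]) (simp only: e e')
qed

lemma subjet_chart_at:
  assumes "\<theta> \<in> J2sub A"
  obtains c where "c \<in> A" "\<theta> \<in> fst (subjet_chart A c)"
proof -
  obtain p L where L: "\<theta> = subjet A p L" "embedded_submanifold A L" "p \<in> L" using assms unfolding J2sub_def by blast
  obtain c f where "c \<in> A" "graph_near c L p f" by (rule embedded_submanifold_graph[OF L(2,3)])
  then show ?thesis using that[of c] in_subjet_chart[OF L(2,3)] L(1) by blast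
qed

end

context geodesic_setting
begin

text \<open>A jet of \<open>S_pr\<close> is determined by its image, its base point and the first derivatives of its
  independent coordinates. The affine map \<open>g\<close> is chosen so that it matches the latter two, and for vanishing
  \<open>\<Theta>\<close> it preserves \<open>S_pr\<close>.\<close>

lemma forget_param_eq_iff:
  assumes zero: "\<And>x v w. \<Theta> std_chart x v w = 0" and \<theta>: "\<theta> \<in> S_pr A \<Gamma> \<Theta>" and \<theta>': "\<theta>' \<in> S_pr A \<Gamma> \<Theta>"
  shows "forget_param A \<theta> = forget_param A \<theta>' \<longleftrightarrow> (\<exists>g\<in>carrier Aff. \<theta>' = prolong A g \<theta>)"
proof
  have im: "\<theta> \<in> ImmJ2pr A" "\<theta>' \<in> ImmJ2pr A" using \<theta> \<theta>' S_pr_subset by blast+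
  {
    assume "\<exists>g\<in>carrier Aff. \<theta>' = prolong A g \<theta>"
    then show "forget_param A \<theta> = forget_param A \<theta>'" using forget_param_prolong(2)[OF _ im(1)] by auto
  next
    assume eq: "forget_param A \<theta> = forget_param A \<theta>'"
    have "forget_param A \<theta> \<in> J2sub A"
      using smooth_map_forget_param im(1) unfolding smooth_map_def J2sub_space_def jet_space.select_convs by blast
    then obtain d where d: "d \<in> A" "forget_param A \<theta> \<in> fst (subjet_chart A d)" by (rule subjet_chart_at)
    note d' = d(2)[unfolded eq]
    have dom: "\<theta> \<in> fst (jet_chart A d)" "\<theta>' \<in> fst (jet_chart A d)"
      using forget_param_domain[OF d(1) im(1) d(2)] forget_param_domain[OF d(1) im(2) d'] by blast+
    obtain a where a: "linear a" "inj (a :: real^'n \<Rightarrow> real^'n)"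
      "\<And>h. a h = fst (lin_of (fst (snd (snd (snd (jet_chart A d) \<theta>)))) h)"
      by (rule lift_coords_of_S_pr[OF d(1) \<theta> dom(1) d(2)]) (rule that)
    obtain a' where a': "linear a'" "inj (a' :: real^'n \<Rightarrow> real^'n)"
      "snd (jet_chart A d) \<theta>' = lift_coords d (fst \<theta>') a' (snd (subjet_chart A d) (forget_param A \<theta>'))"
      by (rule lift_coords_of_S_pr[OF d(1) \<theta>' dom(2) d']) (rule that)
    \<comment> \<open>The linear part \<open>a'\<^sup>-\<^sup>1 \<circ> a\<close> of \<open>g\<close>, so that \<open>a \<circ> N = a'\<close> for its inverse \<open>N\<close>.\<close>
    let ?M = "\<lambda>h. inv_into UNIV a' (a h)"
    have lM: "linear ?M" using linear_compose[OF a(1) linear_inverse_of_bij[OF a'(1,2)]] by (simp add: comp_def)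
    have surj: "surj a'" "surj a" using linear_injective_imp_surjective a(1,2) a'(1,2) by blast+
    have injM: "inj ?M"
    proof (rule injI)
      fix h k assume "?M h = ?M k"
      then have "a' (?M h) = a' (?M k)" by simp
      then have "a h = a k" by (simp add: surj_f_inv_f[OF surj(1)])
      then show "h = k" by (rule injD[OF a(2)])
    qed
    define g where "g y = ?M y + (fst \<theta>' - ?M (fst \<theta>))" for y
    have mM: "matrix ?M *v y = ?M y" for y using fun_cong[OF matrix_vector_mul(2)[OF lM], of y] .
    have "invertible (matrix ?M)"
      unfolding invertible_left_inverse matrix_left_invertible_injective mM by (rule injM)
    moreover have "g = (\<lambda>y. matrix ?M *v y + (fst \<theta>' - ?M (fst \<theta>)))" by (rule ext) (simp only: g_def mM)
    ultimately have g: "g \<in> carrier Aff" unfolding Aff_def partial_object.select_convs by blast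
    obtain N b where N: "linear N" "inv_into UNIV g = (\<lambda>y. N y + b)" "\<And>x. inv_into UNIV g (g x) = x"
      by (rule AffE[OF g]) (rule that)
    have gx: "g (fst \<theta>) = fst \<theta>'" by (simp add: g_def)
    have NM: "N (?M h) = h" for h
    proof -
      have "N (g y) + b = y" for y using fun_cong[OF N(2), of "g y"] N(3)[of y] by simp
      from this[of h] this[of 0] have "N (g h) - N (g 0) = h" by (metis add_diff_cancel_right diff_zero)
      moreover have "g h - g 0 = ?M h" by (simp add: g_def linear_0[OF lM])
      ultimately show ?thesis by (simp add: linear_diff[OF N(1), symmetric])
    qed
    have aN: "a (N h) = a' h" for h
    proof -
      obtain k where k: "h = ?M k"
      proof -
        obtain k where "a' h = a k" using surjD[OF surj(2)] by blast
        then have "?M k = h" using inv_into_f_f[OF a'(2), of h] by simp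
        from that[OF this[symmetric]] show ?thesis .
      qed
      have "a' h = a k" unfolding k by (rule surj_f_inv_f[OF surj(1)])
      then show ?thesis unfolding k NM by (simp add: k)
    qed
    let ?\<theta> = "prolong A g \<theta>"
    have S: "?\<theta> \<in> S_pr A \<Gamma> \<Theta>" by (rule prolong_in_S_pr[OF zero g \<theta>])
    have fp: "forget_param A ?\<theta> = forget_param A \<theta>'" using forget_param_prolong(2)[OF g im(1)] eq by simp
    obtain x z P Q where w: "snd (jet_chart A d) \<theta> = (x, z, P, Q)" by (metis prod_cases4)
    obtain P' Q' where dom'': "?\<theta> \<in> fst (jet_chart A d)" and w': "snd (jet_chart A d) ?\<theta> = (g x, z, P', Q')"
      and P': "\<And>h. lin_of P' h = lin_of P (N h)"
      by (rule prolong_coords[OF d(1) dom(1) w g N]) (rule that)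
    have x: "x = fst \<theta>" using base_point_coords(1)[OF d(1) dom(1)] w by simp
    have fx: "fst ?\<theta> = fst \<theta>'" using base_point_coords(1)[OF d(1) dom''] w' x gx by simp
    obtain a'' where a'': "\<And>h. a'' h = fst (lin_of (fst (snd (snd (snd (jet_chart A d) ?\<theta>)))) h)"
      "snd (jet_chart A d) ?\<theta> = lift_coords d (fst ?\<theta>) a'' (snd (subjet_chart A d) (forget_param A ?\<theta>))"
      by (rule lift_coords_of_S_pr[OF d(1) S dom'' d'[folded fp]]) (rule that)
    have "a'' h = a' h" for h
      unfolding a''(1) w' aN[symmetric] a(3) w by (simp add: P')
    then have "a'' = a'" by (rule ext)
    then have "snd (jet_chart A d) ?\<theta> = snd (jet_chart A d) \<theta>'"
      unfolding a''(2) a'(3) fx fp by simp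
    then have "?\<theta> = \<theta>'" by (rule inj_onD[OF inj_on_jet_chart[OF d(1)] _ dom'' dom(2)])
    then show "\<exists>g\<in>carrier Aff. \<theta>' = prolong A g \<theta>" using g by blast
  }
qed

end


section \<open>The Cartan distributions of the equations\<close>

text \<open>With \<open>l \<zeta> = 1\<close>, the cubic \<open>l h b (h, h) / 2\<close> has the third derivative
  \<open>l \<zeta> b (h, k) + l h b (\<zeta>, k) + l k b (\<zeta>, h)\<close> in the direction \<open>\<zeta>\<close>. The corrections in \<open>b\<close> make this
  equal to the given symmetric form.\<close>

lemma section_with_prescribed_third_derivative:
  fixes w :: "(real^'n) \<times> 'v::euclidean_space \<times> ('v^'n) \<times> ('v^('n uprod))"
  assumes w: "w = (x, z, P, Q)" and \<zeta>: "\<zeta> \<noteq> 0"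
  obtains u where "smooth_on UNIV u" "coords2 x u = w"
    "\<And>t h k. deriv2 u (x + t *\<^sub>R \<zeta>) h k = bil_of Q h k + t *\<^sub>R bil_of W h k"
proof -
  let ?W = "bil_of W"
  define l where "l h = (h \<bullet> \<zeta>) / (\<zeta> \<bullet> \<zeta>)" for h
  have l1: "l \<zeta> = 1" using \<zeta> by (simp add: l_def)
  have ll: "linear l" unfolding l_def
    by (rule linearI) (simp_all add: inner_add_left add_divide_distrib)
  define b where "b h k = ?W h k - (1/2) *\<^sub>R (l h *\<^sub>R ?W \<zeta> k + l k *\<^sub>R ?W \<zeta> h) + (1/3) *\<^sub>R ((l h * l k) *\<^sub>R ?W \<zeta> \<zeta>)" for h k
  note W = bilinear_ladd[OF bilinear_bil_of] bilinear_radd[OF bilinear_bil_of]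
    bilinear_lmul[OF bilinear_bil_of] bilinear_rmul[OF bilinear_bil_of]
  note L = linear_add[OF ll] linear_cmul[OF ll]
  have bb: "bilinear b"
    unfolding bilinear_def b_def
    by (intro conjI allI linearI) (simp_all add: W L algebra_simps)
  have bsym: "b h k = b k h" for h k
    unfolding b_def by (simp add: bil_of_commute[of W h k] add.commute mult.commute)
  have b\<zeta>: "l h *\<^sub>R b \<zeta> k + l k *\<^sub>R b \<zeta> h + b h k = ?W h k" for h k
  proof -
    have c: "b \<zeta> k = (1/2) *\<^sub>R ?W \<zeta> k - (1/6) *\<^sub>R (l k *\<^sub>R ?W \<zeta> \<zeta>)" for k
    proof -
      have "b \<zeta> k = ?W \<zeta> k - (1/2) *\<^sub>R ?W \<zeta> k - (1/2) *\<^sub>R (l k *\<^sub>R ?W \<zeta> \<zeta>) + (1/3) *\<^sub>R (l k *\<^sub>R ?W \<zeta> \<zeta>)"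
        by (simp add: b_def l1 scaleR_add_right)
      also have "\<dots> = (1 - 1/2) *\<^sub>R ?W \<zeta> k - (1/2 - 1/3) *\<^sub>R (l k *\<^sub>R ?W \<zeta> \<zeta>)"
        by (simp only: scaleR_left_diff_distrib scaleR_one) (simp add: algebra_simps)
      finally show ?thesis by simp
    qed
    have "l h *\<^sub>R b \<zeta> k + l k *\<^sub>R b \<zeta> h + b h k
      = ?W h k + (1/3 - 1/6 - 1/6) *\<^sub>R ((l h * l k) *\<^sub>R ?W \<zeta> \<zeta>)"
      unfolding c unfolding b_def
      by (simp only: scaleR_left_diff_distrib scaleR_add_right scaleR_diff_right scaleR_scaleR, simp add: algebra_simps, simp flip: scaleR_left_distrib)
    then show ?thesis by simp
  qed
  have Bb: "bounded_bilinear b" using bb bilinear_conv_bounded_bilinear by blast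
  have Bl: "bounded_linear l" using ll linear_conv_bounded_linear by blast
  let ?C = "\<lambda>y. (1/2) *\<^sub>R (l (y - x) *\<^sub>R b (y - x) (y - x))"
  let ?u = "\<lambda>y. quadratic w y + ?C y"
  have dx: "smooth_on UNIV (\<lambda>y. y - x)"
    by (rule smooth_on_diff[OF open_UNIV smooth_on_id[OF open_UNIV] smooth_on_const])
  have sC: "smooth_on UNIV ?C"
    by (rule smooth_on_bounded_linear[OF open_UNIV bounded_linear_scaleR_right smooth_on_scaleR[OF open_UNIV
          smooth_on_bounded_linear[OF open_UNIV Bl dx] smooth_on_bilinear[OF open_UNIV Bb dx dx]]])
  have su: "smooth_on UNIV ?u" by (rule smooth_on_add[OF open_UNIV smooth_on_quadratic sC])
  have d: "((\<lambda>y. y - x) has_derivative (\<lambda>h. h)) (at y)" for y by (auto intro!: derivative_eq_intros)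
  note dl = bounded_linear.has_derivative[OF Bl d] and db = bounded_bilinear.FDERIV[OF Bb d d]
  have db1: "((\<lambda>y. b (y - x) k) has_derivative (\<lambda>h. b h k)) (at y)" for y k
    using bounded_linear.has_derivative[OF bounded_bilinear.bounded_linear_left[OF Bb] d] .
  have C1: "FD ?C y k = (1/2) *\<^sub>R (l k *\<^sub>R b (y - x) (y - x)) + l (y - x) *\<^sub>R b (y - x) k" for y k
  proof -
    have "(?C has_derivative (\<lambda>k. (1/2) *\<^sub>R (l (y - x) *\<^sub>R (b (y - x) k + b k (y - x)) + l k *\<^sub>R b (y - x) (y - x)))) (at y)"
      by (intro has_derivative_scaleR_right has_derivative_scaleR dl db)
    then have "FD ?C y k = (1/2) *\<^sub>R (l (y - x) *\<^sub>R (b (y - x) k + b k (y - x)) + l k *\<^sub>R b (y - x) (y - x))"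
      by (simp add: FD_eq)
    also have "b (y - x) k + b k (y - x) = 2 *\<^sub>R b (y - x) k" by (simp add: bsym[of k "y - x"] scaleR_2)
    finally show ?thesis by (simp add: scaleR_add_right add.commute)
  qed
  have C2: "deriv2 ?C y h k = l k *\<^sub>R b (y - x) h + (l (y - x) *\<^sub>R b h k + l h *\<^sub>R b (y - x) k)" for y h k
  proof -
    have "((\<lambda>y. (1/2) *\<^sub>R (l k *\<^sub>R b (y - x) (y - x)) + l (y - x) *\<^sub>R b (y - x) k) has_derivative
      (\<lambda>h. (1/2) *\<^sub>R (l k *\<^sub>R (b (y - x) h + b h (y - x))) + (l (y - x) *\<^sub>R b h k + l h *\<^sub>R b (y - x) k))) (at y)"
      by (intro has_derivative_add has_derivative_scaleR_right has_derivative_scaleR dl db db1)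
    then have "deriv2 ?C y h k = (1/2) *\<^sub>R (l k *\<^sub>R (b (y - x) h + b h (y - x))) + (l (y - x) *\<^sub>R b h k + l h *\<^sub>R b (y - x) k)"
      unfolding deriv2_def C1 by (simp add: FD_eq)
    also have "b (y - x) h + b h (y - x) = 2 *\<^sub>R b (y - x) h" by (simp add: bsym[of h "y - x"] scaleR_2)
    finally show ?thesis by simp
  qed
  have u1: "FD ?u y k = FD (quadratic w) y k + FD ?C y k" for y k
    by (rule fun_cong[OF FD_eq[OF has_derivative_add[OF smooth_on_has_derivative[OF smooth_on_quadratic UNIV_I]
            smooth_on_has_derivative[OF sC UNIV_I]]]])
  have u2: "deriv2 ?u y h k = deriv2 (quadratic w) y h k + deriv2 ?C y h k" for y h k
    unfolding deriv2_def u1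
    by (rule fun_cong[OF FD_eq[OF has_derivative_add[OF smooth_on_has_derivative[OF smooth_on_FD[OF smooth_on_quadratic] UNIV_I]
            smooth_on_has_derivative[OF smooth_on_FD[OF sC] UNIV_I]]]])
  have q: "coords2 x (quadratic w) = w" using coords2_quadratic[of w] by (simp add: w)
  have q2: "deriv2 (quadratic w) y h k = bil_of Q h k" for y h k
    unfolding w by (rule deriv2_quadratic)
  have b0: "b 0 k = 0" "b k 0 = 0" "l 0 = 0" for k
    using bilinear_lzero[OF bb] bilinear_rzero[OF bb] linear_0[OF ll] by auto
  have e: "z = quadratic w x" "lin_of P = FD (quadratic w) x" "bil_of Q = deriv2 (quadratic w) x"
    using q unfolding w coords2_eq_iff[OF open_UNIV smooth_on_quadratic UNIV_I] by auto
  have "coords2 x ?u = (x, z, P, Q)"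
    unfolding coords2_eq_iff[OF open_UNIV su UNIV_I]
  proof (intro conjI refl)
    show "z = ?u x" using e(1) by (simp add: b0)
    show "lin_of P = FD ?u x"
      by (rule ext) (simp only: u1 C1 e(2) diff_self b0 scaleR_zero_left scaleR_zero_right add_0_right)
    show "bil_of Q = deriv2 ?u x"
      by (intro ext) (simp only: u2 C2 e(3) diff_self b0 scaleR_zero_left scaleR_zero_right add_0_right)
  qed
  moreover have "deriv2 ?u (x + t *\<^sub>R \<zeta>) h k = bil_of Q h k + t *\<^sub>R bil_of W h k" for t h k
  proof -
    have "deriv2 ?C (x + t *\<^sub>R \<zeta>) h k = t *\<^sub>R (l h *\<^sub>R b \<zeta> k + l k *\<^sub>R b \<zeta> h + b h k)"
      unfolding C2 by (simp add: bilinear_lmul[OF bb] linear_cmul[OF ll] l1 scaleR_add_right algebra_simps)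
    then show ?thesis unfolding u2 q2 b\<zeta> by simp
  qed
  ultimately show ?thesis using that[OF su] w by blast
qed

lemma has_vector_derivative_line: "((\<lambda>t. a + t *\<^sub>R b) has_vector_derivative b) (at t)"
  by (auto intro!: derivative_eq_intros)

lemma smooth_on_line:
  fixes b :: "'b::euclidean_space"
  shows "smooth_on UNIV (\<lambda>t::real. a + t *\<^sub>R b)"
  by (intro smooth_on_add[OF open_UNIV smooth_on_const] smooth_on_bounded_linear[OF open_UNIV bounded_linear_scaleR_left]
      smooth_on_id open_UNIV)

context atlas
begin

text \<open>Along the line \<open>x + t \<zeta>\<close> the second derivatives of the cubic section are \<open>Q + t W\<close>, so \<open>W\<close> is the last
  component of the velocity of its prolongation.\<close>

lemma cartan_J2pr_vector:
  fixes \<zeta> :: "real^'n"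
  assumes d: "d \<in> A" and \<theta>: "(\<theta> :: ('n, 'e) jet) \<in> fst (jet_chart A d)" and w: "snd (jet_chart A d) \<theta> = (x, z, P, Q)" and \<zeta>: "\<zeta> \<noteq> 0"
  shows "(\<zeta>, lin_of P \<zeta>, (\<chi> i. bil_of Q \<zeta> (axis i 1)), W) \<in> cartan (J2pr_space A) (jet_chart A d) \<theta>" (is "?w \<in> _")
proof -
  let ?c = "jet_chart A d"
  obtain u where u: "smooth_on UNIV u" "coords2 x u = (x, z, P, Q)"
    and u2: "\<And>t h k. deriv2 u (x + t *\<^sub>R \<zeta>) h k = bil_of Q h k + t *\<^sub>R bil_of (snd (snd (snd ?w))) h k"
    by (rule section_with_prescribed_third_derivative[OF refl \<zeta>]) (rule that, auto)
  have e: "z = u x" "lin_of P = FD u x" "bil_of Q = deriv2 u x"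
    using u(2) unfolding coords2_eq_iff[OF open_UNIV u(1) UNIV_I] by auto
  let ?s = "\<lambda>y. cinv d (u y)"
  let ?N = "u -` (snd d ` fst d)"
  have N: "open ?N" using continuous_open_preimage[OF smooth_on_continuous[OF u(1)] open_UNIV open_range[OF d]] by simp
  have eq: "(snd d \<circ> ?s) y = u y" if "y \<in> ?N" for y using that by (simp add: chart_cinv[OF d])
  have sm: "smooth_on ?N (snd d \<circ> ?s)"
    by (rule smooth_on_cong[OF N eq[symmetric] smooth_on_subset[OF u(1)]]) auto
  have x: "x \<in> ?N" using base_point_coords(2)[OF d \<theta>] w e(1) by simp
  have sN: "?s ` ?N \<subseteq> fst d" using cinv_domain[OF d] by blast
  have near: "smooth_near A y ?s" "?s y \<in> fst d" if "y \<in> ?N" for y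
    using smooth_near_chartI[OF d N that sN sm] sN that by blast+
  have co: "snd ?c (jet A y ?s) = (y, u y, (\<chi> i. FD u y (axis i 1)), (\<chi> \<sigma>. deriv2 u y (axis (rep1 \<sigma>) 1) (axis (rep2 \<sigma>) 1)))"
    if y: "y \<in> ?N" for y
    unfolding jet_coords[OF d near[OF y]]
  proof (rule coords2_eqI[OF N sm y])
    show "u y = (snd d \<circ> ?s) y" using eq[OF y] by (rule sym)
    have "FD u y = FD (snd d \<circ> ?s) y" "deriv2 u y = deriv2 (snd d \<circ> ?s) y"
      by (rule FD_cong[OF N y eq[symmetric]], assumption) (rule deriv2_cong[OF N y eq[symmetric]], assumption)
    then show "(\<chi> i. FD u y (axis i 1)) $ i = FD (snd d \<circ> ?s) y (axis i 1)"
      "(\<chi> \<sigma>. deriv2 u y (axis (rep1 \<sigma>) 1) (axis (rep2 \<sigma>) 1)) $ \<sigma> = deriv2 (snd d \<circ> ?s) y (axis (rep1 \<sigma>) 1) (axis (rep2 \<sigma>) 1)" for i \<sigma>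
      by simp_all
  qed
  have dom: "jet A y ?s \<in> fst ?c" if "y \<in> ?N" for y using in_jet_chart[OF near(1)[OF that]] near(2)[OF that] by blast
  have PQ: "P $ i = FD u x (axis i 1)" "Q $ \<sigma> = deriv2 u x (axis (rep1 \<sigma>) 1) (axis (rep2 \<sigma>) 1)" for i \<sigma>
    by (simp_all add: e(2,3)[symmetric] lin_of_axis bil_of_axis Upair_rep)
  have "snd ?c (jet A x ?s) = snd ?c \<theta>"
    unfolding w co[OF x] by (simp add: vec_eq_iff PQ e(1))
  then have \<theta>s: "jet A x ?s = \<theta>" by (rule inj_onD[OF inj_on_jet_chart[OF d] _ dom[OF x] \<theta>])
  have s\<theta>: "?s \<in> snd \<theta>" using in_jet_self[OF near(1)[OF x]] unfolding \<theta>s .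
  let ?l = "\<lambda>t::real. x + t *\<^sub>R \<zeta>"
  obtain \<epsilon> where \<epsilon>: "0 < \<epsilon>" "\<And>t. t \<in> {-\<epsilon><..<\<epsilon>} \<Longrightarrow> ?l t \<in> ?N"
    by (rule real_interval_in_open[OF zero_less_one smooth_on_continuous[OF smooth_on_subset[OF smooth_on_line subset_UNIV]] N])
      (use x in simp, rule that, assumption)
  let ?I = "{-\<epsilon><..<\<epsilon>}"
  let ?G = "\<lambda>t. (?l t, u (?l t), (\<chi> i. FD u (?l t) (axis i 1)), Q + t *\<^sub>R W)"
  have G: "snd ?c (jet A (?l t) ?s) = ?G t" if "t \<in> ?I" for t
    unfolding co[OF \<epsilon>(2)[OF that]] by (simp add: vec_eq_iff u2 bil_of_axis Upair_rep)
  have sG: "smooth_on UNIV ?G"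
    by (intro smooth_on_Pair[OF open_UNIV] smooth_on_vec[OF open_UNIV] smooth_on_line
        smooth_on_compose[OF open_UNIV open_UNIV subset_UNIV smooth_on_line u(1)]
        smooth_on_compose[OF open_UNIV open_UNIV subset_UNIV smooth_on_line smooth_on_FD[OF u(1)]])
  note dG = smooth_on_has_vector_derivative[OF sG UNIV_I, of 0]
  note l' = has_vector_derivative_line[of x \<zeta> 0]
  have l0: "?l 0 = x" by simp
  have c1: "fst (FD ?G 0 1) = \<zeta>"
    using vector_derivative_unique_at[OF has_vector_derivative_linear[OF linear_fst dG, unfolded fst_conv] l'] .
  note dG2 = has_vector_derivative_linear[OF linear_snd dG, unfolded snd_conv]
  have c2: "fst (snd (FD ?G 0 1)) = lin_of P \<zeta>"
    using vector_derivative_unique_at[OF has_vector_derivative_linear[OF linear_fst dG2, unfolded fst_conv]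
        has_vector_derivative_compose_smooth[OF u(1) UNIV_I l']]
    unfolding l0 e(2) .
  note dG3 = has_vector_derivative_linear[OF linear_snd dG2, unfolded snd_conv]
  have c3: "fst (snd (snd (FD ?G 0 1))) $ i = bil_of Q \<zeta> (axis i 1)" for i
    using vector_derivative_unique_at[OF has_vector_derivative_linear[OF linear_vec_nth
          has_vector_derivative_linear[OF linear_fst dG3, unfolded fst_conv], of i, unfolded vec_lambda_beta]
        has_vector_derivative_compose_smooth[OF smooth_on_FD[OF u(1)] UNIV_I l']]
    unfolding l0 e(3) deriv2_def .
  have c4: "snd (snd (snd (FD ?G 0 1))) = W"
    using vector_derivative_unique_at[OF has_vector_derivative_linear[OF linear_snd dG3, unfolded snd_conv]
        has_vector_derivative_line] .
  have FDG: "FD ?G 0 1 = ?w"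
    using c1 c2 c3 c4 by (simp add: prod_eq_iff vec_eq_iff)
  have "?w \<in> tangent_vectors ?c (prolonged_section A ?s) \<theta>"
  proof (rule tangent_vectorsI[where \<gamma> = "\<lambda>t. jet A (?l t) ?s", OF \<epsilon>(1)])
    show "jet A (?l 0) ?s = \<theta>" unfolding l0 by (rule \<theta>s)
    show "jet A (?l t) ?s \<in> prolonged_section A ?s \<inter> fst ?c" if "t \<in> ?I" for t
      using near(1)[OF \<epsilon>(2)[OF that]] dom[OF \<epsilon>(2)[OF that]] unfolding prolonged_section_def by blast
    show "smooth_on ?I (\<lambda>t. snd ?c (jet A (?l t) ?s))"
      by (rule smooth_on_cong[OF _ G[symmetric] smooth_on_subset[OF sG]]) auto
    show "((\<lambda>t. snd ?c (jet A (?l t) ?s)) has_vector_derivative ?w) (at 0)"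
      by (rule has_vector_derivative_transform_within_open[OF dG[unfolded FDG], of ?I])
        (use \<epsilon>(1) in simp, use \<epsilon>(1) in simp, rule G[symmetric])
  qed
  then show ?thesis unfolding cartan_J2pr using s\<theta> by (intro span_base) blast
qed

end

context geodesic_setting
begin

text \<open>The curve in \<open>S_pr\<close> over the line \<open>x + t \<zeta>\<close> is chosen so that the derivatives up to order one change as the
  Cartan distribution requires, and the equation then determines the second derivatives. By
  \<open>cartan_J2pr_vector\<close> the velocity of this curve is a Cartan vector, whatever its last component is. The
  cubic section needs a direction \<open>\<zeta> \<noteq> 0\<close>.\<close>

lemma cartan_tangent_exists:
  fixes \<zeta> :: "real^'n"
  assumes d: "d \<in> A" and \<theta>: "\<theta> \<in> S_pr A \<Gamma> \<Theta>" "\<theta> \<in> fst (jet_chart A d)" "forget_param A \<theta> \<in> fst (subjet_chart A d)"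
    and w: "snd (jet_chart A d) \<theta> = (x, z, P, Q)"
  obtains w' where "w' \<in> cartan (J2pr_space A) (jet_chart A d) \<theta>" "w' \<in> tangent_vectors (jet_chart A d) (S_pr A \<Gamma> \<Theta>) \<theta>"
    "fst (snd w') = lin_of P \<zeta>"
proof (cases "\<zeta> = 0")
  case True
  let ?c = "jet_chart A d"
  have "(0::(real^'n) \<times> ((real^'n) \<times> (real^'m)) \<times> (((real^'n) \<times> (real^'m))^'n) \<times> (((real^'n) \<times> (real^'m))^('n uprod))) \<in> tangent_vectors ?c (S_pr A \<Gamma> \<Theta>) \<theta>"
    by (rule tangent_vectorsI[where \<gamma> = "\<lambda>t. \<theta>", OF zero_less_one]) (use \<theta> in \<open>auto simp: smooth_on_const\<close>)
  then show ?thesis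
    using that[of 0] by (simp add: cartan_J2pr span_zero True linear_0[OF linear_lin_of])
next
  case False
  let ?c = "jet_chart A d" and ?d = "subjet_chart A d" and ?\<pi> = "forget_param A"
  have cJ: "?c \<in> jet_charts (J2pr_space A)" and dK: "?d \<in> jet_charts (J2sub_space A)"
    using d by (auto simp: J2pr_space_def J2sub_space_def)
  have im: "\<theta> \<in> ImmJ2pr A" using \<theta>(1) S_pr_subset by blast
  note inj = inj_on_jet_chart[OF d]
  note V = smooth_mapD(1)[OF smooth_map_forget_param cJ dK]
  have zc: "z \<in> snd d ` fst d" using base_point_coords(2)[OF d \<theta>(2)] w by simp
  have geo: "bil_of Q h k + \<Gamma> d z (lin_of P h) (lin_of P k) = lin_of P (\<Theta> std_chart x h k)" for h k
    using S_pr_coords[OF d \<theta>(2) w] \<theta>(1) by blast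
  \<comment> \<open>The velocity of the first derivatives along a prolonged section.\<close>
  let ?R = "\<chi> i. bil_of Q \<zeta> (axis i 1)"
  let ?x = "\<lambda>t. x + t *\<^sub>R \<zeta>" and ?z = "\<lambda>t. z + t *\<^sub>R lin_of P \<zeta>" and ?P = "\<lambda>t. P + t *\<^sub>R ?R"
  let ?B = "\<lambda>t h k. lin_of (?P t) (\<Theta> std_chart (?x t) h k) - \<Gamma> d (?z t) (lin_of (?P t) h) (lin_of (?P t) k)"
  let ?Q = "\<lambda>t. \<chi> \<sigma>. ?B t (axis (rep1 \<sigma>) 1) (axis (rep2 \<sigma>) 1)"
  let ?g = "\<lambda>t. (?x t, ?z t, ?P t, ?Q t)"
  obtain \<delta> where \<delta>: "0 < \<delta>" "\<And>t. t \<in> {-\<delta><..<\<delta>} \<Longrightarrow> ?z t \<in> snd d ` fst d"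
    by (rule real_interval_in_open[OF zero_less_one smooth_on_continuous[OF smooth_on_subset[OF smooth_on_line subset_UNIV]] open_range[OF d]])
      (use zc in simp, rule that, assumption)
  let ?J = "{-\<delta><..<\<delta>}"
  have J: "open ?J" by simp
  note line = smooth_on_subset[OF smooth_on_line subset_UNIV]
  have zJ: "?z ` ?J \<subseteq> snd d ` fst d" using \<delta>(2) by blast
  have sP: "smooth_on ?J (\<lambda>t. lin_of (?P t) h)" for h by (rule smooth_on_lin_of[OF J line])
  have s\<Theta>: "smooth_on ?J (\<lambda>t. \<Theta> std_chart (?x t) h k)" for h k
    by (rule smooth_on_compose[OF J open_UNIV subset_UNIV line smooth_param_christoffel])
  have sg: "smooth_on ?J ?g"
    by (intro smooth_on_Pair[OF J] smooth_on_vec[OF J] line smooth_on_diff[OF J]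
        smooth_on_linear_apply[OF J linear_lin_of sP s\<Theta>] smooth_on_christoffel_apply[OF d J line zJ sP sP])
  have B: "bil_of (?Q t) = ?B t" if t: "t \<in> ?J" for t
  proof (rule bil_of_bilinear)
    have 1: "bilinear (\<lambda>h k. lin_of (?P t) (\<Theta> std_chart (?x t) h k))"
      by (rule linear_compose_bilinear[OF bilinear_param linear_lin_of])
    have 2: "bilinear (\<lambda>h k. \<Gamma> d (?z t) (lin_of (?P t) h) (lin_of (?P t) k))"
      by (rule bilinear_compose_linear[OF bilinear_christoffel[OF d \<delta>(2)[OF t]] linear_lin_of])
    show "bilinear (?B t)" using 1 2 unfolding bilinear_def by (auto intro!: linear_compose_sub)
    show "?B t h k = ?B t k h" for h k
      by (simp only: param_sym[of _ h k] christoffel_sym[OF d \<delta>(2)[OF t], of "lin_of (?P t) h" "lin_of (?P t) k"])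
  qed
  have J0: "0 \<in> ?J" using \<delta>(1) by simp
  have g0: "?g 0 = snd ?c \<theta>"
  proof -
    have "bil_of Q h k = ?B 0 h k" for h k using geo[of h k] by (simp add: eq_diff_eq)
    then have "Q $ \<sigma> = ?Q 0 $ \<sigma>" for \<sigma>
      by (simp add: bil_of_axis[symmetric, of Q "rep1 \<sigma>" "rep2 \<sigma>", unfolded Upair_rep])
    then have "Q = ?Q 0" unfolding vec_eq_iff by blast
    then show ?thesis unfolding w by simp
  qed
  have "?g 0 \<in> coord_domain ?c ?d (ImmJ2pr A) ?\<pi>" unfolding g0 using im \<theta>(2,3) by blast
  then obtain \<epsilon> where \<epsilon>: "0 < \<epsilon>" "\<epsilon> \<le> \<delta>" "\<And>t. t \<in> {-\<epsilon><..<\<epsilon>} \<Longrightarrow> ?g t \<in> coord_domain ?c ?d (ImmJ2pr A) ?\<pi>"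
    by (rule real_interval_in_open[OF \<delta>(1) smooth_on_continuous[OF sg] V]) (rule that, assumption+)
  let ?I = "{-\<epsilon><..<\<epsilon>}"
  let ?\<eta> = "\<lambda>t. jet A (fst (?g t)) (quad_section d (?g t))"
  have IJ: "t \<in> ?J" if "t \<in> ?I" for t using that \<epsilon>(2) by simp
  have \<eta>: "?\<eta> t \<in> fst ?c" "snd ?c (?\<eta> t) = ?g t" "?\<eta> t \<in> S_pr A \<Gamma> \<Theta>" if t: "t \<in> ?I" for t
  proof -
    have "fst (snd (?g t)) \<in> snd d ` fst d" using \<delta>(2)[OF IJ[OF t]] by simp
    note q = quad_section[OF d this]
    show dom: "?\<eta> t \<in> fst ?c" and co: "snd ?c (?\<eta> t) = ?g t" by (rule q)+
    obtain \<theta>' where \<theta>': "\<theta>' \<in> fst ?c" "\<theta>' \<in> ImmJ2pr A" "?\<pi> \<theta>' \<in> fst ?d" "snd ?c \<theta>' = ?g t"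
      using \<epsilon>(3)[OF t] by auto
    have "inj (\<lambda>h. fst (lin_of (?P t) h))" using forget_param_in_chart(1)[OF d \<theta>'(1,2,4)] \<theta>'(3) by blast
    then have "inj (lin_of (?P t))" unfolding inj_def by metis
    then show "?\<eta> t \<in> S_pr A \<Gamma> \<Theta>"
      unfolding S_pr_coords[OF d dom co] B[OF IJ[OF t]] by simp
  qed
  have I0: "0 \<in> ?I" using \<epsilon>(1) by simp
  have \<eta>0: "?\<eta> 0 = \<theta>"
    by (rule inj_onD[OF inj trans[OF \<eta>(2)[OF I0] g0] \<eta>(1)[OF I0] \<theta>(2)])
  note dg = smooth_on_has_vector_derivative[OF sg J0]
  let ?w' = "FD ?g 0 1"
  have "?w' \<in> tangent_vectors ?c (S_pr A \<Gamma> \<Theta>) \<theta>"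
  proof (rule tangent_vectorsI[where \<gamma> = "?\<eta>", OF \<epsilon>(1) \<eta>0])
    show "?\<eta> t \<in> S_pr A \<Gamma> \<Theta> \<inter> fst ?c" if "t \<in> ?I" for t using \<eta>(1,3)[OF that] by blast
    show "smooth_on ?I (\<lambda>t. snd ?c (?\<eta> t))"
      by (rule smooth_on_cong[OF _ \<eta>(2)[symmetric] smooth_on_subset[OF sg]]) (use \<epsilon>(2) in auto)
    show "((\<lambda>t. snd ?c (?\<eta> t)) has_vector_derivative ?w') (at 0)"
      by (rule has_vector_derivative_transform_within_open[OF dg, of ?I])
        (use \<epsilon>(1) in simp, use \<epsilon>(1) in simp, rule \<eta>(2)[symmetric])
  qed
  moreover have c: "fst ?w' = \<zeta>" "fst (snd ?w') = lin_of P \<zeta>" "fst (snd (snd ?w')) = ?R"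
  proof -
    note dg2 = has_vector_derivative_linear[OF linear_snd dg, unfolded snd_conv]
    note dg3 = has_vector_derivative_linear[OF linear_snd dg2, unfolded snd_conv]
    show "fst ?w' = \<zeta>" "fst (snd ?w') = lin_of P \<zeta>" "fst (snd (snd ?w')) = ?R"
      using vector_derivative_unique_at[OF has_vector_derivative_linear[OF linear_fst dg, unfolded fst_conv] has_vector_derivative_line]
        vector_derivative_unique_at[OF has_vector_derivative_linear[OF linear_fst dg2, unfolded fst_conv] has_vector_derivative_line]
        vector_derivative_unique_at[OF has_vector_derivative_linear[OF linear_fst dg3, unfolded fst_conv] has_vector_derivative_line]
      by blast+
  qed
  moreover have "?w' \<in> cartan (J2pr_space A) ?c \<theta>"
  proof -
    have "?w' = (\<zeta>, lin_of P \<zeta>, ?R, snd (snd (snd ?w')))" by (simp only: prod_eq_iff fst_conv snd_conv c simp_thms)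
    then show ?thesis using cartan_J2pr_vector[OF d \<theta>(2) w False, of "snd (snd (snd ?w'))"] by (simp only:)
  qed
  ultimately show ?thesis using that by blast
qed

end

context split_atlas
begin

text \<open>A section through a jet of an immersion parametrizes a submanifold, so the prolongation of the
  section is mapped to that of the submanifold.\<close>

lemma forget_param_cartan:
  assumes c: "c \<in> jet_charts (J2pr_space A)" and d: "d \<in> jet_charts (J2sub_space A)"
    and \<theta>: "\<theta> \<in> ImmJ2pr A" "\<theta> \<in> fst c" "forget_param A \<theta> \<in> fst d"
  shows "differential c d (forget_param A) \<theta> ` cartan (J2pr_space A) c \<theta> \<subseteq> cartan (J2sub_space A) d (forget_param A \<theta>)"
proof -
  interpret J: jet_manifold "J2pr_space A :: (('n, 'e) jet, _) jet_space" by (rule jet_manifold_J2pr)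
  let ?\<pi> = "forget_param A" let ?D = "differential c d ?\<pi> \<theta>"
  obtain e where e: "e \<in> A" "c = jet_chart A e" using c by (auto simp: J2pr_space_def)
  note inj = J.inj_on_jet_chart[OF c]
  have "?D v \<in> cartan (J2sub_space A) d (?\<pi> \<theta>)"
    if s: "s \<in> snd \<theta>" and v: "v \<in> tangent_vectors c (prolonged_section A s) \<theta>" for s v
  proof -
    let ?x = "fst \<theta>"
    obtain s0 where s0: "smooth_near A ?x s0" "\<theta> = jet A ?x s0" using J2prE[of \<theta>] \<theta>(1) ImmJ2pr_subset by blast
    have ss: "s \<in> snd (jet A ?x s0)" using s s0(2) by simp
    have near: "smooth_near A ?x s" and js: "jet A ?x s = \<theta>" using in_jetD(1,4)[OF ss] s0(2) by simp_all
    have sx: "s ?x \<in> fst e" using in_jet_chart[OF near, of e] \<theta>(2) unfolding js e(2) by blast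
    have "inj (FD (snd e \<circ> s) ?x)" using in_ImmJ2pr_chart[OF e(1) near sx] \<theta>(1) unfolding js by blast
    then have "immersive_at A ?x s" by (rule immersive_atI[OF e(1) near sx])
    then obtain N where N: "?x \<in> N" "embedding_on A N s" using embedding_exists[OF near] by blast
    let ?U = "fst -` N :: ((real^'n) \<times> ((real^'n) \<times> (real^'m)) \<times> (((real^'n) \<times> (real^'m))^'n) \<times> (((real^'n) \<times> (real^'m))^('n uprod))) set"
    have U: "open ?U" by (rule open_vimage_fst[OF embedding_onD(1)[OF N(2)]])
    have "snd c \<theta> \<in> ?U" using base_point_coords(1)[OF e(1), of \<theta>] \<theta>(2) N(1) e(2) by simp
    from tangent_vectors_local[OF v U this]
    have v': "v \<in> tangent_vectors c {b \<in> prolonged_section A s \<inter> fst c. snd c b \<in> ?U} \<theta>" .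
    let ?L = "s ` N"
    have "?\<pi> ` ({b \<in> prolonged_section A s \<inter> fst c. snd c b \<in> ?U} \<inter> ImmJ2pr A) \<subseteq> (\<lambda>q. subjet A q ?L) ` ?L"
    proof
      fix b' assume "b' \<in> ?\<pi> ` ({b \<in> prolonged_section A s \<inter> fst c. snd c b \<in> ?U} \<inter> ImmJ2pr A)"
      then obtain b where b: "b' = ?\<pi> b" "b \<in> prolonged_section A s" "b \<in> fst c" "fst (snd c b) \<in> N" by auto
      then obtain y where y: "b = jet A y s" unfolding prolonged_section_def by blast
      have "y \<in> N" using base_point_coords(1)[OF e(1), of b] b(3,4) e(2) y by simp
      then show "b' \<in> (\<lambda>q. subjet A q ?L) ` ?L" unfolding b(1) y using forget_param_jet[OF N(2)] by blast
    qed
    from tangent_vectors_mono[OF this] differential_tangent[OF smooth_map_forget_param c inj d \<theta> v']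
    have t: "?D v \<in> tangent_vectors d ((\<lambda>q. subjet A q ?L) ` ?L) (?\<pi> \<theta>)" by blast
    have "?\<pi> \<theta> = subjet A (s ?x) ?L" using forget_param_jet[OF N(2,1)] unfolding js .
    moreover have "?L \<in> snd (subjet A (s ?x) ?L)"
      unfolding in_subjet using embedded_submanifold_image[OF N(2)] contact2_refl N(1) by blast
    ultimately show ?thesis
      unfolding J2sub_space_def jet_space.select_convs using t by (intro span_base) auto
  qed
  then have "?D ` (\<Union>s\<in>snd \<theta>. tangent_vectors c (prolonged_section A s) \<theta>) \<subseteq> cartan (J2sub_space A) d (?\<pi> \<theta>)" by blast
  then show ?thesis
    unfolding cartan_J2pr unfolding J2sub_space_def jet_space.select_convs
    by (rule linear_image_span_subset[OF linear_differential[OF smooth_map_forget_param c d \<theta>]])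
qed

end

context geodesic_setting
begin

text \<open>A vector \<open>v\<close> of the Cartan distribution that is tangent to \<open>S_unparam\<close> is determined by its
  independent components, since the Cartan distribution fixes the changes of \<open>f\<close> and \<open>Df\<close> and the equation
  fixes the change of \<open>D\<^sup>2f\<close>. Since \<open>h \<mapsto> fst (lin_of P h)\<close> is surjective, some Cartan vector tangent to
  \<open>S_pr\<close> has an image with the same independent components, and this image is \<open>v\<close>.\<close>

lemma cartan_S_unparam:
  assumes d: "d \<in> A" and \<theta>: "\<theta> \<in> S_pr A \<Gamma> \<Theta>" "\<theta> \<in> fst (jet_chart A d)" "forget_param A \<theta> \<in> fst (subjet_chart A d)"
  shows "differential (jet_chart A d) (subjet_chart A d) (forget_param A) \<theta> `
      (cartan (J2pr_space A) (jet_chart A d) \<theta> \<inter> tangent_vectors (jet_chart A d) (S_pr A \<Gamma> \<Theta>) \<theta>)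
     = cartan (J2sub_space A) (subjet_chart A d) (forget_param A \<theta>) \<inter> tangent_vectors (subjet_chart A d) (S_unparam A \<Gamma>) (forget_param A \<theta>)"
    (is "?D ` (?C \<inter> ?S) = ?C' \<inter> ?R")
proof
  let ?c = "jet_chart A d" and ?d = "subjet_chart A d" and ?\<pi> = "forget_param A"
  have cJ: "?c \<in> jet_charts (J2pr_space A)" and dK: "?d \<in> jet_charts (J2sub_space A)"
    using d by (auto simp: J2pr_space_def J2sub_space_def)
  have im: "\<theta> \<in> ImmJ2pr A" using \<theta>(1) S_pr_subset by blast
  note V = smooth_mapD[OF smooth_map_forget_param cJ dK]
  note C = forget_param_cartan[OF cJ dK im \<theta>(2,3)] and T = tangent_S_unparam[OF d \<theta>]
  show "?D ` (?C \<inter> ?S) \<subseteq> ?C' \<inter> ?R" using C T by blast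
  show "?C' \<inter> ?R \<subseteq> ?D ` (?C \<inter> ?S)"
  proof
    fix v assume v: "v \<in> ?C' \<inter> ?R"
    obtain x z P Q where w: "snd ?c \<theta> = (x, z, P, Q)" by (metis prod_cases4)
    have "inj (\<lambda>h. fst (lin_of P h))" using forget_param_in_chart(1)[OF d \<theta>(2) im w] \<theta>(3) by blast
    moreover have "linear (\<lambda>h. fst (lin_of P h))" using linear_compose[OF linear_lin_of linear_fst] by (simp add: comp_def)
    ultimately have "surj (\<lambda>h. fst (lin_of P h))" using linear_injective_imp_surjective by blast
    then obtain \<zeta> where \<zeta>: "fst v = fst (lin_of P \<zeta>)" using surjD by metis
    obtain w' where w': "w' \<in> ?C" "w' \<in> ?S" "fst (snd w') = lin_of P \<zeta>"
      by (rule cartan_tangent_exists[OF d \<theta> w]) (rule that)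
    have D: "?D w' \<in> ?C'" "?D w' \<in> ?R" using C T w'(1,2) by blast+
    have "fst (?D w') = fst (fst (snd w'))"
    proof -
      let ?V = "coord_domain ?c ?d (ImmJ2pr A) ?\<pi>"
      have aV: "snd ?c \<theta> \<in> ?V" using im \<theta>(2,3) by blast
      have e: "fst (in_charts ?c ?d ?\<pi> y) = fst (fst (snd y))" if y: "y \<in> ?V" for y
      proof -
        obtain \<theta>' where \<theta>': "\<theta>' \<in> fst ?c" "\<theta>' \<in> ImmJ2pr A" "?\<pi> \<theta>' \<in> fst ?d" "y = snd ?c \<theta>'" using y by blast
        obtain x' z' P' Q' where y4: "snd ?c \<theta>' = (x', z', P', Q')" by (metis prod_cases4)
        note F = forget_param_in_chart[OF d \<theta>'(1,2) y4]
        obtain y' \<phi>' p' q' where e: "snd ?d (?\<pi> \<theta>') = (y', \<phi>', p', q')" by (metis prod_cases4)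
        have "y' = fst z'" using F(2)[OF F(1)[THEN iffD1, OF \<theta>'(3)]] e by blast
        then show ?thesis
          unfolding \<theta>'(4) in_charts_apply[OF inj_on_jet_chart[OF d] \<theta>'(1)] unfolding e y4 by simp
      qed
      have l: "linear (\<lambda>y :: (real^'n) \<times> ((real^'n) \<times> (real^'m)) \<times> (((real^'n) \<times> (real^'m))^'n) \<times> (((real^'n) \<times> (real^'m))^('n uprod)). fst (fst (snd y)))"
        by (rule linearI) simp_all
      have "fst (?D w') = FD (\<lambda>y. fst (in_charts ?c ?d ?\<pi> y)) (snd ?c \<theta>) w'"
        unfolding differential_def by (rule FD_linear_compose[OF linear_fst V(2) aV, symmetric])
      also have "\<dots> = FD (\<lambda>y. fst (fst (snd y))) (snd ?c \<theta>) w'"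
        by (rule fun_cong[OF FD_cong[OF V(1) aV e]])
      finally show ?thesis using linear_imp_FD[OF l] by simp
    qed
    then have f: "fst (?D w') = fst v" unfolding \<zeta> w'(3) .
    obtain y \<phi> p q where w2: "snd ?d (?\<pi> \<theta>) = (y, \<phi>, p, q)" by (metis prod_cases4)
    have v': "v \<in> ?C'" "v \<in> ?R" using v by blast+
    note C1 = cartan_J2sub_conditions[OF d \<theta>(3) w2 D(1)] and C2 = cartan_J2sub_conditions[OF d \<theta>(3) w2 v'(1)]
    have "?D w' = v"
      by (rule tangent_S_unparam_determined[OF d \<theta>(3) D(2) v'(2) f]) (simp_all add: C1 C2 f vec_eq_iff)
    then show "v \<in> ?D ` (?C \<inter> ?S)" using w'(1,2) by blast
  qed
qed

end


section \<open>The factorization\<close>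

context geodesic_setting
begin

text \<open>The claims about tangent vectors are proved in the chart of jets induced by the same chart of \<open>E\<close>
  as that of submanifolds. Its domain contains all jets that are mapped into the latter.\<close>

lemma projects_onto_forget_param:
  "projects_onto (J2pr_space A) (ImmJ2pr A) (S_pr A \<Gamma> \<Theta>) (J2sub_space A) (S_unparam A \<Gamma>) (forget_param A)"
  unfolding projects_onto_def
proof (intro conjI ballI impI)
  let ?\<pi> = "forget_param A"
  interpret J: jet_manifold "J2pr_space A :: (('n, 'e) jet, _) jet_space" by (rule jet_manifold_J2pr)
  fix \<theta> c d
  assume \<theta>: "\<theta> \<in> S_pr A \<Gamma> \<Theta>" and c: "c \<in> jet_charts (J2pr_space A)" and d: "d \<in> jet_charts (J2sub_space A)"
    and dom: "\<theta> \<in> fst c \<and> ?\<pi> \<theta> \<in> fst d"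
  have im: "\<theta> \<in> ImmJ2pr A" using \<theta> S_pr_subset by blast
  obtain d' where d': "d' \<in> A" "d = subjet_chart A d'" using d by (auto simp: J2sub_space_def)
  let ?e = "jet_chart A d'"
  have e: "?e \<in> jet_charts (J2pr_space A)" using d'(1) by (auto simp: J2pr_space_def)
  have \<theta>c: "\<theta> \<in> fst c" and \<theta>d: "?\<pi> \<theta> \<in> fst (subjet_chart A d')" using dom d'(2) by blast+
  have \<theta>e: "\<theta> \<in> fst ?e" by (rule forget_param_domain[OF d'(1) im \<theta>d])
  let ?E = "differential c ?e (\<lambda>a. a) \<theta>"
  have X: "ImmJ2pr A \<subseteq> jets (J2pr_space A)" and S: "S_pr A \<Gamma> \<Theta> \<subseteq> jets (J2pr_space A)"
    using ImmJ2pr_subset S_pr_subset(2) by (auto simp: J2pr_space_def)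
  have D: "differential c d ?\<pi> \<theta> ` M = differential ?e (subjet_chart A d') ?\<pi> \<theta> ` (?E ` M)" for M
    unfolding image_image d'(2)
    by (intro image_cong refl J.differential_change_chart[OF smooth_map_forget_param X c e d[unfolded d'(2)] im \<theta>c \<theta>e \<theta>d])
  have T: "?E ` tangent_vectors c (S_pr A \<Gamma> \<Theta>) \<theta> = tangent_vectors ?e (S_pr A \<Gamma> \<Theta>) \<theta>"
    by (rule J.tangent_vectors_change_chart[OF S c e \<theta>c \<theta>e])
  have C: "?E ` cartan (J2pr_space A) c \<theta> = cartan (J2pr_space A) ?e \<theta>"
    using contact_transformation_identity c e \<theta>c \<theta>e S \<theta> unfolding contact_transformation_def by blast
  have "inj ?E"
  proof (rule inj_on_inverseI)
    show "differential ?e c (\<lambda>a. a) \<theta> (?E v) = v" for v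
      by (rule J.differential_inverse[OF J.smooth_map_id J.smooth_map_id refl c e \<theta>c \<theta>e])
  qed
  from image_Int[OF this]
  have CT: "?E ` (cartan (J2pr_space A) c \<theta> \<inter> tangent_vectors c (S_pr A \<Gamma> \<Theta>) \<theta>)
      = cartan (J2pr_space A) ?e \<theta> \<inter> tangent_vectors ?e (S_pr A \<Gamma> \<Theta>) \<theta>"
    by (simp only: T C)
  show "differential c d ?\<pi> \<theta> ` tangent_vectors c (S_pr A \<Gamma> \<Theta>) \<theta> = tangent_vectors d (S_unparam A \<Gamma>) (?\<pi> \<theta>)"
    unfolding D T unfolding d'(2) by (rule tangent_S_unparam[OF d'(1) \<theta> \<theta>e \<theta>d])
  show "differential c d ?\<pi> \<theta> ` (cartan (J2pr_space A) c \<theta> \<inter> tangent_vectors c (S_pr A \<Gamma> \<Theta>) \<theta>)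
      = cartan (J2sub_space A) d (?\<pi> \<theta>) \<inter> tangent_vectors d (S_unparam A \<Gamma>) (?\<pi> \<theta>)"
    unfolding D CT unfolding d'(2) by (rule cartan_S_unparam[OF d'(1) \<theta> \<theta>e \<theta>d])
qed (rule S_pr_subset smooth_map_forget_param forget_param_image)+

lemma factoring_iff_flat:
  "obtained_by_factoring (J2pr_space A) (ImmJ2pr A) (S_pr A \<Gamma> \<Theta>) (J2sub_space A) (S_unparam A \<Gamma>) (forget_param A) Aff (prolong A)
    \<longleftrightarrow> (\<forall>x v w. \<Theta> std_chart x v w = 0)"
proof
  assume "obtained_by_factoring (J2pr_space A) (ImmJ2pr A) (S_pr A \<Gamma> \<Theta>) (J2sub_space A) (S_unparam A \<Gamma>) (forget_param A) Aff (prolong A)"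
  then interpret group_hom "Aff :: (real^'n \<Rightarrow> real^'n) monoid" "external_symmetry_group (J2pr_space A) (S_pr A \<Gamma> \<Theta>)" "prolong A"
    unfolding obtained_by_factoring_def by blast
  have sym: "prolong A g ` S_pr A \<Gamma> \<Theta> \<subseteq> S_pr A \<Gamma> \<Theta>" if "g \<in> carrier Aff" for g :: "real^'n \<Rightarrow> real^'n"
    using hom_closed[OF that] by (simp add: external_symmetry_group_def external_symmetry_def)
  have "linear (\<lambda>h::real^'n. (h, 0::real^'m))" by (rule linearI) simp_all
  moreover have "inj (\<lambda>h::real^'n. (h, 0::real^'m))" by (simp add: inj_def)
  ultimately show "\<forall>x v w. \<Theta> std_chart x v w = 0" using param_flat_if_symmetric[OF sym] by blast
next
  assume "\<forall>x v w. \<Theta> std_chart x v w = 0"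
  then have zero: "\<Theta> std_chart x v w = 0" for x v w by blast
  show "obtained_by_factoring (J2pr_space A) (ImmJ2pr A) (S_pr A \<Gamma> \<Theta>) (J2sub_space A) (S_unparam A \<Gamma>) (forget_param A) Aff (prolong A)"
    unfolding obtained_by_factoring_def
    using group_hom_prolong[OF zero] inj_on_prolong projects_onto_forget_param forget_param_eq_iff[OF zero] by blast
qed

end

theorem theorem8:
  fixes A :: "('e::{t2_space, second_countable_topology}, (real^'n) \<times> (real^'m)) chart set"
    and \<Gamma> :: "('e, (real^'n) \<times> (real^'m)) christoffel"
    and \<Theta> :: "(real^'n, real^'n) christoffel"
  assumes "smooth_manifold A"
    and "linear_connection A \<Gamma>" and "torsion_free A \<Gamma>"
    and "linear_connection {std_chart} \<Theta>" and "torsion_free {std_chart} \<Theta>"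
  shows "projects_onto (J2pr_space A) (ImmJ2pr A) (S_pr A \<Gamma> \<Theta>)
           (J2sub_space A) (S_unparam A \<Gamma>) (forget_param A)
       \<and> (obtained_by_factoring (J2pr_space A) (ImmJ2pr A) (S_pr A \<Gamma> \<Theta>)
           (J2sub_space A) (S_unparam A \<Gamma>) (forget_param A) Aff (prolong A)
         \<longleftrightarrow> (\<forall>x v w. \<Theta> std_chart x v w = 0))"
proof -
  interpret geodesic_setting A \<Gamma> \<Theta>
    using assms by unfold_locales
  show ?thesis using projects_onto_forget_param factoring_iff_flat by blast
qed

end
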